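(* Let $1\le b\le r$ be integers with $\gcd(r,b)=1$. Let $T(n,d,k)$ be the running time of an $\alpha$-approximation algorithm for the (unconstrained) $k$-median problem over $n$ points in $\mathbb{R}^d$. Then there exists an $O(d\cdot n\cdot\log n+T(n,d,k))$-time algorithm that, given a set $P\subseteq\mathbb{R}^d$ of $n$ points, each colored red or blue, with $\mathrm{balance}(P)\ge b/r$ and with aspect ratio polynomial in $n$, and given the balance parameters $(r,b)$, computes an $(r,b)$-fair $k$-median clustering of $P$ whose cost is within a factor of $O_{r,b}(d\cdot\log n+\alpha)$ from the optimal cost of $(r,b)$-fair $k$-median of $P$.
   Context: Distances are Euclidean. The notation $O_{r,b}(\cdot)$ hides a factor depending only on $r$ and $b$. The aspect ratio of $P$ is the ratio between the maximum and minimum distance between distinct points of $P$; it is assumed to be $n^{O(1)}$. For a set $S$ of points colored red or blue, with red part $S_r$ and blue part $S_b$, $\mathrm{balance}(S):=\min\{|S_r|/|S_b|,\,|S_b|/|S_r|\}$. The $k$-median problem: given a finite collection of points (repetitions allowed), find $k$ centers and partition the points into $k$ clusters centered at the selected centers so that the sum, over all points, of the distance from the point to the center of its cluster (the cost) is minimized. An $\alpha$-approximation algorithm returns a solution of cost at most $\alpha$ times the minimum. A clustering $\{C_1,\dots,C_k\}$ of $P$ is $(r,b)$-fair if every cluster $C$ in it satisfies $\mathrm{balance}(C)\ge b/r$. The $(r,b)$-fair $k$-median problem is the $k$-median problem in which the clustering is required to be $(r,b)$-fair. *)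

theory Defs
  imports Complex_Main "HOL-Analysis.L2_Norm"
begin

section \<open>The model of computation: a deterministic real RAM\<close>

text \<open>
  Memory consists of infinite arrays of natural numbers and infinite arrays of reals; a program,
  being finite, mentions finitely many array names, and a scalar is an array used at index 0 only.
  Natural numbers (addresses, counters) support only addition, truncated subtraction and comparison:
  unit-cost multiplication and division of unbounded integers would be unreasonably powerful.
  Reals are exact and support the four operations, square roots and comparison, but there is
  no conversion from reals to naturals (no floor) and there are no real constants other than
  (images of) natural numbers. Array entries that are not part of the input are initially 0.
\<close>

type_synonym name = string

datatype nexp =
    NConst nat
  | NGet name nexp
  | NAdd nexp nexp
  | NSub nexp nexp

datatype rexp =
    ROfNat nexp
  | RGet name nexp
  | RAdd rexp rexp
  | RSub rexp rexp
  | RMul rexp rexp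
  | RDiv rexp rexp
  | RSqrt rexp

datatype bexp =
    NLess nexp nexp
  | RLess rexp rexp
  | Neg bexp
  | Conj bexp bexp

datatype com =
    Skip
  | NSet name nexp nexp
  | RSet name nexp rexp
  | Seq com com
  | Cond bexp com com
  | While bexp com

type_synonym store = "(name \<Rightarrow> nat \<Rightarrow> nat) \<times> (name \<Rightarrow> nat \<Rightarrow> real)"

primrec nval :: "store \<Rightarrow> nexp \<Rightarrow> nat" where
  "nval s (NConst m) = m"
| "nval s (NGet x e) = fst s x (nval s e)"
| "nval s (NAdd e f) = nval s e + nval s f"
| "nval s (NSub e f) = nval s e - nval s f"

primrec rval :: "store \<Rightarrow> rexp \<Rightarrow> real" where
  "rval s (ROfNat e) = real (nval s e)"
| "rval s (RGet x e) = snd s x (nval s e)"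
| "rval s (RAdd e f) = rval s e + rval s f"
| "rval s (RSub e f) = rval s e - rval s f"
| "rval s (RMul e f) = rval s e * rval s f"
| "rval s (RDiv e f) = rval s e / rval s f"
| "rval s (RSqrt e) = sqrt (rval s e)"

primrec bval :: "store \<Rightarrow> bexp \<Rightarrow> bool" where
  "bval s (NLess e f) = (nval s e < nval s f)"
| "bval s (RLess e f) = (rval s e < rval s f)"
| "bval s (Neg p) = (\<not> bval s p)"
| "bval s (Conj p q) = (bval s p \<and> bval s q)"

text \<open>Every constant, memory access and operation costs one unit of time.\<close>

primrec ncost :: "nexp \<Rightarrow> nat" where
  "ncost (NConst m) = 1"
| "ncost (NGet x e) = ncost e + 1"
| "ncost (NAdd e f) = ncost e + ncost f + 1"
| "ncost (NSub e f) = ncost e + ncost f + 1"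

primrec rcost :: "rexp \<Rightarrow> nat" where
  "rcost (ROfNat e) = ncost e + 1"
| "rcost (RGet x e) = ncost e + 1"
| "rcost (RAdd e f) = rcost e + rcost f + 1"
| "rcost (RSub e f) = rcost e + rcost f + 1"
| "rcost (RMul e f) = rcost e + rcost f + 1"
| "rcost (RDiv e f) = rcost e + rcost f + 1"
| "rcost (RSqrt e) = rcost e + 1"

primrec bcost :: "bexp \<Rightarrow> nat" where
  "bcost (NLess e f) = ncost e + ncost f + 1"
| "bcost (RLess e f) = rcost e + rcost f + 1"
| "bcost (Neg p) = bcost p + 1"
| "bcost (Conj p q) = bcost p + bcost q + 1"

definition nwrite :: "store \<Rightarrow> name \<Rightarrow> nat \<Rightarrow> nat \<Rightarrow> store" where
  "nwrite s x i v = ((fst s)(x := (fst s x)(i := v)), snd s)"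

definition rwrite :: "store \<Rightarrow> name \<Rightarrow> nat \<Rightarrow> real \<Rightarrow> store" where
  "rwrite s x i v = (fst s, (snd s)(x := (snd s x)(i := v)))"

text \<open>\<open>exec c s t s'\<close>: program \<open>c\<close>, started in store \<open>s\<close>, halts after time \<open>t\<close> in store \<open>s'\<close>.\<close>

inductive exec :: "com \<Rightarrow> store \<Rightarrow> nat \<Rightarrow> store \<Rightarrow> bool" where
  Skip: "exec Skip s 1 s"
| NSet: "exec (NSet x e f) s (ncost e + ncost f + 1) (nwrite s x (nval s e) (nval s f))"
| RSet: "exec (RSet x e f) s (ncost e + rcost f + 1) (rwrite s x (nval s e) (rval s f))"
| Seq: "\<lbrakk>exec c s t s'; exec c' s' t' s''\<rbrakk> \<Longrightarrow> exec (Seq c c') s (t + t') s''"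
| CondTrue: "\<lbrakk>bval s p; exec c s t s'\<rbrakk> \<Longrightarrow> exec (Cond p c c') s (bcost p + t + 1) s'"
| CondFalse: "\<lbrakk>\<not> bval s p; exec c' s t s'\<rbrakk> \<Longrightarrow> exec (Cond p c c') s (bcost p + t + 1) s'"
| WhileFalse: "\<not> bval s p \<Longrightarrow> exec (While p c) s (bcost p + 1) s"
| WhileTrue: "\<lbrakk>bval s p; exec c s t s'; exec (While p c) s' t' s''\<rbrakk>
    \<Longrightarrow> exec (While p c) s (bcost p + t + t' + 1) s''"

inductive_cases SkipE: "exec Skip s t s'"
inductive_cases NSetE: "exec (NSet x e f) s t s'"
inductive_cases RSetE: "exec (RSet x e f) s t s'"
inductive_cases SeqE: "exec (Seq c c') s t s'"
inductive_cases CondE: "exec (Cond p c c') s t s'"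
inductive_cases WhileE: "exec (While p c) s t s'"

text \<open>Executions are deterministic, so ``there is an execution with the property \<open>Q\<close>''
  below means that the program halts and that its execution has the property \<open>Q\<close>.\<close>

lemma exec_deterministic:
  "exec c s t s' \<Longrightarrow> exec c s u s'' \<Longrightarrow> u = t \<and> s'' = s'"
proof (induction arbitrary: u s'' rule: exec.induct)
  case Skip
  then show ?case by (elim SkipE) simp
next
  case NSet
  then show ?case by (elim NSetE) simp
next
  case RSet
  then show ?case by (elim RSetE) simp
next
  case (Seq c s t s1 c' t' s2)
  from Seq.prems obtain u1 u2 r where "exec c s u1 r" "exec c' r u2 s''" "u = u1 + u2"
    by (elim SeqE)
  with Seq.IH show ?case by metis
next
  case (CondTrue s p c t s' c')
  from CondTrue.prems CondTrue.hyps(1) obtain v where "exec c s v s''" "u = bcost p + v + 1"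
    by (elim CondE) simp_all
  with CondTrue.IH show ?case by metis
next
  case (CondFalse s p c' t s' c)
  from CondFalse.prems CondFalse.hyps(1) obtain v where "exec c' s v s''" "u = bcost p + v + 1"
    by (elim CondE) simp_all
  with CondFalse.IH show ?case by metis
next
  case (WhileFalse s p c)
  from WhileFalse.prems show ?case by (rule WhileE) (use WhileFalse.hyps in simp_all)
next
  case (WhileTrue s p c t s1 t' s2)
  from WhileTrue.prems obtain u1 u2 r
    where "exec c s u1 r" "exec (While p c) r u2 s''" "u = bcost p + u1 + u2 + 1"
    by (rule WhileE) (use WhileTrue.hyps(1) in simp_all)
  with WhileTrue.IH show ?case by metis
qed


section \<open>Clustering in Euclidean space\<close>

text \<open>
  The dimension \<open>d\<close> and the number of points \<open>n\<close> are inputs of the algorithms, so a vector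
  of R^d is a function on \<open>{..<d}\<close> (its values elsewhere are irrelevant) and a collection of \<open>n\<close>
  points is a family \<open>P\<close> indexed by \<open>{..<n}\<close>, possibly with repetitions. Subsets of
  the collection (clusters) are sets of indices.
\<close>

type_synonym vector = "nat \<Rightarrow> real"

definition edist :: "nat \<Rightarrow> vector \<Rightarrow> vector \<Rightarrow> real" where
  "edist d x y = L2_set (\<lambda>j. x j - y j) {..<d}"

definition distinct_points :: "nat \<Rightarrow> nat \<Rightarrow> (nat \<Rightarrow> vector) \<Rightarrow> bool" where
  "distinct_points n d P \<longleftrightarrow> (\<forall>i<n. \<forall>i'<n. i \<noteq> i' \<longrightarrow> (\<exists>j<d. P i j \<noteq> P i' j))"

text \<open>Meant for at least two, pairwise distinct, points.\<close>

definition pair_dists :: "nat \<Rightarrow> nat \<Rightarrow> (nat \<Rightarrow> vector) \<Rightarrow> real set" where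
  "pair_dists n d P = {edist d (P i) (P i') | i i'. i < n \<and> i' < n \<and> i \<noteq> i'}"

definition aspect_ratio :: "nat \<Rightarrow> nat \<Rightarrow> (nat \<Rightarrow> vector) \<Rightarrow> real" where
  "aspect_ratio n d P = Max (pair_dists n d P) / Min (pair_dists n d P)"

text \<open>
  A solution consists of centers \<open>Z c\<close> for \<open>c < k\<close>, arbitrary points of R^d, and
  of labels: point \<open>i\<close> belongs to the cluster centered at \<open>Z (lab i)\<close>. Clusters may be empty.
\<close>

definition clustering :: "nat \<Rightarrow> nat \<Rightarrow> (nat \<Rightarrow> nat) \<Rightarrow> bool" where
  "clustering n k lab \<longleftrightarrow> (\<forall>i<n. lab i < k)"

definition cluster :: "nat \<Rightarrow> (nat \<Rightarrow> nat) \<Rightarrow> nat \<Rightarrow> nat set" where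
  "cluster n lab c = {i. i < n \<and> lab i = c}"

definition cost :: "nat \<Rightarrow> nat \<Rightarrow> (nat \<Rightarrow> vector) \<Rightarrow> (nat \<Rightarrow> vector) \<Rightarrow> (nat \<Rightarrow> nat) \<Rightarrow> real" where
  "cost n d P Z lab = (\<Sum>i<n. edist d (P i) (Z (lab i)))"

text \<open>A one-colored set gets balance 0, because \<open>x / 0 = 0\<close>.\<close>

definition balance :: "(nat \<Rightarrow> bool) \<Rightarrow> nat set \<Rightarrow> real" where
  "balance red S =
     (let R = real (card {i \<in> S. red i}); B = real (card {i \<in> S. \<not> red i})
      in min (R / B) (B / R))"

text \<open>The balance of an empty cluster is undefined; empty clusters do not violate fairness.\<close>

definition fair_clustering ::
    "nat \<Rightarrow> nat \<Rightarrow> nat \<Rightarrow> nat \<Rightarrow> (nat \<Rightarrow> bool) \<Rightarrow> (nat \<Rightarrow> nat) \<Rightarrow> bool" where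
  "fair_clustering r b n k red lab \<longleftrightarrow>
     clustering n k lab \<and>
     (\<forall>c<k. cluster n lab c \<noteq> {} \<longrightarrow> balance red (cluster n lab c) \<ge> real b / real r)"

definition kmedian_opt :: "nat \<Rightarrow> nat \<Rightarrow> nat \<Rightarrow> (nat \<Rightarrow> vector) \<Rightarrow> real" where
  "kmedian_opt n d k P = Inf {cost n d P Z lab | Z lab. clustering n k lab}"

definition fair_kmedian_opt ::
    "nat \<Rightarrow> nat \<Rightarrow> nat \<Rightarrow> nat \<Rightarrow> nat \<Rightarrow> (nat \<Rightarrow> vector) \<Rightarrow> (nat \<Rightarrow> bool) \<Rightarrow> real" where
  "fair_kmedian_opt r b n d k P red =
     Inf {cost n d P Z lab | Z lab. fair_clustering r b n k red lab}"


section \<open>Input and output of the algorithms\<close>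

text \<open>Coordinate \<open>j\<close> of vector number \<open>i\<close> is stored at position \<open>i * d + j\<close>.\<close>

definition flatten :: "nat \<Rightarrow> nat \<Rightarrow> (nat \<Rightarrow> vector) \<Rightarrow> nat \<Rightarrow> real" where
  "flatten n d P m = (if m < n * d then P (m div d) (m mod d) else 0)"

definition scalar :: "nat \<Rightarrow> nat \<Rightarrow> nat" where
  "scalar v = (\<lambda>_. 0)(0 := v)"

definition kmedian_input :: "nat \<Rightarrow> nat \<Rightarrow> nat \<Rightarrow> (nat \<Rightarrow> vector) \<Rightarrow> store" where
  "kmedian_input n d k P =
     ((\<lambda>_ _. 0)(''n'' := scalar n, ''d'' := scalar d, ''k'' := scalar k),
      (\<lambda>_ _. 0)(''points'' := flatten n d P))"

text \<open>Color 1 is red, color 0 is blue.\<close>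

definition fair_kmedian_input ::
    "nat \<Rightarrow> nat \<Rightarrow> nat \<Rightarrow> nat \<Rightarrow> nat \<Rightarrow> (nat \<Rightarrow> vector) \<Rightarrow> (nat \<Rightarrow> bool) \<Rightarrow> store" where
  "fair_kmedian_input r b n d k P red =
     ((\<lambda>_ _. 0)(''n'' := scalar n, ''d'' := scalar d, ''k'' := scalar k,
        ''r'' := scalar r, ''b'' := scalar b,
        ''color'' := (\<lambda>i. if i < n \<and> red i then 1 else 0)),
      (\<lambda>_ _. 0)(''points'' := flatten n d P))"

definition out_labels :: "store \<Rightarrow> nat \<Rightarrow> nat" where
  "out_labels s i = fst s ''label'' i"

definition out_centers :: "nat \<Rightarrow> store \<Rightarrow> nat \<Rightarrow> vector" where
  "out_centers d s c j = snd s ''center'' (c * d + j)"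

definition approx_kmedian_algorithm ::
    "com \<Rightarrow> real \<Rightarrow> (nat \<Rightarrow> nat \<Rightarrow> nat \<Rightarrow> nat) \<Rightarrow> bool" where
  "approx_kmedian_algorithm A \<alpha> T \<longleftrightarrow>
     (\<forall>n d k P. n \<ge> 1 \<longrightarrow> d \<ge> 1 \<longrightarrow> k \<ge> 1 \<longrightarrow>
       (\<exists>t s. exec A (kmedian_input n d k P) t s \<and> t \<le> T n d k \<and>
          clustering n k (out_labels s) \<and>
          cost n d P (out_centers d s) (out_labels s) \<le> \<alpha> * kmedian_opt n d k P))"

end

theory Submission
  imports Defs
begin

text \<open>
  Round the coordinates to multiples of a width \<open>w\<close> fine enough for the aspect ratio, and lay a
  hierarchy of \<open>H = O(log n)\<close> nested grids over them, shifted along the diagonal by \<open>t < 2^H\<close>. From the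
  finest grid upwards, points are combined into fairlets, balanced groups of at most \<open>r + b\<close> points;
  the points that cannot be balanced inside their cell wait for the next level, and some fairlets are
  dissolved again to help them. Only \<open>O(I)\<close> points move at the level above a grid with imbalance \<open>I\<close>,
  the sum over its cells of the violation of the ratio \<open>r : b\<close>, so moving every point to the
  representative of its fairlet costs \<open>O(sqrt d * w * (n + (SUM m. 2^m * I m)))\<close>.

  A cell is unbalanced only because it separates points of clusters of a fair solution from their
  medoids. On average over \<open>t\<close> the sum is therefore at most \<open>O(H * r)\<close> times the l1-cost of the fair
  solution in units of \<open>w\<close>, and \<open>sqrt d\<close> is lost once more between the l1-norm and the Euclidean norm.
  Instead of drawing \<open>t\<close> at random, the algorithm finds the shift minimising the sum: the cells of
  level \<open>m\<close> depend, up to translation, only on \<open>t mod 2^m\<close> and change only when it passes the residue of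
  one of the \<open>n * d\<close> coordinates, so all imbalances of a level are computed by a sweep in linear time, and
  the minima are folded from the coarsest level to the finest.

  Finally each point receives the label that the given algorithm assigns, on the original points, to
  the representative of its fairlet. Each representative stands for at most \<open>r + b\<close> points. If
  \<open>d > n^a\<close>, the rounding is too coarse, but then the aspect ratio is below \<open>d\<close> and any
  representatives will do.
\<close>

section \<open>Total correctness with a time budget\<close>

text \<open>Three charges carry the estimate. (1) Levels: two coordinates at distance x, in units of
  \<open>w\<close>, are separated at level m by at most a fraction x / 2^m of the shifts; weighted
  by 2^m, every level contributes the same amount, which is the source of the factor
  \<open>H + 1\<close>. (2) Moves: the waiting points may all have one color, so fairlets formed
  earlier must be opened. Each opened fairlet lowers the excess of the opened points of its cell by
  at least 1, and q waiting points have excess at most b * q; hence at most b * q fairlets of at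
  most r + b points are opened, which gives the constant \<open>kappa\<close>. It is safe to stop
  once no fairlet helps: those left closed have no room for the color in excess, so the opened
  points are no more unbalanced than their whole cell. (3) Rounding: every nonempty cluster of a
  fair solution has at least two points, so at least half of the points pay the minimum distance
  \<open>\<delta>\<close> to their medoids; if d is at most n^a, the grid is so fine that d * w is
  at most \<open>\<delta>\<close>, and the rounding errors are charged to this cost.\<close>

definition run :: "com \<Rightarrow> store \<Rightarrow> nat \<Rightarrow> (store \<Rightarrow> bool) \<Rightarrow> bool" where
  "run c s T Q \<longleftrightarrow> (\<exists>t s'. exec c s t s' \<and> t \<le> T \<and> Q s')"

lemma run_mono: "run c s T Q \<Longrightarrow> T \<le> T' \<Longrightarrow> (\<And>s'. Q s' \<Longrightarrow> Q' s') \<Longrightarrow> run c s T' Q'"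
  unfolding run_def by (meson order_trans)

lemma run_Seq:
  "run c s T1 R \<Longrightarrow> (\<And>s'. R s' \<Longrightarrow> run c' s' T2 Q) \<Longrightarrow> T1 + T2 \<le> T \<Longrightarrow> run (Seq c c') s T Q"
  unfolding run_def by (meson add_mono exec.Seq order_trans)

primrec seqs :: "com list \<Rightarrow> com" where
  "seqs [] = Skip"
| "seqs (c # cs) = (if cs = [] then c else Seq c (seqs cs))"

section \<open>Frame conditions: the arrays that a program can change\<close>

primrec nwr :: "com \<Rightarrow> name set" where
  "nwr Skip = {}"
| "nwr (NSet x e f) = {x}"
| "nwr (RSet x e f) = {}"
| "nwr (Seq c c') = nwr c \<union> nwr c'"
| "nwr (Cond p c c') = nwr c \<union> nwr c'"
| "nwr (While p c) = nwr c"

primrec rwr :: "com \<Rightarrow> name set" where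
  "rwr Skip = {}"
| "rwr (NSet x e f) = {}"
| "rwr (RSet x e f) = {x}"
| "rwr (Seq c c') = rwr c \<union> rwr c'"
| "rwr (Cond p c c') = rwr c \<union> rwr c'"
| "rwr (While p c) = rwr c"

definition same :: "name set \<Rightarrow> name set \<Rightarrow> store \<Rightarrow> store \<Rightarrow> bool" where
  "same W V s s' \<longleftrightarrow> (\<forall>y. y \<notin> W \<longrightarrow> fst s' y = fst s y) \<and> (\<forall>y. y \<notin> V \<longrightarrow> snd s' y = snd s y)"

lemma same_refl: "same W V s s"
  by (simp add: same_def)

lemma same_trans: "same W V s s' \<Longrightarrow> same W' V' s' s'' \<Longrightarrow> same (W \<union> W') (V \<union> V') s s''"
  by (simp add: same_def)

lemma same_mono: "same W V s s' \<Longrightarrow> W \<subseteq> W' \<Longrightarrow> V \<subseteq> V' \<Longrightarrow> same W' V' s s'"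
  unfolding same_def by blast

lemma sameD: "same W V s s' \<Longrightarrow> y \<notin> W \<Longrightarrow> fst s' y = fst s y"
  "same W V s s' \<Longrightarrow> y \<notin> V \<Longrightarrow> snd s' y = snd s y"
  by (simp_all add: same_def)

lemma fst_nwrite [simp]:
  "fst (nwrite s x i v) y = (if y = x then (fst s x)(i := v) else fst s y)"
  by (simp add: nwrite_def)

lemma snd_nwrite [simp]: "snd (nwrite s x i v) = snd s"
  by (simp add: nwrite_def)

lemma fst_rwrite [simp]: "fst (rwrite s x i v) = fst s"
  by (simp add: rwrite_def)

lemma snd_rwrite [simp]:
  "snd (rwrite s x i v) y = (if y = x then (snd s x)(i := v) else snd s y)"
  by (simp add: rwrite_def)

lemma exec_same: "exec c s t s' \<Longrightarrow> same (nwr c) (rwr c) s s'"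
  by (induction rule: exec.induct) (auto simp: same_def)

lemma run_same: "run c s T Q \<Longrightarrow> run c s T (\<lambda>s'. Q s' \<and> same (nwr c) (rwr c) s s')"
  unfolding run_def using exec_same by blast

section \<open>Symbolic execution of loop-free programs\<close>

primrec loopfree :: "com \<Rightarrow> bool" where
  "loopfree Skip \<longleftrightarrow> True"
| "loopfree (NSet x e f) \<longleftrightarrow> True"
| "loopfree (RSet x e f) \<longleftrightarrow> True"
| "loopfree (Seq c c') \<longleftrightarrow> loopfree c \<and> loopfree c'"
| "loopfree (Cond p c c') \<longleftrightarrow> loopfree c \<and> loopfree c'"
| "loopfree (While p c) \<longleftrightarrow> False"

text \<open>The value for \<open>While\<close> is a dummy, as is the time in \<open>maxtime\<close>
  below: both are only evaluated under \<open>loopfree\<close>.\<close>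

primrec result :: "com \<Rightarrow> store \<Rightarrow> store" where
  "result Skip s = s"
| "result (NSet x e f) s = nwrite s x (nval s e) (nval s f)"
| "result (RSet x e f) s = rwrite s x (nval s e) (rval s f)"
| "result (Seq c c') s = result c' (result c s)"
| "result (Cond p c c') s = (if bval s p then result c s else result c' s)"
| "result (While p c) s = s"

primrec maxtime :: "com \<Rightarrow> nat" where
  "maxtime Skip = 1"
| "maxtime (NSet x e f) = ncost e + ncost f + 1"
| "maxtime (RSet x e f) = ncost e + rcost f + 1"
| "maxtime (Seq c c') = maxtime c + maxtime c'"
| "maxtime (Cond p c c') = bcost p + max (maxtime c) (maxtime c') + 1"
| "maxtime (While p c) = 0"

lemma exec_loopfree: "loopfree c \<Longrightarrow> \<exists>t\<le>maxtime c. exec c s t (result c s)"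
proof (induction c arbitrary: s)
  case Skip
  show ?case using exec.Skip[of s] by (auto intro!: exI[of _ 1] simp del: One_nat_def)
next
  case (NSet x e f)
  show ?case using exec.NSet[of x e f s] by (auto intro!: exI[of _ "ncost e + ncost f + 1"])
next
  case (RSet x e f)
  show ?case using exec.RSet[of x e f s] by (auto intro!: exI[of _ "ncost e + rcost f + 1"])
next
  case (Seq c c')
  then obtain t t' where "t \<le> maxtime c" "exec c s t (result c s)"
    "t' \<le> maxtime c'" "exec c' (result c s) t' (result c' (result c s))" by fastforce
  then show ?case by (auto intro!: exI[of _ "t + t'"] exec.Seq)
next
  case (Cond p c c')
  then obtain t t' where t: "t \<le> maxtime c" "exec c s t (result c s)"
    "t' \<le> maxtime c'" "exec c' s t' (result c' s)" by fastforce
  show ?case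
  proof (cases "bval s p")
    case True
    with t show ?thesis by (auto intro!: exI[of _ "bcost p + t + 1"] exec.CondTrue)
  next
    case False
    with t show ?thesis by (auto intro!: exI[of _ "bcost p + t' + 1"] exec.CondFalse)
  qed
qed simp

lemma run_loopfree: "loopfree c \<Longrightarrow> maxtime c \<le> T \<Longrightarrow> Q (result c s) \<Longrightarrow> run c s T Q"
  unfolding run_def using exec_loopfree[of c s] by fastforce

lemma run_Cond:
  "(bval s p \<Longrightarrow> run c s T Q) \<Longrightarrow> (\<not> bval s p \<Longrightarrow> run c' s T Q) \<Longrightarrow> bcost p + T + 1 \<le> T'
    \<Longrightarrow> run (Cond p c c') s T' Q"
  unfolding run_def
  by (cases "bval s p") (fastforce intro: exec.CondTrue exec.CondFalse)+

text \<open>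
  The potential \<open>F\<close> of an auxiliary state \<open>g\<close>, which need not be stored, pays for the iterations.
\<close>

lemma run_While_potential:
  fixes F :: "'g \<Rightarrow> nat"
  assumes step: "\<And>g s. I g s \<Longrightarrow> bval s p \<Longrightarrow> \<exists>T g'. run c s T (I g') \<and> T + bcost p + 1 + F g' \<le> F g"
    and "I g s"
  shows "run (While p c) s (F g + bcost p + 1) (\<lambda>s'. \<exists>g'. I g' s' \<and> \<not> bval s' p)"
proof -
  have "\<exists>t s' g'. exec (While p c) s t s' \<and> t \<le> F g + bcost p + 1 \<and> I g' s' \<and> \<not> bval s' p"
    using \<open>I g s\<close>
  proof (induction "F g" arbitrary: g s rule: less_induct)
    case less
    show ?case
    proof (cases "bval s p")
      case False
      then show ?thesis using less.prems exec.WhileFalse by fastforce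
    next
      case True
      then obtain T g1 t s1 where 1: "exec c s t s1" "t \<le> T" "I g1 s1" "T + bcost p + 1 + F g1 \<le> F g"
        using step[OF less.prems True] unfolding run_def by blast
      \<comment> \<open>The unit charged for the round itself makes the potential drop strictly, so
        the loop terminates.\<close>
      then have "F g1 < F g" by simp
      from less.hyps[OF this 1(3)] obtain t' s2 g2 where
        2: "exec (While p c) s1 t' s2" "t' \<le> F g1 + bcost p + 1" "I g2 s2" "\<not> bval s2 p" by blast
      have "exec (While p c) s (bcost p + t + t' + 1) s2"
        using True 1(1) 2(1) by (rule exec.WhileTrue)
      then show ?thesis using 1 2 by fastforce
    qed
  qed
  then show ?thesis unfolding run_def by blast
qed

text \<open>The invariant is indexed by the round, so it alone decides the test: true before round
  \<open>B\<close>, false at \<open>B\<close>.\<close>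

lemma run_While_count:
  assumes step: "\<And>j s. j < B \<Longrightarrow> I j s \<Longrightarrow> bval s p \<and> run c s T (I (Suc j))"
    and last: "\<And>s. I B s \<Longrightarrow> \<not> bval s p"
    and I0: "I 0 s"
    and T': "B * (T + bcost p + 1) + bcost p + 1 \<le> T'"
  shows "run (While p c) s T' (I B)"
proof -
  have "\<exists>t s'. exec (While p c) s t s' \<and> t \<le> (B - j) * (T + bcost p + 1) + bcost p + 1 \<and> I B s'"
    if "j \<le> B" "I j s" for j s
    using that
  proof (induction "B - j" arbitrary: j s)
    case 0
    then show ?case using last exec.WhileFalse by fastforce
  next
    case (Suc m)
    then have j: "j < B" by simp
    with step[OF j \<open>I j s\<close>] obtain t s1 where 1: "bval s p" "exec c s t s1" "t \<le> T" "I (Suc j) s1"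
      unfolding run_def by blast
    have "m = B - Suc j" "Suc j \<le> B" using Suc.hyps(2) j by simp_all
    from Suc.hyps(1)[OF this 1(4)] obtain t' s2 where
      2: "exec (While p c) s1 t' s2" "t' \<le> (B - Suc j) * (T + bcost p + 1) + bcost p + 1" "I B s2"
      by blast
    have "exec (While p c) s (bcost p + t + t' + 1) s2"
      using 1(1,2) 2(1) by (rule exec.WhileTrue)
    moreover have "bcost p + t + t' + 1 \<le> (B - j) * (T + bcost p + 1) + bcost p + 1"
    proof -
      have "B - j = Suc (B - Suc j)" using j by simp
      then show ?thesis using 2(2) 1(3) by simp
    qed
    ultimately show ?case using 2(3) by blast
  qed
  from this[of 0 s] I0 T' show ?thesis unfolding run_def by fastforce
qed

definition For :: "name \<Rightarrow> nexp \<Rightarrow> com \<Rightarrow> com" where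
  "For x e c = Seq (NSet x (NConst 0) (NConst 0))
     (While (NLess (NGet x (NConst 0)) e)
       (Seq c (NSet x (NConst 0) (NAdd (NGet x (NConst 0)) (NConst 1)))))"

lemma nwr_For [simp]: "nwr (For x e c) = insert x (nwr c)"
  by (auto simp: For_def)

lemma rwr_For [simp]: "rwr (For x e c) = rwr c"
  by (auto simp: For_def)

text \<open>The bound \<open>e\<close> is evaluated anew in every round, so it must have the value
  \<open>B\<close> in all stores that differ from \<open>s\<close> only where the loop writes.
  \<open>stable\<close> keeps the invariant independent of the counter, which changes outside
  \<open>c\<close>. The frame condition is passed to \<open>step\<close>, so invariants only
  describe what the body changes.\<close>

lemma run_For:
  assumes x: "x \<notin> nwr c"
    and e: "\<And>s'. same (insert x (nwr c)) (rwr c) s s' \<Longrightarrow> nval s' e = B"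
    and I0: "I 0 s"
    and stable: "\<And>j s' v. I j s' \<Longrightarrow> I j (nwrite s' x 0 v)"
    and step: "\<And>j s'. j < B \<Longrightarrow> same (insert x (nwr c)) (rwr c) s s' \<Longrightarrow> fst s' x 0 = j \<Longrightarrow> I j s'
                \<Longrightarrow> run c s' T (I (Suc j))"
    and T': "B * (T + ncost e + 10) + ncost e + 10 \<le> T'"
  shows "run (For x e c) s T' (\<lambda>s'. I B s' \<and> same (insert x (nwr c)) (rwr c) s s')"
proof -
  let ?S = "same (insert x (nwr c)) (rwr c) s"
  let ?J = "\<lambda>j s'. ?S s' \<and> fst s' x 0 = j \<and> I j s'"
  let ?p = "NLess (NGet x (NConst 0)) e"
  have "run (While ?p (Seq c (NSet x (NConst 0) (NAdd (NGet x (NConst 0)) (NConst 1)))))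
          (nwrite s x 0 0) (B * (T + 6 + bcost ?p + 1) + bcost ?p + 1) (?J B)"
  proof (rule run_While_count[where I = ?J and T = "T + 6"])
    fix j s' assume j: "j < B" and J: "?J j s'"
    then have e': "nval s' e = B" using e by blast
    have "run (Seq c (NSet x (NConst 0) (NAdd (NGet x (NConst 0)) (NConst 1)))) s' (T + 6) (?J (Suc j))"
    proof (rule run_Seq)
      show "run c s' T (\<lambda>s''. I (Suc j) s'' \<and> same (nwr c) (rwr c) s' s'')"
        by (rule run_same) (use step j J in blast)
    next
      fix s'' assume s'': "I (Suc j) s'' \<and> same (nwr c) (rwr c) s' s''"
      then have "fst s'' x 0 = j" using J x by (simp add: same_def)
      moreover have "?S s''" using J s'' by (auto simp: same_def)
      ultimately show "run (NSet x (NConst 0) (NAdd (NGet x (NConst 0)) (NConst 1))) s'' 6 (?J (Suc j))"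
        using s'' stable by (intro run_loopfree) (auto simp: same_def)
    qed simp
    then show "bval s' ?p \<and> run (Seq c (NSet x (NConst 0) (NAdd (NGet x (NConst 0)) (NConst 1)))) s' (T + 6) (?J (Suc j))"
      using J j e' by simp
  next
    fix s' assume J: "?J B s'"
    then show "\<not> bval s' ?p" using e by auto
  next
    show "?J 0 (nwrite s x 0 0)" using stable[OF I0] by (auto simp: same_def)
  qed simp
  note loop = this
  show ?thesis
    unfolding For_def
  proof (rule run_Seq[where R = "\<lambda>s'. s' = nwrite s x 0 0" and ?T1.0 = 3])
    show "run (NSet x (NConst 0) (NConst 0)) s 3 (\<lambda>s'. s' = nwrite s x 0 0)"
      by (rule run_loopfree) simp_all
  next
    fix s' assume "s' = nwrite s x 0 0"
    then show "run (While ?p (Seq c (NSet x (NConst 0) (NAdd (NGet x (NConst 0)) (NConst 1))))) s'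
       (B * (T + 6 + bcost ?p + 1) + bcost ?p + 1) (\<lambda>s'. I B s' \<and> ?S s')"
      using run_mono[OF loop order_refl] by simp
  qed (use T' in \<open>simp add: algebra_simps\<close>)
qed

section \<open>Renaming the arrays of a program\<close>

primrec ren_n :: "(name \<Rightarrow> name) \<Rightarrow> nexp \<Rightarrow> nexp" where
  "ren_n \<rho> (NConst m) = NConst m"
| "ren_n \<rho> (NGet x e) = NGet (\<rho> x) (ren_n \<rho> e)"
| "ren_n \<rho> (NAdd e f) = NAdd (ren_n \<rho> e) (ren_n \<rho> f)"
| "ren_n \<rho> (NSub e f) = NSub (ren_n \<rho> e) (ren_n \<rho> f)"

primrec ren_r :: "(name \<Rightarrow> name) \<Rightarrow> rexp \<Rightarrow> rexp" where
  "ren_r \<rho> (ROfNat e) = ROfNat (ren_n \<rho> e)"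
| "ren_r \<rho> (RGet x e) = RGet (\<rho> x) (ren_n \<rho> e)"
| "ren_r \<rho> (RAdd e f) = RAdd (ren_r \<rho> e) (ren_r \<rho> f)"
| "ren_r \<rho> (RSub e f) = RSub (ren_r \<rho> e) (ren_r \<rho> f)"
| "ren_r \<rho> (RMul e f) = RMul (ren_r \<rho> e) (ren_r \<rho> f)"
| "ren_r \<rho> (RDiv e f) = RDiv (ren_r \<rho> e) (ren_r \<rho> f)"
| "ren_r \<rho> (RSqrt e) = RSqrt (ren_r \<rho> e)"

primrec ren_b :: "(name \<Rightarrow> name) \<Rightarrow> bexp \<Rightarrow> bexp" where
  "ren_b \<rho> (NLess e f) = NLess (ren_n \<rho> e) (ren_n \<rho> f)"
| "ren_b \<rho> (RLess e f) = RLess (ren_r \<rho> e) (ren_r \<rho> f)"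
| "ren_b \<rho> (Neg p) = Neg (ren_b \<rho> p)"
| "ren_b \<rho> (Conj p q) = Conj (ren_b \<rho> p) (ren_b \<rho> q)"

primrec ren :: "(name \<Rightarrow> name) \<Rightarrow> com \<Rightarrow> com" where
  "ren \<rho> Skip = Skip"
| "ren \<rho> (NSet x e f) = NSet (\<rho> x) (ren_n \<rho> e) (ren_n \<rho> f)"
| "ren \<rho> (RSet x e f) = RSet (\<rho> x) (ren_n \<rho> e) (ren_r \<rho> f)"
| "ren \<rho> (Seq c c') = Seq (ren \<rho> c) (ren \<rho> c')"
| "ren \<rho> (Cond p c c') = Cond (ren_b \<rho> p) (ren \<rho> c) (ren \<rho> c')"
| "ren \<rho> (While p c) = While (ren_b \<rho> p) (ren \<rho> c)"

text \<open>The store as seen through the names of the original program: a renamed program on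
  \<open>s\<close> simulates the original one on \<open>pull \<rho> s\<close>.\<close>

definition pull :: "(name \<Rightarrow> name) \<Rightarrow> store \<Rightarrow> store" where
  "pull \<rho> s = (fst s \<circ> \<rho>, snd s \<circ> \<rho>)"

lemma nval_ren [simp]: "nval s (ren_n \<rho> e) = nval (pull \<rho> s) e"
  by (induction e) (simp_all add: pull_def)

lemma rval_ren [simp]: "rval s (ren_r \<rho> e) = rval (pull \<rho> s) e"
  by (induction e) (simp_all add: pull_def[of \<rho> s])

lemma bval_ren [simp]: "bval s (ren_b \<rho> p) = bval (pull \<rho> s) p"
  by (induction p) simp_all

lemma ncost_ren [simp]: "ncost (ren_n \<rho> e) = ncost e"
  by (induction e) simp_all

lemma rcost_ren [simp]: "rcost (ren_r \<rho> e) = rcost e"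
  by (induction e) simp_all

lemma bcost_ren [simp]: "bcost (ren_b \<rho> p) = bcost p"
  by (induction p) simp_all

lemma pull_nwrite: "inj \<rho> \<Longrightarrow> pull \<rho> (nwrite s (\<rho> x) i v) = nwrite (pull \<rho> s) x i v"
  by (auto simp: pull_def nwrite_def fun_eq_iff inj_eq)

lemma pull_rwrite: "inj \<rho> \<Longrightarrow> pull \<rho> (rwrite s (\<rho> x) i v) = rwrite (pull \<rho> s) x i v"
  by (auto simp: pull_def rwrite_def fun_eq_iff inj_eq)

text \<open>Injectivity makes a write to \<open>\<rho> x\<close> appear through \<open>pull\<close>
  as a write to \<open>x\<close> alone. The time is preserved exactly, so a time bound for the
  original program carries over.\<close>

lemma exec_ren:
  assumes "inj \<rho>"
  shows "exec c s t s' \<Longrightarrow> s = pull \<rho> u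
    \<Longrightarrow> \<exists>u'. exec (ren \<rho> c) u t u' \<and> s' = pull \<rho> u'"
proof (induction arbitrary: u rule: exec.induct)
  case (Skip s)
  then show ?case by (metis exec.Skip ren.simps(1))
next
  case (NSet x e f s)
  then have "exec (ren \<rho> (NSet x e f)) u (ncost e + ncost f + 1) (nwrite u (\<rho> x) (nval s e) (nval s f))"
    using exec.NSet[of "\<rho> x" "ren_n \<rho> e" "ren_n \<rho> f" u] by simp
  then show ?case using NSet pull_nwrite[OF assms] by metis
next
  case (RSet x e f s)
  then have "exec (ren \<rho> (RSet x e f)) u (ncost e + rcost f + 1) (rwrite u (\<rho> x) (nval s e) (rval s f))"
    using exec.RSet[of "\<rho> x" "ren_n \<rho> e" "ren_r \<rho> f" u] by simp
  then show ?case using RSet pull_rwrite[OF assms] by metis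
next
  case (Seq c s t s' c' t' s'')
  then show ?case by (metis exec.Seq ren.simps(4))
next
  case (CondTrue s p c t s' c')
  then show ?case by (metis exec.CondTrue ren.simps(5) bval_ren bcost_ren)
next
  case (CondFalse s p c' t s' c)
  then show ?case by (metis exec.CondFalse ren.simps(5) bval_ren bcost_ren)
next
  case (WhileFalse s p c)
  then show ?case by (metis exec.WhileFalse ren.simps(6) bval_ren bcost_ren)
next
  case (WhileTrue s p c t s' t' s'')
  then show ?case by (metis exec.WhileTrue ren.simps(6) bval_ren bcost_ren)
qed

lemma nwr_ren: "nwr (ren \<rho> c) \<subseteq> range \<rho>"
  by (induction c) auto

lemma rwr_ren: "rwr (ren \<rho> c) \<subseteq> range \<rho>"
  by (induction c) auto

section \<open>Excess of a bichromatic set\<close>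

locale fairness =
  fixes r b :: nat and col :: "nat \<Rightarrow> nat"
  assumes b_pos: "1 \<le> b" and b_le_r: "b \<le> r" and col_less: "col i < 2"
begin

text \<open>The violation of the ratio r:b by a set with \<open>x\<close> and \<open>y\<close>
  points of the two colors. Since b is at most r, only one of the two truncated differences can be
  positive.\<close>

definition excess :: "nat \<Rightarrow> nat \<Rightarrow> nat" where
  "excess x y = (b * x - r * y) + (b * y - r * x)"

text \<open>The number of points to leave out of the majority color when the other color is kept:
  \<open>r * y div b\<close> is the greatest number of partners that \<open>y\<close> points
  admit.\<close>

definition surplus :: "nat \<Rightarrow> nat \<Rightarrow> nat" where
  "surplus x y = (x - r * y div b) + (y - r * x div b)"

lemma excess_0_iff: "excess x y = 0 \<longleftrightarrow> b * x \<le> r * y \<and> b * y \<le> r * x"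
  by (simp add: excess_def)

lemma excess_0_0 [simp]: "excess 0 0 = 0"
  by (simp add: excess_def)

lemma excess_commute: "excess x y = excess y x"
  by (simp add: excess_def)

lemma excess_add: "excess (x + x') (y + y') \<le> excess x y + excess x' y'"
  by (simp add: excess_def algebra_simps)

lemma excess_le: "excess x y \<le> b * (x + y)"
proof -
  have "b * x \<le> r * x" "b * y \<le> r * y" using b_le_r by simp_all
  then show ?thesis by (simp add: excess_def algebra_simps)
qed

text \<open>Removing a point can only raise the difference in which its color is subtracted, and
  raises it by at most \<open>r\<close>.\<close>

lemma excess_diff: "excess x y \<le> excess (x + x') (y + y') + r * (x' + y')"
proof -
  have "b * x' \<le> r * x'" "b * y' \<le> r * y'" using b_le_r by simp_all
  then show ?thesis by (simp add: excess_def algebra_simps)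
qed

lemma surplus_0_iff: "surplus x y = 0 \<longleftrightarrow> excess x y = 0"
  using b_pos by (simp add: surplus_def excess_0_iff less_eq_div_iff_mult_less_eq mult.commute)

text \<open>The first point beyond the floor \<open>r * y div b\<close> already makes
  \<open>b * x\<close> exceed \<open>r * y\<close> by at least 1, and each further point adds
  \<open>b\<close>.\<close>

lemma surplus_le_excess: "surplus x y \<le> excess x y"
proof -
  have "x - r * y div b \<le> b * x - r * y" for x y
  proof (cases "x \<le> r * y div b")
    case False
    define q where "q = r * y div b"
    define k where "k = x - Suc q"
    have x: "x = Suc q + k" using False by (simp add: q_def k_def)
    have "r * y < b * Suc q" using b_pos unfolding q_def
      by (metis Suc_le_eq dividend_less_times_div mult.commute mult_Suc_right One_nat_def)
    moreover have "k \<le> b * k" using b_pos by simp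
    ultimately have "Suc k + r * y \<le> b * x"
      unfolding x by (simp only: distrib_left mult_Suc_right)
    then show ?thesis using x by (simp add: q_def)
  qed simp
  then show ?thesis unfolding surplus_def excess_def by (meson add_mono)
qed

text \<open>
  The sizes of the next fairlet cut off from \<open>x\<close> points of one color and \<open>y \<le> x\<close> points of the other.
  A 1:1 pair is cut off as long as the rest stays balanced, then saturated r:b blocks, and a
  smaller saturated block at the end. Without points of the second color, a single point is cut off.
\<close>

definition cut_minor :: "nat \<Rightarrow> nat \<Rightarrow> nat" where
  "cut_minor x y = (if y = 0 then 0 else if b * x + r \<le> r * y + b then 1 else min b y)"

definition cut_major :: "nat \<Rightarrow> nat \<Rightarrow> nat" where
  "cut_major x y = (if y = 0 \<or> b * x + r \<le> r * y + b then 1 else min x (r * min b y div b))"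

lemma cut_bounds:
  assumes "y \<le> x" "1 \<le> x"
  shows "1 \<le> cut_major x y" "cut_major x y \<le> x" "cut_minor x y \<le> y"
    "cut_major x y + cut_minor x y \<le> r + b"
proof -
  have *: "1 \<le> r * min b y div b" if "y \<noteq> 0"
  proof -
    have "b \<le> r * min b y" using b_le_r b_pos that
      by (metis One_nat_def Suc_leI le_trans min_def mult.right_neutral mult_le_mono2 neq0_conv nat_mult_1_right)
    then show ?thesis using b_pos by (simp add: less_eq_div_iff_mult_less_eq)
  qed
  show "1 \<le> cut_major x y" using * assms by (auto simp: cut_major_def)
  show "cut_major x y \<le> x" "cut_minor x y \<le> y"
    using assms by (auto simp: cut_major_def cut_minor_def)
  have "r * min b y div b \<le> r"
    using b_pos by (metis div_le_mono div_mult_self_is_m le_trans less_eq_Suc_le One_nat_def min.cobounded1 mult_le_mono2 order_refl)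
  then show "cut_major x y + cut_minor x y \<le> r + b"
    using b_pos b_le_r by (auto simp: cut_major_def cut_minor_def min_def)
qed

lemma cut_fair:
  assumes "y \<le> x" "1 \<le> y"
  shows "excess (cut_major x y) (cut_minor x y) = 0"
proof (cases "b * x + r \<le> r * y + b")
  case True
  then show ?thesis using b_le_r assms by (simp add: excess_0_iff cut_major_def cut_minor_def)
next
  case False
  let ?v = "min b y"
  have u: "cut_major x y = min x (r * ?v div b)" "cut_minor x y = ?v"
    using False assms by (simp_all add: cut_major_def cut_minor_def)
  have "b * (r * ?v div b) \<le> r * ?v" by simp
  then have 1: "b * cut_major x y \<le> r * cut_minor x y"
    unfolding u using mult_le_mono2[of "min x (r * ?v div b)" "r * ?v div b" b] by linarith
  have "?v \<le> r * ?v div b"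
    using b_pos b_le_r by (simp add: less_eq_div_iff_mult_less_eq mult.commute)
  moreover have "?v \<le> x" using assms by simp
  ultimately have "?v \<le> cut_major x y" unfolding u by simp
  then have "b * cut_minor x y \<le> r * cut_major x y" unfolding u(2) using b_le_r by (rule mult_le_mono[rotated])
  with 1 show ?thesis by (simp add: excess_0_iff)
qed

text \<open>As long as both colors are present, no cut creates points without partners. A pair is
  cut only if the rest stays balanced; any other piece takes as many majority points as its minority
  points admit.\<close>

lemma cut_surplus:
  assumes "y \<le> x" "1 \<le> y"
  shows "surplus (x - cut_major x y) (y - cut_minor x y) \<le> surplus x y"
proof (cases "b * x + r \<le> r * y + b")
  case True
  have "b * (x - 1) \<le> r * (y - 1)" using True assms by (simp add: diff_mult_distrib2)
  moreover have "b * (y - 1) \<le> r * (x - 1)" using assms b_le_r by (intro mult_le_mono) auto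
  ultimately have "surplus (x - 1) (y - 1) = 0" by (simp add: surplus_0_iff excess_0_iff)
  then show ?thesis using True assms by (simp add: cut_major_def cut_minor_def)
next
  case False
  show ?thesis
  proof (cases "y \<le> b")
    case True
    then have "cut_minor x y = y" "cut_major x y = min x (r * y div b)"
      using False assms by (auto simp: cut_major_def cut_minor_def)
    then show ?thesis by (simp add: surplus_def)
  next
    case y: False
    define z where "z = y - Suc b"
    define q where "q = r - b"
    have yz: "y = b + 1 + z" and rq: "r = b + q" using y b_le_r by (simp_all add: z_def q_def)
    \<comment> \<open>The failed pair test says \<open>b * (x - 1) > r * (y - 1)\<close>. With more
      than \<open>b\<close> minority points this forces x - r to be at least y - b, so after an r:b
      block the minority color cannot become the one in surplus.\<close>
    have "\<not> x + b < y + r"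
    proof
      assume "x + b < y + r"
      then have "b * (x + b + 1) \<le> b * (y + r)" by (intro mult_le_mono) auto
      moreover have "r * y + b < b * x + r" using False by simp
      ultimately show False unfolding yz rq by (simp add: algebra_simps)
    qed
    then have le: "y - b \<le> x - r" and xr: "r < x" using yz by auto
    have mb: "min b y = b" using y by simp
    have u: "cut_minor x y = b" "cut_major x y = r"
      using False y xr b_pos by (auto simp: cut_major_def cut_minor_def mb)
    \<comment> \<open>An r:b block is exactly saturated: the number of admissible partners falls by
      \<open>r\<close>, just like the number of majority points.\<close>
    have "r * (y - b) div b = r * y div b - r"
    proof -
      have "r * y = r * (y - b) + r * b" using y by (simp add: diff_mult_distrib2)
      then show ?thesis using b_pos by simp
    qed
    moreover have "r \<le> r * y div b"
      using y b_pos by (simp add: less_eq_div_iff_mult_less_eq)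
    moreover have "b * (y - b) \<le> r * (x - r)" using le b_le_r by (rule mult_le_mono[rotated])
    then have "y - b \<le> r * (x - r) div b" using b_pos by (simp add: less_eq_div_iff_mult_less_eq mult.commute)
    ultimately show ?thesis unfolding u by (simp add: surplus_def)
  qed
qed

lemma surplus_single: "surplus (Suc x) 0 = Suc (surplus x 0)"
  by (simp add: surplus_def)

lemma surplus_commute: "surplus x y = surplus y x"
  by (simp add: surplus_def)

section \<open>Total excess of the cells of a partition\<close>

definition colcount :: "(nat \<Rightarrow> nat) \<Rightarrow> nat set \<Rightarrow> nat \<Rightarrow> nat \<Rightarrow> nat" where
  "colcount cell D a c = card {i \<in> D. cell i = a \<and> col i = c}"

definition cell_excess :: "(nat \<Rightarrow> nat) \<Rightarrow> nat set \<Rightarrow> nat \<Rightarrow> nat" where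
  "cell_excess cell D a = excess (colcount cell D a 0) (colcount cell D a 1)"

definition imbalance :: "(nat \<Rightarrow> nat) \<Rightarrow> nat set \<Rightarrow> nat" where
  "imbalance cell D = (\<Sum>a\<in>cell ` D. cell_excess cell D a)"

lemma colcount_notin: "a \<notin> cell ` D \<Longrightarrow> colcount cell D a c = 0"
  unfolding colcount_def by (rule card_eq_0_iff[THEN iffD2]) auto

lemma cell_excess_notin: "a \<notin> cell ` D \<Longrightarrow> cell_excess cell D a = 0"
  by (simp add: cell_excess_def colcount_notin)

lemma imbalance_superset: "finite A \<Longrightarrow> cell ` D \<subseteq> A \<Longrightarrow> imbalance cell D = (\<Sum>a\<in>A. cell_excess cell D a)"
  unfolding imbalance_def by (rule sum.mono_neutral_left) (auto simp: cell_excess_notin)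

lemma colcount_union:
  assumes "finite D" "finite F" "D \<inter> F = {}"
  shows "colcount cell (D \<union> F) a c = colcount cell D a c + colcount cell F a c"
proof -
  have "{i \<in> D \<union> F. cell i = a \<and> col i = c} = {i \<in> D. cell i = a \<and> col i = c} \<union> {i \<in> F. cell i = a \<and> col i = c}"
    by auto
  then show ?thesis unfolding colcount_def using assms by (subst card_Un_disjoint[symmetric]) auto
qed

lemma colcount_insert:
  "finite D \<Longrightarrow> i \<notin> D \<Longrightarrow>
    colcount cell (insert i D) a c = colcount cell D a c + (if cell i = a \<and> col i = c then 1 else 0)"
proof -
  assume *: "finite D" "i \<notin> D"
  have "{k \<in> insert i D. cell k = a \<and> col k = c} =
    (if cell i = a \<and> col i = c then insert i {k \<in> D. cell k = a \<and> col k = c} else {k \<in> D. cell k = a \<and> col k = c})"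
    by auto
  then show ?thesis using * by (simp add: colcount_def)
qed

text \<open>Only the cell \<open>a\<close> changes. The additive form avoids truncated subtraction;
  it serves both the insertion or removal of one point and the dissolution of a whole group.\<close>

lemma imbalance_union_one_cell:
  assumes "finite D" "finite F" "D \<inter> F = {}" "\<And>i. i \<in> F \<Longrightarrow> cell i = a"
  shows "imbalance cell (D \<union> F) + cell_excess cell D a = imbalance cell D + cell_excess cell (D \<union> F) a"
proof -
  let ?A = "insert a (cell ` D)"
  have fin: "finite ?A" using assms by simp
  have 1: "imbalance cell (D \<union> F) = (\<Sum>x\<in>?A. cell_excess cell (D \<union> F) x)"
    by (rule imbalance_superset) (use assms in auto)
  have 2: "imbalance cell D = (\<Sum>x\<in>?A. cell_excess cell D x)"
    by (rule imbalance_superset) (use assms in auto)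
  have "cell_excess cell (D \<union> F) x = cell_excess cell D x" if "x \<noteq> a" for x
  proof -
    have "x \<notin> cell ` F" using assms(4) that by auto
    then show ?thesis using assms by (simp add: cell_excess_def colcount_union colcount_notin)
  qed
  then have "(\<Sum>x\<in>?A - {a}. cell_excess cell (D \<union> F) x) = (\<Sum>x\<in>?A - {a}. cell_excess cell D x)"
    by (intro sum.cong) auto
  with 1 2 show ?thesis
    using sum.remove[OF fin, of a "cell_excess cell (D \<union> F)"] sum.remove[OF fin, of a "cell_excess cell D"] by simp
qed

text \<open>The addresses of the cells do not matter, only the partition. A translation is the
  renaming that occurs when a grid is shifted by a multiple of its width.\<close>

lemma imbalance_shift:
  assumes "\<And>i. i \<in> D \<Longrightarrow> cell' i = cell i + K"
  shows "imbalance cell' D = imbalance cell D"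
proof -
  have im: "cell' ` D = (\<lambda>a. a + K) ` cell ` D" using assms by force
  have "imbalance cell' D = (\<Sum>a\<in>cell ` D. cell_excess cell' D (a + K))"
    unfolding imbalance_def im by (subst sum.reindex) auto
  also have "\<dots> = imbalance cell D"
    unfolding imbalance_def
  proof (rule sum.cong[OF refl])
    fix a
    have "{i \<in> D. cell' i = a + K \<and> col i = c} = {i \<in> D. cell i = a \<and> col i = c}" for c
      using assms by auto
    then show "cell_excess cell' D (a + K) = cell_excess cell D a"
      by (simp add: cell_excess_def colcount_def)
  qed
  finally show ?thesis .
qed

lemma imbalance_cong: "(\<And>i. i \<in> D \<Longrightarrow> cell' i = cell i) \<Longrightarrow> imbalance cell' D = imbalance cell D"
  using imbalance_shift[of D cell' cell 0] by simp

lemma excess_sum: "finite C \<Longrightarrow> excess (\<Sum>c\<in>C. f c) (\<Sum>c\<in>C. g c) \<le> (\<Sum>c\<in>C. excess (f c) (g c))"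
  by (induction C rule: finite_induct) (auto intro: order_trans[OF excess_add])

lemma sum_colcount: "finite D \<Longrightarrow> (\<Sum>a\<in>cell ` D. colcount cell D a 0 + colcount cell D a 1) = card D"
proof -
  assume fin: "finite D"
  have "colcount cell D a 0 + colcount cell D a 1 = card {i \<in> D. cell i = a}" for a
  proof -
    have "{i \<in> D. cell i = a} = {i \<in> D. cell i = a \<and> col i = 0} \<union> {i \<in> D. cell i = a \<and> col i = 1}"
      using col_less less_2_cases by (auto simp: One_nat_def[symmetric] simp del: One_nat_def)
    then show ?thesis unfolding colcount_def using fin by (subst card_Un_disjoint[symmetric]) auto
  qed
  then show ?thesis using sum.image_gen[OF fin, of "\<lambda>_. 1 :: nat" cell] by simp
qed

lemma imbalance_le: "finite D \<Longrightarrow> imbalance cell D \<le> b * card D"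
proof -
  assume fin: "finite D"
  have "imbalance cell D \<le> (\<Sum>a\<in>cell ` D. b * (colcount cell D a 0 + colcount cell D a 1))"
    unfolding imbalance_def cell_excess_def by (intro sum_mono excess_le)
  also have "\<dots> = b * card D" using sum_colcount[OF fin, of cell] by (simp add: sum_distrib_left[symmetric])
  finally show ?thesis .
qed

lemma imbalance_union:
  assumes "finite D" "finite F" "D \<inter> F = {}"
  shows "imbalance cell (D \<union> F) \<le> imbalance cell D + imbalance cell F"
proof -
  let ?A = "cell ` D \<union> cell ` F"
  have fin: "finite ?A" using assms by simp
  have "imbalance cell (D \<union> F) = (\<Sum>a\<in>?A. cell_excess cell (D \<union> F) a)"
    using fin by (intro imbalance_superset) auto
  also have "\<dots> \<le> (\<Sum>a\<in>?A. cell_excess cell D a + cell_excess cell F a)"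
    by (intro sum_mono) (simp add: cell_excess_def colcount_union assms excess_add)
  also have "\<dots> = imbalance cell D + imbalance cell F"
    using fin imbalance_superset[of ?A cell D] imbalance_superset[of ?A cell F] by (simp add: sum.distrib)
  finally show ?thesis .
qed

lemma imbalance_diff:
  assumes "finite D" "F \<subseteq> D"
  shows "imbalance cell (D - F) \<le> imbalance cell D + r * card F"
proof -
  have finF: "finite F" using assms finite_subset by blast
  let ?A = "cell ` D"
  have fin: "finite ?A" using assms by simp
  have DF: "colcount cell D a c = colcount cell (D - F) a c + colcount cell F a c" for a c
    using colcount_union[of "D - F" F cell a c] assms finF by (auto simp: Un_absorb2)
  have "imbalance cell (D - F) = (\<Sum>a\<in>?A. cell_excess cell (D - F) a)"
    using fin by (intro imbalance_superset) auto
  also have "\<dots> \<le> (\<Sum>a\<in>?A. cell_excess cell D a + r * (colcount cell F a 0 + colcount cell F a 1))"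
    by (intro sum_mono) (simp add: cell_excess_def DF excess_diff)
  also have "\<dots> = imbalance cell D + r * (\<Sum>a\<in>?A. colcount cell F a 0 + colcount cell F a 1)"
    by (simp add: sum.distrib imbalance_def sum_distrib_left distrib_left)
  also have "(\<Sum>a\<in>?A. colcount cell F a 0 + colcount cell F a 1) = card F"
  proof -
    have "(\<Sum>a\<in>?A. colcount cell F a 0 + colcount cell F a 1) = (\<Sum>a\<in>cell ` F. colcount cell F a 0 + colcount cell F a 1)"
      using assms by (intro sum.mono_neutral_right) (auto simp: colcount_notin)
    then show ?thesis using sum_colcount[OF finF, of cell] by simp
  qed
  finally show ?thesis .
qed

lemma imbalance_one_cell:
  assumes "\<And>i. i \<in> D \<Longrightarrow> cell i = a" "excess (card {i \<in> D. col i = 0}) (card {i \<in> D. col i = 1}) = 0"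
  shows "imbalance cell D = 0"
proof -
  have "colcount cell D a c = card {i \<in> D. col i = c}" for c
    unfolding colcount_def using assms(1) by (intro arg_cong[where f = card]) auto
  then have "cell_excess cell D a = 0" using assms(2) by (simp add: cell_excess_def)
  moreover have "cell ` D \<subseteq> {a}" using assms(1) by auto
  ultimately show ?thesis unfolding imbalance_def by (intro sum.neutral) auto
qed

text \<open>Only the points separated from a center \<open>p\<close> of a balanced set contribute.\<close>

lemma imbalance_balanced_set:
  assumes fin: "finite C" and bal: "excess (card {i \<in> C. col i = 0}) (card {i \<in> C. col i = 1}) = 0"
  shows "imbalance cell C \<le> 2 * r * card {i \<in> C. cell i \<noteq> cell p}"
proof -
  let ?O = "{i \<in> C. cell i \<noteq> cell p}"
  have finO: "finite ?O" using fin by simp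
  \<comment> \<open>The points in the cell of \<open>p\<close> form the balanced set
    \<open>C\<close> without the separated points. Removing these from a single cell costs
    \<open>r\<close> each, and on their own they have excess at most \<open>b\<close> each: together
    the factor \<open>2 * r\<close>.\<close>
  have "C = (C - ?O) \<union> ?O" by auto
  then have "imbalance cell C \<le> imbalance cell (C - ?O) + imbalance cell ?O"
    using imbalance_union[of "C - ?O" ?O cell] fin by auto
  also have "imbalance cell ?O \<le> r * card ?O"
    using imbalance_le[OF finO, of cell] b_le_r by (meson mult_le_mono1 order_trans)
  also have "imbalance cell (C - ?O) = imbalance (\<lambda>_. cell p) (C - ?O)"
    by (rule imbalance_cong) auto
  also have "\<dots> \<le> imbalance (\<lambda>_. cell p) C + r * card ?O"
    using fin by (intro imbalance_diff) auto
  also have "imbalance (\<lambda>_. cell p) C = 0"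
    using bal by (intro imbalance_one_cell) auto
  finally show ?thesis by simp
qed

text \<open>Subadditivity reduces the bound to single clusters, which are added one at a time, each
  compared with the cell of its own center \<open>p c\<close>.\<close>

lemma imbalance_balanced_clusters:
  assumes fin: "finite D"
    and bal: "\<And>c. c \<in> lab ` D \<Longrightarrow>
      excess (card {i \<in> D. lab i = c \<and> col i = 0}) (card {i \<in> D. lab i = c \<and> col i = 1}) = 0"
  shows "imbalance cell D \<le> 2 * r * card {i \<in> D. cell i \<noteq> cell (p (lab i))}"
proof -
  have "imbalance cell {i \<in> D. lab i \<in> L} \<le> 2 * r * card {i \<in> D. lab i \<in> L \<and> cell i \<noteq> cell (p (lab i))}"
    if "finite L" "L \<subseteq> lab ` D" for L
    using that
  proof (induction L rule: finite_induct)
    case empty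
    then show ?case by (simp add: imbalance_def)
  next
    case (insert c L)
    let ?C = "{i \<in> D. lab i = c}" and ?R = "{i \<in> D. lab i \<in> L}"
    have eq: "{i \<in> D. lab i \<in> insert c L} = ?C \<union> ?R" by auto
    have disj: "?C \<inter> ?R = {}" using insert by auto
    have "imbalance cell ?C \<le> 2 * r * card {i \<in> ?C. cell i \<noteq> cell (p c)}"
      using fin bal[of c] insert.prems by (intro imbalance_balanced_set) (auto simp: conj_assoc)
    also have "{i \<in> ?C. cell i \<noteq> cell (p c)} = {i \<in> D. lab i = c \<and> cell i \<noteq> cell (p (lab i))}" by auto
    finally have 1: "imbalance cell ?C \<le> 2 * r * card {i \<in> D. lab i = c \<and> cell i \<noteq> cell (p (lab i))}" .
    have 2: "imbalance cell ?R \<le> 2 * r * card {i \<in> D. lab i \<in> L \<and> cell i \<noteq> cell (p (lab i))}"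
      using insert by auto
    have "card {i \<in> D. lab i \<in> insert c L \<and> cell i \<noteq> cell (p (lab i))}
      = card {i \<in> D. lab i = c \<and> cell i \<noteq> cell (p (lab i))} + card {i \<in> D. lab i \<in> L \<and> cell i \<noteq> cell (p (lab i))}"
      using fin insert by (subst card_Un_disjoint[symmetric]) (auto intro!: arg_cong[where f = card])
    then show ?case
      unfolding eq using imbalance_union[of ?C ?R cell] disj fin 1 2
      by (simp add: distrib_left)
  qed
  from this[of "lab ` D"] fin have "imbalance cell {i \<in> D. lab i \<in> lab ` D}
     \<le> 2 * r * card {i \<in> D. lab i \<in> lab ` D \<and> cell i \<noteq> cell (p (lab i))}" by simp
  moreover have "{i \<in> D. lab i \<in> lab ` D} = D"
    "{i \<in> D. lab i \<in> lab ` D \<and> cell i \<noteq> cell (p (lab i))} = {i \<in> D. cell i \<noteq> cell (p (lab i))}" by auto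
  ultimately show ?thesis by simp
qed

end

section \<open>Nested grids shifted along the diagonal\<close>

lemma digits_unique:
  fixes f g :: "nat \<Rightarrow> nat"
  assumes "\<And>j. j < d \<Longrightarrow> f j < B" "\<And>j. j < d \<Longrightarrow> g j < B"
    and "(\<Sum>j<d. f j * B ^ j) = (\<Sum>j<d. g j * B ^ j)" "j < d"
  shows "f j = g j"
  using assms
proof (induction d arbitrary: f g j)
  case (Suc d)
  have split: "(\<Sum>j<Suc d. h j * B ^ j) = h 0 + B * (\<Sum>j<d. h (Suc j) * B ^ j)" for h :: "nat \<Rightarrow> nat"
    by (subst sum.lessThan_Suc_shift) (simp add: sum_distrib_left mult.left_commute)
  have eq: "f 0 + B * (\<Sum>j<d. f (Suc j) * B ^ j) = g 0 + B * (\<Sum>j<d. g (Suc j) * B ^ j)"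
    using Suc.prems(3) unfolding split .
  have B: "0 < B" "f 0 < B" "g 0 < B" using Suc.prems(1,2)[of 0] by auto
  have "f 0 = g 0" using arg_cong[OF eq, of "\<lambda>x. x mod B"] B by simp
  with eq B have "(\<Sum>j<d. f (Suc j) * B ^ j) = (\<Sum>j<d. g (Suc j) * B ^ j)" by simp
  then have "f (Suc j) = g (Suc j)" if "j < d" for j
    by (intro Suc.IH[of "\<lambda>j. f (Suc j)" "\<lambda>j. g (Suc j)"]) (use Suc.prems(1,2) that in auto)
  with \<open>f 0 = g 0\<close> Suc.prems(4) show ?case by (cases j) auto
qed simp

lemma less_add_if_div_eq:
  fixes x y M :: nat
  assumes "x div M = y div M" "0 < M"
  shows "x < y + M"
proof -
  have "x = M * (y div M) + x mod M" by (metis assms(1) mult_div_mod_eq)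
  moreover have "y = M * (y div M) + y mod M" by simp
  moreover have "x mod M < M" using assms(2) by simp
  ultimately show ?thesis by linarith
qed

lemma sorted_map_add: "sorted xs \<Longrightarrow> sorted (map (\<lambda>x. c + x) xs)" for c :: nat
  by (induction xs) auto

text \<open>Numbers in different intervals of a grid have one of its lines between them; the last
  line not above \<open>y\<close> is the witness.\<close>

lemma div_neq_crossing:
  fixes x y t M :: nat
  assumes "x \<le> y" "t \<le> x" "(x - t) div M \<noteq> (y - t) div M"
  shows "\<exists>z. x < z \<and> z \<le> y \<and> M dvd z - t"
proof -
  define q where "q = (y - t) div M"
  have "(x - t) div M < q" using assms unfolding q_def by (simp add: div_le_mono order_le_neq_trans)
  moreover have "M \<noteq> 0" using assms(3) by (cases "M = 0") auto
  ultimately have "x - t < M * q" by (simp add: div_less_iff_less_mult mult.commute)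
  moreover have "M * q \<le> y - t" unfolding q_def by simp
  ultimately have "x < t + M * q" "t + M * q \<le> y" using assms(1,2) by linarith+
  moreover have "M dvd (t + M * q) - t" by simp
  ultimately show ?thesis by blast
qed

text \<open>A grid line passes through \<open>z\<close> exactly when the shift is congruent to
  \<open>z\<close> modulo \<open>2 ^ m\<close>. The bound \<open>2 ^ H \<le> z\<close> keeps
  \<open>z - t\<close> from truncating.\<close>

lemma card_residue_le:
  fixes z :: nat
  assumes "m \<le> H" "2 ^ H \<le> z"
  shows "card {t. t < 2 ^ H \<and> 2 ^ m dvd z - t} \<le> 2 ^ (H - m)"
proof -
  let ?A = "{t::nat. t < 2 ^ H \<and> 2 ^ m dvd z - t}"
  have mod: "t mod 2 ^ m = z mod 2 ^ m" if "t \<in> ?A" for t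
  proof -
    have "t \<le> z" "2 ^ m dvd z - t" using that assms(2) by auto
    then show ?thesis using mod_eq_dvd_iff_nat[of t z "2 ^ m"] by simp
  qed
  have "inj_on (\<lambda>t. t div 2 ^ m) ?A"
    by (rule inj_onI) (metis mod div_mult_mod_eq)
  moreover have "(\<lambda>t. t div 2 ^ m) ` ?A \<subseteq> {..<2 ^ (H - m)}"
    using assms by (auto simp: less_mult_imp_div_less power_add[symmetric])
  ultimately have "card ?A \<le> card {..<2 ^ (H - m) :: nat}"
    by (rule card_inj_on_le) simp
  then show ?thesis by simp
qed

locale grid = fairness +
  fixes n d H :: nat and crd :: "nat \<Rightarrow> nat"
  assumes d_pos: "1 \<le> d" and crd_less: "k < n * d \<Longrightarrow> crd k < 2 ^ H"
begin

abbreviation N :: nat where "N \<equiv> n * d"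

text \<open>The offset keeps \<open>S k - t\<close> from truncating for every shift up to
  \<open>2 ^ H\<close>. It costs one bit, hence the base \<open>2 ^ (H + 1)\<close> of the
  addresses.\<close>

definition S :: "nat \<Rightarrow> nat" where "S k = crd k + 2 ^ H"

definition dig :: "nat \<Rightarrow> nat \<Rightarrow> nat \<Rightarrow> nat" where
  "dig m t k = (S k - t) div 2 ^ m"

definition W :: "nat \<Rightarrow> nat" where "W k = (2 ^ (H + 1)) ^ (k mod d)"

text \<open>The base-\<open>2^(H+1)\<close> number with the given digits serves as the address of a cell.\<close>

definition address :: "(nat \<Rightarrow> nat) \<Rightarrow> nat \<Rightarrow> nat" where
  "address c i = (\<Sum>k | k < N \<and> k div d = i. c k * W k)"

definition cell :: "nat \<Rightarrow> nat \<Rightarrow> nat \<Rightarrow> nat" where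
  "cell m t = address (dig m t)"

lemma index_less: "i < n \<Longrightarrow> j < d \<Longrightarrow> i * d + j < N"
proof -
  assume ij: "i < n" "j < d"
  then have "i * d + j < Suc i * d" by simp
  also have "\<dots> \<le> N" using ij by (intro mult_le_mono1) simp
  finally show ?thesis .
qed

lemma S_bounds: "k < N \<Longrightarrow> 2 ^ H \<le> S k" "k < N \<Longrightarrow> S k < 2 ^ (H + 1)"
  using crd_less[of k] by (simp_all add: S_def)

lemma dig_less: "k < N \<Longrightarrow> dig m t k < 2 ^ (H + 1)"
  using S_bounds(2)[of k] div_le_dividend[of "S k - t" "2 ^ m"] unfolding dig_def by linarith

lemma address_sum: "i < n \<Longrightarrow> address c i = (\<Sum>j<d. c (i * d + j) * (2 ^ (H + 1)) ^ j)"
proof -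
  assume i: "i < n"
  have "{k. k < N \<and> k div d = i} = (\<lambda>j. i * d + j) ` {..<d}"
  proof (intro equalityI subsetI)
    fix k assume "k \<in> {k. k < N \<and> k div d = i}"
    then have "k = i * d + k mod d" "k mod d < d" using d_pos by auto
    then show "k \<in> (\<lambda>j. i * d + j) ` {..<d}" by blast
  next
    fix k assume "k \<in> (\<lambda>j. i * d + j) ` {..<d}"
    then show "k \<in> {k. k < N \<and> k div d = i}" using index_less[OF i] by auto
  qed
  then show ?thesis
    unfolding address_def by (simp add: sum.reindex W_def)
qed

lemma cell_eqD:
  assumes "i < n" "i' < n" "j < d" "cell m t i = cell m t i'"
  shows "dig m t (i * d + j) = dig m t (i' * d + j)"
proof (rule digits_unique[where B = "2 ^ (H + 1)" and d = d and f = "\<lambda>j. dig m t (i * d + j)"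
      and g = "\<lambda>j. dig m t (i' * d + j)"])
  show "(\<Sum>j<d. dig m t (i * d + j) * (2 ^ (H + 1)) ^ j) = (\<Sum>j<d. dig m t (i' * d + j) * (2 ^ (H + 1)) ^ j)"
    using assms(4) unfolding cell_def address_sum[OF assms(1)] address_sum[OF assms(2)] .
qed (use assms index_less dig_less in auto)

lemma cell_eqI:
  assumes "i < n" "i' < n" "\<And>j. j < d \<Longrightarrow> dig m t (i * d + j) = dig m t (i' * d + j)"
  shows "cell m t i = cell m t i'"
  unfolding cell_def address_sum[OF assms(1)] address_sum[OF assms(2)] using assms(3) by simp

lemma cell_nested:
  assumes "i < n" "i' < n" "cell m t i = cell m t i'"
  shows "cell (Suc m) t i = cell (Suc m) t i'"
proof (rule cell_eqI)
  fix j assume "j < d"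
  have "dig (Suc m) t k = dig m t k div 2" for k
    by (simp only: dig_def power_Suc2 div_mult2_eq)
  then show "dig (Suc m) t (i * d + j) = dig (Suc m) t (i' * d + j)"
    using cell_eqD[OF assms(1,2) \<open>j < d\<close> assms(3)] by simp
qed (use assms in auto)

text \<open>All values \<open>S k\<close> are below \<open>2 ^ (H + 1)\<close>, so level
  \<open>H + 1\<close> has a single cell, where every point still waiting finds all others.\<close>

lemma cell_root: "i < n \<Longrightarrow> cell (Suc H) t i = 0"
proof -
  assume i: "i < n"
  have "dig (Suc H) t k = 0" if "k < N" for k
    using S_bounds(2)[OF that] unfolding dig_def by simp
  then show ?thesis unfolding cell_def address_def by simp
qed

lemma cell_close:
  assumes "i < n" "i' < n" "j < d" "t \<le> 2 ^ H" "cell m t i = cell m t i'"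
  shows "crd (i * d + j) < crd (i' * d + j) + 2 ^ m"
proof -
  let ?x = "S (i * d + j)" and ?y = "S (i' * d + j)"
  have "(?x - t) div 2 ^ m = (?y - t) div 2 ^ m"
    using cell_eqD[OF assms(1-3,5)] unfolding dig_def .
  then have "?x - t < ?y - t + 2 ^ m" by (rule less_add_if_div_eq) simp
  then show ?thesis using assms(4) by (simp add: S_def)
qed

text \<open>A multiple of the width added to the shift lowers every digit by the same number and so
  translates all addresses by a constant. Thus level \<open>m\<close> has only \<open>2 ^ m\<close>
  essentially different shifts.\<close>

lemma imbalance_cell_period:
  assumes "2 ^ m dvd T" "T + u \<le> 2 ^ H"
  shows "imbalance (cell m u) {..<n} = imbalance (cell m (T + u)) {..<n}"
proof (rule imbalance_shift)
  define q where "q = T div 2 ^ m"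
  have T: "T = 2 ^ m * q" unfolding q_def using assms(1) by simp
  fix i assume "i \<in> {..<n}"
  then have i: "i < n" by simp
  have "dig m u (i * d + j) = dig m (T + u) (i * d + j) + q" if "j < d" for j
  proof -
    let ?x = "S (i * d + j)"
    have "2 ^ H \<le> ?x" using S_bounds(1) index_less[OF i that] by blast
    then have "?x - u = (?x - (T + u)) + 2 ^ m * q" using assms(2) T by simp
    then show ?thesis unfolding dig_def by simp
  qed
  then show "cell m u i = cell m (T + u) i + T div 2 ^ m * (\<Sum>j<d. (2 ^ (H + 1)) ^ j)"
    unfolding cell_def address_sum[OF i] by (simp add: distrib_right sum.distrib sum_distrib_left q_def)
qed

text \<open>While the shift runs from 0 to below the width, each digit drops by one exactly once,
  when the shift passes the residue of its coordinate. These drops are the events of the sweep; the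
  second claim keeps them from truncating.\<close>

lemma dig_sweep:
  assumes "k < N" "m \<le> H" "u < 2 ^ m"
  shows "dig m u k = dig m 0 k - (if S k mod 2 ^ m < u then 1 else 0)" "1 \<le> dig m 0 k"
proof -
  define q where "q = S k div 2 ^ m"
  define e where "e = S k mod 2 ^ m"
  have Sk: "S k = q * 2 ^ m + e" unfolding q_def e_def by (simp only: div_mult_mod_eq)
  have e: "e < 2 ^ m" unfolding e_def by simp
  have "2 ^ m \<le> S k" using S_bounds(1)[OF assms(1)] assms(2) by (meson le_trans one_le_numeral power_increasing)
  then have q: "1 \<le> q" unfolding q_def by (simp add: Suc_le_eq div_greater_zero_iff)
  then show "1 \<le> dig m 0 k" by (simp add: dig_def q_def)
  have "(S k - u) div 2 ^ m = q - (if e < u then 1 else 0)"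
  proof (cases "e < u")
    case True
    have "S k - u = (q - 1) * 2 ^ m + (2 ^ m + e - u)"
      using q True assms(3) unfolding Sk by (cases q) auto
    moreover have "2 ^ m + e - u < 2 ^ m" using True assms(3) by simp
    ultimately show ?thesis using True by simp
  next
    case False
    then have "S k - u = q * 2 ^ m + (e - u)" unfolding Sk by simp
    moreover have "(q * 2 ^ m + (e - u)) div 2 ^ m = q" using e by simp
    ultimately show ?thesis using False by (simp only: if_False diff_zero)
  qed
  then show "dig m u k = dig m 0 k - (if S k mod 2 ^ m < u then 1 else 0)"
    by (simp add: dig_def q_def e_def)
qed

subsection \<open>Sorting the coordinates by their residues\<close>

definition bit_of :: "nat \<Rightarrow> nat \<Rightarrow> nat" where
  "bit_of m k = (S k div 2 ^ m) mod 2"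

text \<open>Radix sort from the lowest bit: a stable split by bit \<open>m\<close> refines the order
  of the residues modulo \<open>2 ^ m\<close> to that modulo \<open>2 ^ (m + 1)\<close>, so each
  level obtains its event order from the one below in linear time.\<close>

primrec order :: "nat \<Rightarrow> nat list" where
  "order 0 = [0..<N]"
| "order (Suc m) = filter (\<lambda>k. bit_of m k = 0) (order m) @ filter (\<lambda>k. bit_of m k \<noteq> 0) (order m)"

lemma mod_Suc_power: "S k mod 2 ^ Suc m = bit_of m k * 2 ^ m + S k mod 2 ^ m"
  using mod_mult2_eq[of "S k" "2 ^ m" 2] by (simp only: bit_of_def power_Suc2 mult.commute)

lemma bit_of_cases: "bit_of m k = 0 \<or> bit_of m k = 1"
  unfolding bit_of_def by presburger

lemma set_order: "set (order m) = {..<N}"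
  by (induction m) auto

lemma distinct_order: "distinct (order m)"
  by (induction m) auto

lemma length_order: "length (order m) = N"
  using distinct_card[OF distinct_order[of m]] by (simp add: set_order)

lemma sorted_order: "sorted (map (\<lambda>k. S k mod 2 ^ m) (order m))"
proof (induction m)
  case 0
  show ?case by (simp add: sorted_iff_nth_mono)
next
  case (Suc m)
  have *: "sorted (map (\<lambda>k. S k mod 2 ^ Suc m) (filter P (order m)))"
    if P: "\<And>k. P k \<Longrightarrow> bit_of m k = c" for P c
  proof -
    have "map (\<lambda>k. S k mod 2 ^ Suc m) (filter P (order m)) =
      map (\<lambda>x. c * 2 ^ m + x) (map (\<lambda>k. S k mod 2 ^ m) (filter P (order m)))"
      using P by (simp add: mod_Suc_power del: power_Suc)
    moreover have "sorted (map (\<lambda>k. S k mod 2 ^ m) (filter P (order m)))"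
      using Suc by (rule sorted_filter)
    ultimately show ?thesis using sorted_map_add by (simp only:)
  qed
  have "S k mod 2 ^ Suc m \<le> S k' mod 2 ^ Suc m" if "bit_of m k = 0" "bit_of m k' \<noteq> 0" for k k'
  proof -
    have "bit_of m k' = 1" using that bit_of_cases[of m k'] by simp
    then show ?thesis
      unfolding mod_Suc_power using that(1) by (simp add: less_imp_le trans_le_add1)
  qed
  moreover have "sorted (map (\<lambda>k. S k mod 2 ^ Suc m) (filter (\<lambda>k. bit_of m k = 0) (order m)))"
    by (rule *)
  moreover have "sorted (map (\<lambda>k. S k mod 2 ^ Suc m) (filter (\<lambda>k. bit_of m k \<noteq> 0) (order m)))"
    by (rule *[where c = 1]) (metis bit_of_cases)
  ultimately show ?case by (auto simp: sorted_append simp del: power_Suc)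
qed

text \<open>The number of events of level \<open>m\<close> that shift \<open>u\<close> has passed.
  Shifts below \<open>2 ^ m\<close> of equal rank induce the same cells on level \<open>m\<close>,
  so ranks replace shifts as array indices.\<close>

definition rank :: "nat \<Rightarrow> nat \<Rightarrow> nat" where
  "rank m u = card {k. k < N \<and> S k mod 2 ^ m < u}"

lemma rank_le: "rank m u \<le> N"
proof -
  have "rank m u \<le> card {..<N}" unfolding rank_def by (intro card_mono) auto
  then show ?thesis by simp
qed

lemma sorted_filter_less_take:
  fixes f :: "'a \<Rightarrow> nat"
  shows "sorted (map f xs) \<Longrightarrow> take (length (filter (\<lambda>x. f x < u) xs)) xs = filter (\<lambda>x. f x < u) xs"
proof (induction xs)
  case (Cons x xs)
  show ?case
  proof (cases "f x < u")
    case False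
    then have "filter (\<lambda>x. f x < u) xs = []" using Cons.prems by (auto simp: filter_empty_conv)
    then show ?thesis using False by simp
  qed (use Cons in simp)
qed simp

lemma set_take_order:
  "set (take (rank m u) (order m)) = {k. k < N \<and> S k mod 2 ^ m < u}"
proof -
  let ?xs = "filter (\<lambda>k. S k mod 2 ^ m < u) (order m)"
  have "distinct ?xs" using distinct_order by simp
  then have "length ?xs = card {k. k < N \<and> S k mod 2 ^ m < u}"
    by (subst distinct_card[symmetric]) (auto simp: set_order intro!: arg_cong[where f = card])
  then have "rank m u = length ?xs" by (simp add: rank_def)
  then have "take (rank m u) (order m) = ?xs"
    using sorted_filter_less_take[OF sorted_order[of m], of u] by (simp only:)
  then show ?thesis by (auto simp: set_order)
qed

lemma length_filter_take_order:
  "length (filter P (take (rank m u) (order m))) = card {k. k < N \<and> S k mod 2 ^ m < u \<and> P k}"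
proof -
  have "distinct (filter P (take (rank m u) (order m)))" using distinct_order by (simp add: distinct_take)
  then have "length (filter P (take (rank m u) (order m))) = card (set (filter P (take (rank m u) (order m))))"
    by (rule distinct_card[symmetric])
  also have "set (filter P (take (rank m u) (order m))) = {k. k < N \<and> S k mod 2 ^ m < u \<and> P k}"
    using set_take_order[of m u] by auto
  finally show ?thesis .
qed

text \<open>For \<open>u\<close> at most \<open>2 ^ m\<close>, a residue modulo
  \<open>2 ^ (m + 1)\<close> lies below \<open>u\<close> iff bit \<open>m\<close> is clear and the
  lower bits lie below \<open>u\<close>. The rank of \<open>u\<close> on the next level is therefore
  a prefix count in the order of this level, available from a running counter without
  searching.\<close>

lemma rank_lower:
  assumes "u \<le> 2 ^ m"
  shows "length (filter (\<lambda>k. bit_of m k = 0) (take (rank m u) (order m))) = rank (Suc m) u"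
proof -
  have "{k. k < N \<and> S k mod 2 ^ m < u \<and> bit_of m k = 0} = {k. k < N \<and> S k mod 2 ^ Suc m < u}"
    using assms bit_of_cases[of m] by (auto simp: mod_Suc_power simp del: power_Suc) (metis add_lessD1 not_le mult_1 One_nat_def)+
  then show ?thesis unfolding length_filter_take_order by (simp add: rank_def del: power_Suc)
qed

text \<open>The shift \<open>u + 2 ^ m\<close> has passed all coordinates with bit \<open>m\<close>
  clear and, of the others, those whose lower bits lie below \<open>u\<close>.\<close>

lemma rank_upper:
  assumes "u \<le> 2 ^ m"
  shows "card {k. k < N \<and> bit_of m k = 0} +
    length (filter (\<lambda>k. bit_of m k \<noteq> 0) (take (rank m u) (order m))) = rank (Suc m) (u + 2 ^ m)"
proof -
  have "{k. k < N \<and> S k mod 2 ^ Suc m < u + 2 ^ m} =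
    {k. k < N \<and> bit_of m k = 0} \<union> {k. k < N \<and> S k mod 2 ^ m < u \<and> bit_of m k \<noteq> 0}" (is "?A = ?B \<union> ?C")
  proof -
    have "S k mod 2 ^ Suc m < u + 2 ^ m \<longleftrightarrow> bit_of m k = 0 \<or> S k mod 2 ^ m < u \<and> bit_of m k \<noteq> 0" for k
    proof -
      have "S k mod 2 ^ m < 2 ^ m" by simp
      then show ?thesis using bit_of_cases[of m k] unfolding mod_Suc_power
        by (auto intro: trans_less_add2)
    qed
    then show ?thesis by auto
  qed
  moreover have "card (?B \<union> ?C) = card ?B + card ?C" by (intro card_Un_disjoint) auto
  ultimately show ?thesis
    unfolding length_filter_take_order by (simp add: rank_def del: power_Suc)
qed

subsection \<open>The best shift\<close>

definition level_imbalance :: "nat \<Rightarrow> nat \<Rightarrow> nat" where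
  "level_imbalance m t = imbalance (cell m t) {..<n}"

text \<open>The objective restricted to the levels from \<open>m\<close> on, in units of
  \<open>2 ^ m\<close>. In these units the passage to the next finer level is a doubling, which
  needs only an addition.\<close>

definition weight :: "nat \<Rightarrow> nat \<Rightarrow> nat" where
  "weight m t = (\<Sum>l=m..H. 2 ^ (l - m) * level_imbalance l t)"

text \<open>
  As a function of \<open>u = t mod 2^m\<close>, the minimum of \<open>weight m t\<close> is constant between
  consecutive residues of coordinates; \<open>g\<close> lists its values and \<open>\<tau>\<close> the multiples of \<open>2^m\<close>
  to be added to \<open>u\<close> to attain them.
\<close>

definition minima :: "nat \<Rightarrow> (nat \<Rightarrow> nat) \<Rightarrow> (nat \<Rightarrow> nat) \<Rightarrow> bool" where
  "minima m g \<tau> \<longleftrightarrow> (\<forall>u<2 ^ m. let e = rank m u in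
     2 ^ m dvd \<tau> e \<and> \<tau> e + u < 2 ^ H \<and> g e = weight m (\<tau> e + u) \<and>
     (\<forall>t<2 ^ H. t mod 2 ^ m = u \<longrightarrow> g e \<le> weight m t))"

lemma weight_Suc:
  assumes "m < H"
  shows "weight m t = level_imbalance m t + 2 * weight (Suc m) t"
proof -
  have "weight m t = level_imbalance m t + (\<Sum>l=Suc m..H. 2 ^ (l - m) * level_imbalance l t)"
    unfolding weight_def using assms by (subst sum.atLeast_Suc_atMost) auto
  also have "(\<Sum>l=Suc m..H. 2 ^ (l - m) * level_imbalance l t) = 2 * weight (Suc m) t"
    unfolding weight_def sum_distrib_left
  proof (intro sum.cong refl)
    fix l assume "l \<in> {Suc m..H}"
    then have "l - m = Suc (l - Suc m)" by auto
    then show "2 ^ (l - m) * level_imbalance l t = 2 * (2 ^ (l - Suc m) * level_imbalance l t)" by simp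
  qed
  finally show ?thesis .
qed

lemma minima_top:
  assumes "\<And>u. u < 2 ^ H \<Longrightarrow> g (rank H u) = level_imbalance H u" "\<And>u. \<tau> (rank H u) = 0"
  shows "minima H g \<tau>"
  using assms by (auto simp: minima_def weight_def Let_def)

text \<open>A shift with residue \<open>u\<close> modulo \<open>2 ^ m\<close> has residue
  \<open>u\<close> or \<open>u + 2 ^ m\<close> modulo \<open>2 ^ (m + 1)\<close>. By periodicity
  level \<open>m\<close> does not distinguish these two, so the better of their two minima on the
  coarser levels is the right choice; \<open>lo\<close> and \<open>hi\<close> are their ranks
  there.\<close>

lemma minima_step:
  assumes m: "m < H" and IH: "minima (Suc m) g \<tau>"
    and XV: "\<And>u. u < 2 ^ m \<Longrightarrow> xv (rank m u) = level_imbalance m u"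
    and lo: "\<And>e. e \<le> N \<Longrightarrow> lo e = length (filter (\<lambda>k. bit_of m k = 0) (take e (order m)))"
    and hi: "\<And>e. e \<le> N \<Longrightarrow> hi e = card {k. k < N \<and> bit_of m k = 0} +
              length (filter (\<lambda>k. bit_of m k \<noteq> 0) (take e (order m)))"
    and g': "\<And>e. e \<le> N \<Longrightarrow> g' e = xv e + 2 * (if g (hi e) < g (lo e) then g (hi e) else g (lo e))"
    and \<tau>': "\<And>e. e \<le> N \<Longrightarrow> \<tau>' e = (if g (hi e) < g (lo e) then \<tau> (hi e) + 2 ^ m else \<tau> (lo e))"
  shows "minima m g' \<tau>'"
  unfolding minima_def Let_def
proof (intro allI impI)
  fix u :: nat assume u: "u < 2 ^ m"
  define e where "e = rank m u"
  have e: "e \<le> N" unfolding e_def by (rule rank_le)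
  have lo_e: "lo e = rank (Suc m) u"
    using lo[OF e] rank_lower[of u m] u by (simp add: e_def)
  have hi_e: "hi e = rank (Suc m) (u + 2 ^ m)"
    using hi[OF e] rank_upper[of u m] u by (simp add: e_def)
  have u1: "u < 2 ^ Suc m" and u2: "u + 2 ^ m < 2 ^ Suc m" using u by simp_all
  note L = IH[unfolded minima_def Let_def, rule_format, OF u1, folded lo_e]
  note U = IH[unfolded minima_def Let_def, rule_format, OF u2, folded hi_e]
  define w where "w = \<tau>' e + u"
  have dvd': "2 ^ m dvd \<tau>' e"
    using L U unfolding \<tau>'[OF e] by (auto intro: dvd_add power_le_dvd[of 2 "Suc m"])
  have w: "w < 2 ^ H" using L U unfolding w_def \<tau>'[OF e] by (auto simp: ac_simps)
  have g_w: "weight (Suc m) w = (if g (hi e) < g (lo e) then g (hi e) else g (lo e))"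
    using L U unfolding w_def \<tau>'[OF e] by (auto simp: ac_simps)
  have "xv e = level_imbalance m w"
    using XV[OF u] imbalance_cell_period[OF dvd', of u] w
    unfolding e_def[symmetric] w_def level_imbalance_def by simp
  then have g'_w: "g' e = weight m w" using g'[OF e] g_w weight_Suc[OF m, of w] by simp
  have "g' e \<le> weight m t" if t: "t < 2 ^ H" "t mod 2 ^ m = u" for t
  proof -
    have "t mod 2 ^ Suc m = u \<or> t mod 2 ^ Suc m = u + 2 ^ m"
      using t(2) by (auto simp: power_Suc2 mod_mult2_eq simp del: power_Suc)
    then have "g (lo e) \<le> weight (Suc m) t \<or> g (hi e) \<le> weight (Suc m) t"
      using L U t(1) by blast
    then have "weight (Suc m) w \<le> weight (Suc m) t" unfolding g_w by auto
    moreover have "level_imbalance m t = xv e"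
      using XV[OF u] imbalance_cell_period[of m "t - u" u] t
      unfolding e_def[symmetric] level_imbalance_def
      by (metis dvd_minus_mod le_add_diff_inverse2 less_imp_le mod_less_eq_dividend)
    ultimately show ?thesis
      using g'_w weight_Suc[OF m, of t] weight_Suc[OF m, of w] \<open>xv e = level_imbalance m w\<close> by simp
  qed
  then show "2 ^ m dvd \<tau>' (rank m u) \<and> \<tau>' (rank m u) + u < 2 ^ H \<and>
      g' (rank m u) = weight m (\<tau>' (rank m u) + u) \<and>
      (\<forall>t<2 ^ H. t mod 2 ^ m = u \<longrightarrow> g' (rank m u) \<le> weight m t)"
    using dvd' w g'_w unfolding w_def e_def by blast
qed

lemma minima_bottom:
  assumes "minima 0 g \<tau>"
  shows "\<tau> 0 < 2 ^ H" "t < 2 ^ H \<Longrightarrow> weight 0 (\<tau> 0) \<le> weight 0 t"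
proof -
  have "rank 0 0 = 0" by (simp add: rank_def)
  with assms have "\<tau> 0 < 2 ^ H \<and> g 0 = weight 0 (\<tau> 0) \<and> (\<forall>t<2 ^ H. g 0 \<le> weight 0 t)"
    unfolding minima_def Let_def by (metis One_nat_def add.right_neutral less_one mod_by_1 power_0 mod_by_Suc_0)
  then show "\<tau> 0 < 2 ^ H" "t < 2 ^ H \<Longrightarrow> weight 0 (\<tau> 0) \<le> weight 0 t" by auto
qed

section \<open>Averaging the imbalance over all shifts\<close>

definition absdiff :: "nat \<Rightarrow> nat \<Rightarrow> nat" where
  "absdiff x y = (x - y) + (y - x)"

text \<open>Each integer position \<open>z\<close> between the two coordinates carries a line of
  level \<open>m\<close> for at most \<open>2 ^ (H - m)\<close> shifts. Divided by the number
  \<open>2 ^ H\<close> of shifts, this is the usual bound on the probability that a random grid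
  separates two coordinates.\<close>

lemma card_separating_shifts:
  assumes k: "k < N" "k' < N" and m: "m \<le> H"
  shows "card {t. t < 2 ^ H \<and> dig m t k \<noteq> dig m t k'} \<le> 2 ^ (H - m) * absdiff (crd k) (crd k')"
proof -
  have *: "card {t. t < 2 ^ H \<and> dig m t k \<noteq> dig m t k'} \<le> 2 ^ (H - m) * (crd k' - crd k)"
    if k: "k < N" "k' < N" and le: "S k \<le> S k'" for k k'
  proof -
    have "{t. t < 2 ^ H \<and> dig m t k \<noteq> dig m t k'} \<subseteq> (\<Union>z\<in>{S k<..S k'}. {t. t < 2 ^ H \<and> 2 ^ m dvd z - t})"
    proof
      fix t assume "t \<in> {t. t < 2 ^ H \<and> dig m t k \<noteq> dig m t k'}"
      then have t: "t < 2 ^ H" "(S k - t) div 2 ^ m \<noteq> (S k' - t) div 2 ^ m" by (auto simp: dig_def)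
      then have "t \<le> S k" using S_bounds(1)[OF k(1)] by simp
      from div_neq_crossing[OF le this t(2)] t(1)
      show "t \<in> (\<Union>z\<in>{S k<..S k'}. {t. t < 2 ^ H \<and> 2 ^ m dvd z - t})" by auto
    qed
    then have "card {t. t < 2 ^ H \<and> dig m t k \<noteq> dig m t k'}
      \<le> card (\<Union>z\<in>{S k<..S k'}. {t. t < 2 ^ H \<and> 2 ^ m dvd z - t})"
      by (intro card_mono) auto
    also have "\<dots> \<le> (\<Sum>z\<in>{S k<..S k'}. card {t. t < 2 ^ H \<and> 2 ^ m dvd z - t})"
      by (rule card_UN_le) simp
    also have "\<dots> \<le> (\<Sum>z\<in>{S k<..S k'}. 2 ^ (H - m))"
      using S_bounds(1)[OF k(1)] m by (intro sum_mono card_residue_le) auto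
    also have "\<dots> = 2 ^ (H - m) * (crd k' - crd k)" by (simp add: S_def)
    finally show ?thesis .
  qed
  show ?thesis
  proof (cases "S k \<le> S k'")
    case True
    then show ?thesis using *[OF k True] by (simp add: absdiff_def distrib_left)
  next
    case False
    have "{t. t < 2 ^ H \<and> dig m t k \<noteq> dig m t k'} = {t. t < 2 ^ H \<and> dig m t k' \<noteq> dig m t k}" by auto
    then show ?thesis using *[OF k(2,1)] False by (simp add: absdiff_def distrib_left)
  qed
qed

definition gridcost :: "(nat \<Rightarrow> nat) \<Rightarrow> nat" where
  "gridcost \<pi> = (\<Sum>i<n. \<Sum>j<d. absdiff (crd (i * d + j)) (crd (\<pi> i * d + j)))"

text \<open>A point contributes only when some axis separates it from its medoid
  \<open>p (lab i)\<close>; the union bound over the axes turns separation counts into an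
  l1-distance.\<close>

lemma sum_level_imbalance:
  assumes m: "m \<le> H"
    and bal: "\<And>c. c \<in> lab ` {..<n} \<Longrightarrow>
      excess (card {i \<in> {..<n}. lab i = c \<and> col i = 0}) (card {i \<in> {..<n}. lab i = c \<and> col i = 1}) = 0"
    and p: "\<And>i. i < n \<Longrightarrow> p (lab i) < n"
  shows "(\<Sum>t<2 ^ H. level_imbalance m t) \<le> 2 * r * (2 ^ (H - m) * gridcost (\<lambda>i. p (lab i)))"
proof -
  let ?sep = "\<lambda>t i j. if dig m t (i * d + j) \<noteq> dig m t (p (lab i) * d + j) then 1 else 0 :: nat"
  have card: "card {i \<in> {..<n}. cell m t i \<noteq> cell m t (p (lab i))} \<le> (\<Sum>i<n. \<Sum>j<d. ?sep t i j)" for t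
  proof -
    have "card {i \<in> {..<n}. cell m t i \<noteq> cell m t (p (lab i))}
        = (\<Sum>i<n. if cell m t i \<noteq> cell m t (p (lab i)) then 1 else 0)"
      by (simp add: sum.If_cases Collect_conj_eq[symmetric] Int_def)
    also have "\<dots> \<le> (\<Sum>i<n. \<Sum>j<d. ?sep t i j)"
    proof (rule sum_mono)
      fix i assume "i \<in> {..<n}"
      then have i: "i < n" by simp
      show "(if cell m t i \<noteq> cell m t (p (lab i)) then 1 else 0) \<le> (\<Sum>j<d. ?sep t i j)"
      proof (cases "cell m t i = cell m t (p (lab i))")
        case False
        then obtain j where "j < d" "dig m t (i * d + j) \<noteq> dig m t (p (lab i) * d + j)"
          using cell_eqI[OF i p[OF i]] by blast
        then have "1 \<le> ?sep t i j" by simp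
        also have "\<dots> \<le> (\<Sum>j<d. ?sep t i j)" using \<open>j < d\<close> by (intro member_le_sum) auto
        finally show ?thesis by simp
      qed simp
    qed
    finally show ?thesis .
  qed
  have "level_imbalance m t \<le> 2 * r * (\<Sum>i<n. \<Sum>j<d. ?sep t i j)" for t
    unfolding level_imbalance_def
    by (rule order_trans[OF imbalance_balanced_clusters[OF finite_lessThan, where lab = lab and p = p]])
      (use bal card in \<open>auto intro: mult_le_mono2\<close>)
  then have "(\<Sum>t<2 ^ H. level_imbalance m t) \<le> (\<Sum>t<2 ^ H. 2 * r * (\<Sum>i<n. \<Sum>j<d. ?sep t i j))"
    by (intro sum_mono)
  also have "\<dots> = 2 * r * (\<Sum>i<n. \<Sum>j<d. \<Sum>t<2 ^ H. ?sep t i j)"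
  proof -
    have "(\<Sum>t<2 ^ H. \<Sum>i<n. \<Sum>j<d. ?sep t i j) = (\<Sum>i<n. \<Sum>t<2 ^ H. \<Sum>j<d. ?sep t i j)"
      by (rule sum.swap)
    also have "\<dots> = (\<Sum>i<n. \<Sum>j<d. \<Sum>t<2 ^ H. ?sep t i j)"
      by (intro sum.cong refl sum.swap)
    finally show ?thesis by (simp add: sum_distrib_left[symmetric])
  qed
  also have "\<dots> \<le> 2 * r * (\<Sum>i<n. \<Sum>j<d. 2 ^ (H - m) * absdiff (crd (i * d + j)) (crd (p (lab i) * d + j)))"
  proof (intro mult_le_mono2 sum_mono)
    fix i j assume ij: "i \<in> {..<n}" "j \<in> {..<d}"
    have "(\<Sum>t<2 ^ H. ?sep t i j) = card {t. t < 2 ^ H \<and> dig m t (i * d + j) \<noteq> dig m t (p (lab i) * d + j)}"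
      by (simp add: sum.If_cases Collect_conj_eq[symmetric] Int_def)
    also have "\<dots> \<le> 2 ^ (H - m) * absdiff (crd (i * d + j)) (crd (p (lab i) * d + j))"
      using ij p index_less m by (intro card_separating_shifts) auto
    finally show "(\<Sum>t<2 ^ H. ?sep t i j) \<le> 2 ^ (H - m) * absdiff (crd (i * d + j)) (crd (p (lab i) * d + j))" .
  qed
  also have "\<dots> = 2 * r * (2 ^ (H - m) * gridcost (\<lambda>i. p (lab i)))"
    by (simp add: gridcost_def sum_distrib_left)
  finally show ?thesis .
qed

text \<open>The minimum is at most the average. The weight \<open>2 ^ l\<close> of level
  \<open>l\<close> cancels against the factor \<open>2 ^ (H - l)\<close> in the number of separating
  shifts, so all \<open>H + 1\<close> levels contribute the same bound.\<close>

lemma weight_best_shift: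
  assumes best: "\<And>t'. t' < 2 ^ H \<Longrightarrow> weight 0 t \<le> weight 0 t'"
    and bal: "\<And>c. c \<in> lab ` {..<n} \<Longrightarrow>
      excess (card {i \<in> {..<n}. lab i = c \<and> col i = 0}) (card {i \<in> {..<n}. lab i = c \<and> col i = 1}) = 0"
    and p: "\<And>i. i < n \<Longrightarrow> p (lab i) < n"
  shows "weight 0 t \<le> (H + 1) * (2 * r * gridcost (\<lambda>i. p (lab i)))"
proof -
  let ?Q = "gridcost (\<lambda>i. p (lab i))"
  have "2 ^ H * weight 0 t = (\<Sum>t'::nat<2 ^ H. weight 0 t)" by simp
  also have "\<dots> \<le> (\<Sum>t'<2 ^ H. weight 0 t')" using best by (intro sum_mono) auto
  also have "\<dots> = (\<Sum>l=0..H. 2 ^ l * (\<Sum>t'<2 ^ H. level_imbalance l t'))"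
    unfolding weight_def by (subst sum.swap) (simp add: sum_distrib_left)
  also have "\<dots> \<le> (\<Sum>l=0..H. 2 ^ l * (2 * r * (2 ^ (H - l) * ?Q)))"
    by (intro sum_mono mult_le_mono2 sum_level_imbalance[where lab = lab and p = p] bal p) auto
  also have "\<dots> = (\<Sum>l=0..H. 2 ^ H * (2 * r * ?Q))"
  proof (intro sum.cong refl)
    fix l assume "l \<in> {0..H}"
    then have "(2::nat) ^ H = 2 ^ l * 2 ^ (H - l)" by (simp add: power_add[symmetric])
    then show "2 ^ l * (2 * r * (2 ^ (H - l) * ?Q)) = 2 ^ H * (2 * r * ?Q)" by simp
  qed
  also have "\<dots> = 2 ^ H * ((H + 1) * (2 * r * ?Q))" by (simp add: algebra_simps)
  finally show ?thesis by (simp del: mult_Suc add_Suc_right add_Suc)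
qed

end

section \<open>The algorithm\<close>

text \<open>
  Coordinate number \<open>q\<close> belongs to point \<open>pt q\<close> and axis \<open>co q\<close>. The arrays \<open>FP\<close> (cell addresses),
  \<open>BIT\<close>, \<open>ORD\<close>, \<open>G\<close> and \<open>T\<close> are two-dimensional: the row of level \<open>m\<close> starts at \<open>ON m\<close>. To do without
  multiplications, \<open>P\<close> and \<open>Q\<close> store \<open>b\<close> times and \<open>r\<close> times the number of points of color \<open>c\<close> in the
  cell with address \<open>a\<close> at index \<open>2a + c\<close>, and \<open>fP\<close> and \<open>fQ\<close> do the same for the group with
  representative \<open>a\<close>. At these indices there are also linked lists of points: \<open>hd\<close> and \<open>nx\<close> store the
  next point plus 1, and 0 at the end.
\<close>

abbreviation var :: "name \<Rightarrow> nexp" where "var x \<equiv> NGet x (NConst 0)"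
abbreviation nadd :: "nexp \<Rightarrow> nexp \<Rightarrow> nexp" (infixl "\<oplus>" 65) where "e \<oplus> f \<equiv> NAdd e f"
abbreviation nsub :: "nexp \<Rightarrow> nexp \<Rightarrow> nexp" (infixl "\<ominus>" 65) where "e \<ominus> f \<equiv> NSub e f"
abbreviation assign :: "name \<Rightarrow> nexp \<Rightarrow> com" (infix "::=" 61) where "x ::= e \<equiv> NSet x (NConst 0) e"
abbreviation incr :: "name \<Rightarrow> com" where "incr x \<equiv> x ::= var x \<oplus> NConst 1"

lemma runE:
  assumes "run c s T Q"
  obtains t s' where "exec c s t s'" "t \<le> T" "Q s'"
  using assms unfolding run_def by blast

lemma runI: "exec c s t s' \<Longrightarrow> t \<le> T \<Longrightarrow> Q s' \<Longrightarrow> run c s T Q"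
  unfolding run_def by blast

text \<open>The form used throughout: the budget is a product, and the \<open>+ 1\<close> in it pays
  for the initialisation and the last test.\<close>

lemma run_For_le:
  assumes "x \<notin> nwr c"
    and "\<And>s'. same (insert x (nwr c)) (rwr c) s s' \<Longrightarrow> nval s' e = B"
    and "I 0 s"
    and "\<And>j s' v. I j s' \<Longrightarrow> I j (nwrite s' x 0 v)"
    and "\<And>j s'. j < B \<Longrightarrow> same (insert x (nwr c)) (rwr c) s s' \<Longrightarrow> fst s' x 0 = j \<Longrightarrow> I j s'
                \<Longrightarrow> run c s' T (I (Suc j))"
    and post: "\<And>s'. I B s' \<Longrightarrow> same (insert x (nwr c)) (rwr c) s s' \<Longrightarrow> Q s'"
    and B: "B \<le> M" and T: "T + ncost e + 10 \<le> T0"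
  shows "run (For x e c) s (T0 * (M + 1)) Q"
proof (rule run_mono[OF run_For[where B = B and I = I and T = T]])
  have "B * (T + ncost e + 10) \<le> M * T0" using B T by (rule mult_le_mono)
  then show "B * (T + ncost e + 10) + ncost e + 10 \<le> T0 * (M + 1)" using T by (simp add: algebra_simps)
qed (use assms in auto)

subsection \<open>Addresses of the cells\<close>

definition double_fp :: com where
  "double_fp = For ''i'' (var ''n'') (NSet ''fp'' (var ''i'') (NGet ''fp'' (var ''i'') \<oplus> NGet ''fp'' (var ''i'')))"

text \<open>\<open>rem\<close> holds the part of each coordinate below \<open>2 ^ (m + 1)\<close>,
  so bit \<open>m\<close> is found by one comparison and one subtraction, in the absence of
  division.\<close>

definition extract_row :: com where
  "extract_row = For ''q'' (var ''N'') (Cond (NLess (NGet ''rem'' (var ''q'')) (NGet ''pw'' (var ''m'')))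
     (NSet ''BIT'' (var ''o'' \<oplus> var ''q'') (NConst 0))
     (seqs [NSet ''rem'' (var ''q'') (NGet ''rem'' (var ''q'') \<ominus> NGet ''pw'' (var ''m'')),
        NSet ''fp'' (NGet ''pt'' (var ''q'')) (NGet ''fp'' (NGet ''pt'' (var ''q'')) \<oplus> NGet ''W'' (var ''q'')),
        NSet ''BIT'' (var ''o'' \<oplus> var ''q'') (NConst 1)]))"

definition store_fp :: com where
  "store_fp = For ''i'' (var ''n'') (NSet ''FP'' (var ''o'' \<oplus> var ''i'') (NGet ''fp'' (var ''i'')))"

definition extract_level :: com where
  "extract_level = seqs [seqs [''m'' ::= var ''H'' \<ominus> var ''j'', ''o'' ::= NGet ''ON'' (var ''m'')],
     double_fp, extract_row, store_fp]"

definition init_extract :: com where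
  "init_extract = seqs [For ''q'' (var ''N'') (NSet ''rem'' (var ''q'') (NGet ''y'' (var ''q''))),
     For ''i'' (var ''n'') (NSet ''fp'' (var ''i'') (NConst 0))]"

definition extract_all :: com where
  "extract_all = Seq init_extract (For ''j'' (var ''H'' \<oplus> NConst 1) extract_level)"

context grid
begin

text \<open>The tables that all phases only read. Row \<open>H + 1\<close> exists for the root cell
  and, in \<open>G\<close> and \<open>T\<close>, for the zero entries above the coarsest level of
  the minimisation.\<close>

definition ctx :: "store \<Rightarrow> bool" where
  "ctx s \<longleftrightarrow> fst s ''n'' 0 = n \<and> fst s ''d'' 0 = d \<and> fst s ''r'' 0 = r \<and> fst s ''b'' 0 = b
     \<and> (\<forall>i<n. fst s ''color'' i = col i) \<and> fst s ''N'' 0 = N \<and> fst s ''H'' 0 = H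
     \<and> (\<forall>q<N. fst s ''pt'' q = q div d) \<and> (\<forall>q<N. fst s ''co'' q = q mod d) \<and> (\<forall>q<N. fst s ''W'' q = W q)
     \<and> (\<forall>h\<le>H + 1. fst s ''pw'' h = 2 ^ h) \<and> (\<forall>m\<le>H + 1. fst s ''ON'' m = m * (N + 1))"

definition ctx_names :: "name set" where
  "ctx_names = {''n'', ''d'', ''r'', ''b'', ''color'', ''N'', ''H'', ''pt'', ''co'', ''W'', ''pw'', ''ON''}"

lemma ctx_same:
  assumes "ctx s" "same X V s s'" "X \<inter> ctx_names = {}"
  shows "ctx s'"
proof -
  have eq: "fst s' y = fst s y" if "y \<in> ctx_names" for y
    using assms(2,3) that unfolding same_def by (meson disjoint_iff)
  have "fst s' ''n'' = fst s ''n''" "fst s' ''d'' = fst s ''d''" "fst s' ''r'' = fst s ''r''"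
    "fst s' ''b'' = fst s ''b''" "fst s' ''color'' = fst s ''color''" "fst s' ''N'' = fst s ''N''"
    "fst s' ''H'' = fst s ''H''" "fst s' ''pt'' = fst s ''pt''" "fst s' ''co'' = fst s ''co''"
    "fst s' ''W'' = fst s ''W''" "fst s' ''pw'' = fst s ''pw''" "fst s' ''ON'' = fst s ''ON''"
    by (rule eq; simp add: ctx_names_def)+
  then show ?thesis using assms(1) unfolding ctx_def by simp
qed

lemma n_le_N: "n \<le> N"
  using d_pos by simp

definition grid_arrays :: "store \<Rightarrow> (nat \<Rightarrow> nat) \<Rightarrow> nat \<Rightarrow> bool" where
  "grid_arrays s y m \<longleftrightarrow> (\<forall>i<n. fst s ''FP'' (m * (N + 1) + i) = address (\<lambda>k. y k div 2 ^ m) i) \<and>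
     (\<forall>q<N. fst s ''BIT'' (m * (N + 1) + q) = y q div 2 ^ m mod 2)"

text \<open>Horner's scheme: from one level to the next finer one an address doubles and receives
  the weights of the axes whose new bit is 1. This yields the addresses of all levels without
  division.\<close>

lemma address_double:
  "address (\<lambda>k. y k div 2 ^ m) i =
     2 * address (\<lambda>k. y k div 2 ^ Suc m) i + (\<Sum>k | k < N \<and> k div d = i. y k div 2 ^ m mod 2 * W k)"
proof -
  have "y k div 2 ^ m = 2 * (y k div 2 ^ Suc m) + y k div 2 ^ m mod 2" for k
    by (simp only: power_Suc2 div_mult2_eq mult_div_mod_eq)
  then have "address (\<lambda>k. y k div 2 ^ m) i =
      (\<Sum>k | k < N \<and> k div d = i. (2 * (y k div 2 ^ Suc m) + y k div 2 ^ m mod 2) * W k)"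
    unfolding address_def by (intro sum.cong) (auto simp del: power_Suc)
  then show ?thesis
    unfolding address_def by (simp add: distrib_right sum.distrib sum_distrib_left mult.assoc del: power_Suc)
qed

lemma run_double_fp:
  assumes "fst s ''n'' 0 = n"
  shows "run double_fp s (30 * (N + 1))
    (\<lambda>s'. (\<forall>i<n. fst s' ''fp'' i = 2 * fst s ''fp'' i) \<and> same {''i'', ''fp''} {} s s')"
  unfolding double_fp_def
proof (rule run_For_le[where B = n and T = 10 and
        I = "\<lambda>j s'. \<forall>i. fst s' ''fp'' i = (if i < j then 2 else 1) * fst s ''fp'' i"], goal_cases)
  case (5 j s')
  then show ?case by (intro run_loopfree) auto
qed (use assms d_pos in \<open>auto simp: same_def\<close>)

lemma run_store_fp:
  assumes "fst s ''n'' 0 = n" "fst s ''o'' 0 = off"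
  shows "run store_fp s (30 * (N + 1))
    (\<lambda>s'. (\<forall>a. fst s' ''FP'' a = (if off \<le> a \<and> a < off + n then fst s ''fp'' (a - off) else fst s ''FP'' a)) \<and>
       same {''i'', ''FP''} {} s s')"
  unfolding store_fp_def
proof (rule run_For_le[where B = n and T = 10 and
        I = "\<lambda>j s'. \<forall>a. fst s' ''FP'' a = (if off \<le> a \<and> a < off + j then fst s ''fp'' (a - off) else fst s ''FP'' a)"], goal_cases)
  case (5 j s')
  then show ?case using assms by (intro run_loopfree) (auto simp: same_def)
qed (use assms d_pos in \<open>auto simp: same_def\<close>)

lemma run_extract_row:
  assumes ctx: "ctx s" and m: "fst s ''m'' 0 = m" "m \<le> H" and off: "fst s ''o'' 0 = off"
    and rm: "\<And>q. q < N \<Longrightarrow> fst s ''rem'' q = bt q * 2 ^ m + low q"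
    and bt: "\<And>q. bt q = 0 \<or> bt q = 1" and low: "\<And>q. low q < 2 ^ m"
  shows "run extract_row s (60 * (N + 1))
    (\<lambda>s'. (\<forall>i<n. fst s' ''fp'' i = fst s ''fp'' i + (\<Sum>k | k < N \<and> k div d = i. bt k * W k)) \<and>
       (\<forall>q<N. fst s' ''rem'' q = low q) \<and>
       (\<forall>a. fst s' ''BIT'' a = (if off \<le> a \<and> a < off + N then bt (a - off) else fst s ''BIT'' a)) \<and>
       same {''q'', ''BIT'', ''rem'', ''fp''} {} s s')"
proof -
  define F where "F j i = (\<Sum>k | k < j \<and> k div d = i. bt k * W k)" for j i
  have F0: "F 0 i = 0" for i by (simp add: F_def)
  have F_Suc: "F (Suc j) i = F j i + (if i = j div d then bt j * W j else 0)" for i j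
  proof -
    have "{k. k < Suc j \<and> k div d = i} = (if i = j div d then insert j {k. k < j \<and> k div d = i} else {k. k < j \<and> k div d = i})"
      by (auto simp: less_Suc_eq)
    then show ?thesis by (simp add: F_def)
  qed
  show ?thesis
    unfolding extract_row_def seqs.simps if_False list.simps F_def[of N, symmetric]
  proof (rule run_For_le[where B = N and T = 45 and
       I = "\<lambda>j s'. (\<forall>i<n. fst s' ''fp'' i = fst s ''fp'' i + F j i) \<and>
         (\<forall>q<N. fst s' ''rem'' q = (if q < j then low q else bt q * 2 ^ m + low q)) \<and>
         (\<forall>a. fst s' ''BIT'' a = (if off \<le> a \<and> a < off + j then bt (a - off) else fst s ''BIT'' a))"],
       goal_cases)
    case (5 j s')
    have c: "ctx s'" by (rule ctx_same[OF ctx 5(2)]) (simp add: ctx_names_def)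
    have st: "fst s' ''m'' 0 = m" "fst s' ''o'' 0 = off" using 5(2) m off by (auto simp: same_def)
    have pt: "fst s' ''pt'' j = j div d" "fst s' ''W'' j = W j" "fst s' ''pw'' m = 2 ^ m"
      using c 5(1) m(2) by (auto simp: ctx_def)
    have lt: "j div d < n" using 5(1) by (simp add: less_mult_imp_div_less)
    have rem: "fst s' ''rem'' j = bt j * 2 ^ m + low j" using 5(1,4) by simp
    from bt[of j] show ?case
    proof
      assume 0: "bt j = 0"
      show ?case
        by (rule run_loopfree; use 0 rem low[of j] 5(3,4) st pt lt in \<open>auto simp: F_Suc less_Suc_eq\<close>)
    next
      assume 1: "bt j = 1"
      show ?case
        by (rule run_loopfree; use 1 rem low[of j] 5(3,4) st pt lt in \<open>auto simp: F_Suc less_Suc_eq\<close>)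
    qed
  qed (use ctx m off rm n_le_N F0 in \<open>auto simp: same_def ctx_def\<close>)
qed

lemma run_init_extract:
  assumes "ctx s"
  shows "run init_extract s (60 * (N + 1))
    (\<lambda>s'. (\<forall>q<N. fst s' ''rem'' q = fst s ''y'' q) \<and> (\<forall>i<n. fst s' ''fp'' i = 0) \<and>
       same {''q'', ''rem'', ''i'', ''fp''} {} s s')"
proof -
  have "run (For ''q'' (var ''N'') (NSet ''rem'' (var ''q'') (NGet ''y'' (var ''q'')))) s (30 * (N + 1))
    (\<lambda>s'. (\<forall>q<N. fst s' ''rem'' q = fst s ''y'' q) \<and> same {''q'', ''rem''} {} s s')"
  proof (rule run_For_le[where B = N and T = 10 and
        I = "\<lambda>j s'. \<forall>q<j. fst s' ''rem'' q = fst s ''y'' q"], goal_cases)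
    case (5 j s')
    then show ?case by (intro run_loopfree) (auto simp: same_def less_Suc_eq)
  qed (use assms in \<open>auto simp: same_def ctx_def\<close>)
  then obtain t1 s1 where 1: "exec (For ''q'' (var ''N'') (NSet ''rem'' (var ''q'') (NGet ''y'' (var ''q'')))) s t1 s1"
    "t1 \<le> 30 * (N + 1)" "\<forall>q<N. fst s1 ''rem'' q = fst s ''y'' q" "same {''q'', ''rem''} {} s s1"
    by (auto elim: runE)
  have "run (For ''i'' (var ''n'') (NSet ''fp'' (var ''i'') (NConst 0))) s1 (30 * (N + 1))
    (\<lambda>s'. (\<forall>i<n. fst s' ''fp'' i = 0) \<and> same {''i'', ''fp''} {} s1 s')"
  proof (rule run_For_le[where B = n and T = 10 and I = "\<lambda>j s'. \<forall>q<j. fst s' ''fp'' q = 0"], goal_cases)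
    case (5 j s')
    then show ?case by (intro run_loopfree) (auto simp: same_def less_Suc_eq)
  qed (use assms 1 d_pos in \<open>auto simp: same_def ctx_def\<close>)
  then obtain t2 s2 where 2: "exec (For ''i'' (var ''n'') (NSet ''fp'' (var ''i'') (NConst 0))) s1 t2 s2"
    "t2 \<le> 30 * (N + 1)" "\<forall>i<n. fst s2 ''fp'' i = 0" "same {''i'', ''fp''} {} s1 s2"
    by (auto elim: runE)
  show ?thesis
    unfolding init_extract_def
    by (rule runI[where t = "t1 + t2"]) (use 1 2 in \<open>auto intro: exec.Seq simp: same_def\<close>)
qed

lemma run_extract_level:
  assumes ctx: "ctx s" and j: "fst s ''j'' 0 = j" "j \<le> H"
    and rm: "\<And>q. q < N \<Longrightarrow> fst s ''rem'' q = y q mod 2 ^ Suc (H - j)"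
    and fp: "\<And>i. i < n \<Longrightarrow> fst s ''fp'' i = address (\<lambda>k. y k div 2 ^ Suc (H - j)) i"
    and arr: "\<And>m. H - j < m \<Longrightarrow> m \<le> H \<Longrightarrow> grid_arrays s y m"
  shows "run extract_level s (140 * (N + 1)) (\<lambda>s'.
      (\<forall>q<N. fst s' ''rem'' q = y q mod 2 ^ (H - j)) \<and>
      (\<forall>i<n. fst s' ''fp'' i = address (\<lambda>k. y k div 2 ^ (H - j)) i) \<and>
      (\<forall>m. H - j \<le> m \<longrightarrow> m \<le> H \<longrightarrow> grid_arrays s' y m))"
proof -
  define m where "m = H - j"
  define off where "off = m * (N + 1)"
  define bt where "bt q = y q div 2 ^ m mod 2" for q
  define low where "low q = y q mod 2 ^ m" for q
  have m: "m \<le> H" by (simp add: m_def)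
  \<comment> \<open>Rows have length \<open>N + 1\<close>, so writing row \<open>m\<close> leaves
    the rows of the coarser levels intact.\<close>
  have sep: "\<not> l * (N + 1) + x < off + (N + 1)" if "m < l" for l x
  proof -
    have "off + (N + 1) \<le> l * (N + 1)" using mult_le_mono1[of "Suc m" l "N + 1"] that(1) by (simp add: off_def)
    then show ?thesis by linarith
  qed
  have rm': "fst s ''rem'' q = bt q * 2 ^ m + low q" if "q < N" for q
    using rm[OF that] mod_mult2_eq[of "y q" "2 ^ m" 2]
    by (simp add: m_def[symmetric] bt_def low_def power_Suc2 mult.commute del: power_Suc)
  have "run (seqs [''m'' ::= var ''H'' \<ominus> var ''j'', ''o'' ::= NGet ''ON'' (var ''m'')]) s 20
     (\<lambda>s'. fst s' ''m'' 0 = m \<and> fst s' ''o'' 0 = off \<and> same {''m'', ''o''} {} s s')"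
    using ctx j by (intro run_loopfree) (auto simp: same_def ctx_def m_def off_def)
  then obtain t1 s1 where 1: "exec (seqs [''m'' ::= var ''H'' \<ominus> var ''j'', ''o'' ::= NGet ''ON'' (var ''m'')]) s t1 s1"
    "t1 \<le> 20" "fst s1 ''m'' 0 = m" "fst s1 ''o'' 0 = off" "same {''m'', ''o''} {} s s1"
    by (auto elim: runE)
  have c1: "ctx s1" by (rule ctx_same[OF ctx 1(5)]) (simp add: ctx_names_def)
  then have n1: "fst s1 ''n'' 0 = n" by (simp add: ctx_def)
  from run_double_fp[OF n1] obtain t2 s2 where 2: "exec double_fp s1 t2 s2"
    "t2 \<le> 30 * (N + 1)" "\<forall>i<n. fst s2 ''fp'' i = 2 * fst s1 ''fp'' i" "same {''i'', ''fp''} {} s1 s2"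
    by (auto elim: runE)
  have c2: "ctx s2" by (rule ctx_same[OF c1 2(4)]) (simp add: ctx_names_def)
  have 22: "fst s2 ''m'' 0 = m" "fst s2 ''o'' 0 = off" "\<And>q. q < N \<Longrightarrow> fst s2 ''rem'' q = bt q * 2 ^ m + low q"
    using 1 2 rm' by (auto simp: same_def)
  from run_extract_row[OF c2 22(1) m 22(2,3)] obtain t3 s3 where 3: "exec extract_row s2 t3 s3"
    "t3 \<le> 60 * (N + 1)"
    "\<forall>i<n. fst s3 ''fp'' i = fst s2 ''fp'' i + (\<Sum>k | k < N \<and> k div d = i. bt k * W k)"
    "\<forall>q<N. fst s3 ''rem'' q = low q"
    "\<forall>a. fst s3 ''BIT'' a = (if off \<le> a \<and> a < off + N then bt (a - off) else fst s2 ''BIT'' a)"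
    "same {''q'', ''BIT'', ''rem'', ''fp''} {} s2 s3"
    by (rule runE) (auto simp: bt_def low_def)
  have 33: "fst s3 ''n'' 0 = n" "fst s3 ''o'' 0 = off"
    using c2 22(2) 3(6) by (auto simp: same_def ctx_def)
  from run_store_fp[OF 33] obtain t4 s4 where 4: "exec store_fp s3 t4 s4"
    "t4 \<le> 30 * (N + 1)"
    "\<forall>a. fst s4 ''FP'' a = (if off \<le> a \<and> a < off + n then fst s3 ''fp'' (a - off) else fst s3 ''FP'' a)"
    "same {''i'', ''FP''} {} s3 s4"
    by (auto elim: runE)
  have fp4: "fst s4 ''fp'' i = address (\<lambda>k. y k div 2 ^ m) i" "fst s3 ''fp'' i = fst s4 ''fp'' i" if "i < n" for i
    using that fp[OF that] 1(5) 2(3) 3(3) 4(4) unfolding address_double[of y m i]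
    by (auto simp: same_def m_def bt_def simp del: power_Suc)
  have "grid_arrays s4 y l" if l: "m \<le> l" "l \<le> H" for l
  proof (cases "l = m")
    case True
    have "fst s4 ''FP'' (off + i) = address (\<lambda>k. y k div 2 ^ m) i" if "i < n" for i
      using 4(3) fp4[OF that] that by simp
    moreover have "fst s4 ''BIT'' (off + q) = bt q" if "q < N" for q
      using 3(5) sameD(1)[OF 4(4), of "''BIT''"] that by simp
    ultimately show ?thesis unfolding grid_arrays_def True off_def bt_def by blast
  next
    case False
    then have "m < l" using l by simp
    then have ml: "H - j < l" by (simp add: m_def)
    have FP3: "fst s3 ''FP'' = fst s ''FP''" and BIT2: "fst s2 ''BIT'' = fst s ''BIT''"
      and BIT4: "fst s4 ''BIT'' = fst s3 ''BIT''"
      using sameD(1)[OF 3(6), of "''FP''"] sameD(1)[OF 2(4)] sameD(1)[OF 1(5)] sameD(1)[OF 4(4)] by simp_all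
    have "fst s4 ''FP'' (l * (N + 1) + x) = fst s ''FP'' (l * (N + 1) + x)"
      "fst s4 ''BIT'' (l * (N + 1) + x) = fst s ''BIT'' (l * (N + 1) + x)" for x
    proof -
      have "\<not> l * (N + 1) + x < off + n" "\<not> l * (N + 1) + x < off + N"
        using sep[OF \<open>m < l\<close>, of x] n_le_N by linarith+
      then show "fst s4 ''FP'' (l * (N + 1) + x) = fst s ''FP'' (l * (N + 1) + x)"
        "fst s4 ''BIT'' (l * (N + 1) + x) = fst s ''BIT'' (l * (N + 1) + x)"
        unfolding BIT4 4(3)[rule_format, of "l * (N + 1) + x"] 3(5)[rule_format, of "l * (N + 1) + x"] FP3 BIT2
        by simp_all
    qed
    then show ?thesis using arr[OF ml l(2)] unfolding grid_arrays_def by simp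
  qed
  moreover have "\<forall>q<N. fst s4 ''rem'' q = y q mod 2 ^ m" using 3(4) 4(4) by (simp add: same_def low_def)
  ultimately show ?thesis
    unfolding extract_level_def seqs.simps m_def[symmetric]
    using 1 2 3 4 fp4
    by (intro runI[where t = "t1 + (t2 + (t3 + t4))" and s' = s4]) (auto intro!: exec.Seq)
qed

lemma run_extract_all:
  assumes ctx: "ctx s" and y: "\<And>q. q < N \<Longrightarrow> fst s ''y'' q < 2 ^ Suc H"
  shows "run extract_all s (300 * (N + 1) * (H + 2)) (\<lambda>s'. (\<forall>m\<le>H. grid_arrays s' (fst s ''y'') m) \<and>
      same {''q'', ''rem'', ''i'', ''fp'', ''j'', ''m'', ''o'', ''BIT'', ''FP''} {} s s')"
proof -
  let ?y = "fst s ''y''"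
  from run_init_extract[OF ctx] obtain t1 s1 where 1: "exec init_extract s t1 s1"
    "t1 \<le> 60 * (N + 1)" "\<forall>q<N. fst s1 ''rem'' q = ?y q" "\<forall>i<n. fst s1 ''fp'' i = 0"
    "same {''q'', ''rem'', ''i'', ''fp''} {} s s1"
    by (auto elim: runE)
  have c1: "ctx s1" by (rule ctx_same[OF ctx 1(5)]) (simp add: ctx_names_def)
  have "run (For ''j'' (var ''H'' \<oplus> NConst 1) extract_level) s1 ((140 * (N + 1) + 20) * (H + 1 + 1)) (\<lambda>s'.
     (\<forall>m\<le>H. grid_arrays s' ?y m) \<and>
      same {''q'', ''rem'', ''i'', ''fp'', ''j'', ''m'', ''o'', ''BIT'', ''FP''} {} s1 s')"
  proof (rule run_For_le[where B = "H + 1" and T = "140 * (N + 1)" and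
        I = "\<lambda>j s'. (\<forall>q<N. fst s' ''rem'' q = ?y q mod 2 ^ (Suc H - j)) \<and>
          (\<forall>i<n. fst s' ''fp'' i = address (\<lambda>k. ?y k div 2 ^ (Suc H - j)) i) \<and>
          (\<forall>m. Suc H - j \<le> m \<longrightarrow> m \<le> H \<longrightarrow> grid_arrays s' ?y m)"], goal_cases)
    case (2 s')
    then show ?case using c1 by (auto simp: same_def ctx_def extract_level_def double_fp_def extract_row_def store_fp_def)
  next
    case 3
    \<comment> \<open>Level \<open>H + 1\<close> has only zero digits, which justifies starting
      Horner's scheme with zero addresses.\<close>
    have "address (\<lambda>k. ?y k div 2 ^ Suc H) i = 0" for i
      unfolding address_def using y by (intro sum.neutral) (auto simp del: power_Suc)
    then show ?case using 1 y by (auto simp del: power_Suc)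
  next
    case (5 j s')
    have c': "ctx s'" by (rule ctx_same[OF c1 5(2)]) (simp add: extract_level_def double_fp_def extract_row_def store_fp_def ctx_names_def)
    have e: "Suc H - j = Suc (H - j)" using 5(1) by simp
    have jH: "j \<le> H" using 5(1) by simp
    have l: "H - j < m \<Longrightarrow> Suc (H - j) \<le> m" for m by simp
    show ?case
      by (rule run_mono[OF run_extract_level[where y = ?y, OF c' 5(3) jH]])
        (use 5(4) e l in \<open>auto simp del: power_Suc\<close>)
  qed (auto simp: same_def extract_level_def double_fp_def extract_row_def store_fp_def grid_arrays_def)
  then obtain t2 s2 where 2: "exec (For ''j'' (var ''H'' \<oplus> NConst 1) extract_level) s1 t2 s2"
    "t2 \<le> (140 * (N + 1) + 20) * (H + 1 + 1)" "\<forall>m\<le>H. grid_arrays s2 ?y m"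
    "same {''q'', ''rem'', ''i'', ''fp'', ''j'', ''m'', ''o'', ''BIT'', ''FP''} {} s1 s2"
    by (auto elim: runE)
  show ?thesis
    unfolding extract_all_def
  proof (rule runI[OF exec.Seq[OF 1(1) 2(1)]])
    have "t1 \<le> 60 * (N + 1) * (H + 2)" using 1(2) by (simp add: algebra_simps)
    then show "t1 + t2 \<le> 300 * (N + 1) * (H + 2)" using 2(2) by (simp add: algebra_simps)
  qed (use 1 2 in \<open>auto simp: same_def\<close>)
qed

end

subsection \<open>Radix sort\<close>

definition scatter :: "bexp \<Rightarrow> com" where
  "scatter p = For ''q'' (var ''N'') (Seq (''u'' ::= NGet ''ORD'' (var ''o'' \<oplus> var ''q''))
     (Cond p (Seq (NSet ''ORD'' (var ''c'') (var ''u'')) (incr ''c'')) Skip))"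

definition bit_clear :: bexp where
  "bit_clear = NLess (NGet ''BIT'' (var ''o'' \<oplus> var ''u'')) (NConst 1)"

definition order_level :: com where
  "order_level = Seq (Seq (''o'' ::= NGet ''ON'' (var ''j'')) (''c'' ::= NGet ''ON'' (var ''j'' \<oplus> NConst 1)))
     (Seq (scatter bit_clear) (scatter (Neg bit_clear)))"

definition order_all :: com where
  "order_all = Seq (For ''q'' (var ''N'') (NSet ''ORD'' (var ''q'') (var ''q''))) (For ''j'' (var ''H'') order_level)"

lemma nwr_scatter: "nwr (scatter p) = {''q'', ''u'', ''ORD'', ''c''}" "rwr (scatter p) = {}"
  by (auto simp: scatter_def)

context grid
begin

text \<open>The target begins behind the row being read (\<open>off + N \<le> c0\<close>), so a pass
  never overwrites its own input. Two passes, the second continuing at the counter left by the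
  first, make one stable split.\<close>

lemma run_scatter:
  assumes ctx: "ctx s" and off: "fst s ''o'' 0 = off" "fst s ''c'' 0 = c0" "off + N \<le> c0"
    and len: "length xs = N" and xs: "\<And>e. e < N \<Longrightarrow> fst s ''ORD'' (off + e) = xs ! e"
    and p: "\<And>s' e. e < N \<Longrightarrow> fst s' ''BIT'' = fst s ''BIT'' \<Longrightarrow> fst s' ''o'' 0 = off \<Longrightarrow>
        fst s' ''u'' 0 = xs ! e \<Longrightarrow> bval s' p = R (xs ! e)"
    and cost: "bcost p \<le> 10"
  shows "run (scatter p) s (60 * (N + 1)) (\<lambda>s'. fst s' ''c'' 0 = c0 + length (filter R xs) \<and>
     (\<forall>e<length (filter R xs). fst s' ''ORD'' (c0 + e) = filter R xs ! e) \<and>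
     (\<forall>a<c0. fst s' ''ORD'' a = fst s ''ORD'' a) \<and> same {''q'', ''u'', ''ORD'', ''c''} {} s s')"
  unfolding scatter_def
proof (rule run_For_le[where B = N and T = 40 and
     I = "\<lambda>j s'. fst s' ''c'' 0 = c0 + length (filter R (take j xs)) \<and>
     (\<forall>e<length (filter R (take j xs)). fst s' ''ORD'' (c0 + e) = filter R (take j xs) ! e) \<and>
     (\<forall>a<c0. fst s' ''ORD'' a = fst s ''ORD'' a)"], goal_cases)
  case (5 j s')
  have st: "fst s' ''o'' 0 = off" "fst s' ''BIT'' = fst s ''BIT''" using 5(2) off by (auto simp: same_def)
  have u: "fst s' ''ORD'' (off + j) = xs ! j" using 5(1,4) xs[of j] off by simp
  have take: "take (Suc j) xs = take j xs @ [xs ! j]" using 5(1) len by (simp add: take_Suc_conv_app_nth)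
  define L where "L = filter R (take j xs)"
  let ?s = "nwrite s' ''u'' 0 (xs ! j)"
  have b: "bval ?s p = R (xs ! j)" using 5(1) st by (intro p) auto
  note I = 5(4)[folded L_def]
  show ?case
    unfolding take filter_append L_def[symmetric]
  proof (rule run_loopfree)
    let ?c = "Seq (''u'' ::= NGet ''ORD'' (var ''o'' \<oplus> var ''q''))
       (Cond p (Seq (NSet ''ORD'' (var ''c'') (var ''u'')) (incr ''c'')) Skip)"
    have res: "result ?c s' = (if R (xs ! j) then
       nwrite (nwrite ?s ''ORD'' (c0 + length L) (xs ! j)) ''c'' 0 (c0 + length L + 1) else ?s)"
      using st u 5(3) I b by auto
    show "fst (result ?c s') ''c'' 0 = c0 + length (L @ filter R [xs ! j]) \<and>
      (\<forall>e<length (L @ filter R [xs ! j]). fst (result ?c s') ''ORD'' (c0 + e) = (L @ filter R [xs ! j]) ! e) \<and>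
      (\<forall>a<c0. fst (result ?c s') ''ORD'' a = fst s ''ORD'' a)"
      unfolding res using I by (cases "R (xs ! j)") (auto simp: nth_append less_Suc_eq)
  qed (use cost in auto)
qed (use ctx off len cost in \<open>auto simp: same_def ctx_def\<close>)

lemma run_order_level:
  assumes ctx: "ctx s" and j: "fst s ''j'' 0 = j" "j < H"
    and bit: "\<And>q. q < N \<Longrightarrow> fst s ''BIT'' (j * (N + 1) + q) = bit_of j q"
    and ord: "\<And>m e. m \<le> j \<Longrightarrow> e < N \<Longrightarrow> fst s ''ORD'' (m * (N + 1) + e) = order m ! e"
  shows "run order_level s (150 * (N + 1)) (\<lambda>s'.
     (\<forall>m\<le>Suc j. \<forall>e<N. fst s' ''ORD'' (m * (N + 1) + e) = order m ! e))"
proof -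
  define off where "off = j * (N + 1)"
  define c0 where "c0 = Suc j * (N + 1)"
  have oc: "off + N \<le> c0" by (simp add: off_def c0_def)
  let ?Z = "\<lambda>k. bit_of j k = 0"
  let ?init = "Seq (''o'' ::= NGet ''ON'' (var ''j'')) (''c'' ::= NGet ''ON'' (var ''j'' \<oplus> NConst 1))"
  have "run ?init s 20
     (\<lambda>s'. fst s' ''o'' 0 = off \<and> fst s' ''c'' 0 = c0 \<and> same {''c'', ''o''} {} s s')"
    using ctx j by (intro run_loopfree) (auto simp: same_def ctx_def off_def c0_def)
  then obtain t1 s1 where 1: "exec ?init s t1 s1" "t1 \<le> 20" "fst s1 ''o'' 0 = off" "fst s1 ''c'' 0 = c0"
    "same {''c'', ''o''} {} s s1" by (auto elim: runE)
  have c1: "ctx s1" by (rule ctx_same[OF ctx 1(5)]) (simp add: ctx_names_def)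
  have less: "order j ! e < N" if "e < N" for e
    using nth_mem[of e "order j"] that unfolding length_order set_order by simp
  have ord1: "fst s1 ''ORD'' (off + e) = order j ! e" if "e < N" for e
    using ord[of j e] that sameD(1)[OF 1(5), of "''ORD''"] by (simp add: off_def)
  have bit1: "fst s1 ''BIT'' (off + order j ! e) = bit_of j (order j ! e)" if "e < N" for e
    using bit[OF less[OF that]] sameD(1)[OF 1(5), of "''BIT''"] by (simp add: off_def)
  have "run (scatter bit_clear) s1 (60 * (N + 1)) (\<lambda>s'. fst s' ''c'' 0 = c0 + length (filter ?Z (order j)) \<and>
     (\<forall>e<length (filter ?Z (order j)). fst s' ''ORD'' (c0 + e) = filter ?Z (order j) ! e) \<and>
     (\<forall>a<c0. fst s' ''ORD'' a = fst s1 ''ORD'' a) \<and> same {''q'', ''u'', ''ORD'', ''c''} {} s1 s')"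
    by (rule run_scatter[OF c1 1(3,4) oc length_order ord1])
      (use bit1 in \<open>auto simp: bit_clear_def\<close>)
  then obtain t2 s2 where 2: "exec (scatter bit_clear) s1 t2 s2" "t2 \<le> 60 * (N + 1)"
     "fst s2 ''c'' 0 = c0 + length (filter ?Z (order j))"
     "\<forall>e<length (filter ?Z (order j)). fst s2 ''ORD'' (c0 + e) = filter ?Z (order j) ! e"
     "\<forall>a<c0. fst s2 ''ORD'' a = fst s1 ''ORD'' a" "same {''q'', ''u'', ''ORD'', ''c''} {} s1 s2"
    by (auto elim: runE)
  have c2: "ctx s2" by (rule ctx_same[OF c1 2(6)]) (simp add: ctx_names_def)
  define c1 where "c1 = c0 + length (filter ?Z (order j))"
  have o2: "fst s2 ''o'' 0 = off" and B2: "fst s2 ''BIT'' = fst s1 ''BIT''"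
    using 1(3) sameD(1)[OF 2(6)] by simp_all
  have ord2: "fst s2 ''ORD'' (off + e) = order j ! e" if "e < N" for e
    using ord1[OF that] 2(5) that oc by simp
  have oc2: "off + N \<le> c1" using oc by (simp add: c1_def)
  have "run (scatter (Neg bit_clear)) s2 (60 * (N + 1)) (\<lambda>s'. fst s' ''c'' 0 = c1 + length (filter (\<lambda>k. \<not> ?Z k) (order j)) \<and>
     (\<forall>e<length (filter (\<lambda>k. \<not> ?Z k) (order j)). fst s' ''ORD'' (c1 + e) = filter (\<lambda>k. \<not> ?Z k) (order j) ! e) \<and>
     (\<forall>a<c1. fst s' ''ORD'' a = fst s2 ''ORD'' a) \<and> same {''q'', ''u'', ''ORD'', ''c''} {} s2 s')"
    by (rule run_scatter[OF c2 o2 2(3)[folded c1_def] oc2 length_order ord2])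
      (use bit1 B2 in \<open>auto simp: bit_clear_def\<close>)
  then obtain t3 s3 where 3: "exec (scatter (Neg bit_clear)) s2 t3 s3" "t3 \<le> 60 * (N + 1)"
     "\<forall>e<length (filter (\<lambda>k. \<not> ?Z k) (order j)). fst s3 ''ORD'' (c1 + e) = filter (\<lambda>k. \<not> ?Z k) (order j) ! e"
     "\<forall>a<c1. fst s3 ''ORD'' a = fst s2 ''ORD'' a"
    by (auto elim: runE)
  have "fst s3 ''ORD'' (m * (N + 1) + e) = order m ! e" if me: "m \<le> Suc j" "e < N" for m e
  proof (cases "m = Suc j")
    case True
    have "length (filter ?Z (order j)) + length (filter (\<lambda>k. \<not> ?Z k) (order j)) = N"
      using sum_length_filter_compl[of ?Z "order j"] by (simp add: length_order)
    then have "fst s3 ''ORD'' (c0 + e) = (filter ?Z (order j) @ filter (\<lambda>k. \<not> ?Z k) (order j)) ! e"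
      using 2(4) 3(3)[rule_format, of "e - length (filter ?Z (order j))"] 3(4) me(2)
      by (cases "e < length (filter ?Z (order j))") (simp_all add: nth_append c1_def)
    then show ?thesis unfolding True order.simps(2) c0_def .
  next
    case False
    then have "m \<le> j" using me by simp
    then have "m * (N + 1) + e < c0" using me(2) mult_le_mono1[of m j "N + 1"] by (simp add: c0_def)
    then show ?thesis
      using 3(4) 2(5) sameD(1)[OF 1(5), of "''ORD''"] ord[OF \<open>m \<le> j\<close> me(2)] by (simp add: c1_def)
  qed
  then show ?thesis unfolding order_level_def
    by (intro runI[OF exec.Seq[OF 1(1) exec.Seq[OF 2(1) 3(1)]]]) (use 1(2) 2(2) 3(2) in auto)
qed

lemma run_order_all:
  assumes ctx: "ctx s" and arr: "\<And>m. m \<le> H \<Longrightarrow> grid_arrays s S m"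
  shows "run order_all s (200 * (N + 1) * (H + 2)) (\<lambda>s'.
     (\<forall>m\<le>H. \<forall>e<N. fst s' ''ORD'' (m * (N + 1) + e) = order m ! e) \<and>
     same {''q'', ''ORD'', ''j'', ''o'', ''c'', ''u''} {} s s')"
proof -
  let ?init = "For ''q'' (var ''N'') (NSet ''ORD'' (var ''q'') (var ''q''))"
  have "run ?init s (30 * (N + 1)) (\<lambda>s'. (\<forall>e<N. fst s' ''ORD'' e = e) \<and> same {''q'', ''ORD''} {} s s')"
  proof (rule run_For_le[where B = N and T = 10 and I = "\<lambda>j s'. \<forall>e<j. fst s' ''ORD'' e = e"], goal_cases)
    case (5 j s')
    then show ?case by (intro run_loopfree) (auto simp: less_Suc_eq)
  qed (use ctx in \<open>auto simp: same_def ctx_def\<close>)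
  then obtain t1 s1 where 1: "exec ?init s t1 s1" "t1 \<le> 30 * (N + 1)" "\<forall>e<N. fst s1 ''ORD'' e = e"
     "same {''q'', ''ORD''} {} s s1" by (auto elim: runE)
  have c1: "ctx s1" by (rule ctx_same[OF ctx 1(4)]) (simp add: ctx_names_def)
  have "run (For ''j'' (var ''H'') order_level) s1 ((150 * (N + 1) + 15) * (H + 1)) (\<lambda>s'.
     (\<forall>m\<le>H. \<forall>e<N. fst s' ''ORD'' (m * (N + 1) + e) = order m ! e) \<and>
     same {''q'', ''ORD'', ''j'', ''o'', ''c'', ''u''} {} s1 s')"
  proof (rule run_For_le[where B = H and T = "150 * (N + 1)" and
     I = "\<lambda>j s'. \<forall>m\<le>j. \<forall>e<N. fst s' ''ORD'' (m * (N + 1) + e) = order m ! e"], goal_cases)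
    case (5 j s')
    have c': "ctx s'" by (rule ctx_same[OF c1 5(2)]) (simp add: order_level_def nwr_scatter ctx_names_def)
    have "fst s' ''BIT'' = fst s ''BIT''"
      using sameD(1)[OF 5(2), of "''BIT''"] sameD(1)[OF 1(4), of "''BIT''"] by (simp add: order_level_def nwr_scatter)
    then have "fst s' ''BIT'' (j * (N + 1) + q) = bit_of j q" if "q < N" for q
      using arr[of j] 5(1) that by (simp add: grid_arrays_def bit_of_def)
    then show ?case using 5 c' by (intro run_order_level) auto
  next
    case 2
    then show ?case using c1 by (auto simp: same_def ctx_def order_level_def nwr_scatter)
  qed (use 1 in \<open>auto simp: same_def order_level_def nwr_scatter\<close>)
  then obtain t2 s2 where 2: "exec (For ''j'' (var ''H'') order_level) s1 t2 s2"
    "t2 \<le> (150 * (N + 1) + 15) * (H + 1)" "\<forall>m\<le>H. \<forall>e<N. fst s2 ''ORD'' (m * (N + 1) + e) = order m ! e"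
     "same {''q'', ''ORD'', ''j'', ''o'', ''c'', ''u''} {} s1 s2"
    by (auto elim: runE)
  show ?thesis
    unfolding order_all_def
  proof (rule runI[OF exec.Seq[OF 1(1) 2(1)]])
    have "t1 \<le> 30 * (N + 1) * (H + 2)" using 1(2) by (simp add: algebra_simps)
    then show "t1 + t2 \<le> 200 * (N + 1) * (H + 2)" using 2(2) by (simp add: algebra_simps)
  qed (use 1 2 in \<open>auto simp: same_def\<close>)
qed

end

subsection \<open>Sweeping over all shifts of one level\<close>

definition excess_exp :: nexp where
  "excess_exp = (NGet ''P'' (var ''a'') \<ominus> NGet ''Q'' (var ''a'' \<oplus> NConst 1)) \<oplus>
     (NGet ''P'' (var ''a'' \<oplus> NConst 1) \<ominus> NGet ''Q'' (var ''a''))"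

abbreviation key_exp :: nexp where
  "key_exp \<equiv> var ''a'' \<oplus> NGet ''color'' (var ''p'')"

definition add_point :: com where
  "add_point = seqs [''a'' ::= NGet ''cur'' (var ''p'') \<oplus> NGet ''cur'' (var ''p''),
     ''X'' ::= var ''X'' \<ominus> excess_exp,
     NSet ''P'' key_exp (NGet ''P'' key_exp \<oplus> var ''b''),
     NSet ''Q'' key_exp (NGet ''Q'' key_exp \<oplus> var ''r''),
     ''X'' ::= var ''X'' \<oplus> excess_exp]"

definition remove_point :: com where
  "remove_point = seqs [''a'' ::= NGet ''cur'' (var ''p'') \<oplus> NGet ''cur'' (var ''p''),
     ''X'' ::= var ''X'' \<ominus> excess_exp,
     NSet ''P'' key_exp (NGet ''P'' key_exp \<ominus> var ''b''),
     NSet ''Q'' key_exp (NGet ''Q'' key_exp \<ominus> var ''r''),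
     ''X'' ::= var ''X'' \<oplus> excess_exp]"

definition load_cells :: com where
  "load_cells = For ''p'' (var ''n'') (NSet ''cur'' (var ''p'') (NGet ''FP'' (var ''o'' \<oplus> var ''p'')))"

definition add_points :: com where
  "add_points = Seq (''X'' ::= NConst 0) (For ''p'' (var ''n'') add_point)"

definition sweep_events :: com where
  "sweep_events = Seq (NSet ''XV'' (NConst 0) (var ''X'')) (For ''q'' (var ''N'')
     (seqs [''u'' ::= NGet ''ORD'' (var ''o'' \<oplus> var ''q''), ''p'' ::= NGet ''pt'' (var ''u''),
       remove_point,
       NSet ''cur'' (var ''p'') (NGet ''cur'' (var ''p'') \<ominus> NGet ''W'' (var ''u'')),
       add_point,
       NSet ''XV'' (var ''q'' \<oplus> NConst 1) (var ''X'')]))"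

text \<open>The counters must be zero again for the next level, but their addresses range over far
  too many values for a scan. Taking the points out one by one resets exactly the entries that were
  touched.\<close>

definition remove_points :: com where
  "remove_points = For ''p'' (var ''n'') remove_point"

definition sweep :: com where
  "sweep = Seq load_cells (Seq add_points (Seq sweep_events remove_points))"

lemma nwr_points [simp]:
  "nwr add_point = {''a'', ''X'', ''P'', ''Q''}" "rwr add_point = {}"
  "nwr remove_point = {''a'', ''X'', ''P'', ''Q''}" "rwr remove_point = {}"
  by (auto simp: add_point_def remove_point_def)

lemma loopfree_points [simp]:
  "loopfree add_point" "loopfree remove_point" "maxtime add_point = 91" "maxtime remove_point = 91"
  by (simp_all add: add_point_def remove_point_def excess_exp_def)

context fairness
begin

lemma colcount_cong:
  "(\<And>i. i \<in> D \<Longrightarrow> cell' i = cell i) \<Longrightarrow> colcount cell' D a c = colcount cell D a c"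
  unfolding colcount_def by (intro arg_cong[where f = card]) auto

definition counts :: "store \<Rightarrow> (nat \<Rightarrow> nat) \<Rightarrow> nat set \<Rightarrow> bool" where
  "counts s cell D \<longleftrightarrow> (\<forall>a c. c < 2 \<longrightarrow>
     fst s ''P'' (a + a + c) = b * colcount cell D a c \<and> fst s ''Q'' (a + a + c) = r * colcount cell D a c)"

definition counts_X :: "store \<Rightarrow> (nat \<Rightarrow> nat) \<Rightarrow> nat set \<Rightarrow> bool" where
  "counts_X s cell D \<longleftrightarrow> counts s cell D \<and> fst s ''X'' 0 = imbalance cell D"

lemma counts_cong: "(\<And>i. i \<in> D \<Longrightarrow> cell' i = cell i) \<Longrightarrow> counts s cell' D = counts s cell D"
  using colcount_cong[of D cell' cell] by (simp add: counts_def)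

lemma counts_X_cong: "(\<And>i. i \<in> D \<Longrightarrow> cell' i = cell i) \<Longrightarrow> counts_X s cell' D = counts_X s cell D"
  using imbalance_cong[of D cell' cell] counts_cong[of D cell' cell s] by (simp add: counts_X_def)

lemma counts_excess:
  assumes "counts s cell D" "fst s ''a'' 0 = a + a"
  shows "nval s excess_exp = cell_excess cell D a"
  using assms(1)[unfolded counts_def, rule_format, of 0 a] assms(1)[unfolded counts_def, rule_format, of 1 a] assms(2)
  by (simp add: excess_exp_def cell_excess_def excess_def)

lemma key_inj: "c < 2 \<Longrightarrow> c' < 2 \<Longrightarrow> a + a + c = a' + a' + (c'::nat) \<Longrightarrow> a = a' \<and> c = c'"
  by presburger

text \<open>Insertion and removal in one statement. \<open>X\<close> loses the old excess of the
  affected cell and gains the new one; the truncated subtraction is exact because that excess is a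
  summand of the imbalance.\<close>

lemma result_point:
  assumes cd: "counts_X s cell D" and D: "finite D"
    and D': "D' = insert p D \<and> p \<notin> D \<and> com = add_point \<or> D' = D - {p} \<and> p \<in> D \<and> com = remove_point"
    and p: "fst s ''p'' 0 = p" "fst s ''color'' p = col p" "fst s ''cur'' p = cell p"
    and rb: "fst s ''r'' 0 = r" "fst s ''b'' 0 = b"
  shows "counts_X (result com s) cell D'"
proof -
  define a where "a = cell p"
  define upd where "upd w x = (if p \<in> D then x - w else x + w)" for w x :: nat
  define s1 where "s1 = nwrite s ''a'' 0 (a + a)"
  define s2 where "s2 = nwrite s1 ''X'' 0 (fst s ''X'' 0 - cell_excess cell D a)"
  define k where "k = a + a + col p"
  define s3 where "s3 = nwrite s2 ''P'' k (upd b (fst s ''P'' k))"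
  define s4 where "s4 = nwrite s3 ''Q'' k (upd r (fst s ''Q'' k))"
  have c1: "counts s1 cell D" using cd by (simp add: counts_X_def counts_def s1_def)
  have e1: "nval s1 excess_exp = cell_excess cell D a"
    using c1 by (rule counts_excess) (simp add: s1_def)
  have cc: "colcount cell D' a' c = (if a' = a \<and> c = col p then upd 1 (colcount cell D a' c) else colcount cell D a' c)" for a' c
  proof (cases "p \<in> D")
    case True
    then have D'': "D' = D - {p}" "D = insert p (D - {p})" using D' by auto
    have "colcount cell D a' c = colcount cell (D - {p}) a' c + (if cell p = a' \<and> col p = c then 1 else 0)"
      using colcount_insert[of "D - {p}" p cell a' c] D D'' by simp
    then show ?thesis using True D'' by (auto simp: upd_def a_def)
  next
    case False
    then have "D' = insert p D" using D' by auto
    then show ?thesis using colcount_insert[OF D False, of cell a' c] False by (auto simp: upd_def a_def)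
  qed
  have upd_mult: "upd (w * 1) (w * x) = w * upd 1 x" for w x
    by (simp add: upd_def diff_mult_distrib2 distrib_left)
  have c4: "counts s4 cell D'"
    unfolding counts_def
  proof (intro allI impI)
    fix a' c :: nat assume c: "c < 2"
    note old = cd[unfolded counts_X_def counts_def, THEN conjunct1, rule_format, OF c, of a']
    have eq: "a' + a' + c = k \<longleftrightarrow> a' = a \<and> c = col p"
      using key_inj[OF c col_less, of a' a p] by (auto simp: k_def)
    show "fst s4 ''P'' (a' + a' + c) = b * colcount cell D' a' c \<and> fst s4 ''Q'' (a' + a' + c) = r * colcount cell D' a' c"
      using old eq upd_mult[of b "colcount cell D a' c"] upd_mult[of r "colcount cell D a' c"]
      by (auto simp: s4_def s3_def s2_def s1_def cc)
  qed
  have e4: "nval s4 excess_exp = cell_excess cell D' a"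
    using c4 by (rule counts_excess) (simp add: s4_def s3_def s2_def s1_def)
  have "result com s = nwrite s4 ''X'' 0 (fst s4 ''X'' 0 + nval s4 excess_exp)"
  proof -
    have 1: "result com s = nwrite s4 ''X'' 0 (fst s4 ''X'' 0 + nval s4 excess_exp)"
      if "com = add_point" "p \<notin> D"
      using that p rb e1[symmetric] unfolding add_point_def seqs.simps list.simps if_False
      by (simp add: s4_def s3_def s2_def s1_def k_def upd_def a_def)
    have 2: "result com s = nwrite s4 ''X'' 0 (fst s4 ''X'' 0 + nval s4 excess_exp)"
      if "com = remove_point" "p \<in> D"
      using that p rb e1[symmetric] unfolding remove_point_def seqs.simps list.simps if_False
      by (simp add: s4_def s3_def s2_def s1_def k_def upd_def a_def)
    show ?thesis using D' 1 2 by blast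
  qed
  moreover have "fst s4 ''X'' 0 = imbalance cell D - cell_excess cell D a"
    using cd by (simp add: s4_def s3_def s2_def s1_def counts_X_def)
  moreover have "cell_excess cell D a \<le> imbalance cell D"
  proof (cases "a \<in> cell ` D")
    case True
    then show ?thesis unfolding imbalance_def using D by (intro member_le_sum) auto
  qed (simp add: cell_excess_notin)
  moreover have "imbalance cell D' + cell_excess cell D a = imbalance cell D + cell_excess cell D' a"
  proof (cases "p \<in> D")
    case True
    then have "D' = D - {p}" "D = (D - {p}) \<union> {p}" using D' by auto
    then show ?thesis using imbalance_union_one_cell[of "D - {p}" "{p}" cell a] D by (auto simp: a_def)
  next
    case False
    then have "D' = D \<union> {p}" using D' by auto
    then show ?thesis using imbalance_union_one_cell[of D "{p}" cell a] D False by (auto simp: a_def)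
  qed
  ultimately show ?thesis
    using c4 e4 unfolding counts_X_def by (simp add: counts_def)
qed

end

context grid
begin

lemma run_load_cells:
  assumes "ctx s" "fst s ''o'' 0 = off"
  shows "run load_cells s (30 * (N + 1)) (\<lambda>s'.
     (\<forall>i<n. fst s' ''cur'' i = fst s ''FP'' (off + i)) \<and> same {''p'', ''cur''} {} s s')"
  unfolding load_cells_def
proof (rule run_For_le[where B = n and T = 10 and I = "\<lambda>j s'. \<forall>i<j. fst s' ''cur'' i = fst s ''FP'' (off + i)"], goal_cases)
  case (5 j s')
  then show ?case using assms by (intro run_loopfree) (auto simp: same_def less_Suc_eq)
qed (use assms d_pos in \<open>auto simp: same_def ctx_def\<close>)

lemma run_add_points:
  assumes ctx: "ctx s" and cell: "\<And>i. i < n \<Longrightarrow> fst s ''cur'' i = cl i" and 0: "counts s cl {}"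
  shows "run add_points s (120 * (N + 1)) (\<lambda>s'. counts_X s' cl {..<n} \<and> same {''p'', ''a'', ''X'', ''P'', ''Q''} {} s s')"
proof -
  have "run (''X'' ::= NConst 0) s 5 (\<lambda>s'. counts_X s' cl {} \<and> same {''X''} {} s s')"
    using 0 by (intro run_loopfree) (auto simp: same_def counts_X_def counts_def imbalance_def)
  then obtain t1 s1 where 1: "exec (''X'' ::= NConst 0) s t1 s1" "t1 \<le> 5" "counts_X s1 cl {}" "same {''X''} {} s s1"
    by (auto elim: runE)
  have c1: "ctx s1" by (rule ctx_same[OF ctx 1(4)]) (simp add: ctx_names_def)
  have "run (For ''p'' (var ''n'') add_point) s1 (110 * (N + 1)) (\<lambda>s'. counts_X s' cl {..<n} \<and>
      same {''p'', ''a'', ''X'', ''P'', ''Q''} {} s1 s')"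
  proof (rule run_For_le[where B = n and T = 91 and I = "\<lambda>j s'. counts_X s' cl {..<j}"], goal_cases)
    case (5 j s')
    have c': "ctx s'" by (rule ctx_same[OF c1 5(2)]) (simp add: ctx_names_def)
    have "fst s' ''cur'' = fst s ''cur''" using sameD(1)[OF 5(2), of "''cur''"] sameD(1)[OF 1(4), of "''cur''"] by simp
    then show ?case using 5 c' cell
      by (intro run_loopfree result_point[where p = j and D = "{..<j}"]) (auto simp: ctx_def lessThan_Suc)
  next
    case 2
    then show ?case using c1 by (auto simp: same_def ctx_def)
  next
    case 3
    show ?case using 1(3) by simp
  next
    case (4 j s' v)
    then show ?case by (simp add: counts_X_def counts_def)
  next
    case (6 s')
    then show ?case by (auto simp: same_def)
  next
    case 7
    show ?case by (rule n_le_N)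
  qed simp_all
  then obtain t2 s2 where 2: "exec (For ''p'' (var ''n'') add_point) s1 t2 s2" "t2 \<le> 110 * (N + 1)"
    "counts_X s2 cl {..<n}" "same {''p'', ''a'', ''X'', ''P'', ''Q''} {} s1 s2"
    by (auto elim: runE)
  show ?thesis unfolding add_points_def
    by (rule runI[OF exec.Seq[OF 1(1) 2(1)]]) (use 1 2 in \<open>auto simp: same_def\<close>)
qed

lemma run_remove_points:
  assumes ctx: "ctx s" and cell: "\<And>i. i < n \<Longrightarrow> fst s ''cur'' i = cl i" and 0: "counts_X s cl {..<n}"
  shows "run remove_points s (110 * (N + 1)) (\<lambda>s'. counts s' cl {} \<and> same {''p'', ''a'', ''X'', ''P'', ''Q''} {} s s')"
  unfolding remove_points_def
proof (rule run_For_le[where B = n and T = 91 and I = "\<lambda>j s'. counts_X s' cl {j..<n}"], goal_cases)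
  case (5 j s')
  have c': "ctx s'" by (rule ctx_same[OF ctx 5(2)]) (simp add: ctx_names_def)
  have "fst s' ''cur'' = fst s ''cur''" using sameD(1)[OF 5(2), of "''cur''"] by simp
  moreover have "{Suc j..<n} = {j..<n} - {j}" by auto
  ultimately show ?case using 5 c' cell
    by (intro run_loopfree result_point[where p = j and D = "{j..<n}"]) (auto simp: ctx_def)
next
  case 2
  then show ?case using ctx by (auto simp: same_def ctx_def)
next
  case 3
  show ?case using 0 by (simp add: lessThan_atLeast0)
next
  case (4 j s' v)
  then show ?case by (simp add: counts_X_def counts_def)
next
  case (6 s')
  then show ?case by (auto simp: same_def counts_X_def)
next
  case 7
  show ?case by (rule n_le_N)
qed simp_all

text \<open>The digits after the first \<open>e\<close> events. If several residues coincide, some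
  \<open>e\<close> are ranks of no shift; the sweep passes through these intermediate states, but
  \<open>minima\<close> never refers to them.\<close>

definition sweep_dig :: "nat \<Rightarrow> nat \<Rightarrow> nat \<Rightarrow> nat" where
  "sweep_dig m e k = dig m 0 k - (if k \<in> set (take e (order m)) then 1 else 0)"

lemma sweep_dig_rank:
  assumes "m \<le> H" "u < 2 ^ m" "i < n"
  shows "address (sweep_dig m (rank m u)) i = cell m u i"
  unfolding cell_def address_def
proof (rule sum.cong[OF refl])
  fix k assume "k \<in> {k. k < N \<and> k div d = i}"
  then have "k < N" by simp
  then show "sweep_dig m (rank m u) k * W k = dig m u k * W k"
    using dig_sweep(1)[OF \<open>k < N\<close> assms(1,2)] by (simp add: sweep_dig_def set_take_order)
qed

lemma order_nth_less: "e < N \<Longrightarrow> order m ! e < N"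
  using nth_mem[of e "order m"] unfolding length_order set_order by simp

lemma address_sweep_Suc:
  assumes "m \<le> H" "e < N"
  shows "address (sweep_dig m e) i = address (sweep_dig m (Suc e)) i + (if i = order m ! e div d then W (order m ! e) else 0)"
proof -
  let ?k = "order m ! e"
  have take: "take (Suc e) (order m) = take e (order m) @ [?k]"
    using assms(2) by (simp add: take_Suc_conv_app_nth length_order)
  have new: "?k \<notin> set (take e (order m))"
    using distinct_order[of m] assms(2) by (metis distinct_take take not_distinct_conv_prefix)
  have k: "?k < N" using order_nth_less[OF assms(2)] .
  have dig: "1 \<le> dig m 0 ?k" using dig_sweep(2)[OF k assms(1), of 0] by simp
  have "sweep_dig m e k * W k = sweep_dig m (Suc e) k * W k + (if k = ?k then W k else 0)" for k
  proof (cases "k = ?k")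
    case True
    obtain x where "dig m 0 ?k = Suc x" using dig by (cases "dig m 0 ?k") auto
    then show ?thesis using new True by (simp add: sweep_dig_def take)
  next
    case False
    then show ?thesis by (simp add: sweep_dig_def take)
  qed
  then have "address (sweep_dig m e) i =
    address (sweep_dig m (Suc e)) i + (\<Sum>k | k < N \<and> k div d = i. if k = ?k then W k else 0)"
    unfolding address_def by (simp only: sum.distrib)
  then show ?thesis using k by (auto simp: sum.delta)
qed

lemma run_sweep_events:
  assumes ctx: "ctx s" and m: "m \<le> H" and off: "fst s ''o'' 0 = off"
    and ord: "\<And>e. e < N \<Longrightarrow> fst s ''ORD'' (off + e) = order m ! e"
    and cur: "\<And>i. i < n \<Longrightarrow> fst s ''cur'' i = address (sweep_dig m 0) i"
    and X: "counts_X s (address (sweep_dig m 0)) {..<n}"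
  shows "run sweep_events s (300 * (N + 1)) (\<lambda>s'. counts_X s' (address (sweep_dig m N)) {..<n} \<and>
     (\<forall>i<n. fst s' ''cur'' i = address (sweep_dig m N) i) \<and>
     (\<forall>e\<le>N. fst s' ''XV'' e = imbalance (address (sweep_dig m e)) {..<n}) \<and>
     same {''q'', ''u'', ''p'', ''a'', ''X'', ''P'', ''Q'', ''cur'', ''XV''} {} s s')"
proof -
  have "run (NSet ''XV'' (NConst 0) (var ''X'')) s 5 (\<lambda>s'. s' = nwrite s ''XV'' 0 (fst s ''X'' 0))"
    by (intro run_loopfree) auto
  then obtain t1 s1 where 1: "exec (NSet ''XV'' (NConst 0) (var ''X'')) s t1 s1" "t1 \<le> 5"
    and s1: "s1 = nwrite s ''XV'' 0 (fst s ''X'' 0)" by (auto elim: runE)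
  have s1_same: "same {''XV''} {} s s1" by (simp add: s1 same_def)
  have c1: "ctx s1" by (rule ctx_same[OF ctx s1_same]) (simp add: ctx_names_def)
  let ?body = "seqs [''u'' ::= NGet ''ORD'' (var ''o'' \<oplus> var ''q''), ''p'' ::= NGet ''pt'' (var ''u''),
       remove_point,
       NSet ''cur'' (var ''p'') (NGet ''cur'' (var ''p'') \<ominus> NGet ''W'' (var ''u'')),
       add_point,
       NSet ''XV'' (var ''q'' \<oplus> NConst 1) (var ''X'')]"
  have nwr: "nwr ?body = {''u'', ''p'', ''a'', ''X'', ''P'', ''Q'', ''cur'', ''XV''}" "rwr ?body = {}" by auto
  have "run (For ''q'' (var ''N'') ?body) s1 (260 * (N + 1)) (\<lambda>s'. counts_X s' (address (sweep_dig m N)) {..<n} \<and>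
     (\<forall>i<n. fst s' ''cur'' i = address (sweep_dig m N) i) \<and>
     (\<forall>e\<le>N. fst s' ''XV'' e = imbalance (address (sweep_dig m e)) {..<n}) \<and>
     same {''q'', ''u'', ''p'', ''a'', ''X'', ''P'', ''Q'', ''cur'', ''XV''} {} s1 s')"
  proof (rule run_For_le[where B = N and T = 240 and I = "\<lambda>j s'. counts_X s' (address (sweep_dig m j)) {..<n} \<and>
     (\<forall>i<n. fst s' ''cur'' i = address (sweep_dig m j) i) \<and>
     (\<forall>e\<le>j. fst s' ''XV'' e = imbalance (address (sweep_dig m e)) {..<n})"], goal_cases)
    case (5 j s')
    note same' = 5(2)[unfolded nwr]
    have c': "ctx s'" by (rule ctx_same[OF c1 same']) (simp add: ctx_names_def)
    define k where "k = order m ! j"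
    define p where "p = k div d"
    have k: "k < N" using order_nth_less[OF 5(1)] by (simp add: k_def)
    have p: "p < n" unfolding p_def using k by (simp add: less_mult_imp_div_less)
    let ?A = "address (sweep_dig m j)" and ?B = "address (sweep_dig m (Suc j))"
    have AB: "?A i = ?B i + (if i = p then W k else 0)" for i
      using address_sweep_Suc[OF m 5(1)] by (simp add: k_def p_def)
    have u: "fst s' ''ORD'' (off + j) = k" "fst s' ''o'' 0 = off" "fst s' ''pt'' k = p" "fst s' ''W'' k = W k"
      "fst s' ''r'' 0 = r" "fst s' ''b'' 0 = b" "fst s' ''color'' p = col p"
      using ord[OF 5(1)] off sameD(1)[OF same'] sameD(1)[OF s1_same] c' k p
      by (simp_all add: k_def ctx_def p_def)
    define s2 where "s2 = nwrite (nwrite s' ''u'' 0 k) ''p'' 0 p"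
    define s3 where "s3 = result remove_point s2"
    define s4 where "s4 = nwrite s3 ''cur'' p (fst s3 ''cur'' p - W k)"
    define s5 where "s5 = result add_point s4"
    have same3: "same {''a'', ''X'', ''P'', ''Q''} {} s2 s3"
      using exec_same[of remove_point s2 _ s3] exec_loopfree[of remove_point s2] by (auto simp: s3_def)
    have same5: "same {''a'', ''X'', ''P'', ''Q''} {} s4 s5"
      using exec_same[of add_point s4 _ s5] exec_loopfree[of add_point s4] by (auto simp: s5_def)
    have X2: "counts_X s2 ?A {..<n}" using 5(4) by (simp add: counts_X_def counts_def s2_def)
    have X3: "counts_X s3 ?A ({..<n} - {p})"
      unfolding s3_def
      by (rule result_point[OF X2, where p = p]) (use 5(4) p u in \<open>auto simp: s2_def\<close>)
    have cur3: "fst s3 ''cur'' = fst s' ''cur''" "fst s3 ''W'' = fst s' ''W''" "fst s3 ''u'' 0 = k" "fst s3 ''p'' 0 = p"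
      "fst s3 ''XV'' = fst s' ''XV''" "fst s3 ''q'' 0 = j" "fst s3 ''r'' 0 = r" "fst s3 ''b'' 0 = b" "fst s3 ''color'' p = col p"
      using sameD(1)[OF same3] u 5(3) by (simp_all add: s2_def)
    \<comment> \<open>The event changes the address of \<open>p\<close> alone, and \<open>p\<close>
      is out of the tables at this moment.\<close>
    have "counts_X s3 ?B ({..<n} - {p})"
      using X3 counts_X_cong[of "{..<n} - {p}" ?A ?B s3] AB by auto
    then have X4: "counts_X s4 ?B ({..<n} - {p})" by (simp add: counts_X_def counts_def s4_def)
    have cur4: "fst s4 ''cur'' i = ?B i" if "i < n" for i
      using 5(4) AB[of i] that p by (cases "i = p") (simp_all add: s4_def cur3)
    have ins: "{..<n} = insert p ({..<n} - {p})" using p by auto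
    have X5: "counts_X s5 ?B {..<n}"
      unfolding s5_def
      by (rule result_point[OF X4, where p = p]) (use ins cur3 cur4[OF p] in \<open>auto simp: s4_def\<close>)
    have cur5: "fst s5 ''cur'' = fst s4 ''cur''" "fst s5 ''XV'' = fst s' ''XV''" "fst s5 ''q'' 0 = j"
      using sameD(1)[OF same5] cur3 by (simp_all add: s4_def)
    have res: "result ?body s' = nwrite s5 ''XV'' (j + 1) (fst s5 ''X'' 0)"
    proof -
      have a: "nwrite (nwrite s' ''u'' 0 k) ''p'' 0 p = s2" by (simp add: s2_def)
      have b: "result remove_point s2 = s3" by (simp add: s3_def)
      have c: "nwrite s3 ''cur'' p (fst s3 ''cur'' p - W k) = s4" by (simp add: s4_def)
      have d: "result add_point s4 = s5" by (simp add: s5_def)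
      show ?thesis using u 5(3) a b c d cur3 cur5 by simp
    qed
    show ?case
    proof (rule run_loopfree)
      show "counts_X (result ?body s') ?B {..<n} \<and>
        (\<forall>i<n. fst (result ?body s') ''cur'' i = ?B i) \<and>
        (\<forall>e\<le>Suc j. fst (result ?body s') ''XV'' e = imbalance (address (sweep_dig m e)) {..<n})"
        unfolding res using X5 cur4 cur5 5(4)
        by (auto simp: counts_X_def counts_def le_Suc_eq)
    qed simp_all
  next
    case 2
    then show ?case using c1 by (auto simp: same_def ctx_def)
  next
    case 3
    show ?case using X cur by (auto simp: s1 counts_X_def counts_def)
  next
    case (4 j s' v)
    then show ?case by (simp add: counts_X_def counts_def)
  next
    case (6 s')
    then show ?case by (auto simp: same_def)
  qed auto
  then obtain t2 s2 where 2: "exec (For ''q'' (var ''N'') ?body) s1 t2 s2" "t2 \<le> 260 * (N + 1)"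
    "counts_X s2 (address (sweep_dig m N)) {..<n}"
     "\<forall>i<n. fst s2 ''cur'' i = address (sweep_dig m N) i"
     "\<forall>e\<le>N. fst s2 ''XV'' e = imbalance (address (sweep_dig m e)) {..<n}"
     "same {''q'', ''u'', ''p'', ''a'', ''X'', ''P'', ''Q'', ''cur'', ''XV''} {} s1 s2"
    by (elim runE) blast
  show ?thesis unfolding sweep_events_def
    by (rule runI[OF exec.Seq[OF 1(1) 2(1)]]) (use 1(2) 2(2-6) s1_same in \<open>auto simp: same_def\<close>)
qed

lemma run_sweep:
  assumes ctx: "ctx s" and m: "m \<le> H" and off: "fst s ''o'' 0 = m * (N + 1)"
    and arr: "grid_arrays s S m"
    and ord: "\<And>e. e < N \<Longrightarrow> fst s ''ORD'' (m * (N + 1) + e) = order m ! e"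
    and 0: "\<And>k. fst s ''P'' k = 0 \<and> fst s ''Q'' k = 0"
  shows "run sweep s (600 * (N + 1)) (\<lambda>s'. (\<forall>k. fst s' ''P'' k = 0 \<and> fst s' ''Q'' k = 0) \<and>
     (\<forall>u<2 ^ m. fst s' ''XV'' (rank m u) = level_imbalance m u) \<and>
     same {''q'', ''u'', ''p'', ''a'', ''X'', ''P'', ''Q'', ''cur'', ''XV''} {} s s')"
proof -
  have empty: "counts s' c {} \<longleftrightarrow> (\<forall>k. fst s' ''P'' k = 0 \<and> fst s' ''Q'' k = 0)" for s' c
  proof -
    have "\<exists>a c. c < 2 \<and> k = a + a + c" for k :: nat
      by (intro exI[of _ "k div 2"] exI[of _ "k mod 2"]) presburger
    then show ?thesis unfolding counts_def by (simp add: colcount_def) metis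
  qed
  from run_load_cells[OF ctx off] obtain t1 s1 where 1: "exec load_cells s t1 s1" "t1 \<le> 30 * (N + 1)"
    "\<forall>i<n. fst s1 ''cur'' i = fst s ''FP'' (m * (N + 1) + i)" "same {''p'', ''cur''} {} s s1"
    by (auto elim: runE)
  have c1: "ctx s1" by (rule ctx_same[OF ctx 1(4)]) (simp add: ctx_names_def)
  let ?A = "address (sweep_dig m 0)"
  have cur1: "fst s1 ''cur'' i = ?A i" if "i < n" for i
  proof -
    have "sweep_dig m 0 = (\<lambda>k. S k div 2 ^ m)" by (simp add: fun_eq_iff sweep_dig_def dig_def)
    then show ?thesis using 1(3) arr that unfolding grid_arrays_def by simp
  qed
  have "counts s1 ?A {}" unfolding empty using 0 sameD(1)[OF 1(4), of "''P''"] sameD(1)[OF 1(4), of "''Q''"] by simp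
  from run_add_points[OF c1 cur1 this] obtain t2 s2 where 2: "exec add_points s1 t2 s2" "t2 \<le> 120 * (N + 1)"
    "counts_X s2 ?A {..<n}" "same {''p'', ''a'', ''X'', ''P'', ''Q''} {} s1 s2"
    by (auto elim: runE)
  have c2: "ctx s2" by (rule ctx_same[OF c1 2(4)]) (simp add: ctx_names_def)
  have cur2: "fst s2 ''cur'' i = ?A i" if "i < n" for i using cur1[OF that] sameD(1)[OF 2(4), of "''cur''"] by simp
  have off2: "fst s2 ''o'' 0 = m * (N + 1)" using off sameD(1)[OF 1(4), of "''o''"] sameD(1)[OF 2(4), of "''o''"] by simp
  have ord2: "fst s2 ''ORD'' (m * (N + 1) + e) = order m ! e" if "e < N" for e
    using ord[OF that] sameD(1)[OF 1(4), of "''ORD''"] sameD(1)[OF 2(4), of "''ORD''"] by simp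
  obtain t3 s3 where 3: "exec sweep_events s2 t3 s3" "t3 \<le> 300 * (N + 1)"
    "counts_X s3 (address (sweep_dig m N)) {..<n}" "\<forall>i<n. fst s3 ''cur'' i = address (sweep_dig m N) i"
    "\<forall>e\<le>N. fst s3 ''XV'' e = imbalance (address (sweep_dig m e)) {..<n}"
    "same {''q'', ''u'', ''p'', ''a'', ''X'', ''P'', ''Q'', ''cur'', ''XV''} {} s2 s3"
    by (rule runE[OF run_sweep_events[OF c2 m off2 ord2 cur2 2(3)]]) blast+
  have c3: "ctx s3" by (rule ctx_same[OF c2 3(6)]) (simp add: ctx_names_def)
  have cur3: "\<And>i. i < n \<Longrightarrow> fst s3 ''cur'' i = address (sweep_dig m N) i" using 3(4) by blast
  obtain t4 s4 where 4: "exec remove_points s3 t4 s4" "t4 \<le> 110 * (N + 1)"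
    "counts s4 (address (sweep_dig m N)) {}" "same {''p'', ''a'', ''X'', ''P'', ''Q''} {} s3 s4"
    by (rule runE[OF run_remove_points[OF c3 cur3 3(3)]]) blast+
  have XV: "fst s4 ''XV'' (rank m u) = level_imbalance m u" if "u < 2 ^ m" for u
  proof -
    have "fst s4 ''XV'' (rank m u) = imbalance (address (sweep_dig m (rank m u))) {..<n}"
      using 3(5)[rule_format, OF rank_le[of m u]] sameD(1)[OF 4(4), of "''XV''"] by simp
    also have "\<dots> = level_imbalance m u"
      unfolding level_imbalance_def by (rule imbalance_cong) (simp add: sweep_dig_rank[OF m that])
    finally show ?thesis .
  qed
  have "same {''q'', ''u'', ''p'', ''a'', ''X'', ''P'', ''Q'', ''cur'', ''XV''} {} s s4"
    by (rule same_mono[OF same_trans[OF 1(4) same_trans[OF 2(4) same_trans[OF 3(6) 4(4)]]]]) auto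
  moreover have "\<forall>k. fst s4 ''P'' k = 0 \<and> fst s4 ''Q'' k = 0" using 4(3) unfolding empty .
  ultimately show ?thesis unfolding sweep_def
    by (intro runI[OF exec.Seq[OF 1(1) exec.Seq[OF 2(1) exec.Seq[OF 3(1) 4(1)]]]])
      (use 1(2) 2(2) 3(2) 4(2) XV in simp_all)
qed

end

subsection \<open>Folding the minima of a level into the next one\<close>

definition count_clear :: com where
  "count_clear = For ''q'' (var ''N'')
     (Cond (NLess (NGet ''BIT'' (var ''o'' \<oplus> var ''q'')) (NConst 1)) (incr ''hi'') Skip)"

text \<open>\<open>lo\<close> and \<open>hi\<close> point to the ranks, in the row of the next
  coarser level, of the shifts \<open>u\<close> and \<open>u + 2 ^ m\<close>. Each event advances
  exactly one of them, according to bit \<open>m\<close> of its coordinate.\<close>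

definition fold_step :: com where
  "fold_step = Seq
     (Cond (NLess (NGet ''G'' (var ''hi'')) (NGet ''G'' (var ''lo'')))
       (Seq (NSet ''G'' (var ''o'' \<oplus> var ''q'')
              (NGet ''XV'' (var ''q'') \<oplus> (NGet ''G'' (var ''hi'') \<oplus> NGet ''G'' (var ''hi''))))
            (NSet ''T'' (var ''o'' \<oplus> var ''q'') (NGet ''T'' (var ''hi'') \<oplus> NGet ''pw'' (var ''m''))))
       (Seq (NSet ''G'' (var ''o'' \<oplus> var ''q'')
              (NGet ''XV'' (var ''q'') \<oplus> (NGet ''G'' (var ''lo'') \<oplus> NGet ''G'' (var ''lo''))))
            (NSet ''T'' (var ''o'' \<oplus> var ''q'') (NGet ''T'' (var ''lo'')))))
     (Seq (''u'' ::= NGet ''ORD'' (var ''o'' \<oplus> var ''q'')) (Cond bit_clear (incr ''lo'') (incr ''hi'')))"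

definition fold_level :: com where
  "fold_level = Seq (Seq (''lo'' ::= NGet ''ON'' (var ''m'' \<oplus> NConst 1)) (''hi'' ::= NGet ''ON'' (var ''m'' \<oplus> NConst 1)))
     (Seq count_clear (For ''q'' (var ''N'' \<oplus> NConst 1) fold_step))"

definition select_level :: com where
  "select_level = Seq (Seq (''m'' ::= var ''H'' \<ominus> var ''j'') (''o'' ::= NGet ''ON'' (var ''m''))) (Seq sweep fold_level)"

definition select_shift :: com where
  "select_shift = For ''j'' (var ''H'' \<oplus> NConst 1) select_level"

lemma nwr_fold: "nwr fold_level = {''lo'', ''hi'', ''q'', ''G'', ''T'', ''u''}" "rwr fold_level = {}"
  by (auto simp: fold_level_def count_clear_def fold_step_def)

lemma nwr_sweep: "nwr sweep = {''q'', ''u'', ''p'', ''a'', ''X'', ''P'', ''Q'', ''cur'', ''XV''}" "rwr sweep = {}"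
  by (auto simp: sweep_def load_cells_def add_points_def sweep_events_def remove_points_def)

lemma nwr_select_level:
  "nwr select_level = {''m'', ''o'', ''q'', ''u'', ''p'', ''a'', ''X'', ''P'', ''Q'', ''cur'', ''XV'', ''lo'', ''hi'', ''G'', ''T''}"
  "rwr select_level = {}"
  by (auto simp: select_level_def nwr_fold nwr_sweep)

context grid
begin

definition lower :: "nat \<Rightarrow> nat \<Rightarrow> nat" where
  "lower m e = length (filter (\<lambda>k. bit_of m k = 0) (take e (order m)))"

definition upper :: "nat \<Rightarrow> nat \<Rightarrow> nat" where
  "upper m e = card {k. k < N \<and> bit_of m k = 0} + length (filter (\<lambda>k. bit_of m k \<noteq> 0) (take e (order m)))"

lemma lower_upper_0: "lower m 0 = 0" "upper m 0 = card {k. k < N \<and> bit_of m k = 0}"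
  by (simp_all add: lower_def upper_def)

lemma lower_upper_Suc:
  assumes "e < N"
  shows "lower m (Suc e) = lower m e + (if bit_of m (order m ! e) = 0 then 1 else 0)"
    "upper m (Suc e) = upper m e + (if bit_of m (order m ! e) = 0 then 0 else 1)"
proof -
  have "take (Suc e) (order m) = take e (order m) @ [order m ! e]"
    using assms by (simp add: take_Suc_conv_app_nth length_order)
  then show "lower m (Suc e) = lower m e + (if bit_of m (order m ! e) = 0 then 1 else 0)"
    "upper m (Suc e) = upper m e + (if bit_of m (order m ! e) = 0 then 0 else 1)"
    by (simp_all add: lower_def upper_def)
qed

lemma lower_upper_le:
  assumes "e \<le> N"
  shows "lower m e \<le> N" "upper m e \<le> N"
proof -
  have "lower m e \<le> length (take e (order m))" unfolding lower_def by (rule length_filter_le)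
  then show "lower m e \<le> N" using assms by (simp add: length_order)
  let ?ones = "filter (\<lambda>k. bit_of m k \<noteq> 0)"
  have "length (?ones (order m)) = length (?ones (take e (order m))) + length (?ones (drop e (order m)))"
    by (metis append_take_drop_id filter_append length_append)
  moreover have "card {k. k < N \<and> bit_of m k = 0} = length (filter (\<lambda>k. bit_of m k = 0) (order m))"
    using distinct_card[OF distinct_filter[OF distinct_order], of "\<lambda>k. bit_of m k = 0" m]
    by (simp add: set_order conj_commute)
  moreover have "length (filter (\<lambda>k. bit_of m k = 0) (order m)) + length (?ones (order m)) = N"
    using sum_length_filter_compl[of "\<lambda>k. bit_of m k = 0" "order m"] by (simp add: length_order)
  ultimately show "upper m e \<le> N" unfolding upper_def by linarith
qed

lemma run_count_clear:
  assumes ctx: "ctx s" and off: "fst s ''o'' 0 = off"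
    and bit: "\<And>q. q < N \<Longrightarrow> fst s ''BIT'' (off + q) = bit_of m q"
  shows "run count_clear s (30 * (N + 1)) (\<lambda>s'. fst s' ''hi'' 0 = fst s ''hi'' 0 + card {k. k < N \<and> bit_of m k = 0} \<and>
     same {''q'', ''hi''} {} s s')"
  unfolding count_clear_def
proof (rule run_For_le[where B = N and T = 15 and
    I = "\<lambda>j s'. fst s' ''hi'' 0 = fst s ''hi'' 0 + card {k. k < j \<and> bit_of m k = 0}"], goal_cases)
  case (5 j s')
  have st: "fst s' ''o'' 0 = off" "fst s' ''BIT'' (off + j) = bit_of m j"
    using 5(2) off bit[OF 5(1)] by (auto simp: same_def)
  have "{k. k < Suc j \<and> bit_of m k = 0} =
     (if bit_of m j = 0 then insert j {k. k < j \<and> bit_of m k = 0} else {k. k < j \<and> bit_of m k = 0})"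
    by (auto simp: less_Suc_eq)
  then have "card {k. k < Suc j \<and> bit_of m k = 0} = card {k. k < j \<and> bit_of m k = 0} + (if bit_of m j = 0 then 1 else 0)"
    by simp
  then show ?case using 5(3,4) st by (intro run_loopfree) auto
qed (use ctx in \<open>auto simp: same_def ctx_def\<close>)

definition row :: "store \<Rightarrow> name \<Rightarrow> nat \<Rightarrow> nat \<Rightarrow> nat" where
  "row s x m e = fst s x (m * (N + 1) + e)"

lemma run_fold_level:
  assumes ctx: "ctx s" and m: "m \<le> H" "fst s ''m'' 0 = m" and off: "fst s ''o'' 0 = m * (N + 1)"
    and bit: "\<And>q. q < N \<Longrightarrow> fst s ''BIT'' (m * (N + 1) + q) = bit_of m q"
    and ord: "\<And>e. e < N \<Longrightarrow> fst s ''ORD'' (m * (N + 1) + e) = order m ! e"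
  shows "run fold_level s (300 * (N + 1)) (\<lambda>s'.
      (\<forall>e\<le>N. row s' ''G'' m e = fst s ''XV'' e +
         2 * (if row s ''G'' (Suc m) (upper m e) < row s ''G'' (Suc m) (lower m e)
              then row s ''G'' (Suc m) (upper m e) else row s ''G'' (Suc m) (lower m e))) \<and>
      (\<forall>e\<le>N. row s' ''T'' m e = (if row s ''G'' (Suc m) (upper m e) < row s ''G'' (Suc m) (lower m e)
              then row s ''T'' (Suc m) (upper m e) + 2 ^ m else row s ''T'' (Suc m) (lower m e))))"
proof -
  define off where "off = m * (N + 1)"
  define off1 where "off1 = Suc m * (N + 1)"
  have off1: "off1 = off + (N + 1)" by (simp add: off_def off1_def)
  let ?init = "Seq (''lo'' ::= NGet ''ON'' (var ''m'' \<oplus> NConst 1)) (''hi'' ::= NGet ''ON'' (var ''m'' \<oplus> NConst 1))"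
  have "run ?init s 20 (\<lambda>s'. fst s' ''lo'' 0 = off1 \<and> fst s' ''hi'' 0 = off1 \<and> same {''lo'', ''hi''} {} s s')"
    using ctx m by (intro run_loopfree) (auto simp: same_def ctx_def off1_def)
  then obtain t1 s1 where 1: "exec ?init s t1 s1" "t1 \<le> 20" "fst s1 ''lo'' 0 = off1" "fst s1 ''hi'' 0 = off1"
     "same {''lo'', ''hi''} {} s s1" by (auto elim: runE)
  have c1: "ctx s1" by (rule ctx_same[OF ctx 1(5)]) (simp add: ctx_names_def)
  have o1: "fst s1 ''o'' 0 = off" using off sameD(1)[OF 1(5), of "''o''"] by (simp add: off_def)
  have b1: "fst s1 ''BIT'' (off + q) = bit_of m q" if "q < N" for q
    using bit[OF that] sameD(1)[OF 1(5), of "''BIT''"] by (simp add: off_def)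
  obtain t2 s2 where 2: "exec count_clear s1 t2 s2" "t2 \<le> 30 * (N + 1)"
    "fst s2 ''hi'' 0 = off1 + upper m 0" "same {''q'', ''hi''} {} s1 s2"
    by (rule runE[OF run_count_clear[OF c1 o1 b1]]) (use 1(4) in \<open>auto simp: lower_upper_0\<close>)
  have c2: "ctx s2" by (rule ctx_same[OF c1 2(4)]) (simp add: ctx_names_def)
  have same2: "same {''lo'', ''hi'', ''q''} {} s s2"
    by (rule same_mono[OF same_trans[OF 1(5) 2(4)]]) auto
  have lo2: "fst s2 ''lo'' 0 = off1 + lower m 0" using 1(3) sameD(1)[OF 2(4), of "''lo''"] by (simp add: lower_upper_0)
  define g where "g e = fst s ''G'' (off1 + e)" for e
  define \<tau> where "\<tau> e = fst s ''T'' (off1 + e)" for e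
  define ng where "ng e = fst s ''XV'' e + 2 * (if g (upper m e) < g (lower m e) then g (upper m e) else g (lower m e))" for e
  define nt where "nt e = (if g (upper m e) < g (lower m e) then \<tau> (upper m e) + 2 ^ m else \<tau> (lower m e))" for e
  let ?W = "{''G'', ''T'', ''u'', ''lo'', ''hi''}"
  have nwr: "nwr fold_step = ?W" "rwr fold_step = {}" by (auto simp: fold_step_def)
  have "run (For ''q'' (var ''N'' \<oplus> NConst 1) fold_step) s2 (80 * (N + 1 + 1)) (\<lambda>s'.
     (\<forall>e\<le>N. fst s' ''G'' (off + e) = ng e \<and> fst s' ''T'' (off + e) = nt e))"
  proof (rule run_For_le[where B = "N + 1" and T = 65 and
      I = "\<lambda>j s'. (\<forall>e<j. fst s' ''G'' (off + e) = ng e \<and> fst s' ''T'' (off + e) = nt e) \<and>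
        (\<forall>a\<ge>off1. fst s' ''G'' a = fst s ''G'' a \<and> fst s' ''T'' a = fst s ''T'' a) \<and>
        (j \<le> N \<longrightarrow> fst s' ''lo'' 0 = off1 + lower m j \<and> fst s' ''hi'' 0 = off1 + upper m j)"], goal_cases)
    case (5 j s')
    note same' = 5(2)[unfolded nwr]
    note sm = sameD(1)[OF same2] sameD(1)[OF same']
    have c': "ctx s'" by (rule ctx_same[OF c2 same']) (simp add: ctx_names_def)
    have jN: "j \<le> N" using 5(1) by simp
    have st: "fst s' ''o'' 0 = off" "fst s' ''m'' 0 = m" "fst s' ''pw'' m = 2 ^ m" "fst s' ''XV'' = fst s ''XV''"
      "fst s' ''BIT'' = fst s ''BIT''" "fst s' ''ORD'' = fst s ''ORD''" "fst s' ''lo'' 0 = off1 + lower m j"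
      "fst s' ''hi'' 0 = off1 + upper m j" "fst s' ''q'' 0 = j"
      using off m c' jN 5(3,4) by (simp_all add: sm off_def ctx_def)
    have gs: "fst s' ''G'' (off1 + e) = g e" "fst s' ''T'' (off1 + e) = \<tau> e" for e
      using 5(4) by (simp_all add: g_def \<tau>_def)
    have ne: "off1 + e \<noteq> off + j" for e using jN by (simp add: off1)
    define s3 where "s3 = nwrite (nwrite s' ''G'' (off + j) (ng j)) ''T'' (off + j) (nt j)"
    define u where "u = fst s ''ORD'' (off + j)"
    define s4 where "s4 = nwrite s3 ''u'' 0 u"
    have res: "result fold_step s' = (if fst s ''BIT'' (off + u) < 1
        then nwrite s4 ''lo'' 0 (off1 + lower m j + 1) else nwrite s4 ''hi'' 0 (off1 + upper m j + 1))"
      unfolding fold_step_def bit_clear_def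
      using st gs ne by (simp add: s4_def s3_def u_def ng_def nt_def mult_2)
    have lu: "Suc j \<le> N \<longrightarrow> lower m (Suc j) = lower m j + (if fst s ''BIT'' (off + u) < 1 then 1 else 0) \<and>
        upper m (Suc j) = upper m j + (if fst s ''BIT'' (off + u) < 1 then 0 else 1)"
    proof
      assume "Suc j \<le> N"
      then have j: "j < N" by simp
      have "u = order m ! j" using ord[OF j] by (simp add: u_def off_def)
      then have "fst s ''BIT'' (off + u) = bit_of m (order m ! j)"
        using bit[OF order_nth_less[OF j]] by (simp add: off_def)
      then show "lower m (Suc j) = lower m j + (if fst s ''BIT'' (off + u) < 1 then 1 else 0) \<and>
        upper m (Suc j) = upper m j + (if fst s ''BIT'' (off + u) < 1 then 0 else 1)"
        using lower_upper_Suc[OF j] by simp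
    qed
    show ?case
    proof (rule run_loopfree)
      show "(\<forall>e<Suc j. fst (result fold_step s') ''G'' (off + e) = ng e \<and> fst (result fold_step s') ''T'' (off + e) = nt e) \<and>
        (\<forall>a\<ge>off1. fst (result fold_step s') ''G'' a = fst s ''G'' a \<and> fst (result fold_step s') ''T'' a = fst s ''T'' a) \<and>
        (Suc j \<le> N \<longrightarrow> fst (result fold_step s') ''lo'' 0 = off1 + lower m (Suc j) \<and>
           fst (result fold_step s') ''hi'' 0 = off1 + upper m (Suc j))"
      proof (intro conjI)
        show "\<forall>e<Suc j. fst (result fold_step s') ''G'' (off + e) = ng e \<and> fst (result fold_step s') ''T'' (off + e) = nt e"
          unfolding res using 5(4) by (simp add: s4_def s3_def less_Suc_eq)
        show "\<forall>a\<ge>off1. fst (result fold_step s') ''G'' a = fst s ''G'' a \<and> fst (result fold_step s') ''T'' a = fst s ''T'' a"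
        proof -
          have "a \<noteq> off + j" if "off1 \<le> a" for a using that jN by (simp add: off1)
          then show ?thesis unfolding res using 5(4) by (simp add: s4_def s3_def)
        qed
        show "Suc j \<le> N \<longrightarrow> fst (result fold_step s') ''lo'' 0 = off1 + lower m (Suc j) \<and>
           fst (result fold_step s') ''hi'' 0 = off1 + upper m (Suc j)"
          unfolding res using lu st by (simp add: s4_def s3_def)
      qed
    qed (simp_all add: fold_step_def bit_clear_def)
  next
    case 2
    then show ?case using c2 by (auto simp: same_def ctx_def nwr)
  next
    case 3
    show ?case using lo2 2(3) sameD(1)[OF same2] by simp
  next
    case 1
    show ?case by (simp add: nwr)
  next
    case (6 s')
    then show ?case by (simp add: less_Suc_eq_le)
  qed simp_all
  then obtain t3 s3 where 3: "exec (For ''q'' (var ''N'' \<oplus> NConst 1) fold_step) s2 t3 s3" "t3 \<le> 80 * (N + 1 + 1)"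
     "\<forall>e\<le>N. fst s3 ''G'' (off + e) = ng e \<and> fst s3 ''T'' (off + e) = nt e"
    by (elim runE) blast
  show ?thesis unfolding fold_level_def
  proof (rule runI[OF exec.Seq[OF 1(1) exec.Seq[OF 2(1) 3(1)]]])
    show "t1 + (t2 + t3) \<le> 300 * (N + 1)" using 1(2) 2(2) 3(2) by simp
  qed (use 3(3) in \<open>simp add: row_def off_def ng_def nt_def g_def \<tau>_def off1_def\<close>)
qed

lemma run_select_level:
  assumes ctx: "ctx s" and j: "j \<le> H" "fst s ''j'' 0 = j"
    and arr: "\<And>m. m \<le> H \<Longrightarrow> grid_arrays s S m"
    and ord: "\<And>m e. m \<le> H \<Longrightarrow> e < N \<Longrightarrow> fst s ''ORD'' (m * (N + 1) + e) = order m ! e"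
    and 0: "\<And>k. fst s ''P'' k = 0 \<and> fst s ''Q'' k = 0"
    and top: "j = 0 \<Longrightarrow> \<forall>e\<le>N. row s ''G'' (Suc H) e = 0 \<and> row s ''T'' (Suc H) e = 0"
    and min: "0 < j \<Longrightarrow> minima (Suc H - j) (row s ''G'' (Suc H - j)) (row s ''T'' (Suc H - j))"
  shows "run select_level s (950 * (N + 1)) (\<lambda>s'.
      minima (Suc H - Suc j) (row s' ''G'' (Suc H - Suc j)) (row s' ''T'' (Suc H - Suc j)) \<and>
      (\<forall>k. fst s' ''P'' k = 0 \<and> fst s' ''Q'' k = 0))"
proof -
  define m where "m = H - j"
  have m: "m \<le> H" "Suc H - j = Suc m" "Suc H - Suc j = m" using j by (auto simp: m_def)
  let ?init = "Seq (''m'' ::= var ''H'' \<ominus> var ''j'') (''o'' ::= NGet ''ON'' (var ''m''))"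
  have "run ?init s 20 (\<lambda>s'. fst s' ''m'' 0 = m \<and> fst s' ''o'' 0 = m * (N + 1) \<and> same {''m'', ''o''} {} s s')"
    using ctx j by (intro run_loopfree) (auto simp: same_def ctx_def m_def)
  then obtain t1 s1 where 1: "exec ?init s t1 s1" "t1 \<le> 20" "fst s1 ''m'' 0 = m" "fst s1 ''o'' 0 = m * (N + 1)"
     "same {''m'', ''o''} {} s s1" by (auto elim: runE)
  note s1 = sameD(1)[OF 1(5)]
  have c1: "ctx s1" by (rule ctx_same[OF ctx 1(5)]) (simp add: ctx_names_def)
  have arr1: "grid_arrays s1 S m" using arr[OF m(1)] s1 by (simp add: grid_arrays_def)
  have ord1: "fst s1 ''ORD'' (m * (N + 1) + e) = order m ! e" if "e < N" for e
    using ord[OF m(1) that] s1 by simp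
  have 01: "fst s1 ''P'' k = 0 \<and> fst s1 ''Q'' k = 0" for k using 0[of k] s1 by simp
  obtain t2 s2 where 2: "exec sweep s1 t2 s2" "t2 \<le> 600 * (N + 1)" "\<forall>k. fst s2 ''P'' k = 0 \<and> fst s2 ''Q'' k = 0"
     "\<forall>u<2 ^ m. fst s2 ''XV'' (rank m u) = level_imbalance m u"
     "same {''q'', ''u'', ''p'', ''a'', ''X'', ''P'', ''Q'', ''cur'', ''XV''} {} s1 s2"
    by (rule runE[OF run_sweep[OF c1 m(1) 1(4) arr1 ord1 01]]) blast+
  note s2 = sameD(1)[OF 2(5)]
  have c2: "ctx s2" by (rule ctx_same[OF c1 2(5)]) (simp add: ctx_names_def)
  have st2: "fst s2 ''m'' 0 = m" "fst s2 ''o'' 0 = m * (N + 1)" using 1 s2 by simp_all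
  have bit2: "fst s2 ''BIT'' (m * (N + 1) + q) = bit_of m q" if "q < N" for q
    using arr1 that s2 by (simp add: grid_arrays_def bit_of_def)
  have ord2: "fst s2 ''ORD'' (m * (N + 1) + e) = order m ! e" if "e < N" for e
    using ord1[OF that] s2 by simp
  have rows: "row s2 ''G'' = row s ''G''" "row s2 ''T'' = row s ''T''" using s1 s2 by (auto simp: row_def fun_eq_iff)
  obtain t3 s3 where 3: "exec fold_level s2 t3 s3" "t3 \<le> 300 * (N + 1)"
      and 4: "\<forall>e\<le>N. row s3 ''G'' m e = fst s2 ''XV'' e +
         2 * (if row s2 ''G'' (Suc m) (upper m e) < row s2 ''G'' (Suc m) (lower m e)
              then row s2 ''G'' (Suc m) (upper m e) else row s2 ''G'' (Suc m) (lower m e))"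
      "\<forall>e\<le>N. row s3 ''T'' m e = (if row s2 ''G'' (Suc m) (upper m e) < row s2 ''G'' (Suc m) (lower m e)
              then row s2 ''T'' (Suc m) (upper m e) + 2 ^ m else row s2 ''T'' (Suc m) (lower m e))"
    by (rule runE[OF run_fold_level[OF c2 m(1) st2 bit2 ord2]]) blast+
  have "minima m (row s3 ''G'' m) (row s3 ''T'' m)"
  proof (cases "j = 0")
    case True
    then have mH: "m = H" by (simp add: m_def)
    \<comment> \<open>Above the coarsest level the rows are still zero, so the general folding step
      copies \<open>XV\<close> and chooses shift 0, as \<open>minima_top\<close> requires.\<close>
    have z: "row s2 ''G'' (Suc m) e = 0" "row s2 ''T'' (Suc m) e = 0" if "e \<le> N" for e
      using top[OF True] that by (simp_all add: rows mH)
    have "row s3 ''G'' m e = fst s2 ''XV'' e" "row s3 ''T'' m e = 0" if "e \<le> N" for e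
      using 4 that z lower_upper_le[OF that, of m] by simp_all
    then show ?thesis using 2(4) rank_le unfolding mH by (intro minima_top) (auto simp: mH)
  next
    case False
    then have "m < H" using j by (simp add: m_def)
    have "minima (Suc m) (row s2 ''G'' (Suc m)) (row s2 ''T'' (Suc m))"
      using min False m(2) by (simp add: rows)
    then show ?thesis
      using 2(4) 4 by (intro minima_step[OF \<open>m < H\<close>, where lo = "lower m" and hi = "upper m" and xv = "fst s2 ''XV''"])
        (simp_all add: lower_def upper_def)
  qed
  moreover have "\<forall>k. fst s3 ''P'' k = 0 \<and> fst s3 ''Q'' k = 0"
    using 2(3) exec_same[OF 3(1)] by (simp add: same_def nwr_fold)
  ultimately show ?thesis unfolding select_level_def m(3)
    by (intro runI[OF exec.Seq[OF 1(1) exec.Seq[OF 2(1) 3(1)]]]) (use 1(2) 2(2) 3(2) in simp_all)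
qed

lemma run_select_shift:
  assumes ctx: "ctx s"
    and arr: "\<And>m. m \<le> H \<Longrightarrow> grid_arrays s S m"
    and ord: "\<And>m e. m \<le> H \<Longrightarrow> e < N \<Longrightarrow> fst s ''ORD'' (m * (N + 1) + e) = order m ! e"
    and 0: "\<And>k. fst s ''P'' k = 0 \<and> fst s ''Q'' k = 0" "\<And>k. fst s ''G'' k = 0 \<and> fst s ''T'' k = 0"
  shows "run select_shift s (1000 * (N + 1) * (H + 2)) (\<lambda>s'.
      fst s' ''T'' 0 < 2 ^ H \<and> (\<forall>t<2 ^ H. weight 0 (fst s' ''T'' 0) \<le> weight 0 t) \<and>
      (\<forall>k. fst s' ''P'' k = 0 \<and> fst s' ''Q'' k = 0) \<and>
      same {''j'', ''m'', ''o'', ''q'', ''u'', ''p'', ''a'', ''X'', ''P'', ''Q'', ''cur'', ''XV'', ''lo'', ''hi'', ''G'', ''T''} {} s s')"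
proof -
  have "run select_shift s ((950 * (N + 1) + 20) * (H + 1 + 1)) (\<lambda>s'.
      minima 0 (row s' ''G'' 0) (row s' ''T'' 0) \<and>
      (\<forall>k. fst s' ''P'' k = 0 \<and> fst s' ''Q'' k = 0) \<and>
      same {''j'', ''m'', ''o'', ''q'', ''u'', ''p'', ''a'', ''X'', ''P'', ''Q'', ''cur'', ''XV'', ''lo'', ''hi'', ''G'', ''T''} {} s s')"
    unfolding select_shift_def
  proof (rule run_For_le[where B = "H + 1" and T = "950 * (N + 1)" and
     I = "\<lambda>j s'. (\<forall>k. fst s' ''P'' k = 0 \<and> fst s' ''Q'' k = 0) \<and>
       (j = 0 \<longrightarrow> (\<forall>e\<le>N. row s' ''G'' (Suc H) e = 0 \<and> row s' ''T'' (Suc H) e = 0)) \<and>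
       (0 < j \<longrightarrow> minima (Suc H - j) (row s' ''G'' (Suc H - j)) (row s' ''T'' (Suc H - j)))"], goal_cases)
    case (5 j s')
    note same' = 5(2)[unfolded nwr_select_level]
    note sm = sameD(1)[OF same']
    have c': "ctx s'" by (rule ctx_same[OF ctx same']) (simp add: ctx_names_def)
    have arr': "grid_arrays s' S m" if "m \<le> H" for m using arr[OF that] sm by (simp add: grid_arrays_def)
    have ord': "fst s' ''ORD'' (m * (N + 1) + e) = order m ! e" if "m \<le> H" "e < N" for m e
      using ord[OF that] sm by simp
    have jH: "j \<le> H" using 5(1) by simp
    show ?case
      by (rule run_mono[OF run_select_level[OF c' jH 5(3) arr' ord']]) (use 5(4) in auto)
  next
    case 2
    then show ?case using ctx by (simp add: same_def ctx_def nwr_select_level)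
  next
    case 3
    show ?case using 0 by (simp add: row_def)
  next
    case (4 j s' v)
    have "row (nwrite s' ''j'' 0 v) ''G'' = row s' ''G''" "row (nwrite s' ''j'' 0 v) ''T'' = row s' ''T''"
      by (simp_all add: row_def fun_eq_iff)
    then show ?case using 4 by simp
  next
    case (6 s')
    then show ?case by (simp add: nwr_select_level)
  next
    case 1
    show ?case by (simp add: nwr_select_level)
  qed simp_all
  then show ?thesis
  proof (rule run_mono)
    have "(950 * (N + 1) + 20) * (H + 1 + 1) \<le> (1000 * (N + 1)) * (H + 2)"
      by (rule mult_le_mono) auto
    then show "(950 * (N + 1) + 20) * (H + 1 + 1) \<le> 1000 * (N + 1) * (H + 2)" by (simp only: mult.assoc)
  qed (auto dest: minima_bottom simp: row_def)
qed

end

section \<open>Fairlets\<close>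

context fairness
begin

definition heads :: "nat set \<Rightarrow> (nat \<Rightarrow> nat) \<Rightarrow> nat set" where
  "heads A rep = {l \<in> A. rep l = l}"

text \<open>
  The points of \<open>A\<close> are grouped into fairlets, each inside one cell and represented by one of
  its points; points that cannot be balanced yet form groups of their own.
\<close>

definition groups :: "nat set \<Rightarrow> (nat \<Rightarrow> nat) \<Rightarrow> (nat \<Rightarrow> nat) \<Rightarrow> bool" where
  "groups A cell rep \<longleftrightarrow> (\<forall>i\<in>A. rep i \<in> heads A rep \<and> cell (rep i) = cell i) \<and>
     (\<forall>l\<in>heads A rep. card {i \<in> A. rep i = l} \<le> r + b \<and>
        (cell_excess rep A l = 0 \<or> {i \<in> A. rep i = l} = {l}))"

text \<open>Here \<open>cell_excess\<close> refers to the partition by representatives. By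
  \<open>groups\<close> an unbalanced group is a single point, so \<open>bad\<close> is the set of
  waiting points themselves.\<close>

definition bad :: "nat set \<Rightarrow> (nat \<Rightarrow> nat) \<Rightarrow> nat set" where
  "bad A rep = {l \<in> heads A rep. cell_excess rep A l \<noteq> 0}"

lemma groupsD:
  assumes "groups A cell rep"
  shows "i \<in> A \<Longrightarrow> rep i \<in> heads A rep" "i \<in> A \<Longrightarrow> cell (rep i) = cell i"
    "l \<in> heads A rep \<Longrightarrow> card {i \<in> A. rep i = l} \<le> r + b"
    "l \<in> bad A rep \<Longrightarrow> {i \<in> A. rep i = l} = {l}"
  using assms unfolding groups_def bad_def by auto

lemma groups_cell:
  "groups A cell rep \<Longrightarrow> (\<And>i i'. i \<in> A \<Longrightarrow> i' \<in> A \<Longrightarrow> cell i = cell i' \<Longrightarrow> cell' i = cell' i') \<Longrightarrow> groups A cell' rep"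
proof -
  assume G: "groups A cell rep" and *: "\<And>i i'. i \<in> A \<Longrightarrow> i' \<in> A \<Longrightarrow> cell i = cell i' \<Longrightarrow> cell' i = cell' i'"
  have "cell' (rep i) = cell' i" if "i \<in> A" for i
    using groupsD(1,2)[OF G that] that by (intro *) (auto simp: heads_def)
  then show "groups A cell' rep" using G unfolding groups_def by simp
qed

lemma groups_extend:
  assumes G: "groups A cell rep" and fin: "finite A" "finite F" and disj: "A \<inter> F = {}" and l: "l \<in> F"
    and cell: "\<And>i. i \<in> F \<Longrightarrow> cell i = a" and size: "card F \<le> r + b"
    and fair: "excess (card {i \<in> F. col i = 0}) (card {i \<in> F. col i = 1}) = 0 \<or> F = {l}"
    and rep': "\<And>i. i \<in> A \<Longrightarrow> rep' i = rep i" "\<And>i. i \<in> F \<Longrightarrow> rep' i = l"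
  shows "groups (A \<union> F) cell rep'" "heads (A \<union> F) rep' = insert l (heads A rep)"
    "\<And>h c. h \<in> heads A rep \<Longrightarrow> colcount rep' (A \<union> F) h c = colcount rep A h c"
    "\<And>c. colcount rep' (A \<union> F) l c = card {i \<in> F. col i = c}"
    "bad (A \<union> F) rep' = bad A rep \<union> (if excess (card {i \<in> F. col i = 0}) (card {i \<in> F. col i = 1}) = 0 then {} else {l})"
proof -
  have lA: "l \<notin> A" using disj l by blast
  have repA: "rep i \<in> A" if "i \<in> A" for i using groupsD(1)[OF G that] by (simp add: heads_def)
  have setA: "{i \<in> A \<union> F. rep' i = h \<and> P i} = {i \<in> A. rep i = h \<and> P i}" if "h \<in> A" for h P
    using that rep' lA by auto
  have setF: "{i \<in> A \<union> F. rep' i = l \<and> P i} = {i \<in> F. P i}" for P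
  proof -
    have "rep' i \<noteq> l" if "i \<in> A" for i using repA[OF that] rep'(1)[OF that] lA by auto
    then show ?thesis using rep'(2) by auto
  qed
  show hd: "heads (A \<union> F) rep' = insert l (heads A rep)"
  proof -
    have "rep' i = i \<longleftrightarrow> i = l" if "i \<in> F" for i using rep'(2)[OF that] by auto
    then show ?thesis unfolding heads_def using rep' l by auto
  qed
  show cA: "colcount rep' (A \<union> F) h c = colcount rep A h c" if "h \<in> heads A rep" for h c
    using setA[of h "\<lambda>i. col i = c"] that by (simp add: colcount_def heads_def)
  show cF: "colcount rep' (A \<union> F) l c = card {i \<in> F. col i = c}" for c
    using setF[of "\<lambda>i. col i = c"] by (simp add: colcount_def)
  have exA: "cell_excess rep' (A \<union> F) h = cell_excess rep A h" if "h \<in> heads A rep" for h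
    using cA[OF that] by (simp add: cell_excess_def)
  have exF: "cell_excess rep' (A \<union> F) l = excess (card {i \<in> F. col i = 0}) (card {i \<in> F. col i = 1})"
    using cF by (simp add: cell_excess_def)
  have "l \<notin> heads A rep" using lA by (simp add: heads_def)
  then show "bad (A \<union> F) rep' = bad A rep \<union> (if excess (card {i \<in> F. col i = 0}) (card {i \<in> F. col i = 1}) = 0 then {} else {l})"
    unfolding bad_def hd using exA exF by auto
  show "groups (A \<union> F) cell rep'"
    unfolding groups_def hd
  proof (intro conjI ballI)
    fix i assume i: "i \<in> A \<union> F"
    show "rep' i \<in> insert l (heads A rep)" "cell (rep' i) = cell i"
      using i rep' groupsD(1,2)[OF G, of i] cell l by auto
  next
    fix h assume h: "h \<in> insert l (heads A rep)"
    have hA: "h \<in> A" if "h \<noteq> l" using h that by (auto simp: heads_def)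
    show "card {i \<in> A \<union> F. rep' i = h} \<le> r + b"
      using setF[of "\<lambda>_. True"] setA[of h "\<lambda>_. True"] hA size h groupsD(3)[OF G, of h] by (cases "h = l") auto
    show "cell_excess rep' (A \<union> F) h = 0 \<or> {i \<in> A \<union> F. rep' i = h} = {h}"
    proof (cases "h = l")
      case True
      then show ?thesis using setF[of "\<lambda>_. True"] fair exF by auto
    next
      case False
      then have h': "h \<in> heads A rep" using h by simp
      then show ?thesis using G setA[of h "\<lambda>_. True"] hA[OF False] exA[OF h'] unfolding groups_def by simp
    qed
  qed
qed

section \<open>Dissolving groups without raising the excess of a cell\<close>

definition members :: "nat set \<Rightarrow> (nat \<Rightarrow> nat) \<Rightarrow> nat set \<Rightarrow> nat set" where
  "members A rep U = {i \<in> A. rep i \<in> U}"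

lemma colcount_members:
  assumes "h \<notin> U"
  shows "colcount rep (A - members A rep U) h c = colcount rep A h c"
  unfolding colcount_def members_def using assms by (intro arg_cong[where f = card]) auto

lemma groups_dissolve:
  assumes G: "groups A cell rep" and U: "U \<subseteq> heads A rep"
  shows "groups (A - members A rep U) cell rep" "heads (A - members A rep U) rep = heads A rep - U"
    "bad (A - members A rep U) rep = bad A rep - U"
proof -
  show hd: "heads (A - members A rep U) rep = heads A rep - U"
    using U by (auto simp: heads_def members_def)
  show "bad (A - members A rep U) rep = bad A rep - U"
    unfolding bad_def hd cell_excess_def using colcount_members by auto
  have set: "{i \<in> A - members A rep U. rep i = h} = {i \<in> A. rep i = h}" if "h \<notin> U" for h
    using that by (auto simp: members_def)
  show "groups (A - members A rep U) cell rep"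
    unfolding groups_def hd
  proof (intro conjI ballI)
    fix i assume "i \<in> A - members A rep U"
    then show "rep i \<in> heads A rep - U" "cell (rep i) = cell i"
      using groupsD(1,2)[OF G, of i] by (auto simp: members_def)
  next
    fix h assume "h \<in> heads A rep - U"
    then have h: "h \<in> heads A rep" "h \<notin> U" by auto
    show "card {i \<in> A - members A rep U. rep i = h} \<le> r + b"
      unfolding set[OF h(2)] by (rule groupsD(3)[OF G h(1)])
    show "cell_excess rep (A - members A rep U) h = 0 \<or> {i \<in> A - members A rep U. rep i = h} = {h}"
      using G h unfolding set[OF h(2)] groups_def cell_excess_def colcount_members[OF h(2)] by auto
  qed
qed

lemma members_insert: "members A rep (insert l U) = members A rep U \<union> {i \<in> A. rep i = l}"
  by (auto simp: members_def)

lemma members_bad: "groups A cell rep \<Longrightarrow> members A rep (bad A rep) = bad A rep"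
proof (intro equalityI subsetI)
  fix i assume G: "groups A cell rep" and i: "i \<in> members A rep (bad A rep)"
  then have "rep i \<in> bad A rep" "i \<in> {i' \<in> A. rep i' = rep i}" by (simp_all add: members_def)
  with groupsD(4)[OF G] show "i \<in> bad A rep" by (metis singletonD)
qed (auto simp: members_def bad_def heads_def)

text \<open>Bad groups contribute one point each, all others at most \<open>r + b\<close>.\<close>

lemma card_members:
  assumes G: "groups A cell rep" and fin: "finite A" and U: "bad A rep \<subseteq> U" "U \<subseteq> heads A rep"
  shows "card (members A rep U) \<le> card (bad A rep) + (r + b) * card (U - bad A rep)"
proof -
  have finH: "finite (heads A rep)" using fin by (simp add: heads_def)
  have "members A rep U = bad A rep \<union> (\<Union>l\<in>U - bad A rep. {i \<in> A. rep i = l})"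
    using members_bad[OF G] U by (auto simp: members_def)
  then have "card (members A rep U) \<le> card (bad A rep) + card (\<Union>l\<in>U - bad A rep. {i \<in> A. rep i = l})"
    using card_Un_le by metis
  also have "card (\<Union>l\<in>U - bad A rep. {i \<in> A. rep i = l}) \<le> (\<Sum>l\<in>U - bad A rep. card {i \<in> A. rep i = l})"
    using finite_subset[OF U(2) finH] by (intro card_UN_le) auto
  also have "\<dots> \<le> (\<Sum>l\<in>U - bad A rep. r + b)"
    using U groupsD(3)[OF G] by (intro sum_mono) auto
  finally show ?thesis by (simp add: mult.commute)
qed

definition deficient :: "(nat \<Rightarrow> nat) \<Rightarrow> nat set \<Rightarrow> nat \<Rightarrow> nat \<Rightarrow> bool" where
  "deficient cell D a c \<longleftrightarrow> r * colcount cell D a (1 - c) < b * colcount cell D a c"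

text \<open>For a balanced group this inequality is an equality: the group has no room for another
  point of color \<open>c\<close>.\<close>

definition saturated :: "nat set \<Rightarrow> (nat \<Rightarrow> nat) \<Rightarrow> nat \<Rightarrow> nat \<Rightarrow> bool" where
  "saturated A rep l c \<longleftrightarrow> r * colcount rep A l (1 - c) \<le> b * colcount rep A l c"

lemma colcount_groups:
  assumes G: "groups A cell rep" and fin: "finite A" and U: "U \<subseteq> heads A rep"
  shows "colcount cell (A - members A rep U) a c = (\<Sum>l | l \<in> heads A rep - U \<and> cell l = a. colcount rep A l c)"
proof -
  let ?L = "{l. l \<in> heads A rep - U \<and> cell l = a}"
  let ?S = "{i \<in> A - members A rep U. cell i = a \<and> col i = c}"
  have finL: "finite ?L" using fin by (simp add: heads_def)
  have "?S = (\<Union>l\<in>?L. {i \<in> A. rep i = l \<and> col i = c})"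
  proof (intro equalityI subsetI)
    fix i assume "i \<in> ?S"
    then show "i \<in> (\<Union>l\<in>?L. {i \<in> A. rep i = l \<and> col i = c})"
      using groupsD(1,2)[OF G, of i] by (auto simp: members_def)
  next
    fix i assume "i \<in> (\<Union>l\<in>?L. {i \<in> A. rep i = l \<and> col i = c})"
    then show "i \<in> ?S" using groupsD(2)[OF G, of i] by (auto simp: members_def)
  qed
  then show ?thesis
    unfolding colcount_def using finL fin by (subst card_UN_disjoint[symmetric]) auto
qed

text \<open>If the dissolved points of a cell have too many points of color \<open>c\<close>, the
  groups left in that cell are saturated with \<open>c\<close>, so putting them back cannot reduce
  the excess. Hence the points that must go on waiting are bounded by the imbalance of the input in
  that cell, whatever happened on the levels below.\<close>

lemma excess_dissolved:
  assumes G: "groups A cell rep" and fin: "finite A" and U: "U \<subseteq> heads A rep"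
    and sat: "\<And>l c. l \<in> heads A rep - U \<Longrightarrow> c < 2 \<Longrightarrow> deficient cell (members A rep U) (cell l) c \<Longrightarrow> saturated A rep l c"
  shows "cell_excess cell (members A rep U) a \<le> cell_excess cell A a"
proof -
  let ?D = "members A rep U"
  have DA: "?D \<subseteq> A" by (auto simp: members_def)
  have tot: "colcount cell A a c = colcount cell ?D a c + colcount cell (A - ?D) a c" for c
    using colcount_union[of ?D "A - ?D" cell a c] fin finite_subset[OF DA fin] DA by (simp add: Un_absorb1)
  have rest: "r * colcount cell (A - ?D) a (1 - c) \<le> b * colcount cell (A - ?D) a c" if "c < 2" "deficient cell ?D a c" for c
    unfolding colcount_groups[OF G fin U] sum_distrib_left
    using sat that unfolding saturated_def by (intro sum_mono) auto
  have *: "b * x - r * y \<le> b * (x + x') - r * (y + y')" if "r * y < b * x \<longrightarrow> r * y' \<le> b * x'" for x x' y y' :: nat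
    using that by (cases "r * y < b * x") (simp_all add: algebra_simps)
  have "cell_excess cell ?D a \<le> (b * (colcount cell ?D a 0 + colcount cell (A - ?D) a 0) - r * (colcount cell ?D a 1 + colcount cell (A - ?D) a 1))
    + (b * (colcount cell ?D a 1 + colcount cell (A - ?D) a 1) - r * (colcount cell ?D a 0 + colcount cell (A - ?D) a 0))"
    unfolding cell_excess_def excess_def
    using rest[of 0] rest[of 1] by (intro add_mono *) (auto simp: deficient_def)
  then show ?thesis unfolding cell_excess_def[of cell A] excess_def tot .
qed

text \<open>A group is dissolved if it relieves its cell; this preserves the condition on the groups left alone.\<close>

lemma deficient_union:
  assumes "r * fy \<ge> b * fx" "r * (y + fy) < b * (x + fx)"
  shows "r * y < b * (x :: nat)"
  using assms unfolding distrib_left by linarith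

text \<open>With the first color in excess, the opposite difference is zero before and after adding
  a balanced group, because \<open>b \<le> r\<close>. Such a group with spare room for the first
  color would thus strictly lower the excess.\<close>

lemma excess_not_relieved:
  assumes "\<not> excess (x + fx) (y + fy) < excess x y" "r * y < b * x" "excess fx fy = 0"
  shows "r * fy \<le> b * fx"
proof (rule ccontr)
  assume lt: "\<not> r * fy \<le> b * fx"
  have "b * y \<le> r * x"
  proof -
    have "b * (b * y) \<le> r * (r * y)" using b_le_r by (intro mult_le_mono) auto
    also have "\<dots> \<le> r * (b * x)" using assms(2) by simp
    finally have "b * (b * y) \<le> b * (r * x)" by (simp add: ac_simps)
    then show ?thesis using b_pos by simp
  qed
  moreover have "b * fy \<le> r * fx" using assms(3) by (simp add: excess_0_iff)
  ultimately have "excess (x + fx) (y + fy) = b * (x + fx) - r * (y + fy)" "excess x y = b * x - r * y"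
    by (simp_all add: excess_def algebra_simps)
  then show False using assms(1,2) lt by (simp add: algebra_simps)
qed

end

primrec chain :: "(nat \<Rightarrow> nat) \<Rightarrow> nat \<Rightarrow> nat list \<Rightarrow> bool" where
  "chain nx h [] \<longleftrightarrow> h = 0"
| "chain nx h (x # xs) \<longleftrightarrow> h = Suc x \<and> chain nx (nx x) xs"

lemma chain_upd: "x \<notin> set xs \<Longrightarrow> chain (nx(x := v)) h xs = chain nx h xs"
  by (induction xs arbitrary: h) auto

lemma chain_0_iff: "chain nx h xs \<Longrightarrow> h = 0 \<longleftrightarrow> xs = []"
  by (cases xs) auto

definition pop_body :: com where
  "pop_body = seqs [''x'' ::= NGet ''hd'' (var ''key'') \<ominus> NConst 1,
     NSet ''hd'' (var ''key'') (NGet ''nx'' (var ''x'')),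
     NSet ''rep'' (var ''x'') (var ''l''),
     NSet ''P'' (var ''key'') (NGet ''P'' (var ''key'') \<ominus> var ''b''),
     NSet ''Q'' (var ''key'') (NGet ''Q'' (var ''key'') \<ominus> var ''r''),
     NSet ''fP'' (var ''fk'') (NGet ''fP'' (var ''fk'') \<oplus> var ''b''),
     NSet ''fQ'' (var ''fk'') (NGet ''fQ'' (var ''fk'') \<oplus> var ''r''),
     ''w'' ::= var ''w'' \<oplus> var ''inc'']"

text \<open>The accumulator \<open>w\<close> divides \<open>cap\<close> by \<open>inc\<close> while
  points are popped: \<open>min (cap div inc) (length xs)\<close> of them leave the stack. The
  quotient in \<open>cut_major\<close> is thus never computed as such.\<close>

definition pop_all :: com where
  "pop_all = While (Conj (Neg (NLess (var ''cap'') (var ''w'' \<oplus> var ''inc''))) (NLess (NConst 0) (NGet ''hd'' (var ''key'')))) pop_body"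

lemma nwr_pop_all: "nwr pop_all = {''x'', ''hd'', ''rep'', ''P'', ''Q'', ''fP'', ''fQ'', ''w''}" "rwr pop_all = {}"
  by (auto simp: pop_all_def pop_body_def)

context fairness
begin

lemma run_pop_all:
  assumes rb: "fst s ''r'' 0 = r" "fst s ''b'' 0 = b"
    and st: "fst s ''key'' 0 = key" "fst s ''l'' 0 = l" "fst s ''fk'' 0 = fk" "fst s ''inc'' 0 = inc" "fst s ''cap'' 0 = cap"
      "fst s ''w'' 0 = 0" and inc: "0 < inc"
    and ch: "chain (fst s ''nx'') (fst s ''hd'' key) xs"
    and PQ: "fst s ''P'' key = b * length xs" "fst s ''Q'' key = r * length xs"
    and k: "k = min (cap div inc) (length xs)"
  shows "run pop_all s (120 * k + 50) (\<lambda>s'.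
     chain (fst s ''nx'') (fst s' ''hd'' key) (drop k xs) \<and>
     (\<forall>i. fst s' ''rep'' i = (if i \<in> set (take k xs) then l else fst s ''rep'' i)) \<and>
     (\<forall>j. j \<noteq> key \<longrightarrow> fst s' ''hd'' j = fst s ''hd'' j \<and> fst s' ''P'' j = fst s ''P'' j \<and> fst s' ''Q'' j = fst s ''Q'' j) \<and>
     fst s' ''P'' key = b * (length xs - k) \<and> fst s' ''Q'' key = r * (length xs - k) \<and>
     (\<forall>j. j \<noteq> fk \<longrightarrow> fst s' ''fP'' j = fst s ''fP'' j \<and> fst s' ''fQ'' j = fst s ''fQ'' j) \<and>
     fst s' ''fP'' fk = fst s ''fP'' fk + b * k \<and> fst s' ''fQ'' fk = fst s ''fQ'' fk + r * k \<and>
     same {''x'', ''hd'', ''rep'', ''P'', ''Q'', ''fP'', ''fQ'', ''w''} {} s s')"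
    (is "run _ _ _ ?Post")
proof -
  define I where "I j s' \<longleftrightarrow> chain (fst s ''nx'') (fst s' ''hd'' key) (drop j xs) \<and>
     (\<forall>i. fst s' ''rep'' i = (if i \<in> set (take j xs) then l else fst s ''rep'' i)) \<and>
     (\<forall>i. i \<noteq> key \<longrightarrow> fst s' ''hd'' i = fst s ''hd'' i \<and> fst s' ''P'' i = fst s ''P'' i \<and> fst s' ''Q'' i = fst s ''Q'' i) \<and>
     fst s' ''P'' key = b * (length xs - j) \<and> fst s' ''Q'' key = r * (length xs - j) \<and>
     (\<forall>i. i \<noteq> fk \<longrightarrow> fst s' ''fP'' i = fst s ''fP'' i \<and> fst s' ''fQ'' i = fst s ''fQ'' i) \<and>
     fst s' ''fP'' fk = fst s ''fP'' fk + b * j \<and> fst s' ''fQ'' fk = fst s ''fQ'' fk + r * j \<and>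
     fst s' ''w'' 0 = inc * j \<and>
     same {''x'', ''hd'', ''rep'', ''P'', ''Q'', ''fP'', ''fQ'', ''w''} {} s s'" for j s'
  have "run pop_all s (120 * k + 50) (I k)"
    unfolding pop_all_def
  proof (rule run_While_count[where T = 85])
    fix j s' assume j: "j < k" and Ij: "I j s'"
    note J = Ij[unfolded I_def]
    have sm: "same {''x'', ''hd'', ''rep'', ''P'', ''Q'', ''fP'', ''fQ'', ''w''} {} s s'" using J by blast
    note smD = sameD(1)[OF sm]
    have jl: "j < length xs" "j < cap div inc" using j k by auto
    have drop: "drop j xs = xs ! j # drop (Suc j) xs" using jl(1) by (simp add: Cons_nth_drop_Suc)
    have take: "take (Suc j) xs = take j xs @ [xs ! j]" using jl(1) by (simp add: take_Suc_conv_app_nth)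
    have hd: "fst s' ''hd'' key = Suc (xs ! j)" "chain (fst s ''nx'') (fst s ''nx'' (xs ! j)) (drop (Suc j) xs)"
      using J unfolding drop by simp_all
    have "inc * (j + 1) \<le> cap"
      using jl(2) inc by (metis Suc_eq_plus1 Suc_leI less_eq_div_iff_mult_less_eq mult.commute)
    then have b1: "bval s' (Conj (Neg (NLess (var ''cap'') (var ''w'' \<oplus> var ''inc''))) (NLess (NConst 0) (NGet ''hd'' (var ''key''))))"
      using J st hd by (simp add: smD)
    have len: "length xs - Suc j = (length xs - j) - 1" "length xs - j = Suc (length xs - Suc j)" using jl by auto
    have "run pop_body s' 85 (I (Suc j))"
    proof (rule run_loopfree)
      define s'' where "s'' = result pop_body s'"
      have s'': "s'' = nwrite (nwrite (nwrite (nwrite (nwrite (nwrite (nwrite (nwrite s' ''x'' 0 (xs ! j))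
          ''hd'' key (fst s ''nx'' (xs ! j))) ''rep'' (xs ! j) l)
          ''P'' key (b * (length xs - Suc j))) ''Q'' key (r * (length xs - Suc j)))
          ''fP'' fk (fst s ''fP'' fk + b * j + b)) ''fQ'' fk (fst s ''fQ'' fk + r * j + r)) ''w'' 0 (inc * j + inc)"
        unfolding s''_def pop_body_def using J st hd rb by (simp add: smD len(2) algebra_simps)
      show "I (Suc j) (result pop_body s')"
        unfolding s''_def[symmetric] I_def
      proof (intro conjI)
        show "chain (fst s ''nx'') (fst s'' ''hd'' key) (drop (Suc j) xs)" unfolding s'' using hd by simp
        show "\<forall>i. fst s'' ''rep'' i = (if i \<in> set (take (Suc j) xs) then l else fst s ''rep'' i)"
          unfolding s'' take using J by auto
        show "same {''x'', ''hd'', ''rep'', ''P'', ''Q'', ''fP'', ''fQ'', ''w''} {} s s''"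
          unfolding s'' using sm by (simp add: same_def)
      qed (use J in \<open>simp_all add: s'' algebra_simps\<close>)
    qed (simp_all add: pop_body_def)
    then show "bval s' (Conj (Neg (NLess (var ''cap'') (var ''w'' \<oplus> var ''inc''))) (NLess (NConst 0) (NGet ''hd'' (var ''key'')))) \<and>
      run pop_body s' 85 (I (Suc j))" using b1 by blast
  next
    fix s' assume "I k s'"
    note J = this[unfolded I_def]
    have sm: "same {''x'', ''hd'', ''rep'', ''P'', ''Q'', ''fP'', ''fQ'', ''w''} {} s s'" using J by blast
    have "cap < inc * k + inc \<or> drop k xs = []"
    proof (cases "cap div inc < length xs")
      case True
      then have "k = cap div inc" using k by simp
      then show ?thesis using inc dividend_less_times_div[of inc cap] by simp
    qed (use k in simp)
    then show "\<not> bval s' (Conj (Neg (NLess (var ''cap'') (var ''w'' \<oplus> var ''inc''))) (NLess (NConst 0) (NGet ''hd'' (var ''key''))))"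
      using J st chain_0_iff[of _ _ "drop k xs"] by (auto simp: sameD(1)[OF sm])
  next
    show "I 0 s" using ch PQ st by (simp add: I_def same_refl)
  qed simp
  then show ?thesis by (rule run_mono) (auto simp: I_def)
qed

end

subsection \<open>Dissolving groups\<close>

abbreviation is_head :: bexp where
  "is_head \<equiv> Conj (Neg (NLess (NGet ''rep'' (var ''p'')) (var ''p''))) (Neg (NLess (var ''p'') (NGet ''rep'' (var ''p''))))"

abbreviation fP_exp :: "nat \<Rightarrow> nexp" where "fP_exp c \<equiv> NGet ''fP'' (var ''p'' \<oplus> var ''p'' \<oplus> NConst c)"
abbreviation fQ_exp :: "nat \<Rightarrow> nexp" where "fQ_exp c \<equiv> NGet ''fQ'' (var ''p'' \<oplus> var ''p'' \<oplus> NConst c)"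
abbreviation P_exp :: "nat \<Rightarrow> nexp" where "P_exp c \<equiv> NGet ''P'' (var ''a'' \<oplus> NConst c)"
abbreviation Q_exp :: "nat \<Rightarrow> nexp" where "Q_exp c \<equiv> NGet ''Q'' (var ''a'' \<oplus> NConst c)"

definition set_a :: com where
  "set_a = (''a'' ::= NGet ''FP'' (var ''o'' \<oplus> var ''p'') \<oplus> NGet ''FP'' (var ''o'' \<oplus> var ''p''))"

definition add_group :: com where
  "add_group = seqs [NSet ''dis'' (var ''p'') (NConst 1),
     NSet ''P'' (var ''a'' \<oplus> NConst 0) (P_exp 0 \<oplus> fP_exp 0), NSet ''P'' (var ''a'' \<oplus> NConst 1) (P_exp 1 \<oplus> fP_exp 1),
     NSet ''Q'' (var ''a'' \<oplus> NConst 0) (Q_exp 0 \<oplus> fQ_exp 0), NSet ''Q'' (var ''a'' \<oplus> NConst 1) (Q_exp 1 \<oplus> fQ_exp 1)]"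

definition dissolve :: "bexp \<Rightarrow> com" where
  "dissolve t = For ''p'' (var ''n'') (Cond is_head (Seq set_a (Cond t add_group Skip)) Skip)"

definition is_bad :: bexp where
  "is_bad = NLess (NConst 0) ((fP_exp 0 \<ominus> fQ_exp 1) \<oplus> (fP_exp 1 \<ominus> fQ_exp 0))"

definition is_relieving :: bexp where
  "is_relieving = Conj (NLess (NGet ''dis'' (var ''p'')) (NConst 1))
     (NLess (((P_exp 0 \<oplus> fP_exp 0) \<ominus> (Q_exp 1 \<oplus> fQ_exp 1)) \<oplus> ((P_exp 1 \<oplus> fP_exp 1) \<ominus> (Q_exp 0 \<oplus> fQ_exp 0)))
        ((P_exp 0 \<ominus> Q_exp 1) \<oplus> (P_exp 1 \<ominus> Q_exp 0)))"

definition clear_dis :: com where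
  "clear_dis = For ''p'' (var ''n'') (NSet ''dis'' (var ''p'') (NConst 0))"

definition push_points :: com where
  "push_points = For ''p'' (var ''n'') (Cond (NLess (NConst 0) (NGet ''dis'' (NGet ''rep'' (var ''p''))))
     (seqs [set_a, NSet ''nx'' (var ''p'') (NGet ''hd'' key_exp), NSet ''hd'' key_exp (var ''p'' \<oplus> NConst 1)]) Skip)"

lemma nwr_dissolve: "nwr (dissolve t) = {''p'', ''a'', ''dis'', ''P'', ''Q''}" "rwr (dissolve t) = {}"
  by (auto simp: dissolve_def set_a_def add_group_def)

context grid
begin

definition group_arrays :: "store \<Rightarrow> nat set \<Rightarrow> (nat \<Rightarrow> nat) \<Rightarrow> bool" where
  "group_arrays s A rep \<longleftrightarrow> (\<forall>l\<in>heads A rep. \<forall>c<2.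
     fst s ''fP'' (l + l + c) = b * colcount rep A l c \<and> fst s ''fQ'' (l + l + c) = r * colcount rep A l c)"

definition level_ctx :: "store \<Rightarrow> (nat \<Rightarrow> nat) \<Rightarrow> (nat \<Rightarrow> nat) \<Rightarrow> bool" where
  "level_ctx s cl rep \<longleftrightarrow> ctx s \<and> (\<forall>i<n. fst s ''FP'' (fst s ''o'' 0 + i) = cl i) \<and> (\<forall>i<n. fst s ''rep'' i = rep i) \<and>
     groups {..<n} cl rep \<and> group_arrays s {..<n} rep"

lemma level_ctx_same:
  assumes "level_ctx s cl rep" "same X V s s'" "X \<inter> ctx_names = {}" "X \<inter> {''FP'', ''o'', ''rep'', ''fP'', ''fQ''} = {}"
  shows "level_ctx s' cl rep"
proof -
  have "fst s' ''FP'' = fst s ''FP''" "fst s' ''o'' = fst s ''o''" "fst s' ''rep'' = fst s ''rep''"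
    "fst s' ''fP'' = fst s ''fP''" "fst s' ''fQ'' = fst s ''fQ''"
    by (rule sameD(1)[OF assms(2)]; use assms(4) in blast)+
  then show ?thesis using assms(1) ctx_same[OF _ assms(2,3)] by (simp add: level_ctx_def group_arrays_def)
qed

definition dissolved :: "store \<Rightarrow> (nat \<Rightarrow> nat) \<Rightarrow> (nat \<Rightarrow> nat) \<Rightarrow> nat set \<Rightarrow> bool" where
  "dissolved s cl rep U \<longleftrightarrow> U \<subseteq> heads {..<n} rep \<and> counts s cl (members {..<n} rep U) \<and>
     (\<forall>l\<in>heads {..<n} rep. fst s ''dis'' l = (if l \<in> U then 1 else 0))"

lemma colcount_members_insert:
  assumes G: "groups {..<n} cl rep" and U: "l \<notin> U" "l \<in> heads {..<n} rep"
  shows "colcount cl (members {..<n} rep (insert l U)) a c =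
    colcount cl (members {..<n} rep U) a c + (if cl l = a then colcount rep {..<n} l c else 0)"
proof -
  let ?F = "{i \<in> {..<n}. rep i = l}"
  have "colcount cl (members {..<n} rep U \<union> ?F) a c = colcount cl (members {..<n} rep U) a c + colcount cl ?F a c"
    using U(1) by (intro colcount_union) (auto simp: members_def)
  moreover have "colcount cl ?F a c = (if cl l = a then colcount rep {..<n} l c else 0)"
  proof -
    have "cl i = cl l" if "i \<in> ?F" for i using groupsD(2)[OF G, of i] that by simp
    then have "{i \<in> ?F. cl i = a \<and> col i = c} = (if cl l = a then {i \<in> {..<n}. rep i = l \<and> col i = c} else {})" by auto
    then show ?thesis by (simp add: colcount_def)
  qed
  ultimately show ?thesis unfolding members_insert by simp
qed

text \<open>One proof for both passes over the groups: \<open>R\<close> is the meaning of the test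
  \<open>t\<close> and \<open>J\<close> an invariant of the dissolved set alone, so the arguments
  about excess can be made without stores.\<close>

lemma run_dissolve:
  assumes L: "level_ctx s cl rep" and D: "dissolved s cl rep U0" and J0: "J 0 U0"
    and step: "\<And>j U. j < n \<Longrightarrow> U \<subseteq> heads {..<n} rep \<Longrightarrow> J j U \<Longrightarrow>
      (if j \<in> heads {..<n} rep \<and> R U j then j \<notin> U \<and> J (Suc j) (insert j U) else J (Suc j) U)"
    and test: "\<And>s' U j. j \<in> heads {..<n} rep \<Longrightarrow> level_ctx s' cl rep \<Longrightarrow> dissolved s' cl rep U \<Longrightarrow> fst s' ''p'' 0 = j \<Longrightarrow>
      fst s' ''a'' 0 = cl j + cl j \<Longrightarrow> bval s' t = R U j"
    and cost: "bcost t \<le> 100"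
  shows "run (dissolve t) s (250 * (N + 1)) (\<lambda>s'. \<exists>U. J n U \<and> dissolved s' cl rep U)"
  unfolding dissolve_def
proof (rule run_For_le[where B = n and T = 230 and I = "\<lambda>j s'. \<exists>U. J j U \<and> dissolved s' cl rep U"], goal_cases)
  case (5 j s')
  let ?c = "Cond is_head (Seq set_a (Cond t add_group Skip)) Skip"
  have nwr: "nwr ?c = {''a'', ''dis'', ''P'', ''Q''}" "rwr ?c = {}" by (auto simp: set_a_def add_group_def)
  note same' = 5(2)[unfolded nwr]
  from 5(4) obtain U where U: "J j U" "dissolved s' cl rep U" by blast
  have L': "level_ctx s' cl rep" by (rule level_ctx_same[OF L same']) (simp_all add: ctx_names_def)
  then have rep: "fst s' ''rep'' j = rep j" and FP: "fst s' ''FP'' (fst s' ''o'' 0 + j) = cl j"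
    and G: "groups {..<n} cl rep" and ga: "group_arrays s' {..<n} rep"
    using 5(1) by (simp_all add: level_ctx_def)
  have head: "bval s' is_head \<longleftrightarrow> j \<in> heads {..<n} rep" using rep 5(1,3) by (auto simp: heads_def)
  define s1 where "s1 = nwrite s' ''a'' 0 (cl j + cl j)"
  have s1: "result set_a s' = s1" using FP 5(3) by (simp add: set_a_def s1_def)
  have "same {''a''} {} s' s1" by (simp add: s1_def same_def)
  then have L1: "level_ctx s1 cl rep" by (rule level_ctx_same[OF L']) (simp_all add: ctx_names_def)
  have D1: "dissolved s1 cl rep U" using U(2) by (simp add: dissolved_def counts_def s1_def)
  have st: "U \<subseteq> heads {..<n} rep" using U(2) by (simp add: dissolved_def)
  note step' = step[OF 5(1) st U(1)]
  show ?case
  proof (rule run_loopfree)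
    show "\<exists>U. J (Suc j) U \<and> dissolved (result ?c s') cl rep U"
    proof (cases "j \<in> heads {..<n} rep")
      case False
      then show ?thesis using step' U(2) head by auto
    next
      case True
      have t: "bval s1 t = R U j"
        by (rule test[OF True L1 D1]) (use 5(3) in \<open>simp_all add: s1_def\<close>)
      show ?thesis
      proof (cases "R U j")
        case False
        then have "result ?c s' = s1" using True head s1 t by simp
        then show ?thesis using False step' D1 by auto
      next
        case R: True
        then have jU: "j \<notin> U" "J (Suc j) (insert j U)" using step' True by auto
        define s2 where "s2 = result add_group s1"
        have res: "result ?c s' = s2" using True head s1 t R by (simp add: s2_def)
        let ?A = "cl j + cl j"
        have g: "fst s' ''fP'' (j + j) = b * colcount rep {..<n} j 0" "fst s' ''fP'' (Suc (j + j)) = b * colcount rep {..<n} j (Suc 0)"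
          "fst s' ''fQ'' (j + j) = r * colcount rep {..<n} j 0" "fst s' ''fQ'' (Suc (j + j)) = r * colcount rep {..<n} j (Suc 0)"
          using ga[unfolded group_arrays_def, rule_format, OF True, of 0] ga[unfolded group_arrays_def, rule_format, OF True, of 1]
          by simp_all
        have "counts s2 cl (members {..<n} rep (insert j U))"
          unfolding counts_def
        proof (intro allI impI)
          fix a' c :: nat assume c: "c < 2"
          note old = U(2)[unfolded dissolved_def counts_def, THEN conjunct2, THEN conjunct1, rule_format, OF c, of a']
          have eq: "a' + a' + c = ?A + c' \<longleftrightarrow> a' = cl j \<and> c = c'" if "c' < 2" for c'
            using key_inj[OF c that, of a' "cl j"] by auto
          have c01: "c = 0 \<or> c = 1" using c by auto
          show "fst s2 ''P'' (a' + a' + c) = b * colcount cl (members {..<n} rep (insert j U)) a' c \<and>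
            fst s2 ''Q'' (a' + a' + c) = r * colcount cl (members {..<n} rep (insert j U)) a' c"
            unfolding colcount_members_insert[OF G jU(1) True] s2_def add_group_def
            using old g eq[of 0] eq[of 1] c01 5(3)
            by (cases "a' = cl j") (auto simp: s1_def distrib_left)
        qed
        moreover have "fst s2 ''dis'' l = (if l \<in> insert j U then 1 else 0)" if "l \<in> heads {..<n} rep" for l
          using U(2) that 5(3) by (auto simp: s2_def add_group_def s1_def dissolved_def)
        ultimately have "dissolved s2 cl rep (insert j U)" using st True by (simp add: dissolved_def)
        then show ?thesis using jU(2) unfolding res by blast
      qed
    qed
  qed (use cost in \<open>simp_all add: set_a_def add_group_def\<close>)
next
  case 1
  show ?case by (simp add: set_a_def add_group_def)
next
  case (2 s')
  then show ?case using L by (simp add: same_def level_ctx_def ctx_def set_a_def add_group_def)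
next
  case 3
  show ?case using J0 D by blast
next
  case (4 j s' v)
  then show ?case by (simp add: dissolved_def counts_def)
next
  case 7
  show ?case by (rule n_le_N)
qed simp_all

lemma run_clear_dis:
  assumes L: "level_ctx s cl rep" and 0: "counts s cl {}"
  shows "run clear_dis s (30 * (N + 1)) (\<lambda>s'. dissolved s' cl rep {} \<and> same {''p'', ''dis''} {} s s')"
  unfolding clear_dis_def
proof (rule run_For_le[where B = n and T = 10 and I = "\<lambda>j s'. counts s' cl {} \<and> (\<forall>i<j. fst s' ''dis'' i = 0)"], goal_cases)
  case (5 j s')
  then show ?case by (intro run_loopfree) (auto simp: less_Suc_eq counts_def)
next
  case (2 s')
  then show ?case using L by (simp add: same_def level_ctx_def ctx_def)
next
  case (4 j s' v)
  then show ?case by (simp add: counts_def)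
next
  case (6 s')
  then show ?case by (simp add: dissolved_def heads_def members_def)
next
  case 7
  show ?case by (rule n_le_N)
qed (use 0 in simp_all)

lemma run_dissolve_bad:
  assumes L: "level_ctx s cl rep" and D: "dissolved s cl rep {}"
  shows "run (dissolve is_bad) s (250 * (N + 1)) (\<lambda>s'. dissolved s' cl rep (bad {..<n} rep))"
proof -
  let ?J = "\<lambda>j U. U = {l \<in> bad {..<n} rep. l < j}"
  have "run (dissolve is_bad) s (250 * (N + 1)) (\<lambda>s'. \<exists>U. ?J n U \<and> dissolved s' cl rep U)"
  proof (rule run_dissolve[OF L D, where J = ?J and R = "\<lambda>U l. cell_excess rep {..<n} l \<noteq> 0"], goal_cases)
    case (2 j U)
    show ?case
    proof (cases "j \<in> bad {..<n} rep")
      case True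
      then show ?thesis using 2 by (auto simp: bad_def less_Suc_eq)
    next
      case False
      then have "{l \<in> bad {..<n} rep. l < Suc j} = {l \<in> bad {..<n} rep. l < j}" by (auto simp: less_Suc_eq)
      then show ?thesis using 2 False by (auto simp: bad_def)
    qed
  next
    case (3 s' U j)
    then have ga: "group_arrays s' {..<n} rep" by (simp add: level_ctx_def)
    show ?case
      using ga[unfolded group_arrays_def, rule_format, OF 3(1), of 0] ga[unfolded group_arrays_def, rule_format, OF 3(1), of 1] 3(4)
      by (auto simp: is_bad_def cell_excess_def excess_def)
  qed (simp_all add: is_bad_def)
  then show ?thesis
  proof (rule run_mono)
    fix s' assume "\<exists>U. ?J n U \<and> dissolved s' cl rep U"
    moreover have "{l \<in> bad {..<n} rep. l < n} = bad {..<n} rep" by (auto simp: bad_def heads_def)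
    ultimately show "dissolved s' cl rep (bad {..<n} rep)" by simp
  qed simp
qed

text \<open>What a level needs from the dissolution: few points move, relative to those that waited,
  and in each cell the dissolved points are no more unbalanced than all points together.\<close>

definition relieved :: "(nat \<Rightarrow> nat) \<Rightarrow> (nat \<Rightarrow> nat) \<Rightarrow> nat set \<Rightarrow> bool" where
  "relieved cl rep U \<longleftrightarrow> bad {..<n} rep \<subseteq> U \<and> U \<subseteq> heads {..<n} rep \<and>
     card (members {..<n} rep U) \<le> (1 + (r + b) * b) * card (bad {..<n} rep) \<and>
     (\<forall>a. cell_excess cl (members {..<n} rep U) a \<le> cell_excess cl {..<n} a)"

lemma cell_excess_members_insert:
  assumes G: "groups {..<n} cl rep" and U: "l \<notin> U" "l \<in> heads {..<n} rep"
  shows "cell_excess cl (members {..<n} rep (insert l U)) (cl l) =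
     excess (colcount cl (members {..<n} rep U) (cl l) 0 + colcount rep {..<n} l 0)
       (colcount cl (members {..<n} rep U) (cl l) 1 + colcount rep {..<n} l 1)"
  unfolding cell_excess_def colcount_members_insert[OF G U] by simp

lemma run_dissolve_relieving:
  assumes L: "level_ctx s cl rep" and D: "dissolved s cl rep (bad {..<n} rep)"
  shows "run (dissolve is_relieving) s (250 * (N + 1)) (\<lambda>s'. \<exists>U. relieved cl rep U \<and> dissolved s' cl rep U)"
proof -
  let ?A = "{..<n}" and ?B = "bad {..<n} rep" and ?M = "members {..<n} rep"
  have G: "groups ?A cl rep" using L by (simp add: level_ctx_def)
  have finH: "finite (heads ?A rep)" by (simp add: heads_def)
  \<comment> \<open>Every group dissolved in this pass lowers the imbalance of the dissolved points
    by at least 1, so \<open>card U\<close> plus that imbalance never grows. As the waiting points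
    start with imbalance at most \<open>b\<close> each, at most \<open>b * card ?B\<close> groups
    are added.\<close>
  define K where "K = card ?B + imbalance cl ?B"
  let ?R = "\<lambda>U l. l \<notin> U \<and> cell_excess cl (?M (insert l U)) (cl l) < cell_excess cl (?M U) (cl l)"
  let ?J = "\<lambda>j U. ?B \<subseteq> U \<and> card U + imbalance cl (?M U) \<le> K \<and>
     (\<forall>l\<in>heads ?A rep - U. l < j \<longrightarrow> (\<forall>c<2. deficient cl (?M U) (cl l) c \<longrightarrow> saturated ?A rep l c))"
  have good: "cell_excess rep ?A l = 0" if "l \<in> heads ?A rep" "?B \<subseteq> U" "l \<notin> U" for l U
    using that by (auto simp: bad_def)
  have "run (dissolve is_relieving) s (250 * (N + 1)) (\<lambda>s'. \<exists>U. ?J n U \<and> dissolved s' cl rep U)"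
  proof (rule run_dissolve[OF L D, where J = ?J and R = ?R], goal_cases)
    case 1
    show ?case by (simp add: K_def members_bad[OF G])
  next
    case (2 j U)
    show ?case
    proof (cases "j \<in> heads ?A rep \<and> ?R U j")
      case True
      then have j: "j \<in> heads ?A rep" "j \<notin> U"
        and less: "cell_excess cl (?M (insert j U)) (cl j) < cell_excess cl (?M U) (cl j)" by auto
      have fj: "excess (colcount rep ?A j 0) (colcount rep ?A j 1) = 0"
        using good[OF j(1) _ j(2)] 2(3) by (simp add: cell_excess_def)
      have im: "imbalance cl (?M (insert j U)) + cell_excess cl (?M U) (cl j) = imbalance cl (?M U) + cell_excess cl (?M (insert j U)) (cl j)"
        unfolding members_insert using j groupsD(2)[OF G]
        by (intro imbalance_union_one_cell) (auto simp: members_def)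
      have "card (insert j U) = Suc (card U)" using j(2) finite_subset[OF 2(2) finH] by simp
      then have "card (insert j U) + imbalance cl (?M (insert j U)) \<le> K" using im less 2(3) by simp
      moreover have "saturated ?A rep l c"
        if l: "l \<in> heads ?A rep - insert j U" "l < Suc j" "c < 2" "deficient cl (?M (insert j U)) (cl l) c" for l c
      proof -
        \<comment> \<open>A balanced group cannot make its cell newly deficient in a color. Groups
          already passed over stay rightly passed over, and a single pass suffices.\<close>
        have "deficient cl (?M U) (cl l) c"
        proof (cases "cl l = cl j")
          case False
          then have "\<not> cl j = cl l" by simp
          then show ?thesis using l(4) unfolding deficient_def colcount_members_insert[OF G j(2,1)] by simp
        next
          case True
          have "b * colcount rep ?A j c \<le> r * colcount rep ?A j (1 - c)"
            using fj l(3) by (auto simp: excess_0_iff less_2_cases_iff)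
          then show ?thesis using l(4) True unfolding deficient_def colcount_members_insert[OF G j(2,1)]
            by (auto intro: deficient_union)
        qed
        moreover have "l < j" using l(1,2) by auto
        ultimately show ?thesis using 2(3) l(1,3) by blast
      qed
      ultimately have "?J (Suc j) (insert j U)" using 2(3) by blast
      then show ?thesis using True by auto
    next
      case False
      have "saturated ?A rep l c"
        if l: "l \<in> heads ?A rep - U" "l < Suc j" "c < 2" "deficient cl (?M U) (cl l) c" for l c
      proof (cases "l = j")
        case False
        then show ?thesis using 2(3) l by auto
      next
        case True
        then have j: "j \<in> heads ?A rep" "j \<notin> U" using l by auto
        then have "\<not> cell_excess cl (?M (insert j U)) (cl j) < cell_excess cl (?M U) (cl j)" using False by simp
        then have nl: "\<not> excess (colcount cl (?M U) (cl j) 0 + colcount rep ?A j 0) (colcount cl (?M U) (cl j) 1 + colcount rep ?A j 1)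
            < excess (colcount cl (?M U) (cl j) 0) (colcount cl (?M U) (cl j) 1)"
          unfolding cell_excess_members_insert[OF G j(2,1)] by (simp add: cell_excess_def)
        have fj: "excess (colcount rep ?A j 0) (colcount rep ?A j 1) = 0"
          using good[OF j(1) _ j(2)] 2(3) by (simp add: cell_excess_def)
        have d: "r * colcount cl (?M U) (cl j) (1 - c) < b * colcount cl (?M U) (cl j) c"
          using l(4) True by (simp add: deficient_def)
        have "c = 0 \<or> c = 1" using l(3) by auto
        then have "r * colcount rep ?A j (1 - c) \<le> b * colcount rep ?A j c"
        proof
          assume "c = 0"
          then show ?thesis using excess_not_relieved[OF nl _ fj] d by simp
        next
          assume "c = 1"
          then show ?thesis
            using excess_not_relieved[of "colcount cl (?M U) (cl j) 1" "colcount rep ?A j 1" "colcount cl (?M U) (cl j) 0" "colcount rep ?A j 0"]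
              nl fj d by (simp add: excess_commute)
        qed
        then show ?thesis using True by (simp add: saturated_def)
      qed
      then have "?J (Suc j) U" using 2(3) by blast
      then show ?thesis using False by auto
    qed
  next
    case (3 s' U j)
    then have ga: "group_arrays s' ?A rep" by (simp add: level_ctx_def)
    note g0 = ga[unfolded group_arrays_def, rule_format, OF 3(1), of 0]
    note g1 = ga[unfolded group_arrays_def, rule_format, OF 3(1), of 1]
    note c = 3(3)[unfolded dissolved_def counts_def, THEN conjunct2, THEN conjunct1, rule_format, of _ "cl j"]
    have dis: "fst s' ''dis'' j = (if j \<in> U then 1 else 0)" using 3(1,3) by (simp add: dissolved_def)
    show ?case
    proof (cases "j \<in> U")
      case True
      then show ?thesis using dis 3(4) by (simp add: is_relieving_def)
    next
      case False
      then show ?thesis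
        unfolding cell_excess_members_insert[OF G False 3(1)]
        using dis g0 g1 c[of 0] c[of 1] 3(4,5)
        by (simp add: is_relieving_def cell_excess_def excess_def distrib_left)
    qed
  qed (simp_all add: is_relieving_def)
  then show ?thesis
  proof (rule run_mono)
    fix s' assume "\<exists>U. ?J n U \<and> dissolved s' cl rep U"
    then obtain U where U: "?J n U" "dissolved s' cl rep U" by blast
    then have UH: "U \<subseteq> heads ?A rep" by (simp add: dissolved_def)
    have BH: "?B \<subseteq> heads ?A rep" by (auto simp: bad_def)
    have finB: "finite ?B" using finite_subset[OF BH finH] .
    have "card (U - ?B) = card U - card ?B" using U(1) by (intro card_Diff_subset[OF finB]) blast
    also have "\<dots> \<le> imbalance cl ?B"
    proof -
      have "card U + imbalance cl (?M U) \<le> K" using U(1) by blast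
      then show ?thesis unfolding K_def by linarith
    qed
    also have "\<dots> \<le> b * card ?B" by (rule imbalance_le[OF finB])
    finally have "(r + b) * card (U - ?B) \<le> (r + b) * (b * card ?B)" by (rule mult_le_mono2)
    then have "card (?M U) \<le> card ?B + (r + b) * (b * card ?B)"
      using card_members[OF G finite_lessThan _ UH] U(1) by (meson add_left_mono order_trans)
    then have "card (?M U) \<le> (1 + (r + b) * b) * card ?B" by (simp add: algebra_simps)
    moreover have "cell_excess cl (?M U) a \<le> cell_excess cl ?A a" for a
      using U(1) by (intro excess_dissolved[OF G finite_lessThan UH]) (auto simp: heads_def)
    ultimately have "relieved cl rep U" using U(1) UH by (simp add: relieved_def)
    then show "\<exists>U. relieved cl rep U \<and> dissolved s' cl rep U" using U(2) by blast
  qed simp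
qed

subsection \<open>Stacks of dissolved points\<close>

definition stacks :: "store \<Rightarrow> (nat \<Rightarrow> nat) \<Rightarrow> nat set \<Rightarrow> bool" where
  "stacks s cl E \<longleftrightarrow> (\<forall>a c. c < 2 \<longrightarrow> (\<exists>xs. distinct xs \<and> set xs = {i \<in> E. cl i = a \<and> col i = c} \<and>
     chain (fst s ''nx'') (fst s ''hd'' (a + a + c)) xs))"

lemma run_push_points:
  assumes L: "level_ctx s cl rep" and D: "dissolved s cl rep U" and hd: "\<And>k. fst s ''hd'' k = 0"
  shows "run push_points s (100 * (N + 1)) (\<lambda>s'. stacks s' cl (members {..<n} rep U) \<and> same {''p'', ''a'', ''nx'', ''hd''} {} s s')"
  unfolding push_points_def
proof (rule run_For_le[where B = n and T = 80 and I = "\<lambda>j s'. stacks s' cl (members {..<j} rep U)"], goal_cases)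
  case (5 j s')
  let ?c = "Cond (NLess (NConst 0) (NGet ''dis'' (NGet ''rep'' (var ''p''))))
     (seqs [set_a, NSet ''nx'' (var ''p'') (NGet ''hd'' key_exp), NSet ''hd'' key_exp (var ''p'' \<oplus> NConst 1)]) Skip"
  have nwr: "nwr ?c = {''a'', ''nx'', ''hd''}" "rwr ?c = {}" by (auto simp: set_a_def)
  note same' = 5(2)[unfolded nwr]
  have L': "level_ctx s' cl rep" by (rule level_ctx_same[OF L same']) (simp_all add: ctx_names_def)
  then have G: "groups {..<n} cl rep" by (simp add: level_ctx_def)
  have st: "fst s' ''rep'' j = rep j" "fst s' ''FP'' (fst s' ''o'' 0 + j) = cl j" "fst s' ''color'' j = col j"
    using L' 5(1) by (simp_all add: level_ctx_def ctx_def)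
  have rj: "rep j \<in> heads {..<n} rep" using groupsD(1)[OF G] 5(1) by simp
  have dis: "fst s' ''dis'' (rep j) = (if rep j \<in> U then 1 else 0)"
    using D rj sameD(1)[OF same', of "''dis''"] by (simp add: dissolved_def)
  show ?case
  proof (rule run_loopfree)
    show "stacks (result ?c s') cl (members {..<Suc j} rep U)"
    proof (cases "rep j \<in> U")
      case False
      then have "members {..<Suc j} rep U = members {..<j} rep U" by (auto simp: members_def less_Suc_eq)
      then show ?thesis using 5(3,4) False st dis by simp
    next
      case True
      then have M: "members {..<Suc j} rep U = insert j (members {..<j} rep U)" by (auto simp: members_def less_Suc_eq)
      have jM: "j \<notin> members {..<j} rep U" by (simp add: members_def)
      let ?k = "cl j + cl j + col j"
      define s2 where "s2 = nwrite (nwrite (nwrite s' ''a'' 0 (cl j + cl j)) ''nx'' j (fst s' ''hd'' ?k)) ''hd'' ?k (Suc j)"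
      have res: "result ?c s' = s2" using True st dis 5(3) by (simp add: set_a_def s2_def)
      show ?thesis
        unfolding res M stacks_def
      proof (intro allI impI)
        fix a c :: nat assume c: "c < 2"
        obtain xs where xs: "distinct xs" "set xs = {i \<in> members {..<j} rep U. cl i = a \<and> col i = c}"
            "chain (fst s' ''nx'') (fst s' ''hd'' (a + a + c)) xs"
          using 5(4) c unfolding stacks_def by blast
        have j: "j \<notin> set xs" using xs(2) jM by simp
        show "\<exists>xs. distinct xs \<and> set xs = {i \<in> insert j (members {..<j} rep U). cl i = a \<and> col i = c} \<and>
            chain (fst s2 ''nx'') (fst s2 ''hd'' (a + a + c)) xs"
        proof (cases "a = cl j \<and> c = col j")
          case True
          then show ?thesis using xs j
            by (intro exI[of _ "j # xs"]) (auto simp: s2_def chain_upd)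
        next
          case False
          then have "a + a + c \<noteq> ?k" using key_inj[OF c col_less] by blast
          then show ?thesis using xs j False
            by (intro exI[of _ xs]) (auto simp: s2_def chain_upd)
        qed
      qed
    qed
  qed (simp_all add: set_a_def)
next
  case 1
  show ?case by (simp add: set_a_def)
next
  case (2 s')
  then show ?case using L by (simp add: same_def level_ctx_def ctx_def set_a_def)
next
  case 3
  show ?case using hd unfolding stacks_def by (intro allI impI exI[of _ "[]"]) (simp add: members_def)
next
  case (4 j s' v)
  then show ?case by (simp add: stacks_def)
next
  case (6 s')
  then show ?case by (auto simp: same_def set_a_def)
next
  case 7
  show ?case by (rule n_le_N)
qed simp_all

end

subsection \<open>Cutting the dissolved points of a cell into fairlets\<close>

definition choose_major :: com where
  "choose_major = Cond (NLess (P_exp 0) (P_exp 1))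
       (Seq (''g'' ::= var ''a'' \<oplus> NConst 1) (''h'' ::= var ''a''))
       (Seq (''g'' ::= var ''a'') (''h'' ::= var ''a'' \<oplus> NConst 1))"

text \<open>The representative is the top of the majority stack, which is always popped because
  \<open>cut_major\<close> is at least 1. Its counters are reset since they may stem from a
  dissolved group; \<open>md\<close> records whether the block is to be saturated.\<close>

definition emit_init :: com where
  "emit_init = Seq choose_major (seqs [''l'' ::= NGet ''hd'' (var ''g'') \<ominus> NConst 1,
     NSet ''fP'' (var ''l'' \<oplus> var ''l'') (NConst 0), NSet ''fP'' (var ''l'' \<oplus> var ''l'' \<oplus> NConst 1) (NConst 0),
     NSet ''fQ'' (var ''l'' \<oplus> var ''l'') (NConst 0), NSet ''fQ'' (var ''l'' \<oplus> var ''l'' \<oplus> NConst 1) (NConst 0),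
     Cond (Conj (NLess (NConst 0) (NGet ''P'' (var ''h'')))
         (NLess (NGet ''Q'' (var ''h'') \<oplus> var ''b'') (NGet ''P'' (var ''g'') \<oplus> var ''r'')))
       (''md'' ::= NConst 1) (''md'' ::= NConst 0)])"

definition minor_init :: com where
  "minor_init = seqs [''key'' ::= var ''h'', ''fk'' ::= var ''l'' \<oplus> var ''l'' \<oplus> (var ''h'' \<ominus> var ''a''),
     ''w'' ::= NConst 0, ''inc'' ::= NConst 1,
     Cond (NLess (var ''md'') (NConst 1)) (''cap'' ::= NConst 1) (''cap'' ::= var ''b'')]"

text \<open>With increment \<open>b\<close>, the capacity \<open>b\<close> admits one point and the
  capacity \<open>r * v\<close> admits \<open>r * v div b\<close>. The latter is the entry of
  \<open>fQ\<close> for the \<open>v\<close> minority points just popped, which is why these come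
  first.\<close>

definition major_init :: com where
  "major_init = seqs [''key'' ::= var ''g'', ''fk'' ::= var ''l'' \<oplus> var ''l'' \<oplus> (var ''g'' \<ominus> var ''a''),
     ''w'' ::= NConst 0, ''inc'' ::= var ''b'',
     Cond (NLess (var ''md'') (NConst 1)) (''cap'' ::= var ''b'')
       (''cap'' ::= NGet ''fQ'' (var ''l'' \<oplus> var ''l'' \<oplus> (var ''h'' \<ominus> var ''a'')))]"

definition emit :: com where
  "emit = Seq emit_init (Seq (Seq minor_init pop_all) (Seq major_init pop_all))"

lemma nwr_emit: "nwr emit = {''g'', ''h'', ''l'', ''fP'', ''fQ'', ''md'', ''key'', ''fk'', ''w'', ''inc'', ''cap'', ''x'', ''hd'', ''rep'', ''P'', ''Q''}"
  "rwr emit = {}"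
  by (auto simp: emit_def emit_init_def choose_major_def minor_init_def major_init_def nwr_pop_all)

context grid
begin

text \<open>The groups formed in a level never leave more single points in a cell than its surplus.\<close>

definition pending_surplus :: "nat set \<Rightarrow> (nat \<Rightarrow> nat) \<Rightarrow> (nat \<Rightarrow> nat) \<Rightarrow> nat set \<Rightarrow> nat \<Rightarrow> nat" where
  "pending_surplus A cl rep E a = card {l \<in> bad A rep. cl l = a} + surplus (colcount cl E a 0) (colcount cl E a 1)"

text \<open>The witness consists of the top \<open>cut_major x y\<close> points of the majority
  stack and the top \<open>cut_minor x y\<close> of the minority stack. The time is linear in
  \<open>card F\<close>, so all calls on a level are paid by the points they cut off.\<close>

lemma run_emit:
  assumes ctx: "ctx s" and a: "fst s ''a'' 0 = a + a" and E: "E \<subseteq> {..<n}"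
    and cnt: "counts s cl E" and stk: "stacks s cl E"
    and A: "A = {..<n} - E" and G: "groups A cl (fst s ''rep'')" and ga: "group_arrays s A (fst s ''rep'')"
    and ne: "0 < colcount cl E a 0 + colcount cl E a 1"
  shows "\<exists>F. F \<subseteq> E \<and> F \<noteq> {} \<and> run emit s (120 * card F + 410) (\<lambda>s'.
      counts s' cl (E - F) \<and> stacks s' cl (E - F) \<and>
      groups (A \<union> F) cl (fst s' ''rep'') \<and> group_arrays s' (A \<union> F) (fst s' ''rep'') \<and>
      (\<forall>i. i \<notin> F \<longrightarrow> fst s' ''rep'' i = fst s ''rep'' i) \<and>
      (\<forall>a'. pending_surplus (A \<union> F) cl (fst s' ''rep'') (E - F) a' \<le> pending_surplus A cl (fst s ''rep'') E a') \<and>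
      same (nwr emit) {} s s')"
proof -
  let ?C = "colcount cl E a"
  define cg where "cg = (if ?C 0 < ?C 1 then 1 else 0 :: nat)"
  define ch where "ch = 1 - cg"
  have c2: "cg < 2" "ch < 2" and cne: "cg \<noteq> ch" and cases01: "cg = 0 \<and> ch = 1 \<or> cg = 1 \<and> ch = 0"
    by (auto simp: cg_def ch_def)
  define x where "x = ?C cg"
  define y where "y = ?C ch"
  have xy: "y \<le> x" "1 \<le> x" using ne by (auto simp: x_def y_def cg_def ch_def)
  define kg where "kg = a + a + cg"
  define kh where "kh = a + a + ch"
  have kgh: "kg \<noteq> kh" using cne by (simp add: kg_def kh_def)
  obtain xs where xs: "distinct xs" "set xs = {i \<in> E. cl i = a \<and> col i = cg}" "chain (fst s ''nx'') (fst s ''hd'' kg) xs"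
    using stk c2(1) unfolding stacks_def kg_def by blast
  obtain ys where ys: "distinct ys" "set ys = {i \<in> E. cl i = a \<and> col i = ch}" "chain (fst s ''nx'') (fst s ''hd'' kh) ys"
    using stk c2(2) unfolding stacks_def kh_def by blast
  have len: "length xs = x" "length ys = y"
    using distinct_card[OF xs(1)] distinct_card[OF ys(1)] xs(2) ys(2) by (simp_all add: x_def y_def colcount_def)
  obtain l xs' where l: "xs = l # xs'" using len(1) xy(2) by (cases xs) auto
  define u where "u = cut_major x y"
  define v where "v = cut_minor x y"
  note bounds = cut_bounds[OF xy, folded u_def v_def]
  define F where "F = set (take u xs) \<union> set (take v ys)"
  have lF: "l \<in> F" using bounds(1) l by (cases u) (auto simp: F_def)
  have FE: "F \<subseteq> E" using xs(2) ys(2) by (auto simp: F_def dest: in_set_takeD)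
  have finE: "finite E" using E finite_subset by blast
  have finF: "finite F" using FE finE finite_subset by blast
  have clF: "cl i = a" if "i \<in> F" for i using that xs(2) ys(2) by (auto simp: F_def dest: in_set_takeD)
  have colF: "{i \<in> F. col i = cg} = set (take u xs)" "{i \<in> F. col i = ch} = set (take v ys)"
    using xs(2) ys(2) cne by (auto simp: F_def dest: in_set_takeD)
  have cardF: "card {i \<in> F. col i = cg} = u" "card {i \<in> F. col i = ch} = v"
    unfolding colF using distinct_card[OF distinct_take[OF xs(1)]] distinct_card[OF distinct_take[OF ys(1)]] len bounds
    by simp_all
  have cardF': "card F = u + v"
  proof -
    have "set (take u xs) \<inter> set (take v ys) = {}" using cne unfolding colF[symmetric] by auto
    then show ?thesis unfolding F_def using cardF by (subst card_Un_disjoint) (auto simp: colF)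
  qed
  have AF: "A \<inter> F = {}" using FE A by auto
  have finA: "finite A" using A by simp
  have rb: "fst s ''r'' 0 = r" "fst s ''b'' 0 = b" using ctx by (simp_all add: ctx_def)
  have PQ: "fst s ''P'' (a + a + c) = b * ?C c" "fst s ''Q'' (a + a + c) = r * ?C c" if "c < 2" for c
    using cnt that unfolding counts_def by auto
  define md where "md = (if y = 0 \<or> b * x + r \<le> r * y + b then 0 else 1 :: nat)"
  have P01: "fst s ''P'' (a + a) < fst s ''P'' (Suc (a + a)) \<longleftrightarrow> ?C 0 < ?C 1"
    using PQ(1)[of 0] PQ(1)[of 1] b_pos by simp
  have hdg: "fst s ''hd'' kg = Suc l" using xs(3) l by simp
  let ?W1 = "{''g'', ''h'', ''l'', ''fP'', ''fQ'', ''md''}"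
  have "run emit_init s 200 (\<lambda>s'. fst s' ''g'' 0 = kg \<and> fst s' ''h'' 0 = kh \<and> fst s' ''l'' 0 = l \<and> fst s' ''md'' 0 = md \<and>
      (\<forall>c<2. fst s' ''fP'' (l + l + c) = 0 \<and> fst s' ''fQ'' (l + l + c) = 0) \<and>
      (\<forall>j. (\<forall>c<2. j \<noteq> l + l + c) \<longrightarrow> fst s' ''fP'' j = fst s ''fP'' j \<and> fst s' ''fQ'' j = fst s ''fQ'' j) \<and> same ?W1 {} s s')"
  proof (rule run_loopfree)
    define s1 where "s1 = nwrite (nwrite s ''g'' 0 kg) ''h'' 0 kh"
    define s2 where "s2 = nwrite s1 ''l'' 0 l"
    define s3 where "s3 = nwrite (nwrite (nwrite (nwrite s2 ''fP'' (l + l) 0) ''fP'' (l + l + 1) 0) ''fQ'' (l + l) 0) ''fQ'' (l + l + 1) 0"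
    have PQgh: "fst s ''P'' kg = b * x" "fst s ''P'' kh = b * y" "fst s ''Q'' kh = r * y"
      using PQ[OF c2(1)] PQ[OF c2(2)] by (simp_all add: kg_def kh_def x_def y_def)
    have i1: "result choose_major s = s1"
      using P01 a by (simp add: choose_major_def s1_def kg_def kh_def cg_def ch_def)
    have res: "result emit_init s = nwrite s3 ''md'' 0 md"
      unfolding emit_init_def result.simps(4) i1
      using hdg PQgh rb b_pos by (simp add: s1_def s2_def s3_def md_def not_le)
    have two: "(\<forall>c<2. Q c) \<longleftrightarrow> Q 0 \<and> Q (Suc 0)" for Q :: "nat \<Rightarrow> bool"
      by (auto simp: less_2_cases_iff)
    show "fst (result emit_init s) ''g'' 0 = kg \<and> fst (result emit_init s) ''h'' 0 = kh \<and> fst (result emit_init s) ''l'' 0 = l \<and>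
      fst (result emit_init s) ''md'' 0 = md \<and>
      (\<forall>c<2. fst (result emit_init s) ''fP'' (l + l + c) = 0 \<and> fst (result emit_init s) ''fQ'' (l + l + c) = 0) \<and>
      (\<forall>j. (\<forall>c<2. j \<noteq> l + l + c) \<longrightarrow> fst (result emit_init s) ''fP'' j = fst s ''fP'' j \<and> fst (result emit_init s) ''fQ'' j = fst s ''fQ'' j) \<and>
      same ?W1 {} s (result emit_init s)"
      unfolding res two by (simp add: s1_def s2_def s3_def same_def)
  qed (simp_all add: emit_init_def choose_major_def)
  then obtain t1 s1 where 1: "exec emit_init s t1 s1" "t1 \<le> 200" "fst s1 ''g'' 0 = kg" "fst s1 ''h'' 0 = kh" "fst s1 ''l'' 0 = l"
      "fst s1 ''md'' 0 = md" "\<And>c. c < 2 \<Longrightarrow> fst s1 ''fP'' (l + l + c) = 0 \<and> fst s1 ''fQ'' (l + l + c) = 0"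
      "\<And>j. \<forall>c<2. j \<noteq> l + l + c \<Longrightarrow> fst s1 ''fP'' j = fst s ''fP'' j \<and> fst s1 ''fQ'' j = fst s ''fQ'' j" "same ?W1 {} s s1"
    by (elim runE) blast
  note s1 = sameD(1)[OF 1(9)]
  let ?W2 = "{''key'', ''fk'', ''w'', ''inc'', ''cap''}"
  have "run minor_init s1 50 (\<lambda>s'. fst s' ''key'' 0 = kh \<and> fst s' ''fk'' 0 = l + l + ch \<and> fst s' ''w'' 0 = 0 \<and> fst s' ''inc'' 0 = 1 \<and>
      fst s' ''cap'' 0 = (if md = 0 then 1 else b) \<and> same ?W2 {} s1 s')"
    using 1(3-6) a rb by (intro run_loopfree) (auto simp: minor_init_def s1 kh_def same_def)
  then obtain t2 s2 where 2: "exec minor_init s1 t2 s2" "t2 \<le> 50" "fst s2 ''key'' 0 = kh" "fst s2 ''fk'' 0 = l + l + ch"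
      "fst s2 ''w'' 0 = 0" "fst s2 ''inc'' 0 = 1" "fst s2 ''cap'' 0 = (if md = 0 then 1 else b)" "same ?W2 {} s1 s2"
    by (elim runE) blast
  note s2 = sameD(1)[OF 2(8)]
  have v_min: "v = min ((if md = 0 then 1 else b) div 1) (length ys)"
    by (auto simp: v_def cut_minor_def md_def len)
  let ?W3 = "{''x'', ''hd'', ''rep'', ''P'', ''Q'', ''fP'', ''fQ'', ''w''}"
  have rb2: "fst s2 ''r'' 0 = r" "fst s2 ''b'' 0 = b" "fst s2 ''l'' 0 = l" using rb 1(5) by (simp_all add: s1 s2)
  have ch2: "chain (fst s2 ''nx'') (fst s2 ''hd'' kh) ys" using ys(3) by (simp add: s1 s2)
  have PQ2: "fst s2 ''P'' kh = b * length ys" "fst s2 ''Q'' kh = r * length ys"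
    using PQ[OF c2(2)] by (simp_all add: s1 s2 kh_def len y_def)
  obtain t3 s3 where 3: "exec pop_all s2 t3 s3" "t3 \<le> 120 * v + 50"
     "chain (fst s2 ''nx'') (fst s3 ''hd'' kh) (drop v ys)"
     "\<And>i. fst s3 ''rep'' i = (if i \<in> set (take v ys) then l else fst s2 ''rep'' i)"
     "\<And>j. j \<noteq> kh \<Longrightarrow> fst s3 ''hd'' j = fst s2 ''hd'' j \<and> fst s3 ''P'' j = fst s2 ''P'' j \<and> fst s3 ''Q'' j = fst s2 ''Q'' j"
     "fst s3 ''P'' kh = b * (length ys - v)" "fst s3 ''Q'' kh = r * (length ys - v)"
     "\<And>j. j \<noteq> l + l + ch \<Longrightarrow> fst s3 ''fP'' j = fst s2 ''fP'' j \<and> fst s3 ''fQ'' j = fst s2 ''fQ'' j"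
     "fst s3 ''fP'' (l + l + ch) = fst s2 ''fP'' (l + l + ch) + b * v" "fst s3 ''fQ'' (l + l + ch) = fst s2 ''fQ'' (l + l + ch) + r * v"
     "same ?W3 {} s2 s3"
    by (rule runE[OF run_pop_all[OF rb2(1,2) 2(3) rb2(3) 2(4,6,7,5) zero_less_one ch2 PQ2 v_min]]) blast
  note s3 = sameD(1)[OF 3(11)]
  have fQ3: "fst s3 ''fQ'' (l + l + ch) = r * v"
    using 3(10) 1(7)[OF c2(2)] by (simp add: s2)
  have "run major_init s3 60 (\<lambda>s'. fst s' ''key'' 0 = kg \<and> fst s' ''fk'' 0 = l + l + cg \<and> fst s' ''w'' 0 = 0 \<and> fst s' ''inc'' 0 = b \<and>
      fst s' ''cap'' 0 = (if md = 0 then b else r * v) \<and> same ?W2 {} s3 s')"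
    using 1(3-6) a rb fQ3 by (intro run_loopfree) (auto simp: major_init_def s1 s2 s3 kh_def kg_def same_def)
  then obtain t4 s4 where 4: "exec major_init s3 t4 s4" "t4 \<le> 60" "fst s4 ''key'' 0 = kg" "fst s4 ''fk'' 0 = l + l + cg"
      "fst s4 ''w'' 0 = 0" "fst s4 ''inc'' 0 = b" "fst s4 ''cap'' 0 = (if md = 0 then b else r * v)" "same ?W2 {} s3 s4"
    by (elim runE) blast
  note s4 = sameD(1)[OF 4(8)]
  have u_min: "u = min ((if md = 0 then b else r * v) div b) (length xs)"
    using xy b_pos by (auto simp: u_def v_def cut_major_def cut_minor_def md_def len min.commute)
  have rb4: "fst s4 ''r'' 0 = r" "fst s4 ''b'' 0 = b" "fst s4 ''l'' 0 = l" using rb 1(5) by (simp_all add: s1 s2 s3 s4)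
  have hd4: "fst s4 ''hd'' j = fst s ''hd'' j" "fst s4 ''P'' j = fst s ''P'' j" "fst s4 ''Q'' j = fst s ''Q'' j" if "j \<noteq> kh" for j
    using 3(5)[OF that] by (simp_all add: s1 s2 s4)
  have ch4: "chain (fst s4 ''nx'') (fst s4 ''hd'' kg) xs" using xs(3) hd4[OF kgh] by (simp add: s1 s2 s3 s4)
  have PQ4: "fst s4 ''P'' kg = b * length xs" "fst s4 ''Q'' kg = r * length xs"
    using PQ[OF c2(1)] hd4[OF kgh] by (simp_all add: kg_def len x_def)
  have b0: "0 < b" using b_pos by simp
  obtain t5 s5 where 5: "exec pop_all s4 t5 s5" "t5 \<le> 120 * u + 50"
     "chain (fst s4 ''nx'') (fst s5 ''hd'' kg) (drop u xs)"
     "\<And>i. fst s5 ''rep'' i = (if i \<in> set (take u xs) then l else fst s4 ''rep'' i)"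
     "\<And>j. j \<noteq> kg \<Longrightarrow> fst s5 ''hd'' j = fst s4 ''hd'' j \<and> fst s5 ''P'' j = fst s4 ''P'' j \<and> fst s5 ''Q'' j = fst s4 ''Q'' j"
     "fst s5 ''P'' kg = b * (length xs - u)" "fst s5 ''Q'' kg = r * (length xs - u)"
     "\<And>j. j \<noteq> l + l + cg \<Longrightarrow> fst s5 ''fP'' j = fst s4 ''fP'' j \<and> fst s5 ''fQ'' j = fst s4 ''fQ'' j"
     "fst s5 ''fP'' (l + l + cg) = fst s4 ''fP'' (l + l + cg) + b * u" "fst s5 ''fQ'' (l + l + cg) = fst s4 ''fQ'' (l + l + cg) + r * u"
     "same ?W3 {} s4 s5"
    by (rule runE[OF run_pop_all[OF rb4(1,2) 4(3) rb4(3) 4(4,6,7,5) b0 ch4 PQ4 u_min]]) blast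
  note s5 = sameD(1)[OF 5(11)]
  have rep5: "fst s5 ''rep'' i = (if i \<in> F then l else fst s ''rep'' i)" for i
    using 3(4)[of i] 5(4)[of i] by (auto simp: F_def s1 s2 s4)
  have nx5: "fst s5 ''nx'' = fst s ''nx''" by (simp add: s1 s2 s3 s4 s5)
  have hdg5: "chain (fst s ''nx'') (fst s5 ''hd'' kg) (drop u xs)" using 5(3) by (simp add: s1 s2 s3 s4)
  have hdh5: "chain (fst s ''nx'') (fst s5 ''hd'' kh) (drop v ys)"
    using 3(3) 5(5)[OF kgh[symmetric]] by (simp add: s1 s2 s4)
  have oth5: "fst s5 ''hd'' j = fst s ''hd'' j" "fst s5 ''P'' j = fst s ''P'' j" "fst s5 ''Q'' j = fst s ''Q'' j"
    if "j \<noteq> kg" "j \<noteq> kh" for j using 5(5)[OF that(1)] hd4[OF that(2)] by simp_all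
  have P5: "fst s5 ''P'' kg = b * (x - u)" "fst s5 ''Q'' kg = r * (x - u)" "fst s5 ''P'' kh = b * (y - v)" "fst s5 ''Q'' kh = r * (y - v)"
    using 5(6,7) 5(5)[OF kgh[symmetric]] 3(6,7) by (simp_all add: len s4)
  have f5: "fst s5 ''fP'' (l + l + cg) = b * u" "fst s5 ''fQ'' (l + l + cg) = r * u"
    "fst s5 ''fP'' (l + l + ch) = b * v" "fst s5 ''fQ'' (l + l + ch) = r * v"
    using 5(8)[of "l + l + ch"] 5(9,10) 3(8)[of "l + l + cg"] 3(9) fQ3 cne 1(7)[OF c2(1)] 1(7)[OF c2(2)]
    by (simp_all add: s2 s4)
  have foth5: "fst s5 ''fP'' j = fst s ''fP'' j" "fst s5 ''fQ'' j = fst s ''fQ'' j" if "\<forall>c<2. j \<noteq> l + l + c" for j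
    using 5(8)[of j] 3(8)[of j] 1(8)[OF that] that c2 by (simp_all add: s2 s4)
  have drop: "set (drop u xs) = {i \<in> E - F. cl i = a \<and> col i = cg}" "set (drop v ys) = {i \<in> E - F. cl i = a \<and> col i = ch}"
  proof -
    have "set xs = set (take u xs) \<union> set (drop u xs)" "set (take u xs) \<inter> set (drop u xs) = {}"
      using xs(1) by (metis append_take_drop_id set_append, metis append_take_drop_id distinct_append xs(1))
    then show "set (drop u xs) = {i \<in> E - F. cl i = a \<and> col i = cg}" using xs(2) colF(1) by auto
    have "set ys = set (take v ys) \<union> set (drop v ys)" "set (take v ys) \<inter> set (drop v ys) = {}"
      using ys(1) by (metis append_take_drop_id set_append, metis append_take_drop_id distinct_append ys(1))
    then show "set (drop v ys) = {i \<in> E - F. cl i = a \<and> col i = ch}" using ys(2) colF(2) by auto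
  qed
  have cgch: "c = cg \<or> c = ch" if "c < 2" for c using that cases01 by auto
  have colE: "colcount cl (E - F) a cg = x - u" "colcount cl (E - F) a ch = y - v"
    using drop distinct_card[OF distinct_drop[OF xs(1)], of u] distinct_card[OF distinct_drop[OF ys(1)], of v] len
    by (simp_all add: colcount_def)
  have colE': "colcount cl (E - F) a' c = colcount cl E a' c" if "a' \<noteq> a" for a' c
    unfolding colcount_def using that clF by (intro arg_cong[where f = card]) auto
  have keyne: "a' + a' + c \<noteq> kg" "a' + a' + c \<noteq> kh" if "a' \<noteq> a" "c < 2" for a' c
    using key_inj[OF that(2) c2(1), of a' a] key_inj[OF that(2) c2(2), of a' a] that(1) by (auto simp: kg_def kh_def)
  have counts5: "counts s5 cl (E - F)"
    unfolding counts_def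
  proof (intro allI impI)
    fix a' c :: nat assume c: "c < 2"
    show "fst s5 ''P'' (a' + a' + c) = b * colcount cl (E - F) a' c \<and> fst s5 ''Q'' (a' + a' + c) = r * colcount cl (E - F) a' c"
    proof (cases "a' = a")
      case True
      then show ?thesis using P5 colE cgch[OF c] by (auto simp: kg_def kh_def)
    next
      case False
      then show ?thesis using oth5[OF keyne[OF False c]] colE'[OF False] cnt c by (simp add: counts_def)
    qed
  qed
  have stacks5: "stacks s5 cl (E - F)"
    unfolding stacks_def
  proof (intro allI impI)
    fix a' c :: nat assume c: "c < 2"
    show "\<exists>xs. distinct xs \<and> set xs = {i \<in> E - F. cl i = a' \<and> col i = c} \<and> chain (fst s5 ''nx'') (fst s5 ''hd'' (a' + a' + c)) xs"
    proof (cases "a' = a")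
      case True
      from cgch[OF c] show ?thesis
      proof
        assume "c = cg"
        then show ?thesis using True drop(1) hdg5 nx5 xs(1) by (intro exI[of _ "drop u xs"]) (simp add: kg_def)
      next
        assume "c = ch"
        then show ?thesis using True drop(2) hdh5 nx5 ys(1) by (intro exI[of _ "drop v ys"]) (simp add: kh_def)
      qed
    next
      case False
      have "{i \<in> E - F. cl i = a' \<and> col i = c} = {i \<in> E. cl i = a' \<and> col i = c}" using False clF by auto
      then show ?thesis using stk c oth5[OF keyne[OF False c]] nx5 unfolding stacks_def by simp
    qed
  qed
  let ?x0 = "card {i \<in> F. col i = 0}" and ?x1 = "card {i \<in> F. col i = 1}"
  have exF: "excess ?x0 ?x1 = excess u v" using cases01 cardF excess_commute by auto
  \<comment> \<open>A piece is unbalanced only if the minority color is exhausted, and then it is a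
    single point.\<close>
  have exF0: "excess u v = 0 \<or> (y = 0 \<and> u = 1 \<and> v = 0)"
    using cut_fair[OF xy(1)] by (cases "y = 0") (auto simp: u_def v_def cut_major_def cut_minor_def)
  have fairF: "excess ?x0 ?x1 = 0 \<or> F = {l}"
  proof (cases "excess u v = 0")
    case False
    then have "card F = 1" using exF0 cardF' by simp
    then show ?thesis using lF by (auto simp: card_1_singleton_iff)
  next
    case True
    then show ?thesis unfolding exF by (rule disjI1)
  qed
  have sizeF: "card F \<le> r + b" using bounds(4) cardF' by simp
  have rep5A: "fst s5 ''rep'' i = fst s ''rep'' i" if "i \<in> A" for i using rep5[of i] AF that by auto
  have rep5F: "fst s5 ''rep'' i = l" if "i \<in> F" for i using rep5[of i] that by simp
  note ext = groups_extend[OF G finA finF AF lF clF sizeF fairF, of "fst s5 ''rep''", OF _ rep5A rep5F]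
  have groups5: "groups (A \<union> F) cl (fst s5 ''rep'')" by (rule ext(1)) auto
  have heads5: "heads (A \<union> F) (fst s5 ''rep'') = insert l (heads A (fst s ''rep''))" by (rule ext(2)) auto
  have col5: "colcount (fst s5 ''rep'') (A \<union> F) h c = colcount (fst s ''rep'') A h c" if "h \<in> heads A (fst s ''rep'')" for h c
    by (rule ext(3)) (use that in auto)
  have coll5: "colcount (fst s5 ''rep'') (A \<union> F) l c = card {i \<in> F. col i = c}" for c by (rule ext(4)) auto
  have bad5: "bad (A \<union> F) (fst s5 ''rep'') = bad A (fst s ''rep'') \<union> (if excess ?x0 ?x1 = 0 then {} else {l})" by (rule ext(5)) auto
  have lA: "l \<notin> A" using AF lF by blast
  have ga5: "group_arrays s5 (A \<union> F) (fst s5 ''rep'')"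
    unfolding group_arrays_def heads5
  proof (intro ballI allI impI)
    fix h c assume h: "h \<in> insert l (heads A (fst s ''rep''))" and c: "c < (2::nat)"
    show "fst s5 ''fP'' (h + h + c) = b * colcount (fst s5 ''rep'') (A \<union> F) h c \<and> fst s5 ''fQ'' (h + h + c) = r * colcount (fst s5 ''rep'') (A \<union> F) h c"
    proof (cases "h = l")
      case True
      then show ?thesis using coll5 f5 cardF cgch[OF c] by auto
    next
      case False
      then have h': "h \<in> heads A (fst s ''rep'')" using h by simp
      have "\<forall>c'<2. h + h + c \<noteq> l + l + c'" using key_inj[OF c, of _ h l] False by blast
      then show ?thesis using foth5 col5[OF h'] ga h' c unfolding group_arrays_def by simp
    qed
  qed
  have sur: "pending_surplus (A \<union> F) cl (fst s5 ''rep'') (E - F) a' \<le> pending_surplus A cl (fst s ''rep'') E a'" for a'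
  proof (cases "a' = a")
    case False
    then have "{h \<in> bad (A \<union> F) (fst s5 ''rep''). cl h = a'} = {h \<in> bad A (fst s ''rep''). cl h = a'}"
      unfolding bad5 using clF[OF lF] by auto
    then show ?thesis unfolding pending_surplus_def colE'[OF False] by simp
  next
    case True
    have surE: "surplus (?C 0) (?C 1) = surplus x y" "surplus (colcount cl (E - F) a 0) (colcount cl (E - F) a 1) = surplus (x - u) (y - v)"
      using cases01 surplus_commute colE by (auto simp: x_def y_def)
    show ?thesis
    proof (cases "excess u v = 0")
      case True
      have "surplus (x - u) (y - v) \<le> surplus x y"
      proof (cases "y = 0")
        case True
        then show ?thesis by (simp add: surplus_def)
      next
        case False
        then show ?thesis using cut_surplus[OF xy(1)] by (simp add: u_def v_def)
      qed
      then show ?thesis using True unfolding pending_surplus_def bad5 exF \<open>a' = a\<close> surE by simp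
    next
      case False
      then have yuv: "y = 0" "u = 1" "v = 0" using exF0 by auto
      \<comment> \<open>The single point adds one waiting group while the surplus of the rest falls
        by one, so the sum does not grow.\<close>
      have "surplus x 0 = Suc (surplus (x - 1) 0)" using surplus_single[of "x - 1"] xy(2) by simp
      then have S: "Suc (surplus (x - u) (y - v)) \<le> surplus x y" using yuv by simp
      have "{h \<in> bad A (fst s ''rep'') \<union> {l}. cl h = a} = insert l {h \<in> bad A (fst s ''rep''). cl h = a}"
        using clF[OF lF] by auto
      moreover have "finite {h \<in> bad A (fst s ''rep''). cl h = a}" using finA by (simp add: bad_def heads_def)
      ultimately have "card {h \<in> bad A (fst s ''rep'') \<union> {l}. cl h = a} \<le> Suc (card {h \<in> bad A (fst s ''rep''). cl h = a})"
        by (simp add: card_insert_if)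
      then show ?thesis using False S unfolding pending_surplus_def bad5 exF \<open>a' = a\<close> surE by simp
    qed
  qed
  have ex: "exec emit s (t1 + ((t2 + t3) + (t4 + t5))) s5"
    unfolding emit_def 
    by (rule exec.Seq[OF 1(1) exec.Seq[OF exec.Seq[OF 2(1) 3(1)] exec.Seq[OF 4(1) 5(1)]]])
  have sm: "same (nwr emit) {} s s5" using exec_same[OF ex] by (simp add: nwr_emit)
  have "run emit s (120 * card F + 410) (\<lambda>s'.
      counts s' cl (E - F) \<and> stacks s' cl (E - F) \<and>
      groups (A \<union> F) cl (fst s' ''rep'') \<and> group_arrays s' (A \<union> F) (fst s' ''rep'') \<and>
      (\<forall>i. i \<notin> F \<longrightarrow> fst s' ''rep'' i = fst s ''rep'' i) \<and>
      (\<forall>a'. pending_surplus (A \<union> F) cl (fst s' ''rep'') (E - F) a' \<le> pending_surplus A cl (fst s ''rep'') E a') \<and>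
      same (nwr emit) {} s s')"
  proof (rule runI[OF ex])
    show "t1 + ((t2 + t3) + (t4 + t5)) \<le> 120 * card F + 410"
      using 1(2) 2(2) 3(2) 4(2) 5(2) cardF' by simp
  qed (use counts5 stacks5 groups5 ga5 rep5 sur sm in simp)
  then show ?thesis using FE lF by blast
qed

end

subsection \<open>One level of the hierarchy\<close>

definition cut_step :: com where
  "cut_step = Seq set_a (Cond (NLess (NConst 0) (P_exp 0 \<oplus> P_exp 1)) emit (incr ''p''))"

definition cut_all :: com where
  "cut_all = Seq (''p'' ::= NConst 0) (While (NLess (var ''p'') (var ''n'')) cut_step)"

definition fair_level :: com where
  "fair_level = Seq (''o'' ::= NGet ''ON'' (var ''m'')) (Seq clear_dis (Seq (dissolve is_bad)
     (Seq (dissolve is_relieving) (Seq push_points cut_all))))"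

lemma nwr_clear_push: "nwr clear_dis = {''p'', ''dis''}" "rwr clear_dis = {}"
  "nwr push_points = {''p'', ''a'', ''nx'', ''hd''}" "rwr push_points = {}"
  by (auto simp: clear_dis_def push_points_def set_a_def)

lemma nwr_cut_all: "nwr cut_all = {''p'', ''a''} \<union> nwr emit" "rwr cut_all = {}"
  by (auto simp: cut_all_def cut_step_def set_a_def nwr_emit(2))

lemma nwr_fair_level:
  "nwr fair_level = {''o'', ''p'', ''dis'', ''a'', ''P'', ''Q'', ''nx'', ''hd''} \<union> nwr emit" "rwr fair_level = {}"
  by (auto simp: fair_level_def nwr_clear_push nwr_dissolve nwr_cut_all nwr_emit(2))

context grid
begin

text \<open>\<open>E\<close> is the set of points still on the stacks and \<open>j\<close> the
  position of the scan. The last clause says that the cells of all points before \<open>j\<close>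
  are exhausted; at \<open>j = n\<close> it leaves \<open>E\<close> empty.\<close>

definition cutting :: "store \<Rightarrow> (nat \<Rightarrow> nat) \<Rightarrow> (nat \<Rightarrow> nat) \<Rightarrow> nat set \<Rightarrow> nat set \<times> nat \<Rightarrow> store \<Rightarrow> bool" where
  "cutting s cl rep D g s' \<longleftrightarrow> (case g of (E, j) \<Rightarrow>
     same (nwr cut_all) {} s s' \<and> fst s' ''p'' 0 = j \<and> j \<le> n \<and> E \<subseteq> D \<and> counts s' cl E \<and> stacks s' cl E \<and>
     groups ({..<n} - E) cl (fst s' ''rep'') \<and> group_arrays s' ({..<n} - E) (fst s' ''rep'') \<and>
     (\<forall>i\<in>{..<n} - D. fst s' ''rep'' i = rep i) \<and>
     (\<forall>a. pending_surplus ({..<n} - E) cl (fst s' ''rep'') E a \<le> surplus (colcount cl D a 0) (colcount cl D a 1)) \<and>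
     (\<forall>i\<in>E. \<forall>i'<j. cl i \<noteq> cl i'))"

lemma colcount_eq_0: "finite E \<Longrightarrow> colcount cl E a 0 + colcount cl E a 1 = 0 \<Longrightarrow> i \<in> E \<Longrightarrow> cl i \<noteq> a"
proof
  assume *: "finite E" "colcount cl E a 0 + colcount cl E a 1 = 0" "i \<in> E" "cl i = a"
  have "col i = 0 \<or> col i = 1" using col_less[of i] by auto
  then have "{i' \<in> E. cl i' = a \<and> col i' = 0} \<noteq> {} \<or> {i' \<in> E. cl i' = a \<and> col i' = 1} \<noteq> {}" using * by blast
  moreover have "card {i' \<in> E. cl i' = a \<and> col i' = 0} = 0" "card {i' \<in> E. cl i' = a \<and> col i' = 1} = 0"
    using *(2) unfolding colcount_def by linarith+
  ultimately show False using *(1) card_0_eq finite_Collect_conjI[OF disjI1, of "\<lambda>i. i \<in> E"] by auto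
qed

text \<open>Either the scan advances, paid by 60 units, or a nonempty fairlet leaves
  \<open>E\<close>, paid by 700 units per point.\<close>

lemma run_cut_step:
  assumes ctx: "ctx s" and FP: "\<And>i. i < n \<Longrightarrow> fst s ''FP'' (fst s ''o'' 0 + i) = cl i" and D: "D \<subseteq> {..<n}"
    and I: "cutting s cl rep D (E, j) s'" and j: "j < n"
  shows "\<exists>T E' j'. run cut_step s' T (cutting s cl rep D (E', j')) \<and> T + 700 * card E' + 60 * (n - j') + 10 \<le> 700 * card E + 60 * (n - j)"
proof -
  have sm: "same (nwr cut_all) {} s s'" and p: "fst s' ''p'' 0 = j" and E: "E \<subseteq> D" and cnt: "counts s' cl E" and stk: "stacks s' cl E"
    and G: "groups ({..<n} - E) cl (fst s' ''rep'')" and ga: "group_arrays s' ({..<n} - E) (fst s' ''rep'')"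
    and rep: "\<forall>i\<in>{..<n} - D. fst s' ''rep'' i = rep i"
    and sur: "\<And>a. pending_surplus ({..<n} - E) cl (fst s' ''rep'') E a \<le> surplus (colcount cl D a 0) (colcount cl D a 1)"
    and past: "\<And>i i'. i \<in> E \<Longrightarrow> i' < j \<Longrightarrow> cl i \<noteq> cl i'"
    using I unfolding cutting_def prod.case by blast+
  have En: "E \<subseteq> {..<n}" using E D by blast
  have finE: "finite E" using En finite_subset by blast
  have c': "ctx s'" by (rule ctx_same[OF ctx sm]) (simp add: nwr_cut_all nwr_emit ctx_names_def)
  have FP': "fst s' ''FP'' (fst s' ''o'' 0 + j) = cl j"
    using FP[OF j] sameD(1)[OF sm, of "''FP''"] sameD(1)[OF sm, of "''o''"] by (simp add: nwr_cut_all nwr_emit)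
  define s1 where "s1 = nwrite s' ''a'' 0 (cl j + cl j)"
  have "run set_a s' 15 (\<lambda>s''. s'' = s1)"
    using FP' p by (intro run_loopfree) (simp_all add: set_a_def s1_def)
  then obtain t1 where 1: "exec set_a s' t1 s1" "t1 \<le> 15" by (elim runE) blast
  have PQ: "fst s1 ''P'' (cl j + cl j + c) = b * colcount cl E (cl j) c" if "c < 2" for c
    using cnt that unfolding counts_def by (simp add: s1_def)
  have test: "bval s1 (NLess (NConst 0) (P_exp 0 \<oplus> P_exp 1)) \<longleftrightarrow> 0 < colcount cl E (cl j) 0 + colcount cl E (cl j) 1"
    using PQ[of 0] PQ[of 1] b_pos by (auto simp: s1_def)
  have sm1: "same (nwr cut_all) {} s s1" using sm by (simp add: same_def s1_def nwr_cut_all)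
  show ?thesis
  proof (cases "0 < colcount cl E (cl j) 0 + colcount cl E (cl j) 1")
    case False
    have "cl i \<noteq> cl i'" if "i \<in> E" "i' < Suc j" for i i'
    proof (cases "i' = j")
      case True
      then show ?thesis using colcount_eq_0[OF finE _ \<open>i \<in> E\<close>, of cl "cl j"] False by simp
    next
      case False
      then show ?thesis using past[OF that(1)] that(2) by simp
    qed
    then have "cutting s cl rep D (E, Suc j) (nwrite s1 ''p'' 0 (Suc j))"
      unfolding cutting_def prod.case
    proof (intro conjI)
      show "same (nwr cut_all) {} s (nwrite s1 ''p'' 0 (Suc j))" using sm1 by (simp add: same_def nwr_cut_all)
    qed (use j E cnt stk G ga rep sur in \<open>simp_all add: s1_def counts_def stacks_def group_arrays_def\<close>)
    moreover have "fst s1 ''p'' 0 = j" using p by (simp add: s1_def)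
    ultimately have "run (incr ''p'') s1 7 (cutting s cl rep D (E, Suc j))"
      by (intro run_loopfree) simp_all
    then have "run (Cond (NLess (NConst 0) (P_exp 0 \<oplus> P_exp 1)) emit (incr ''p'')) s1 30 (cutting s cl rep D (E, Suc j))"
      by (intro run_Cond[where T = 7]) (use False test in auto)
    then obtain t2 s2 where 2: "exec (Cond (NLess (NConst 0) (P_exp 0 \<oplus> P_exp 1)) emit (incr ''p'')) s1 t2 s2" "t2 \<le> 30"
        "cutting s cl rep D (E, Suc j) s2" by (elim runE) blast
    have "run cut_step s' 45 (cutting s cl rep D (E, Suc j))"
      unfolding cut_step_def by (rule runI[OF exec.Seq[OF 1(1) 2(1)]]) (use 1(2) 2(2,3) in auto)
    moreover have "n - j = Suc (n - Suc j)" using j by simp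
    ultimately show ?thesis by (intro exI[of _ 45] exI[of _ E] exI[of _ "Suc j"]) simp
  next
    case True
    have c1: "ctx s1" by (rule ctx_same[OF ctx sm1]) (simp add: nwr_cut_all nwr_emit ctx_names_def)
    have a1: "fst s1 ''a'' 0 = cl j + cl j" by (simp add: s1_def)
    have rep1: "fst s1 ''rep'' = fst s' ''rep''" by (simp add: s1_def)
    have "counts s1 cl E" "stacks s1 cl E" "groups ({..<n} - E) cl (fst s1 ''rep'')" "group_arrays s1 ({..<n} - E) (fst s1 ''rep'')"
      using cnt stk G ga by (simp_all add: s1_def counts_def stacks_def group_arrays_def)
    from run_emit[OF c1 a1 En this(1,2) refl this(3,4) True] obtain F where F: "F \<subseteq> E" "F \<noteq> {}"
      "run emit s1 (120 * card F + 410) (\<lambda>s''.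
        counts s'' cl (E - F) \<and> stacks s'' cl (E - F) \<and>
        groups ({..<n} - E \<union> F) cl (fst s'' ''rep'') \<and> group_arrays s'' ({..<n} - E \<union> F) (fst s'' ''rep'') \<and>
        (\<forall>i. i \<notin> F \<longrightarrow> fst s'' ''rep'' i = fst s1 ''rep'' i) \<and>
        (\<forall>a'. pending_surplus ({..<n} - E \<union> F) cl (fst s'' ''rep'') (E - F) a' \<le> pending_surplus ({..<n} - E) cl (fst s1 ''rep'') E a') \<and>
        same (nwr emit) {} s1 s'')" by blast
    have AF: "{..<n} - E \<union> F = {..<n} - (E - F)" using F(1) En by blast
    have FD: "F \<subseteq> D" using F(1) E by blast
    have "run emit s1 (120 * card F + 410) (cutting s cl rep D (E - F, j))"
    proof (rule run_mono[OF F(3)])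
      fix s'' assume Q: "counts s'' cl (E - F) \<and> stacks s'' cl (E - F) \<and>
        groups ({..<n} - E \<union> F) cl (fst s'' ''rep'') \<and> group_arrays s'' ({..<n} - E \<union> F) (fst s'' ''rep'') \<and>
        (\<forall>i. i \<notin> F \<longrightarrow> fst s'' ''rep'' i = fst s1 ''rep'' i) \<and>
        (\<forall>a'. pending_surplus ({..<n} - E \<union> F) cl (fst s'' ''rep'') (E - F) a' \<le> pending_surplus ({..<n} - E) cl (fst s1 ''rep'') E a') \<and>
        same (nwr emit) {} s1 s''"
      then have sm2: "same (nwr emit) {} s1 s''" by blast
      show "cutting s cl rep D (E - F, j) s''"
        unfolding cutting_def prod.case
      proof (intro conjI)
        show "same (nwr cut_all) {} s s''"
          by (rule same_mono[OF same_trans[OF sm1 sm2]]) (auto simp: nwr_cut_all)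
        show "fst s'' ''p'' 0 = j" using p sameD(1)[OF sm2, of "''p''"] by (simp add: nwr_emit s1_def)
        show "\<forall>i\<in>{..<n} - D. fst s'' ''rep'' i = rep i" using Q rep FD rep1 by auto
        show "\<forall>a. pending_surplus ({..<n} - (E - F)) cl (fst s'' ''rep'') (E - F) a \<le> surplus (colcount cl D a 0) (colcount cl D a 1)"
          using Q sur unfolding AF rep1 by (meson order_trans)
        show "\<forall>i\<in>E - F. \<forall>i'<j. cl i \<noteq> cl i'" using past by blast
      qed (use Q j E in \<open>auto simp: AF\<close>)
    qed simp
    then have "run (Cond (NLess (NConst 0) (P_exp 0 \<oplus> P_exp 1)) emit (incr ''p'')) s1 (120 * card F + 440) (cutting s cl rep D (E - F, j))"
      by (intro run_Cond[where T = "120 * card F + 410"]) (use True test in auto)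
    then obtain t2 s2 where 2: "exec (Cond (NLess (NConst 0) (P_exp 0 \<oplus> P_exp 1)) emit (incr ''p'')) s1 t2 s2" "t2 \<le> 120 * card F + 440"
        "cutting s cl rep D (E - F, j) s2" by (elim runE) blast
    have "run cut_step s' (120 * card F + 460) (cutting s cl rep D (E - F, j))"
      unfolding cut_step_def by (rule runI[OF exec.Seq[OF 1(1) 2(1)]]) (use 1(2) 2(2,3) in auto)
    moreover have "card E = card (E - F) + card F"
      using card_Diff_subset[OF finite_subset[OF F(1) finE] F(1)] card_mono[OF finE F(1)] by simp
    moreover have "1 \<le> card F" using F(1,2) finE finite_subset by (metis One_nat_def Suc_leI card_gt_0_iff)
    ultimately show ?thesis by (intro exI[of _ "120 * card F + 460"] exI[of _ "E - F"] exI[of _ j]) simp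
  qed
qed

lemma run_cut_all:
  assumes ctx: "ctx s" and FP: "\<And>i. i < n \<Longrightarrow> fst s ''FP'' (fst s ''o'' 0 + i) = cl i" and D: "D \<subseteq> {..<n}"
    and cnt: "counts s cl D" and stk: "stacks s cl D"
    and G: "groups ({..<n} - D) cl (fst s ''rep'')" and ga: "group_arrays s ({..<n} - D) (fst s ''rep'')"
    and bad: "bad ({..<n} - D) (fst s ''rep'') = {}"
  shows "run cut_all s (800 * (N + 1)) (\<lambda>s'. counts s' cl {} \<and> stacks s' cl {} \<and>
     groups {..<n} cl (fst s' ''rep'') \<and> group_arrays s' {..<n} (fst s' ''rep'') \<and>
     (\<forall>i\<in>{..<n} - D. fst s' ''rep'' i = fst s ''rep'' i) \<and>
     (\<forall>a. card {l \<in> bad {..<n} (fst s' ''rep''). cl l = a} \<le> surplus (colcount cl D a 0) (colcount cl D a 1)))"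
proof -
  let ?I = "cutting s cl (fst s ''rep'') D"
  let ?F = "\<lambda>g. 700 * card (fst g :: nat set) + 60 * (n - snd g)"
  define s1 where "s1 = nwrite s ''p'' 0 0"
  have I0: "?I (D, 0) s1"
    unfolding cutting_def prod.case
  proof (intro conjI)
    show "same (nwr cut_all) {} s s1" by (simp add: s1_def same_def nwr_cut_all)
  qed (use assms in \<open>simp_all add: s1_def counts_def stacks_def group_arrays_def pending_surplus_def\<close>)
  have "run (''p'' ::= NConst 0) s 5 (\<lambda>s'. s' = s1)" by (rule run_loopfree) (simp_all add: s1_def)
  then obtain t1 where 1: "exec (''p'' ::= NConst 0) s t1 s1" "t1 \<le> 5" by (elim runE) blast
  have "run (While (NLess (var ''p'') (var ''n'')) cut_step) s1 (?F (D, 0) + bcost (NLess (var ''p'') (var ''n'')) + 1)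
     (\<lambda>s'. \<exists>g. ?I g s' \<and> \<not> bval s' (NLess (var ''p'') (var ''n'')))"
  proof (rule run_While_potential[where I = ?I and F = ?F])
    fix g s' assume I: "?I g s'" and b: "bval s' (NLess (var ''p'') (var ''n''))"
    obtain E j where g: "g = (E, j)" by (cases g)
    have sm: "same (nwr cut_all) {} s s'" and p: "fst s' ''p'' 0 = j" using I unfolding g cutting_def by auto
    have "fst s' ''n'' 0 = n" using ctx_same[OF ctx sm] by (simp add: ctx_def nwr_cut_all nwr_emit ctx_names_def)
    then have j: "j < n" using b p by simp
    from run_cut_step[OF ctx FP D I[unfolded g] j] obtain T E' j' where
      "run cut_step s' T (?I (E', j'))" "T + 700 * card E' + 60 * (n - j') + 10 \<le> 700 * card E + 60 * (n - j)" by blast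
    then show "\<exists>T g'. run cut_step s' T (?I g') \<and> T + bcost (NLess (var ''p'') (var ''n'')) + 1 + ?F g' \<le> ?F g"
      unfolding g by (intro exI[of _ T] exI[of _ "(E', j')"]) simp
  qed (rule I0)
  then obtain t2 s2 E j where 2: "exec (While (NLess (var ''p'') (var ''n'')) cut_step) s1 t2 s2" "t2 \<le> ?F (D, 0) + 6"
    "?I (E, j) s2" "\<not> bval s2 (NLess (var ''p'') (var ''n''))"
    by (elim runE) auto
  note I = 2(3)[unfolded cutting_def prod.case]
  have sm: "same (nwr cut_all) {} s s2" using I by blast
  have "fst s2 ''n'' 0 = n" using ctx_same[OF ctx sm] by (simp add: ctx_def nwr_cut_all nwr_emit ctx_names_def)
  then have j: "j = n" using I 2(4) by simp
  have "E = {}"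
  proof (rule ccontr)
    assume "E \<noteq> {}"
    then obtain i where "i \<in> E" by blast
    moreover from this have "i < n" using I D by auto
    ultimately show False using I j by blast
  qed
  then have post: "counts s2 cl {}" "stacks s2 cl {}" "groups {..<n} cl (fst s2 ''rep'')" "group_arrays s2 {..<n} (fst s2 ''rep'')"
     "\<forall>i\<in>{..<n} - D. fst s2 ''rep'' i = fst s ''rep'' i"
     "\<And>a. pending_surplus {..<n} cl (fst s2 ''rep'') {} a \<le> surplus (colcount cl D a 0) (colcount cl D a 1)"
    using I by simp_all
  have "card D \<le> n" using card_mono[OF finite_lessThan D] by simp
  then have "?F (D, 0) \<le> 760 * N" using n_le_N unfolding fst_conv snd_conv by linarith
  then have "t1 + t2 \<le> 800 * (N + 1)" using 1(2) 2(2) by simp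
  moreover have "card {l \<in> bad {..<n} (fst s2 ''rep''). cl l = a} \<le> surplus (colcount cl D a 0) (colcount cl D a 1)" for a
    using post(6)[of a] unfolding pending_surplus_def by simp
  ultimately show ?thesis
    unfolding cut_all_def using post by (intro runI[OF exec.Seq[OF 1(1) 2(1)]]) auto
qed

text \<open>The waiting points afterwards are bounded, cell by cell, through the chain surplus of
  the dissolved points, their excess, excess of the whole cell. The points that change their
  representative lie in the dissolved set, whose size is governed by the points waiting beforehand,
  that is, by the level below.\<close>

lemma run_fair_level:
  assumes ctx: "ctx s" and m: "fst s ''m'' 0 = m" "m \<le> H + 1"
    and FP: "\<And>i. i < n \<Longrightarrow> fst s ''FP'' (m * (N + 1) + i) = cl i"
    and G: "groups {..<n} cl (fst s ''rep'')" and ga: "group_arrays s {..<n} (fst s ''rep'')"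
    and PQ: "counts s cl {}" and hd: "\<And>k. fst s ''hd'' k = 0"
  shows "run fair_level s (1500 * (N + 1)) (\<lambda>s'. counts s' cl {} \<and> (\<forall>k. fst s' ''hd'' k = 0) \<and>
     groups {..<n} cl (fst s' ''rep'') \<and> group_arrays s' {..<n} (fst s' ''rep'') \<and>
     card (bad {..<n} (fst s' ''rep'')) \<le> imbalance cl {..<n} \<and>
     (\<exists>D\<subseteq>{..<n}. (\<forall>i\<in>{..<n} - D. fst s' ''rep'' i = fst s ''rep'' i) \<and>
        card D \<le> (1 + (r + b) * b) * card (bad {..<n} (fst s ''rep''))))"
proof -
  define rep where "rep = fst s ''rep''"
  let ?A = "{..<n}" and ?B = "bad {..<n} rep" and ?M = "members {..<n} rep"
  have "run (''o'' ::= NGet ''ON'' (var ''m'')) s 8 (\<lambda>s'. fst s' ''o'' 0 = m * (N + 1) \<and> same {''o''} {} s s')"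
    using ctx m by (intro run_loopfree) (auto simp: ctx_def same_def)
  then obtain t1 s1 where 1: "exec (''o'' ::= NGet ''ON'' (var ''m'')) s t1 s1" "t1 \<le> 8" "fst s1 ''o'' 0 = m * (N + 1)" "same {''o''} {} s s1"
    by (elim runE) blast
  note s1 = sameD(1)[OF 1(4)]
  have c1: "ctx s1" by (rule ctx_same[OF ctx 1(4)]) (simp add: ctx_names_def)
  have L1: "level_ctx s1 cl rep"
    using c1 FP G ga 1(3) by (simp add: level_ctx_def rep_def group_arrays_def s1)
  have cnt1: "counts s1 cl {}" using PQ by (simp add: counts_def s1)
  obtain t2 s2 where 2: "exec clear_dis s1 t2 s2" "t2 \<le> 30 * (N + 1)" "dissolved s2 cl rep {}" "same {''p'', ''dis''} {} s1 s2"
    by (rule runE[OF run_clear_dis[OF L1 cnt1]]) blast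
  have L2: "level_ctx s2 cl rep" by (rule level_ctx_same[OF L1 2(4)]) (simp_all add: ctx_names_def)
  obtain t3 s3 where 3: "exec (dissolve is_bad) s2 t3 s3" "t3 \<le> 250 * (N + 1)" "dissolved s3 cl rep ?B"
    by (rule runE[OF run_dissolve_bad[OF L2 2(3)]]) blast
  note sm3 = exec_same[OF 3(1), unfolded nwr_dissolve]
  have L3: "level_ctx s3 cl rep" by (rule level_ctx_same[OF L2 sm3]) (simp_all add: ctx_names_def)
  obtain t4 s4 U where 4: "exec (dissolve is_relieving) s3 t4 s4" "t4 \<le> 250 * (N + 1)" "relieved cl rep U" "dissolved s4 cl rep U"
    by (rule runE[OF run_dissolve_relieving[OF L3 3(3)]]) blast
  note sm4 = exec_same[OF 4(1), unfolded nwr_dissolve]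
  have L4: "level_ctx s4 cl rep" by (rule level_ctx_same[OF L3 sm4]) (simp_all add: ctx_names_def)
  have hd4: "fst s4 ''hd'' k = 0" for k
    using hd sameD(1)[OF sm4, of "''hd''"] sameD(1)[OF sm3, of "''hd''"] sameD(1)[OF 2(4), of "''hd''"] s1 by simp
  obtain t5 s5 where 5: "exec push_points s4 t5 s5" "t5 \<le> 100 * (N + 1)" "stacks s5 cl (?M U)" "same {''p'', ''a'', ''nx'', ''hd''} {} s4 s5"
    by (rule runE[OF run_push_points[OF L4 4(4) hd4]]) blast
  have L5: "level_ctx s5 cl rep" by (rule level_ctx_same[OF L4 5(4)]) (simp_all add: ctx_names_def)
  note s5 = sameD(1)[OF 5(4)]
  have U: "?B \<subseteq> U" "U \<subseteq> heads ?A rep" using 4(3) by (simp_all add: relieved_def)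
  have sub: "?M U \<subseteq> ?A" by (auto simp: members_def)
  have rep5: "fst s5 ''rep'' = rep"
    using sameD(1)[OF sm3, of "''rep''"] sameD(1)[OF sm4, of "''rep''"] sameD(1)[OF 2(4), of "''rep''"] s1 s5 by (simp add: rep_def)
  have c5: "ctx s5" and FP5: "\<And>i. i < n \<Longrightarrow> fst s5 ''FP'' (fst s5 ''o'' 0 + i) = cl i" and G5: "groups ?A cl rep" and ga5: "group_arrays s5 ?A rep"
    using L5 by (simp_all add: level_ctx_def)
  have cnt5: "counts s5 cl (?M U)" using 4(4) by (simp add: dissolved_def counts_def s5)
  note gd = groups_dissolve[OF G5 U(2)]
  have ga5': "group_arrays s5 (?A - ?M U) rep"
    unfolding group_arrays_def gd(2) using ga5 colcount_members unfolding group_arrays_def by auto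
  have bad5: "bad (?A - ?M U) rep = {}" unfolding gd(3) using U(1) by auto
  obtain t6 s6 where 6: "exec cut_all s5 t6 s6" "t6 \<le> 800 * (N + 1)" "counts s6 cl {}" "stacks s6 cl {}"
     "groups ?A cl (fst s6 ''rep'')" "group_arrays s6 ?A (fst s6 ''rep'')"
     "\<forall>i\<in>?A - ?M U. fst s6 ''rep'' i = fst s5 ''rep'' i"
     "\<forall>a. card {l \<in> bad ?A (fst s6 ''rep''). cl l = a} \<le> surplus (colcount cl (?M U) a 0) (colcount cl (?M U) a 1)"
    by (rule runE[OF run_cut_all[OF c5 FP5 sub cnt5 5(3), unfolded rep5, OF _ gd(1) ga5' bad5]]) (simp_all add: rep5)
  have hd6: "fst s6 ''hd'' k = 0" for k
  proof -
    have "k = k div 2 + k div 2 + k mod 2" by presburger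
    moreover obtain xs where "set xs = {}" "chain (fst s6 ''nx'') (fst s6 ''hd'' (k div 2 + k div 2 + k mod 2)) xs"
      using 6(4) unfolding stacks_def by (metis (no_types, lifting) Collect_empty_eq empty_iff mod_less_divisor pos2)
    ultimately show ?thesis by simp
  qed
  let ?B' = "bad ?A (fst s6 ''rep'')"
  have B'A: "?B' \<subseteq> ?A" by (auto simp: bad_def heads_def)
  have "card ?B' = card (\<Union>a\<in>cl ` ?A. {l \<in> ?B'. cl l = a})"
    using B'A by (intro arg_cong[where f = card]) auto
  also have "\<dots> \<le> (\<Sum>a\<in>cl ` ?A. card {l \<in> ?B'. cl l = a})" by (rule card_UN_le) simp
  also have "\<dots> \<le> (\<Sum>a\<in>cl ` ?A. cell_excess cl ?A a)"
  proof (rule sum_mono)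
    fix a
    have "card {l \<in> ?B'. cl l = a} \<le> cell_excess cl (?M U) a"
      using 6(8) surplus_le_excess unfolding cell_excess_def by (meson order_trans)
    also have "\<dots> \<le> cell_excess cl ?A a" using 4(3) by (simp add: relieved_def)
    finally show "card {l \<in> ?B'. cl l = a} \<le> cell_excess cl ?A a" .
  qed
  also have "\<dots> = imbalance cl ?A" by (simp add: imbalance_def)
  finally have B': "card ?B' \<le> imbalance cl ?A" .
  have D: "\<forall>i\<in>?A - ?M U. fst s6 ''rep'' i = fst s ''rep'' i" using 6(7) by (simp add: rep5 rep_def)
  have cD: "card (?M U) \<le> (1 + (r + b) * b) * card (bad ?A (fst s ''rep''))" using 4(3) by (simp add: relieved_def rep_def)
  show ?thesis unfolding fair_level_def
    by (rule runI[OF exec.Seq[OF 1(1) exec.Seq[OF 2(1) exec.Seq[OF 3(1) exec.Seq[OF 4(1) exec.Seq[OF 5(1) 6(1)]]]]]])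
      (use 1(2) 2(2) 3(2) 4(2) 5(2) 6(2,3,5,6) hd6 B' D cD sub in auto)
qed

end

subsection \<open>All levels\<close>

definition init_groups :: com where
  "init_groups = For ''p'' (var ''n'') (seqs [NSet ''rep'' (var ''p'') (var ''p''),
     NSet ''fP'' (var ''p'' \<oplus> var ''p'' \<oplus> NGet ''color'' (var ''p'')) (var ''b''),
     NSet ''fQ'' (var ''p'' \<oplus> var ''p'' \<oplus> NGet ''color'' (var ''p'')) (var ''r'')])"

text \<open>Row \<open>H + 1\<close> describes the root cell, which lies above the levels written by
  \<open>extract_all\<close>.\<close>

definition clear_root :: com where
  "clear_root = Seq (''o'' ::= NGet ''ON'' (var ''H'' \<oplus> NConst 1))
     (For ''p'' (var ''n'') (NSet ''FP'' (var ''o'' \<oplus> var ''p'') (NConst 0)))"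

definition shift_points :: com where
  "shift_points = For ''q'' (var ''N'') (NSet ''y'' (var ''q'') (NGet ''y'' (var ''q'') \<ominus> var ''T''))"

definition fair_levels :: com where
  "fair_levels = For ''m'' (var ''H'' \<oplus> NConst 2) fair_level"

text \<open>The first \<open>extract_all\<close> serves the search for the shift. The second one
  recomputes the addresses from the coordinates reduced by the shift found.\<close>

definition fairlets :: com where
  "fairlets = Seq extract_all (Seq order_all (Seq select_shift (Seq shift_points (Seq extract_all
     (Seq clear_root (Seq init_groups fair_levels))))))"

context grid
begin

lemma colcount_id: "i \<in> A \<Longrightarrow> colcount (\<lambda>i. i) A i c = (if col i = c then 1 else 0)"
proof -
  assume "i \<in> A"
  then have "{j \<in> A. j = i \<and> col j = c} = (if col i = c then {i} else {})" by auto
  then show ?thesis by (simp add: colcount_def)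
qed

lemma run_init_groups:
  assumes ctx: "ctx s" and z: "\<And>k. fst s ''fP'' k = 0 \<and> fst s ''fQ'' k = 0"
  shows "run init_groups s (100 * (N + 1)) (\<lambda>s'. (\<forall>i<n. fst s' ''rep'' i = i) \<and> group_arrays s' {..<n} (\<lambda>i. i) \<and>
     same {''p'', ''rep'', ''fP'', ''fQ''} {} s s')"
proof -
  have k2: "2 * l + c = 2 * j + c' \<longleftrightarrow> l = j \<and> c = c'" if "c < 2" "c' < 2" for l j c c' :: nat
    using that by presburger
  have "run init_groups s (100 * (N + 1)) (\<lambda>s'. (\<forall>i<n. fst s' ''rep'' i = i) \<and>
     (\<forall>l<n. \<forall>c<2. fst s' ''fP'' (l + l + c) = (if col l = c then b else 0) \<and> fst s' ''fQ'' (l + l + c) = (if col l = c then r else 0)) \<and>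
     same {''p'', ''rep'', ''fP'', ''fQ''} {} s s')"
    unfolding init_groups_def seqs.simps if_False list.simps
  proof (rule run_For_le[where B = n and T = 80 and
        I = "\<lambda>j s'. (\<forall>i<j. fst s' ''rep'' i = i) \<and>
     (\<forall>l. \<forall>c<2. fst s' ''fP'' (l + l + c) = (if l < j \<and> col l = c then b else 0) \<and>
        fst s' ''fQ'' (l + l + c) = (if l < j \<and> col l = c then r else 0))"], goal_cases)
    case (5 j s')
    have c: "ctx s'" by (rule ctx_same[OF ctx 5(2)]) (simp add: ctx_names_def)
    have *: "fst s' ''color'' j = col j" "fst s' ''b'' 0 = b" "fst s' ''r'' 0 = r"
      using c 5(1) by (auto simp: ctx_def)
    show ?case
      by (rule run_loopfree) (use * 5(3,4) col_less[of j] in \<open>auto simp: mult_2[symmetric] k2 less_Suc_eq\<close>)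
  qed (use ctx n_le_N z in \<open>auto simp: ctx_def same_def\<close>)
  then show ?thesis
  proof (rule run_mono)
    fix s' assume *: "(\<forall>i<n. fst s' ''rep'' i = i) \<and>
     (\<forall>l<n. \<forall>c<2. fst s' ''fP'' (l + l + c) = (if col l = c then b else 0) \<and> fst s' ''fQ'' (l + l + c) = (if col l = c then r else 0)) \<and>
     same {''p'', ''rep'', ''fP'', ''fQ''} {} s s'"
    have "group_arrays s' {..<n} (\<lambda>i. i)"
      unfolding group_arrays_def
    proof (intro ballI allI impI)
      fix l c assume l: "l \<in> heads {..<n} (\<lambda>i. i)" and c: "c < (2 :: nat)"
      then have ln: "l < n" by (simp add: heads_def)
      then show "fst s' ''fP'' (l + l + c) = b * colcount (\<lambda>i. i) {..<n} l c \<and> fst s' ''fQ'' (l + l + c) = r * colcount (\<lambda>i. i) {..<n} l c"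
        using * c colcount_id[of l "{..<n}" c] by simp
    qed
    with * show "(\<forall>i<n. fst s' ''rep'' i = i) \<and> group_arrays s' {..<n} (\<lambda>i. i) \<and> same {''p'', ''rep'', ''fP'', ''fQ''} {} s s'" by blast
  qed simp
qed

lemma groups_id: "groups {..<n} cl (\<lambda>i. i)"
proof -
  have "1 \<le> r + b" using b_pos by simp
  moreover have "{i \<in> {..<n}. i = l} = {l}" if "l < n" for l using that by auto
  ultimately show ?thesis by (simp add: groups_def heads_def)
qed

lemma heads_cong: "(\<And>i. i \<in> A \<Longrightarrow> rep i = rep' i) \<Longrightarrow> heads A rep = heads A rep'"
  by (auto simp: heads_def)

lemma groups_cong:
  assumes "\<And>i. i \<in> A \<Longrightarrow> rep i = rep' i"
  shows "groups A cl rep \<longleftrightarrow> groups A cl rep'" "group_arrays s A rep \<longleftrightarrow> group_arrays s A rep'" "bad A rep = bad A rep'"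
proof -
  have set: "{i \<in> A. rep i = l \<and> P i} = {i \<in> A. rep' i = l \<and> P i}" for l P using assms by auto
  have cc: "colcount rep A = colcount rep' A" by (intro ext) (simp only: colcount_def set)
  have ce: "cell_excess rep A = cell_excess rep' A" by (intro ext) (simp only: cell_excess_def cc)
  have h: "heads A rep = heads A rep'" by (rule heads_cong) (rule assms)
  show "bad A rep = bad A rep'" "group_arrays s A rep \<longleftrightarrow> group_arrays s A rep'"
    unfolding bad_def group_arrays_def h ce cc by simp_all
  show "groups A cl rep \<longleftrightarrow> groups A cl rep'"
    unfolding groups_def h ce using set[of _ "\<lambda>_. True"] assms by simp
qed

lemma run_clear_root:
  assumes ctx: "ctx s" and FP: "\<And>m i. m \<le> H \<Longrightarrow> i < n \<Longrightarrow> fst s ''FP'' (m * (N + 1) + i) = cell m t i"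
  shows "run clear_root s (50 * (N + 1)) (\<lambda>s'. (\<forall>m\<le>H + 1. \<forall>i<n. fst s' ''FP'' (m * (N + 1) + i) = cell m t i) \<and>
     same {''o'', ''p'', ''FP''} {} s s')"
proof -
  let ?off = "(H + 1) * (N + 1)"
  have "run (''o'' ::= NGet ''ON'' (var ''H'' \<oplus> NConst 1)) s 10 (\<lambda>s'. fst s' ''o'' 0 = ?off \<and> same {''o''} {} s s')"
    using ctx by (intro run_loopfree) (auto simp: ctx_def same_def)
  then obtain t1 s1 where 1: "exec (''o'' ::= NGet ''ON'' (var ''H'' \<oplus> NConst 1)) s t1 s1" "t1 \<le> 10"
    "fst s1 ''o'' 0 = ?off" "same {''o''} {} s s1" by (elim runE) blast
  have c1: "ctx s1" by (rule ctx_same[OF ctx 1(4)]) (simp add: ctx_names_def)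
  have "run (For ''p'' (var ''n'') (NSet ''FP'' (var ''o'' \<oplus> var ''p'') (NConst 0))) s1 (30 * (N + 1))
    (\<lambda>s'. (\<forall>x. fst s' ''FP'' x = (if ?off \<le> x \<and> x < ?off + n then 0 else fst s1 ''FP'' x)) \<and> same {''p'', ''FP''} {} s1 s')"
  proof (rule run_For_le[where B = n and T = 10 and
        I = "\<lambda>j s'. \<forall>x. fst s' ''FP'' x = (if ?off \<le> x \<and> x < ?off + j then 0 else fst s1 ''FP'' x)"], goal_cases)
    case (5 j s')
    have "fst s' ''o'' 0 = ?off" using 1(3) sameD(1)[OF 5(2), of "''o''"] by simp
    then show ?case using 5(3,4) by (intro run_loopfree) auto
  qed (use c1 n_le_N in \<open>auto simp: ctx_def same_def\<close>)
  then obtain t2 s2 where 2: "exec (For ''p'' (var ''n'') (NSet ''FP'' (var ''o'' \<oplus> var ''p'') (NConst 0))) s1 t2 s2" "t2 \<le> 30 * (N + 1)"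
    "\<forall>x. fst s2 ''FP'' x = (if ?off \<le> x \<and> x < ?off + n then 0 else fst s1 ''FP'' x)" "same {''p'', ''FP''} {} s1 s2"
    by (elim runE) blast
  have "fst s2 ''FP'' (m * (N + 1) + i) = cell m t i" if m: "m \<le> H + 1" and i: "i < n" for m i
  proof (cases "m = H + 1")
    case True
    then show ?thesis using 2(3) i cell_root[OF i, of t] by simp
  next
    case False
    then have mH: "m \<le> H" using m by simp
    have "Suc m * (N + 1) \<le> ?off" using mH by (intro mult_le_mono1) simp
    moreover have "i < N + 1" using i n_le_N by linarith
    ultimately have "\<not> ?off \<le> m * (N + 1) + i" by simp
    then show ?thesis using 2(3) FP[OF mH i] sameD(1)[OF 1(4), of "''FP''"] by simp
  qed
  moreover have "same {''o'', ''p'', ''FP''} {} s s2" using 1(4) 2(4) by (simp add: same_def)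
  ultimately show ?thesis
    unfolding clear_root_def by (intro runI[OF exec.Seq[OF 1(1) 2(1)]]) (use 1(2) 2(2) in auto)
qed

lemma run_shift_points:
  assumes ctx: "ctx s"
  shows "run shift_points s (30 * (N + 1)) (\<lambda>s'. (\<forall>q<N. fst s' ''y'' q = fst s ''y'' q - fst s ''T'' 0) \<and> same {''q'', ''y''} {} s s')"
  unfolding shift_points_def
proof (rule run_For_le[where B = N and T = 15 and
      I = "\<lambda>j s'. \<forall>q. fst s' ''y'' q = (if q < j then fst s ''y'' q - fst s ''T'' 0 else fst s ''y'' q)"], goal_cases)
  case (5 j s')
  then show ?case using sameD(1)[OF 5(2), of "''T''"] by (intro run_loopfree) auto
qed (use ctx in \<open>auto simp: ctx_def same_def\<close>)

text \<open>A bound on the points waiting when level \<open>m\<close> begins: initially all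
  \<open>n\<close>, since a single point is unbalanced, and later the imbalance of the previous
  level.\<close>

definition prior :: "nat \<Rightarrow> nat \<Rightarrow> nat" where
  "prior t m = (if m = 0 then n else level_imbalance (m - 1) t)"

definition kappa :: nat where "kappa = 1 + (r + b) * b"

text \<open>The geometry enters only through \<open>dst\<close>, which is at most
  \<open>2 ^ m * \<delta>\<close> inside a cell of level \<open>m\<close>. At level \<open>m\<close>
  at most \<open>kappa * prior t m\<close> points change their representative, each staying inside
  its cell, so the bound is a sum over the levels.\<close>

lemma run_fair_levels:
  fixes dst :: "nat \<Rightarrow> nat \<Rightarrow> real" and \<delta> :: real
  assumes ctx: "ctx s" and FP: "\<And>m i. m \<le> H + 1 \<Longrightarrow> i < n \<Longrightarrow> fst s ''FP'' (m * (N + 1) + i) = cell m t i"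
    and rep: "\<And>i. i < n \<Longrightarrow> fst s ''rep'' i = i" and ga: "group_arrays s {..<n} (\<lambda>i. i)"
    and PQ: "counts s (cell 0 t) {}" and hd: "\<And>k. fst s ''hd'' k = 0"
    and dst: "\<And>m i i'. m \<le> H + 1 \<Longrightarrow> i < n \<Longrightarrow> i' < n \<Longrightarrow> cell m t i = cell m t i' \<Longrightarrow> dst i i' \<le> 2 ^ m * \<delta>"
    and dst0: "\<And>i. dst i i = 0" "\<And>i i'. 0 \<le> dst i i'" and \<delta>: "0 \<le> \<delta>"
  shows "run fair_levels s (1520 * (N + 1) * (H + 3)) (\<lambda>s'. groups {..<n} (\<lambda>_. 0) (fst s' ''rep'') \<and>
     card (bad {..<n} (fst s' ''rep'')) \<le> level_imbalance (Suc H) t \<and>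
     (\<Sum>i<n. dst i (fst s' ''rep'' i)) \<le> kappa * \<delta> * (n + 2 * weight 0 t))"
proof -
  let ?I = "\<lambda>j s'. groups {..<n} (cell (j - 1) t) (fst s' ''rep'') \<and> group_arrays s' {..<n} (fst s' ''rep'') \<and>
     counts s' (cell 0 t) {} \<and> (\<forall>k. fst s' ''hd'' k = 0) \<and> card (bad {..<n} (fst s' ''rep'')) \<le> prior t j \<and>
     (\<Sum>i<n. dst i (fst s' ''rep'' i)) \<le> kappa * \<delta> * (\<Sum>m<j. 2 ^ m * prior t m)"
  have H3: "H + 3 = H + 2 + 1" by simp
  show ?thesis
    unfolding fair_levels_def H3
  proof (rule run_For_le[where B = "H + 2" and T = "1500 * (N + 1)" and I = ?I], goal_cases)
    case 3
    have "card (bad {..<n} (\<lambda>i. i)) \<le> card {..<n}" by (rule card_mono) (auto simp: bad_def heads_def)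
    moreover have "groups {..<n} (cell 0 t) (fst s ''rep'')" "group_arrays s {..<n} (fst s ''rep'')"
       "bad {..<n} (fst s ''rep'') = bad {..<n} (\<lambda>i. i)"
      using groups_cong[of "{..<n}" "fst s ''rep''" "\<lambda>i. i"] rep groups_id ga by auto
    ultimately show ?case using PQ hd rep dst0 by (simp add: prior_def)
  next
    case (4 j s' v)
    then show ?case by (simp add: group_arrays_def counts_def)
  next
    case (5 j s')
    have sm: "same (insert ''m'' (nwr fair_level)) {} s s'" using 5(2) by (simp add: nwr_fair_level)
    have c': "ctx s'" by (rule ctx_same[OF ctx sm]) (simp add: nwr_fair_level nwr_emit ctx_names_def)
    have jH: "j \<le> H + 1" using 5(1) by simp
    have FP': "fst s' ''FP'' (j * (N + 1) + i) = cell j t i" if "i < n" for i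
      using FP[OF jH that] sameD(1)[OF sm, of "''FP''"] by (simp add: nwr_fair_level nwr_emit)
    let ?rep = "fst s' ''rep''"
    have G: "groups {..<n} (cell (j - 1) t) ?rep" and ga': "group_arrays s' {..<n} ?rep" and cnt: "counts s' (cell 0 t) {}"
      and hd': "\<And>k. fst s' ''hd'' k = 0" and cb: "card (bad {..<n} ?rep) \<le> prior t j"
      and ds: "(\<Sum>i<n. dst i (?rep i)) \<le> kappa * \<delta> * (\<Sum>m<j. 2 ^ m * prior t m)"
      using 5(4) by blast+
    have G': "groups {..<n} (cell j t) ?rep"
    proof (cases j)
      case 0
      then show ?thesis using G by simp
    next
      case (Suc j')
      show ?thesis
      proof (rule groups_cell[OF G])
        fix i i' assume "i \<in> {..<n}" "i' \<in> {..<n}" "cell (j - 1) t i = cell (j - 1) t i'"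
        then show "cell j t i = cell j t i'" unfolding Suc diff_Suc_1 by (intro cell_nested) simp_all
      qed
    qed
    have cnt': "counts s' (cell j t) {}" using cnt counts_cong[of "{}" "cell j t" "cell 0 t"] by simp
    show ?case
    proof (rule run_mono[OF run_fair_level[where cl = "cell j t", OF c' 5(3) jH FP' G' ga' cnt' hd']], goal_cases)
      case (3 s'')
      let ?rep' = "fst s'' ''rep''"
      obtain D where D: "D \<subseteq> {..<n}" "\<And>i. i \<in> {..<n} - D \<Longrightarrow> ?rep' i = ?rep i" "card D \<le> kappa * card (bad {..<n} ?rep)"
        using 3 unfolding kappa_def by blast
      have GG: "groups {..<n} (cell j t) ?rep'" using 3 by blast
      have rn: "?rep' i < n" "cell j t (?rep' i) = cell j t i" if "i < n" for i
        using groupsD(1,2)[OF GG, of i] that by (auto simp: heads_def)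
      have finD: "finite D" using D(1) finite_subset by blast
      have "(\<Sum>i<n. dst i (?rep' i)) \<le> (\<Sum>i<n. dst i (?rep i) + (if i \<in> D then 2 ^ j * \<delta> else 0))"
      proof (rule sum_mono)
        fix i assume i: "i \<in> {..<n}"
        show "dst i (?rep' i) \<le> dst i (?rep i) + (if i \<in> D then 2 ^ j * \<delta> else 0)"
        proof (cases "i \<in> D")
          case True
          \<comment> \<open>The new distance is bounded by the size of the present cell directly; no
            distances are accumulated over the levels.\<close>
          have "dst i (?rep' i) \<le> 2 ^ j * \<delta>" using i rn[of i] by (intro dst[OF jH]) auto
          then show ?thesis using True dst0(2)[of i "?rep i"] by simp
        next
          case False
          then show ?thesis using D(2)[of i] i by simp
        qed
      qed
      also have "\<dots> = (\<Sum>i<n. dst i (?rep i)) + card D * (2 ^ j * \<delta>)"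
        using D(1) by (simp add: sum.distrib sum.If_cases Int_absorb1)
      also have "card D * (2 ^ j * \<delta>) \<le> real kappa * real (prior t j) * (2 ^ j * \<delta>)"
      proof (intro mult_right_mono)
        have "card D \<le> kappa * prior t j" using D(3) cb mult_le_mono2[of _ _ kappa] order_trans by blast
        then show "real (card D) \<le> real kappa * real (prior t j)" by (simp flip: of_nat_mult)
      qed (use \<delta> in simp)
      finally have "(\<Sum>i<n. dst i (?rep' i)) \<le> kappa * \<delta> * (\<Sum>m<Suc j. 2 ^ m * prior t m)"
        using ds by (simp add: algebra_simps)
      moreover have "prior t (Suc j) = imbalance (cell j t) {..<n}" by (simp add: prior_def level_imbalance_def)
      moreover have "counts s'' (cell 0 t) {}" using 3 counts_cong[of "{}" "cell j t" "cell 0 t" s''] by simp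
      ultimately show ?case using 3 by simp
    qed simp_all
  next
    case (6 s')
    have "(\<Sum>m<H + 2. 2 ^ m * prior t m) = n + 2 * weight 0 t"
    proof -
      \<comment> \<open>Imbalance at level \<open>m\<close> makes points move at level
        \<open>m + 1\<close>, in cells twice as wide: hence the factor 2 before
        \<open>weight\<close>.\<close>
      have "(\<Sum>m<H + 2. 2 ^ m * prior t m) = prior t 0 + (\<Sum>m<Suc H. 2 ^ Suc m * prior t (Suc m))"
        by (simp add: sum.lessThan_Suc_shift del: sum.lessThan_Suc)
      also have "(\<Sum>m<Suc H. 2 ^ Suc m * prior t (Suc m)) = 2 * weight 0 t"
        unfolding weight_def sum_distrib_left
        by (intro sum.cong) (auto simp: prior_def)
      finally show ?thesis by (simp add: prior_def)
    qed
    then have *: "(\<Sum>m<H + 2. 2 ^ m * real (prior t m)) = n + 2 * weight 0 t"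
      by (simp only: of_nat_eq_iff[where 'a = real, symmetric] of_nat_sum of_nat_mult of_nat_power of_nat_add of_nat_numeral)
    have "groups {..<n} (\<lambda>_. 0) (fst s' ''rep'')"
      using 6(1) groups_cell[of "{..<n}" "cell (H + 1) t" _ "\<lambda>_. 0"] by simp
    then show ?case using 6(1) * by (simp add: prior_def)
  qed (use ctx sameD(1) in \<open>auto simp: ctx_def nwr_fair_level nwr_emit\<close>)
qed

lemma run_fairlets:
  fixes dst :: "nat \<Rightarrow> nat \<Rightarrow> real" and \<delta> :: real
  assumes ctx: "ctx s" and y: "\<And>q. q < N \<Longrightarrow> fst s ''y'' q = S q"
    and z: "\<And>x k. x \<in> {''P'', ''Q'', ''G'', ''T'', ''fP'', ''fQ'', ''hd''} \<Longrightarrow> fst s x k = 0"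
    and total: "excess (card {i \<in> {..<n}. col i = 0}) (card {i \<in> {..<n}. col i = 1}) = 0"
    and dst: "\<And>t m i i'. t \<le> 2 ^ H \<Longrightarrow> i < n \<Longrightarrow> i' < n \<Longrightarrow> cell m t i = cell m t i' \<Longrightarrow> dst i i' \<le> 2 ^ m * \<delta>"
    and dst0: "\<And>i. dst i i = 0" "\<And>i i'. 0 \<le> dst i i'" and \<delta>: "0 \<le> \<delta>"
  shows "run fairlets s (6000 * (N + 1) * (H + 2)) (\<lambda>s'. groups {..<n} (\<lambda>_. 0) (fst s' ''rep'') \<and>
     bad {..<n} (fst s' ''rep'') = {} \<and>
     (\<exists>t<2 ^ H. (\<forall>t'<2 ^ H. weight 0 t \<le> weight 0 t') \<and>
       (\<Sum>i<n. dst i (fst s' ''rep'' i)) \<le> kappa * \<delta> * (n + 2 * weight 0 t)))"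
proof -
  have y1: "fst s ''y'' q < 2 ^ Suc H" if "q < N" for q using S_bounds(2)[OF that] y[OF that] by simp
  obtain t1 s1 where 1: "exec extract_all s t1 s1" "t1 \<le> 300 * (N + 1) * (H + 2)"
    "\<forall>m\<le>H. grid_arrays s1 (fst s ''y'') m" "same {''q'', ''rem'', ''i'', ''fp'', ''j'', ''m'', ''o'', ''BIT'', ''FP''} {} s s1"
    by (rule runE[OF run_extract_all[OF ctx y1]]) auto
  have c1: "ctx s1" by (rule ctx_same[OF ctx 1(4)]) (simp add: ctx_names_def)
  have g1: "grid_arrays s1 S m" if "m \<le> H" for m
  proof -
    have "address (\<lambda>k. fst s ''y'' k div 2 ^ m) i = address (\<lambda>k. S k div 2 ^ m) i" for i
      unfolding address_def by (intro sum.cong) (use y in auto)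
    then show ?thesis using 1(3) that y unfolding grid_arrays_def by simp
  qed
  obtain t2 s2 where 2: "exec order_all s1 t2 s2" "t2 \<le> 200 * (N + 1) * (H + 2)"
    "\<forall>m\<le>H. \<forall>e<N. fst s2 ''ORD'' (m * (N + 1) + e) = order m ! e" "same {''q'', ''ORD'', ''j'', ''o'', ''c'', ''u''} {} s1 s2"
    by (rule runE[OF run_order_all[OF c1 g1]]) auto
  have c2: "ctx s2" by (rule ctx_same[OF c1 2(4)]) (simp add: ctx_names_def)
  have g2: "grid_arrays s2 S m" if "m \<le> H" for m
    using g1[OF that] sameD(1)[OF 2(4)] by (simp add: grid_arrays_def)
  have z2: "fst s2 x k = 0" if "x \<in> {''P'', ''Q'', ''G'', ''T'', ''fP'', ''fQ'', ''hd''}" for x k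
    using z[OF that] that sameD(1)[OF 2(4), of x] sameD(1)[OF 1(4), of x] by auto
  obtain t3 s3 where 3: "exec select_shift s2 t3 s3" "t3 \<le> 1000 * (N + 1) * (H + 2)"
    "fst s3 ''T'' 0 < 2 ^ H" "\<forall>t<2 ^ H. weight 0 (fst s3 ''T'' 0) \<le> weight 0 t" "\<forall>k. fst s3 ''P'' k = 0 \<and> fst s3 ''Q'' k = 0"
    "same {''j'', ''m'', ''o'', ''q'', ''u'', ''p'', ''a'', ''X'', ''P'', ''Q'', ''cur'', ''XV'', ''lo'', ''hi'', ''G'', ''T''} {} s2 s3"
    by (rule runE[OF run_select_shift[OF c2 g2]]) (use 2(3) z2 in auto)
  have c3: "ctx s3" by (rule ctx_same[OF c2 3(6)]) (simp add: ctx_names_def)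
  define t where "t = fst s3 ''T'' 0"
  have y3: "fst s3 ''y'' = fst s ''y''"
    using sameD(1)[OF 3(6), of "''y''"] sameD(1)[OF 2(4), of "''y''"] sameD(1)[OF 1(4), of "''y''"] by simp
  obtain t4 s4 where 4: "exec shift_points s3 t4 s4" "t4 \<le> 30 * (N + 1)"
    "\<forall>q<N. fst s4 ''y'' q = fst s ''y'' q - t" "same {''q'', ''y''} {} s3 s4"
    by (rule runE[OF run_shift_points[OF c3]]) (auto simp: y3 t_def)
  have c4: "ctx s4" by (rule ctx_same[OF c3 4(4)]) (simp add: ctx_names_def)
  have y4: "fst s4 ''y'' q < 2 ^ Suc H" if "q < N" for q
    using y1[OF that] 4(3) that by (simp add: less_imp_diff_less)
  obtain t5 s5 where 5: "exec extract_all s4 t5 s5" "t5 \<le> 300 * (N + 1) * (H + 2)"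
    "\<forall>m\<le>H. grid_arrays s5 (fst s4 ''y'') m" "same {''q'', ''rem'', ''i'', ''fp'', ''j'', ''m'', ''o'', ''BIT'', ''FP''} {} s4 s5"
    by (rule runE[OF run_extract_all[OF c4 y4]]) auto
  have c5: "ctx s5" by (rule ctx_same[OF c4 5(4)]) (simp add: ctx_names_def)
  have FP5: "fst s5 ''FP'' (m * (N + 1) + i) = cell m t i" if "m \<le> H" "i < n" for m i
  proof -
    have "address (\<lambda>k. fst s4 ''y'' k div 2 ^ m) i = cell m t i"
      unfolding cell_def address_def by (intro sum.cong) (use 4(3) y in \<open>auto simp: dig_def\<close>)
    then show ?thesis using 5(3) that unfolding grid_arrays_def by simp
  qed
  obtain t6 s6 where 6: "exec clear_root s5 t6 s6" "t6 \<le> 50 * (N + 1)"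
    "\<forall>m\<le>H + 1. \<forall>i<n. fst s6 ''FP'' (m * (N + 1) + i) = cell m t i" "same {''o'', ''p'', ''FP''} {} s5 s6"
    by (rule runE[OF run_clear_root[OF c5 FP5]]) auto
  have c6: "ctx s6" by (rule ctx_same[OF c5 6(4)]) (simp add: ctx_names_def)
  have z6: "fst s6 x k = 0" if "x \<in> {''fP'', ''fQ'', ''hd''}" for x k
    using z2[of x k] that sameD(1)[OF 3(6), of x] sameD(1)[OF 4(4), of x] sameD(1)[OF 5(4), of x] sameD(1)[OF 6(4), of x] by auto
  have PQ6: "fst s6 x k = 0" if "x \<in> {''P'', ''Q''}" for x k
    using 3(5) that sameD(1)[OF 4(4), of x] sameD(1)[OF 5(4), of x] sameD(1)[OF 6(4), of x] by auto
  have zz: "fst s6 ''fP'' k = 0 \<and> fst s6 ''fQ'' k = 0" for k using z6 by simp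
  obtain t7 s7 where 7: "exec init_groups s6 t7 s7" "t7 \<le> 100 * (N + 1)"
    "\<forall>i<n. fst s7 ''rep'' i = i" "group_arrays s7 {..<n} (\<lambda>i. i)" "same {''p'', ''rep'', ''fP'', ''fQ''} {} s6 s7"
    by (rule runE[OF run_init_groups[OF c6 zz]]) blast
  have c7: "ctx s7" by (rule ctx_same[OF c6 7(5)]) (simp add: ctx_names_def)
  have cnt7: "counts s7 (cell 0 t) {}"
    using PQ6 sameD(1)[OF 7(5)] by (simp add: counts_def colcount_def)
  have hd7: "fst s7 ''hd'' k = 0" for k using z6 sameD(1)[OF 7(5)] by simp
  have FP7: "fst s7 ''FP'' (m * (N + 1) + i) = cell m t i" if "m \<le> H + 1" "i < n" for m i
    using 6(3) that sameD(1)[OF 7(5)] by simp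
  have rep7: "fst s7 ''rep'' i = i" if "i < n" for i using 7(3) that by simp
  have t: "t \<le> 2 ^ H" using 3(3) by (simp add: t_def)
  obtain t8 s8 where 8: "exec fair_levels s7 t8 s8" "t8 \<le> 1520 * (N + 1) * (H + 3)"
    "groups {..<n} (\<lambda>_. 0) (fst s8 ''rep'')" "card (bad {..<n} (fst s8 ''rep'')) \<le> level_imbalance (Suc H) t"
    "(\<Sum>i<n. dst i (fst s8 ''rep'' i)) \<le> kappa * \<delta> * (n + 2 * weight 0 t)"
    by (rule runE[OF run_fair_levels[where dst = dst and \<delta> = \<delta>, OF c7 FP7 rep7 7(4) cnt7 hd7 dst[OF t] dst0 \<delta>]]) auto
  \<comment> \<open>The root cell contains the whole input, which is balanced, so no point is left
    waiting at the end.\<close>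
  have "level_imbalance (Suc H) t = 0"
    unfolding level_imbalance_def by (rule imbalance_one_cell[where a = 0]) (use cell_root total in auto)
  then have b0: "bad {..<n} (fst s8 ''rep'') = {}" using 8(4) by (simp add: bad_def heads_def)
  have "t4 + t6 + t7 \<le> 180 * (N + 1)" using 4(2) 6(2) 7(2) by simp
  also have "\<dots> \<le> 180 * (N + 1) * (H + 2)" by simp
  finally have "t4 + t6 + t7 \<le> 180 * ((N + 1) * (H + 2))" by (simp only: mult.assoc)
  moreover have "(N + 1) * (H + 3) \<le> (N + 1) * (2 * (H + 2))" by (rule mult_le_mono2) simp
  then have "(N + 1) * (H + 3) \<le> 2 * ((N + 1) * (H + 2))" by (simp only: mult.left_commute)
  moreover have "t1 \<le> 300 * ((N + 1) * (H + 2))" "t2 \<le> 200 * ((N + 1) * (H + 2))" "t3 \<le> 1000 * ((N + 1) * (H + 2))"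
    "t5 \<le> 300 * ((N + 1) * (H + 2))" "t8 \<le> 1520 * ((N + 1) * (H + 3))"
    using 1(2) 2(2) 3(2) 5(2) 8(2) by (simp_all only: mult.assoc)
  ultimately have "t1 + (t2 + (t3 + (t4 + (t5 + (t6 + (t7 + t8)))))) \<le> 6000 * ((N + 1) * (H + 2))" by linarith
  then have T: "t1 + (t2 + (t3 + (t4 + (t5 + (t6 + (t7 + t8)))))) \<le> 6000 * (N + 1) * (H + 2)" by (simp only: mult.assoc)
  show ?thesis
    unfolding fairlets_def
    by (rule runI[OF exec.Seq[OF 1(1) exec.Seq[OF 2(1) exec.Seq[OF 3(1) exec.Seq[OF 4(1) exec.Seq[OF 5(1) exec.Seq[OF 6(1) exec.Seq[OF 7(1) 8(1)]]]]]]] T])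
      (use 8(3,5) b0 3(3,4) in \<open>auto simp: t_def mult.assoc\<close>)
qed

end

section \<open>The cost of moving the points to their representatives\<close>

lemma edist_nonneg [simp]: "0 \<le> edist d x y"
  by (simp add: edist_def)

lemma edist_refl [simp]: "edist d x x = 0"
  by (simp add: edist_def L2_set_0')

lemma edist_commute: "edist d x y = edist d y x"
  by (simp add: edist_def L2_set_def power2_commute)

lemma edist_triangle: "edist d x z \<le> edist d x y + edist d y z"
proof -
  have "edist d x z = L2_set (\<lambda>j. (x j - y j) + (y j - z j)) {..<d}" by (simp add: edist_def)
  also have "\<dots> \<le> edist d x y + edist d y z" unfolding edist_def by (rule L2_set_triangle_ineq)
  finally show ?thesis .
qed

lemma sum_abs_le_edist: "(\<Sum>j<d. \<bar>x j - y j\<bar>) \<le> sqrt d * edist d x y"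
  using L2_set_mult_ineq[of "\<lambda>_. 1" "\<lambda>j. x j - y j" "{..<d}"] L2_set_constant[of 1 "{..<d}"]
  by (simp add: edist_def)

lemma edist_le_sqrt:
  assumes "\<And>j. j < d \<Longrightarrow> \<bar>x j - y j\<bar> \<le> c"
  shows "edist d x y \<le> sqrt d * c"
proof (cases "d = 0")
  case False
  then have "0 \<le> c" using assms[of 0] by simp
  have "edist d x y = L2_set (\<lambda>j. \<bar>x j - y j\<bar>) {..<d}" by (simp add: edist_def L2_set_def)
  also have "\<dots> \<le> L2_set (\<lambda>_. c) {..<d}" by (rule L2_set_mono) (use assms in auto)
  also have "\<dots> = sqrt d * c" using \<open>0 \<le> c\<close> by (simp add: L2_set_constant)
  finally show ?thesis .
qed (simp add: edist_def)

section \<open>Medoids in place of arbitrary centers\<close>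

definition medoids :: "nat \<Rightarrow> nat \<Rightarrow> (nat \<Rightarrow> vector) \<Rightarrow> (nat \<Rightarrow> vector) \<Rightarrow> (nat \<Rightarrow> nat) \<Rightarrow> (nat \<Rightarrow> nat) \<Rightarrow> bool" where
  "medoids n d P Z lab p \<longleftrightarrow> (\<forall>i<n. p (lab i) < n \<and> lab (p (lab i)) = lab i \<and>
     edist d (P i) (P (p (lab i))) \<le> 2 * edist d (P i) (Z (lab i)))"

text \<open>Grid cells are defined for input points only, whereas centers may lie anywhere. The
  point of a cluster closest to its center is at most as far from the center as any other member, so
  the triangle inequality loses a factor of 2.\<close>

lemma ex_medoids: "\<exists>p. medoids n d P Z lab p"
proof -
  have "\<exists>l<n. lab l = lab i \<and> (\<forall>i'<n. lab i' = lab i \<longrightarrow> edist d (P l) (Z (lab i)) \<le> edist d (P i') (Z (lab i)))"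
    if "i < n" for i
  proof -
    let ?C = "{i' \<in> {..<n}. lab i' = lab i}"
    have "finite ?C" "?C \<noteq> {}" using that by auto
    then obtain l where "l \<in> ?C" "\<And>i'. i' \<in> ?C \<Longrightarrow> edist d (P l) (Z (lab i)) \<le> edist d (P i') (Z (lab i))"
      using arg_min_if_finite[of ?C "\<lambda>i'. edist d (P i') (Z (lab i))"] by (metis (no_types, lifting) not_le_imp_less)
    then show ?thesis by (intro exI[of _ l]) auto
  qed
  then have "\<forall>c. \<exists>l. \<forall>i<n. lab i = c \<longrightarrow> l < n \<and> lab l = c \<and> (\<forall>i'<n. lab i' = c \<longrightarrow> edist d (P l) (Z c) \<le> edist d (P i') (Z c))"
    by metis
  then obtain p where p: "\<And>c i. i < n \<Longrightarrow> lab i = c \<Longrightarrow> p c < n \<and> lab (p c) = c \<and> (\<forall>i'<n. lab i' = c \<longrightarrow> edist d (P (p c)) (Z c) \<le> edist d (P i') (Z c))"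
    by metis
  have "edist d (P i) (P (p (lab i))) \<le> 2 * edist d (P i) (Z (lab i))" if "i < n" for i
    using p[OF that refl] that edist_triangle[of d "P i" "P (p (lab i))" "Z (lab i)"] edist_commute[of d "Z (lab i)" "P (p (lab i))"]
    by fastforce
  with p show ?thesis unfolding medoids_def by blast
qed

lemma medoids_cost:
  assumes "medoids n d P Z lab p"
  shows "(\<Sum>i<n. edist d (P i) (P (p (lab i)))) \<le> 2 * cost n d P Z lab"
  using assms unfolding cost_def sum_distrib_left medoids_def by (intro sum_mono) simp

text \<open>At least half of the points differ from their medoids.\<close>

lemma medoids_lower_bound:
  assumes M: "medoids n d P Z lab p"
    and two: "\<And>i. i < n \<Longrightarrow> \<exists>i'<n. i' \<noteq> i \<and> lab i' = lab i"
    and sep: "\<And>i i'. i < n \<Longrightarrow> i' < n \<Longrightarrow> i \<noteq> i' \<Longrightarrow> \<delta> \<le> edist d (P i) (P i')" and \<delta>: "0 \<le> \<delta>"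
  shows "n * \<delta> \<le> 2 * (\<Sum>i<n. edist d (P i) (P (p (lab i))))"
proof -
  let ?F = "{i \<in> {..<n}. p (lab i) = i}" and ?G = "{i \<in> {..<n}. p (lab i) \<noteq> i}"
  \<comment> \<open>A point that is its own medoid is paired with another point of its cluster. The
    partner differs from the common medoid, and it determines the cluster and thereby the medoid, so
    the pairing is injective.\<close>
  obtain f where f: "\<And>i. i < n \<Longrightarrow> f i < n \<and> f i \<noteq> i \<and> lab (f i) = lab i" using two by metis
  have "inj_on f ?F"
  proof (rule inj_onI)
    fix i i' assume "i \<in> ?F" "i' \<in> ?F" "f i = f i'"
    then show "i = i'" using f[of i] f[of i'] by (metis (mono_tags, lifting) lessThan_iff mem_Collect_eq)
  qed
  moreover have "f ` ?F \<subseteq> ?G"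
  proof (rule image_subsetI)
    fix i assume "i \<in> ?F"
    then show "f i \<in> ?G" using f[of i] by auto
  qed
  ultimately have "card ?F \<le> card ?G" by (rule card_inj_on_le) simp
  moreover have "card ?F + card ?G = n"
    by (subst card_Un_disjoint[symmetric]) (auto intro: arg_cong[where f = card, of _ "{..<n}", simplified])
  ultimately have "n \<le> 2 * card ?G" by simp
  then have "real n * \<delta> \<le> (2 * card ?G) * \<delta>" using \<delta> by (intro mult_right_mono) (simp_all flip: of_nat_mult)
  also have "\<dots> = 2 * (\<Sum>i\<in>?G. \<delta>)" by simp
  also have "(\<Sum>i\<in>?G. \<delta>) \<le> (\<Sum>i\<in>?G. edist d (P i) (P (p (lab i))))"
  proof (rule sum_mono)
    fix i assume "i \<in> ?G"
    then show "\<delta> \<le> edist d (P i) (P (p (lab i)))" using M unfolding medoids_def by (intro sep) auto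
  qed
  also have "\<dots> \<le> (\<Sum>i<n. edist d (P i) (P (p (lab i))))" by (rule sum_mono2) auto
  finally show ?thesis by simp
qed

section \<open>Fair clusterings in terms of excess and groups\<close>

lemma (in fairness) balance_excess:
  assumes "finite D" "D \<noteq> {}" and col: "\<And>i. i \<in> D \<Longrightarrow> col i = (if red i then 1 else 0)"
  shows "real b / real r \<le> balance red D \<longleftrightarrow> excess (card {i \<in> D. col i = 0}) (card {i \<in> D. col i = 1}) = 0"
proof -
  have sets: "{i \<in> D. red i} = {i \<in> D. col i = 1}" "{i \<in> D. \<not> red i} = {i \<in> D. col i = 0}"
    using col by (auto split: if_splits)
  define R where "R = card {i \<in> D. col i = 1}"
  define B where "B = card {i \<in> D. col i = 0}"
  have "col i = 0 \<or> col i = 1" if "i \<in> D" for i using col[OF that] by (cases "red i") simp_all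
  then have "{i \<in> D. col i = 1} \<union> {i \<in> D. col i = 0} = D" by blast
  then have "R + B = card D"
    unfolding R_def B_def using assms(1) by (subst card_Un_disjoint[symmetric]) auto
  then have pos: "R + B \<noteq> 0" using assms(1,2) by simp
  have r: "0 < b" "0 < r" using b_pos b_le_r by simp_all
  have "real b / real r \<le> min (real R / real B) (real B / real R) \<longleftrightarrow> b * B \<le> r * R \<and> b * R \<le> r * B"
  proof (cases "R = 0 \<or> B = 0")
    case True
    \<comment> \<open>For a nonempty one-colored set the convention \<open>x / 0 = 0\<close> makes
      the balance 0, and its excess is positive: both sides fail.\<close>
    then show ?thesis using pos r by (auto simp: field_simps divide_le_0_iff)
  next
    case False
    then have "real b / real r \<le> real R / real B \<longleftrightarrow> real (b * B) \<le> real (r * R)"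
      "real b / real r \<le> real B / real R \<longleftrightarrow> real (b * R) \<le> real (r * B)"
      using r by (simp_all add: field_simps)
    then show ?thesis by (simp only: min.bounded_iff of_nat_le_iff) 
  qed
  then show ?thesis
    unfolding balance_def Let_def sets R_def[symmetric] B_def[symmetric] excess_0_iff by blast
qed

lemma (in fairness) fair_clustering_excess:
  assumes "fair_clustering r b n k red lab" and col: "\<And>i. i < n \<Longrightarrow> col i = (if red i then 1 else 0)" and c: "c \<in> lab ` {..<n}"
  shows "excess (card {i \<in> {..<n}. lab i = c \<and> col i = 0}) (card {i \<in> {..<n}. lab i = c \<and> col i = 1}) = 0"
proof -
  have "cluster n lab c \<noteq> {}" "c < k" using c assms(1) by (auto simp: cluster_def fair_clustering_def clustering_def)
  then have "real b / real r \<le> balance red (cluster n lab c)" using assms(1) by (simp add: fair_clustering_def)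
  moreover have "finite (cluster n lab c)" by (simp add: cluster_def)
  ultimately have "excess (card {i \<in> cluster n lab c. col i = 0}) (card {i \<in> cluster n lab c. col i = 1}) = 0"
    using balance_excess[of "cluster n lab c" red] \<open>cluster n lab c \<noteq> {}\<close> col by (auto simp: cluster_def)
  then show ?thesis by (simp add: cluster_def conj_assoc)
qed

text \<open>A cluster with a single point would have excess \<open>b\<close>, which is
  positive.\<close>

lemma (in fairness) fair_clustering_two:
  assumes F: "fair_clustering r b n k red lab" and col: "\<And>i. i < n \<Longrightarrow> col i = (if red i then 1 else 0)" and i: "i < n"
  shows "\<exists>i'<n. i' \<noteq> i \<and> lab i' = lab i"
proof (rule ccontr)
  assume "\<not> ?thesis"
  then have *: "{i' \<in> {..<n}. lab i' = lab i \<and> Q i'} = (if Q i then {i} else {})" for Q using i by auto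
  have "excess (card {i' \<in> {..<n}. lab i' = lab i \<and> col i' = 0}) (card {i' \<in> {..<n}. lab i' = lab i \<and> col i' = 1}) = 0"
    by (rule fair_clustering_excess[OF F col]) (use i in auto)
  then show False unfolding * using b_pos col_less[of i] by (auto simp: excess_def split: if_splits)
qed

text \<open>Labels are constant on groups, so every cluster is a union of balanced groups, and
  excess is subadditive. No relation between groups and clusters beyond this is needed.\<close>

lemma (in fairness) fair_clustering_groups:
  assumes G: "groups {..<n} (\<lambda>_. 0) rep" "bad {..<n} rep = {}" and col: "\<And>i. i < n \<Longrightarrow> col i = (if red i then 1 else 0)"
    and lab: "clustering n k lab"
  shows "fair_clustering r b n k red (\<lambda>i. lab (rep i))"
  unfolding fair_clustering_def
proof (intro conjI allI impI)
  have rep: "rep i \<in> heads {..<n} rep" if "i < n" for i using groupsD(1)[OF G(1)] that by simp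
  then show "clustering n k (\<lambda>i. lab (rep i))" using lab by (auto simp: clustering_def heads_def)
  fix c assume "cluster n (\<lambda>i. lab (rep i)) c \<noteq> {}"
  let ?C = "cluster n (\<lambda>i. lab (rep i)) c" and ?L = "{l \<in> heads {..<n} rep. lab l = c}"
  have "card {i \<in> ?C. col i = a} = (\<Sum>l\<in>?L. colcount rep {..<n} l a)" for a
  proof -
    have "{i \<in> ?C. col i = a} = (\<Union>l\<in>?L. {i \<in> {..<n}. rep i = l \<and> col i = a})"
      using rep by (auto simp: cluster_def)
    moreover have "card (\<Union>l\<in>?L. {i \<in> {..<n}. rep i = l \<and> col i = a}) = (\<Sum>l\<in>?L. card {i \<in> {..<n}. rep i = l \<and> col i = a})"
      by (rule card_UN_disjoint) (auto simp: heads_def)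
    ultimately show ?thesis by (simp add: colcount_def)
  qed
  moreover have "excess (\<Sum>l\<in>?L. colcount rep {..<n} l 0) (\<Sum>l\<in>?L. colcount rep {..<n} l 1) \<le> (\<Sum>l\<in>?L. cell_excess rep {..<n} l)"
    unfolding cell_excess_def by (rule excess_sum) (simp add: heads_def)
  moreover have "(\<Sum>l\<in>?L. cell_excess rep {..<n} l) = 0"
    using G(2) by (intro sum.neutral) (auto simp: bad_def)
  ultimately have "excess (card {i \<in> ?C. col i = 0}) (card {i \<in> ?C. col i = 1}) = 0" by simp
  then show "real b / real r \<le> balance red ?C"
    using balance_excess[of ?C red] \<open>?C \<noteq> {}\<close> col by (auto simp: cluster_def)
qed

text \<open>Each point goes to its representative and then to the center of the latter. The second
  leg is counted once for every member of the group, hence at most \<open>r + b\<close>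
  times.\<close>

lemma (in fairness) cost_groups:
  assumes G: "groups {..<n} (\<lambda>_. 0) rep"
  shows "cost n d P Z (\<lambda>i. lab (rep i)) \<le> (\<Sum>i<n. edist d (P i) (P (rep i))) + (r + b) * cost n d P Z lab"
proof -
  let ?f = "\<lambda>l. edist d (P l) (Z (lab l))"
  have rep: "rep i < n" if "i < n" for i using groupsD(1)[OF G] that by (auto simp: heads_def)
  have "cost n d P Z (\<lambda>i. lab (rep i)) \<le> (\<Sum>i<n. edist d (P i) (P (rep i)) + ?f (rep i))"
    unfolding cost_def by (intro sum_mono edist_triangle)
  also have "\<dots> = (\<Sum>i<n. edist d (P i) (P (rep i))) + (\<Sum>i<n. ?f (rep i))" by (simp add: sum.distrib)
  also have "(\<Sum>i<n. ?f (rep i)) = (\<Sum>l<n. \<Sum>i\<in>{i \<in> {..<n}. rep i = l}. ?f (rep i))"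
    by (rule sum.group[symmetric]) (use rep in auto)
  also have "\<dots> = (\<Sum>l<n. card {i \<in> {..<n}. rep i = l} * ?f l)"
    by (intro sum.cong) auto
  also have "\<dots> \<le> (\<Sum>l<n. (r + b) * ?f l)"
  proof (intro sum_mono mult_right_mono)
    fix l assume "l \<in> {..<n}"
    have "card {i \<in> {..<n}. rep i = l} \<le> r + b"
    proof (cases "l \<in> heads {..<n} rep")
      case False
      then have "{i \<in> {..<n}. rep i = l} = {}" using groupsD(1)[OF G] by auto
      then show ?thesis by (simp only: card.empty zero_le)
    qed (rule groupsD(3)[OF G])
    then show "real (card {i \<in> {..<n}. rep i = l}) \<le> real (r + b)" by simp
  qed simp
  also have "\<dots> = (r + b) * cost n d P Z lab" by (simp add: cost_def sum_distrib_left)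
  finally show ?thesis by simp
qed

text \<open>
  \<open>crd\<close> lists the coordinates, relative to the first point and in units of \<open>2M/2^H\<close>, rounded down.
\<close>

locale quantized = grid +
  fixes P :: "nat \<Rightarrow> vector" and M \<delta> :: real and e :: nat
  assumes lower: "k < n * d \<Longrightarrow> real (crd k) * (2 * M) \<le> (P (k div d) (k mod d) - P 0 (k mod d) + M) * 2 ^ H"
    and upper: "k < n * d \<Longrightarrow> (P (k div d) (k mod d) - P 0 (k mod d) + M) * 2 ^ H \<le> (real (crd k) + 1) * (2 * M)"
    and M_def: "M = (\<Sum>k<n * d. \<bar>P (k div d) (k mod d) - P 0 (k mod d)\<bar>)"
    and resolution: "2 * real n ^ (3 * e + 1) \<le> 2 ^ H"
    and separated: "i < n \<Longrightarrow> i' < n \<Longrightarrow> i \<noteq> i' \<Longrightarrow> \<delta> \<le> edist d (P i) (P i')"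
    and spread: "i < n \<Longrightarrow> i' < n \<Longrightarrow> edist d (P i) (P i') \<le> real n ^ e * \<delta>"
    and \<delta>_pos: "0 < \<delta>" and n_pos: "0 < n"
begin

definition width :: real where "width = 2 * M / 2 ^ H"

lemma M_nonneg: "0 \<le> M"
  unfolding M_def by (rule sum_nonneg) simp

lemma width_nonneg: "0 \<le> width"
  unfolding width_def using M_nonneg by simp

lemma crd_coordinate:
  assumes "i < n" "j < d"
  shows "real (crd (i * d + j)) * width \<le> P i j - P 0 j + M" "P i j - P 0 j + M \<le> (real (crd (i * d + j)) + 1) * width"
proof -
  have "(i * d + j) div d = i" "(i * d + j) mod d = j" using assms by simp_all
  then show "real (crd (i * d + j)) * width \<le> P i j - P 0 j + M" "P i j - P 0 j + M \<le> (real (crd (i * d + j)) + 1) * width"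
    using lower[OF index_less[OF assms]] upper[OF index_less[OF assms]] unfolding width_def by (simp_all add: field_simps)
qed

lemma edist_cell:
  assumes "t \<le> 2 ^ H" "i < n" "i' < n" "cell m t i = cell m t i'"
  shows "edist d (P i) (P i') \<le> 2 ^ m * (sqrt d * width)"
proof -
  have "\<bar>P i j - P i' j\<bar> \<le> 2 ^ m * width" if j: "j < d" for j
  proof -
    let ?u = "crd (i * d + j)" and ?v = "crd (i' * d + j)"
    have "?u + 1 \<le> ?v + 2 ^ m" "?v + 1 \<le> ?u + 2 ^ m"
      using cell_close[OF assms(2,3) j assms(1,4)] cell_close[OF assms(3,2) j assms(1) assms(4)[symmetric]] by simp_all
    then have "real (?u + 1) \<le> real (?v + 2 ^ m)" "real (?v + 1) \<le> real (?u + 2 ^ m)" by (simp_all only: of_nat_le_iff)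
    then have "real (?u + 1) * width \<le> real (?v + 2 ^ m) * width" "real (?v + 1) * width \<le> real (?u + 2 ^ m) * width"
      using width_nonneg by (simp_all only: mult_right_mono)
    then show ?thesis
      using crd_coordinate[OF assms(2) j] crd_coordinate[OF assms(3) j] by (simp add: abs_le_iff algebra_simps)
  qed
  then have "edist d (P i) (P i') \<le> sqrt d * (2 ^ m * width)" by (rule edist_le_sqrt)
  then show ?thesis by (simp add: mult.left_commute)
qed

lemma absdiff_width:
  assumes "i < n" "i' < n" "j < d"
  shows "absdiff (crd (i * d + j)) (crd (i' * d + j)) * width \<le> \<bar>P i j - P i' j\<bar> + width"
proof -
  have "real (absdiff x y) = \<bar>real x - real y\<bar>" for x y by (simp add: absdiff_def)
  then have "absdiff (crd (i * d + j)) (crd (i' * d + j)) * width = \<bar>real (crd (i * d + j)) * width - real (crd (i' * d + j)) * width\<bar>"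
    using width_nonneg by (simp add: abs_mult flip: left_diff_distrib)
  then show ?thesis using crd_coordinate[OF assms(1,3)] crd_coordinate[OF assms(2,3)]
    unfolding distrib_right mult_1 by linarith
qed

text \<open>\<open>M\<close> sums all coordinate deviations because this takes one pass and still
  bounds each of them. Its overestimate of the extent is at most polynomial and is absorbed by the
  resolution.\<close>

lemma M_le: "M \<le> real n * (real d * (real n ^ e * \<delta>))"
proof -
  have "M = (\<Sum>i<n. \<Sum>j<d. \<bar>P i j - P 0 j\<bar>)"
  proof -
    have "M = (\<Sum>k\<in>(\<lambda>(i, j). i * d + j) ` ({..<n} \<times> {..<d}). \<bar>P (k div d) (k mod d) - P 0 (k mod d)\<bar>)"
      unfolding M_def
    proof (rule sum.cong)
      show "{..<n * d} = (\<lambda>(i, j). i * d + j) ` ({..<n} \<times> {..<d})"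
      proof (intro equalityI subsetI)
        fix k assume "k \<in> {..<n * d}"
        then have "k div d < n" "k mod d < d" using d_pos by (simp_all add: less_mult_imp_div_less)
        then show "k \<in> (\<lambda>(i, j). i * d + j) ` ({..<n} \<times> {..<d})" by (intro image_eqI[of _ _ "(k div d, k mod d)"]) auto
      qed (use index_less in auto)
    qed simp
    also have "\<dots> = (\<Sum>(i, j)\<in>{..<n} \<times> {..<d}. \<bar>P i j - P 0 j\<bar>)"
    proof (subst sum.reindex)
      show "inj_on (\<lambda>(i, j). i * d + j) ({..<n} \<times> {..<d})"
      proof (rule inj_onI, clarify)
        fix i j i' j' assume *: "j < d" "j' < d" "i * d + j = i' * d + j'"
        have "i = (i * d + j) div d" "j = (i * d + j) mod d" using *(1) by simp_all
        then show "i = i' \<and> j = j'" unfolding *(3) using *(2) by simp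
      qed
    qed (auto intro: sum.cong)
    finally show ?thesis by (simp add: sum.cartesian_product)
  qed
  also have "\<dots> \<le> (\<Sum>i<n. real d * (real n ^ e * \<delta>))"
  proof (rule sum_mono)
    fix i assume "i \<in> {..<n}"
    then have "(\<Sum>j<d. \<bar>P i j - P 0 j\<bar>) \<le> sqrt d * (real n ^ e * \<delta>)"
      using sum_abs_le_edist[of "P i" "P 0" d] mult_left_mono[OF spread[of i 0], of "sqrt d"] n_pos by simp
    also have "\<dots> \<le> real d * (real n ^ e * \<delta>)"
      using d_pos \<delta>_pos real_le_lsqrt[of "real d" "real d"] by (intro mult_right_mono) (simp_all add: power2_eq_square)
    finally show "(\<Sum>j<d. \<bar>P i j - P 0 j\<bar>) \<le> real d * (real n ^ e * \<delta>)" .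
  qed
  finally show ?thesis by simp
qed

text \<open>The origin of the exponent \<open>3 * e + 1\<close>: the bound on \<open>M\<close>
  contributes a factor \<open>n\<close>, a factor \<open>d\<close> and the aspect ratio, the l1-norm
  contributes another \<open>d\<close>, and \<open>d\<close> is at most \<open>n ^ e\<close>
  here.\<close>

lemma d_width:
  assumes "real d \<le> real n ^ e"
  shows "real d * width \<le> \<delta>"
proof -
  have "real d * (2 * M) \<le> 2 * (real n ^ e * (real n * (real n ^ e * (real n ^ e * \<delta>))))"
  proof -
    have "M \<le> real n * (real n ^ e * (real n ^ e * \<delta>))"
      using M_le mult_left_mono[OF mult_right_mono[OF assms, of "real n ^ e * \<delta>"], of "real n"] \<delta>_pos by simp
    then show ?thesis using mult_mono[OF assms _ _ M_nonneg, of "real n * (real n ^ e * (real n ^ e * \<delta>))"] by simp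
  qed
  also have "\<dots> = 2 * real n ^ (3 * e + 1) * \<delta>"
    by (simp add: power_add power_mult power3_eq_cube numeral_3_eq_3)
  also have "\<dots> \<le> 2 ^ H * \<delta>" using resolution \<delta>_pos by simp
  finally show ?thesis by (simp add: width_def field_simps)
qed

text \<open>Rounding adds at most \<open>width\<close> per axis, in total
  \<open>d * width \<le> \<delta>\<close>, which is no more than the distance of two distinct
  points. It therefore costs only the factor 2.\<close>

lemma gridcost_le:
  assumes small: "real d \<le> real n ^ e" and \<pi>: "\<And>i. i < n \<Longrightarrow> \<pi> i < n"
  shows "gridcost \<pi> * width \<le> 2 * sqrt d * (\<Sum>i<n. edist d (P i) (P (\<pi> i)))"
proof -
  have "(\<Sum>j<d. absdiff (crd (i * d + j)) (crd (\<pi> i * d + j)) * width) \<le> 2 * sqrt d * edist d (P i) (P (\<pi> i))" if i: "i < n" for i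
  proof (cases "\<pi> i = i")
    case True
    then show ?thesis by (simp add: absdiff_def)
  next
    case False
    have "(\<Sum>j<d. absdiff (crd (i * d + j)) (crd (\<pi> i * d + j)) * width) \<le> (\<Sum>j<d. \<bar>P i j - P (\<pi> i) j\<bar> + width)"
      by (intro sum_mono absdiff_width i \<pi>) auto
    also have "\<dots> = (\<Sum>j<d. \<bar>P i j - P (\<pi> i) j\<bar>) + real d * width" by (simp add: sum.distrib)
    also have "\<dots> \<le> sqrt d * edist d (P i) (P (\<pi> i)) + \<delta>" using sum_abs_le_edist d_width[OF small] by (intro add_mono)
    finally have *: "(\<Sum>j<d. absdiff (crd (i * d + j)) (crd (\<pi> i * d + j)) * width) \<le> sqrt d * edist d (P i) (P (\<pi> i)) + \<delta>" .
    have "\<delta> \<le> edist d (P i) (P (\<pi> i))" using separated[OF i \<pi>[OF i]] False by simp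
    also have "\<dots> \<le> sqrt d * edist d (P i) (P (\<pi> i))" using d_pos mult_right_mono[of 1 "sqrt d" "edist d (P i) (P (\<pi> i))"] by simp
    finally show ?thesis using * by simp
  qed
  then have "(\<Sum>i<n. \<Sum>j<d. absdiff (crd (i * d + j)) (crd (\<pi> i * d + j)) * width) \<le> (\<Sum>i<n. 2 * sqrt d * edist d (P i) (P (\<pi> i)))"
    by (intro sum_mono) simp
  then show ?thesis by (simp add: gridcost_def sum_distrib_left sum_distrib_right)
qed

text \<open>Relative to the cost \<open>E\<close> of the medoids, the initial moves contribute 2.
  The term \<open>2 * weight\<close> contributes \<open>8 * r * d * (H + 1)\<close>: 2 from the term
  itself, \<open>2 * r * (H + 1)\<close> from the best shift, 2 from rounding, and \<open>d\<close>
  from using \<open>sqrt d\<close> twice. Passing from \<open>E\<close> to the cost of the solution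
  doubles both.\<close>

lemma representatives_cost:
  assumes best: "\<And>t'. t' < 2 ^ H \<Longrightarrow> weight 0 t \<le> weight 0 t'"
    and D: "(\<Sum>i<n. edist d (P i) (P (rep i))) \<le> kappa * (sqrt d * width) * (n + 2 * weight 0 t)"
    and rep: "\<And>i. i < n \<Longrightarrow> rep i < n"
    and F: "fair_clustering r b n k red lab" and col: "\<And>i. i < n \<Longrightarrow> col i = (if red i then 1 else 0)"
  shows "(\<Sum>i<n. edist d (P i) (P (rep i))) \<le> kappa * (4 + 16 * r * d * (H + 1)) * cost n d P Z lab"
proof -
  obtain p where p: "medoids n d P Z lab p" using ex_medoids by blast
  define E where "E = (\<Sum>i<n. edist d (P i) (P (p (lab i))))"
  have E: "E \<le> 2 * cost n d P Z lab" unfolding E_def by (rule medoids_cost[OF p])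
  have E0: "0 \<le> E" unfolding E_def by (rule sum_nonneg) simp
  have nE: "n * \<delta> \<le> 2 * E"
    unfolding E_def by (rule medoids_lower_bound[OF p fair_clustering_two[OF F col] separated]) (use \<delta>_pos in auto)
  have pn: "p (lab i) < n" if "i < n" for i using p that by (simp add: medoids_def)
  have kap: "1 \<le> real kappa" by (simp add: kappa_def)
  have "(\<Sum>i<n. edist d (P i) (P (rep i))) \<le> kappa * (2 + 8 * r * d * (H + 1)) * E"
  proof (cases "real d \<le> real n ^ e")
    case True
    have w: "weight 0 t \<le> (H + 1) * (2 * r * gridcost (\<lambda>i. p (lab i)))"
      by (rule weight_best_shift[where lab = lab and p = p, OF best]) (use fair_clustering_excess[OF F col] pn in auto)
    have "sqrt d * width * n \<le> real d * width * n"
      using d_pos width_nonneg real_le_lsqrt[of "real d" "real d"]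
      by (intro mult_right_mono) (simp_all add: power2_eq_square)
    also have "\<dots> \<le> \<delta> * n" using d_width[OF True] by (intro mult_right_mono) simp_all
    finally have 1: "sqrt d * width * n \<le> 2 * E" using nE by (simp add: mult.commute)
    have "sqrt d * width * weight 0 t \<le> sqrt d * width * real ((H + 1) * (2 * r * gridcost (\<lambda>i. p (lab i))))"
      using w width_nonneg by (intro mult_left_mono) (simp_all only: of_nat_le_iff mult_nonneg_nonneg real_sqrt_ge_zero of_nat_0_le_iff)
    also have "\<dots> = sqrt d * (2 * r * (H + 1)) * (gridcost (\<lambda>i. p (lab i)) * width)" by (simp add: algebra_simps)
    also have "\<dots> \<le> sqrt d * (2 * r * (H + 1)) * (2 * sqrt d * E)"
      unfolding E_def by (intro mult_left_mono gridcost_le True pn) simp_all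
    also have "\<dots> = (sqrt d * sqrt d) * (4 * r * (H + 1)) * E" by (simp add: algebra_simps del: real_sqrt_mult_self)
    also have "\<dots> = d * (4 * r * (H + 1)) * E" by simp
    finally have "sqrt d * width * (n + 2 * weight 0 t) \<le> (2 + 8 * r * d * (H + 1)) * E"
      using 1 by (simp add: algebra_simps)
    then have "kappa * (sqrt d * width * (n + 2 * weight 0 t)) \<le> kappa * ((2 + 8 * r * d * (H + 1)) * E)"
      using kap by (intro mult_left_mono) simp_all
    then show ?thesis using D by (simp only: mult.assoc of_nat_mult)
  next
    case False
    \<comment> \<open>All distances are at most \<open>n ^ e * \<delta>\<close>, hence below
      \<open>d * \<delta>\<close>, and \<open>n * \<delta>\<close> is at most twice the medoid cost.
      This holds for arbitrary representatives.\<close>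
    have "(\<Sum>i<n. edist d (P i) (P (rep i))) \<le> (\<Sum>i<n. real n ^ e * \<delta>)"
      by (intro sum_mono spread) (use rep in auto)
    also have "\<dots> = real n ^ e * (n * \<delta>)" by simp
    also have "\<dots> \<le> d * (n * \<delta>)" using False \<delta>_pos by (intro mult_right_mono) simp_all
    also have "\<dots> \<le> d * (2 * E)" using nE by (intro mult_left_mono) simp_all
    also have "\<dots> = real (1 * (2 * d)) * E" by simp
    also have "\<dots> \<le> real (kappa * (2 + 8 * r * d * (H + 1))) * E"
    proof (intro mult_right_mono E0)
      have "1 * 1 \<le> r * (H + 1)" using b_pos b_le_r by (intro mult_le_mono) simp_all
      then have "2 * d \<le> 8 * d * (r * (H + 1))" using mult_le_mono2[of 1 "r * (H + 1)" "8 * d"] by simp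
      then have "2 * d \<le> 2 + 8 * r * d * (H + 1)" by (simp only: ac_simps trans_le_add2)
      then have "1 * (2 * d) \<le> kappa * (2 + 8 * r * d * (H + 1))" by (intro mult_le_mono) (simp add: kappa_def)
      then show "real (1 * (2 * d)) \<le> real (kappa * (2 + 8 * r * d * (H + 1)))" by (simp only: of_nat_le_iff)
    qed
    finally show ?thesis .
  qed
  also have "\<dots> \<le> kappa * (2 + 8 * r * d * (H + 1)) * (2 * cost n d P Z lab)"
    using E by (intro mult_left_mono) simp_all
  finally show ?thesis by (simp add: algebra_simps)
qed

end

section \<open>Rounding the coordinates\<close>

abbreviation rel_coord :: rexp where
  "rel_coord \<equiv> RSub (RGet ''points'' (var ''q'')) (RGet ''points'' (NGet ''co'' (var ''q'')))"

text \<open>Counting yields the quotients and remainders by \<open>d\<close> in the absence of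
  division.\<close>

definition index_points :: com where
  "index_points = Seq (Seq (''u'' ::= NConst 0) (''c'' ::= NConst 0))
     (For ''q'' (var ''N'') (seqs [NSet ''pt'' (var ''q'') (var ''u''), NSet ''co'' (var ''q'') (var ''c''), incr ''c'',
        Cond (NLess (var ''c'') (var ''d'')) Skip (Seq (''c'' ::= NConst 0) (incr ''u''))]))"

text \<open>The expression \<open>sqrt (x * x)\<close> computes the absolute value.\<close>

definition measure_extent :: com where
  "measure_extent = Seq (RSet ''M'' (NConst 0) (ROfNat (NConst 0)))
     (For ''q'' (var ''N'') (RSet ''M'' (NConst 0) (RAdd (RGet ''M'' (NConst 0)) (RSqrt (RMul rel_coord rel_coord)))))"

text \<open>The power is formed in the reals, which can be multiplied. The exponent is fixed in the
  program text, so one evaluation takes constant time.\<close>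

primrec n_power :: "nat \<Rightarrow> rexp" where
  "n_power 0 = ROfNat (NConst 1)"
| "n_power (Suc m) = RMul (ROfNat (var ''n'')) (n_power m)"

definition coarse :: "nat \<Rightarrow> bexp" where
  "coarse a = RLess (ROfNat (NGet ''pw'' (var ''H''))) (RMul (ROfNat (NConst 2)) (n_power (3 * a + 1)))"

definition choose_resolution :: "nat \<Rightarrow> com" where
  "choose_resolution a = Seq (seqs [''H'' ::= NConst 0, NSet ''pw'' (NConst 0) (NConst 1), NSet ''pw'' (NConst 1) (NConst 2)])
     (While (coarse a) (Seq (incr ''H'') (NSet ''pw'' (var ''H'' \<oplus> NConst 1) (NGet ''pw'' (var ''H'') \<oplus> NGet ''pw'' (var ''H'')))))"

definition row_offsets :: com where
  "row_offsets = Seq (''x'' ::= NConst 0) (For ''j'' (var ''H'' \<oplus> NConst 2)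
     (Seq (NSet ''ON'' (var ''j'') (var ''x'')) (''x'' ::= var ''x'' \<oplus> var ''N'' \<oplus> NConst 1)))"

text \<open>Each next power of the base \<open>2 ^ (H + 1)\<close> arises by \<open>H + 1\<close>
  doublings, so the powers for all axes take time proportional to
  \<open>d * (H + 1)\<close>.\<close>

definition base_powers :: com where
  "base_powers = Seq (''x'' ::= NConst 1) (For ''j'' (var ''d'')
     (Seq (NSet ''BW'' (var ''j'') (var ''x'')) (For ''m'' (var ''H'' \<oplus> NConst 1) (''x'' ::= var ''x'' \<oplus> var ''x''))))"

definition digit_weights :: com where
  "digit_weights = For ''q'' (var ''N'') (NSet ''W'' (var ''q'') (NGet ''BW'' (NGet ''co'' (var ''q''))))"

definition scale_points :: com where
  "scale_points = For ''q'' (var ''N'') (Seq (NSet ''y'' (var ''q'') (NGet ''pw'' (var ''H'')))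
     (RSet ''Z'' (var ''q'') (RMul (RAdd rel_coord (RGet ''M'' (NConst 0))) (ROfNat (NGet ''pw'' (var ''H''))))))"

abbreviation bit_size :: rexp where
  "bit_size \<equiv> RMul (RAdd (RGet ''M'' (NConst 0)) (RGet ''M'' (NConst 0))) (ROfNat (NGet ''pw'' (var ''m'')))"

text \<open>Reals cannot be converted to naturals, so the quotient of \<open>Z\<close> by
  \<open>2 * M\<close> is developed bit by bit from the top: compare, subtract, and add the power of
  two to \<open>y\<close>.\<close>

definition round_bit :: com where
  "round_bit = Seq (''m'' ::= (var ''H'' \<ominus> NConst 1) \<ominus> var ''j'')
     (For ''q'' (var ''N'') (Cond (RLess (RGet ''Z'' (var ''q'')) bit_size) Skip
        (Seq (NSet ''y'' (var ''q'') (NGet ''y'' (var ''q'') \<oplus> NGet ''pw'' (var ''m'')))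
           (RSet ''Z'' (var ''q'') (RSub (RGet ''Z'' (var ''q'')) bit_size)))))"

definition round_points :: com where
  "round_points = Seq scale_points (For ''j'' (var ''H'') round_bit)"

definition prelude :: "nat \<Rightarrow> com" where
  "prelude a = Seq index_points (Seq measure_extent (Seq (choose_resolution a) (Seq row_offsets
     (Seq base_powers (Seq digit_weights round_points)))))"

lemma rval_n_power [simp]: "rval s (n_power m) = real (fst s ''n'' 0) ^ m"
  by (induction m) simp_all

lemma rcost_n_power: "rcost (n_power m) = 2 + 4 * m"
  by (induction m) simp_all

definition loaded :: "nat \<Rightarrow> nat \<Rightarrow> (nat \<Rightarrow> vector) \<Rightarrow> store \<Rightarrow> bool" where
  "loaded n d P s \<longleftrightarrow> fst s ''n'' 0 = n \<and> fst s ''d'' 0 = d \<and> fst s ''N'' 0 = n * d \<and> snd s ''points'' = flatten n d P"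

lemma loaded_same:
  assumes "loaded n d P s" "same X V s s'" "X \<inter> {''n'', ''d'', ''N''} = {}" "''points'' \<notin> V"
  shows "loaded n d P s'"
proof -
  have "fst s' ''n'' = fst s ''n''" "fst s' ''d'' = fst s ''d''" "fst s' ''N'' = fst s ''N''"
    by (rule sameD(1)[OF assms(2)]; use assms(3) in blast)+
  then show ?thesis using assms(1) sameD(2)[OF assms(2,4)] by (simp add: loaded_def)
qed

section \<open>Correctness of the rounding program\<close>

definition relative :: "nat \<Rightarrow> (nat \<Rightarrow> vector) \<Rightarrow> nat \<Rightarrow> real" where
  "relative d P k = P (k div d) (k mod d) - P 0 (k mod d)"

definition extent :: "nat \<Rightarrow> nat \<Rightarrow> (nat \<Rightarrow> vector) \<Rightarrow> real" where
  "extent n d P = (\<Sum>k<n * d. \<bar>relative d P k\<bar>)"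

lemma relative_bounds: "k < n * d \<Longrightarrow> \<bar>relative d P k\<bar> \<le> extent n d P"
  unfolding extent_def by (rule member_le_sum) auto

context
  fixes n d :: nat and P :: "nat \<Rightarrow> vector"
  assumes d: "1 \<le> d"
begin

lemma rval_rel_coord:
  assumes "loaded n d P s" "fst s ''q'' 0 = q" "q < n * d" "fst s ''co'' q = q mod d"
  shows "rval s rel_coord = relative d P q"
proof -
  have "q mod d < d" using d by simp
  moreover have "d \<le> n * d" using assms(3) by (cases n) auto
  ultimately have "q mod d < n * d" by linarith
  then show ?thesis using assms d by (simp add: loaded_def flatten_def relative_def)
qed

lemma run_index_points:
  assumes "loaded n d P s"
  shows "run index_points s (100 * (n * d + 1)) (\<lambda>s'. (\<forall>q<n * d. fst s' ''pt'' q = q div d \<and> fst s' ''co'' q = q mod d) \<and>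
     same {''u'', ''c'', ''q'', ''pt'', ''co''} {} s s')"
proof -
  have "run (Seq (''u'' ::= NConst 0) (''c'' ::= NConst 0)) s 10 (\<lambda>s'. fst s' ''u'' 0 = 0 \<and> fst s' ''c'' 0 = 0 \<and> same {''u'', ''c''} {} s s')"
    by (rule run_loopfree) (simp_all add: same_def)
  then obtain t1 s1 where 1: "exec (Seq (''u'' ::= NConst 0) (''c'' ::= NConst 0)) s t1 s1" "t1 \<le> 10"
    "fst s1 ''u'' 0 = 0" "fst s1 ''c'' 0 = 0" "same {''u'', ''c''} {} s s1" by (elim runE) blast
  have l1: "loaded n d P s1" by (rule loaded_same[OF assms 1(5)]) simp_all
  have "run (For ''q'' (var ''N'') (seqs [NSet ''pt'' (var ''q'') (var ''u''), NSet ''co'' (var ''q'') (var ''c''), incr ''c'',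
        Cond (NLess (var ''c'') (var ''d'')) Skip (Seq (''c'' ::= NConst 0) (incr ''u''))])) s1 (80 * (n * d + 1))
     (\<lambda>s'. (\<forall>q<n * d. fst s' ''pt'' q = q div d \<and> fst s' ''co'' q = q mod d) \<and> same {''u'', ''c'', ''q'', ''pt'', ''co''} {} s1 s')"
    unfolding seqs.simps if_False list.simps
  proof (rule run_For_le[where B = "n * d" and T = 60 and
        I = "\<lambda>i s'. fst s' ''u'' 0 = i div d \<and> fst s' ''c'' 0 = i mod d \<and> (\<forall>q<i. fst s' ''pt'' q = q div d \<and> fst s' ''co'' q = q mod d)"], goal_cases)
    case (5 i s')
    have dd: "fst s' ''d'' 0 = d" using l1 sameD(1)[OF 5(2), of "''d''"] by (simp add: loaded_def)
    have "i mod d < d" using d by simp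
    then show ?case
      by (intro run_loopfree) (use 5(3,4) dd in \<open>auto simp: less_Suc_eq div_Suc mod_Suc\<close>)
  qed (use l1 1(3,4) in \<open>auto simp: loaded_def same_def\<close>)
  then obtain t2 s2 where 2: "exec (For ''q'' (var ''N'') (seqs [NSet ''pt'' (var ''q'') (var ''u''), NSet ''co'' (var ''q'') (var ''c''), incr ''c'',
        Cond (NLess (var ''c'') (var ''d'')) Skip (Seq (''c'' ::= NConst 0) (incr ''u''))])) s1 t2 s2" "t2 \<le> 80 * (n * d + 1)"
     "\<forall>q<n * d. fst s2 ''pt'' q = q div d \<and> fst s2 ''co'' q = q mod d" "same {''u'', ''c'', ''q'', ''pt'', ''co''} {} s1 s2"
    by (elim runE) blast
  have "same {''u'', ''c'', ''q'', ''pt'', ''co''} {} s s2"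
    by (rule same_mono[OF same_trans[OF 1(5) 2(4)]]) auto
  then show ?thesis
    unfolding index_points_def by (intro runI[OF exec.Seq[OF 1(1) 2(1)]]) (use 1(2) 2(2,3) in auto)
qed

lemma run_measure_extent:
  assumes "loaded n d P s" and co: "\<And>q. q < n * d \<Longrightarrow> fst s ''co'' q = q mod d"
  shows "run measure_extent s (100 * (n * d + 1)) (\<lambda>s'. snd s' ''M'' 0 = extent n d P \<and> same {''q''} {''M''} s s')"
proof -
  have "run (RSet ''M'' (NConst 0) (ROfNat (NConst 0))) s 10 (\<lambda>s'. snd s' ''M'' 0 = 0 \<and> same {} {''M''} s s')"
    by (rule run_loopfree) (simp_all add: same_def)
  then obtain t1 s1 where 1: "exec (RSet ''M'' (NConst 0) (ROfNat (NConst 0))) s t1 s1" "t1 \<le> 10"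
    "snd s1 ''M'' 0 = 0" "same {} {''M''} s s1" by (elim runE) blast
  have l1: "loaded n d P s1" by (rule loaded_same[OF assms(1) 1(4)]) simp_all
  have "run (For ''q'' (var ''N'') (RSet ''M'' (NConst 0) (RAdd (RGet ''M'' (NConst 0)) (RSqrt (RMul rel_coord rel_coord))))) s1 (80 * (n * d + 1))
     (\<lambda>s'. snd s' ''M'' 0 = extent n d P \<and> same {''q''} {''M''} s1 s')"
  proof (rule run_For_le[where B = "n * d" and T = 60 and I = "\<lambda>i s'. snd s' ''M'' 0 = (\<Sum>k<i. \<bar>relative d P k\<bar>)"], goal_cases)
    case (5 i s')
    have "loaded n d P s'" by (rule loaded_same[OF l1 5(2)]) simp_all
    moreover have "fst s' ''co'' i = i mod d"
      using co[OF 5(1)] sameD(1)[OF 1(4), of "''co''"] sameD(1)[OF 5(2), of "''co''"] by simp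
    ultimately have "rval s' rel_coord = relative d P i" using rval_rel_coord 5(1,3) by blast
    then show ?case using 5(4) by (intro run_loopfree) (simp_all del: rval.simps(4))
  qed (use l1 1(3) in \<open>auto simp: loaded_def same_def extent_def\<close>)
  then obtain t2 s2 where 2: "exec (For ''q'' (var ''N'') (RSet ''M'' (NConst 0) (RAdd (RGet ''M'' (NConst 0)) (RSqrt (RMul rel_coord rel_coord))))) s1 t2 s2"
     "t2 \<le> 80 * (n * d + 1)" "snd s2 ''M'' 0 = extent n d P" "same {''q''} {''M''} s1 s2" by (elim runE) blast
  have "same {''q''} {''M''} s s2" by (rule same_mono[OF same_trans[OF 1(4) 2(4)]]) auto
  then show ?thesis
    unfolding measure_extent_def by (intro runI[OF exec.Seq[OF 1(1) 2(1)]]) (use 1(2) 2(2,3) in auto)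
qed

text \<open>\<open>H\<close> is the least admissible exponent. Minimality gives the bound on
  \<open>2 ^ (H - 1)\<close> that later makes \<open>H\<close> logarithmic in
  \<open>n\<close>.\<close>

lemma run_choose_resolution:
  assumes l: "loaded n d P s"
  shows "\<exists>H. 2 * real n ^ (3 * a + 1) \<le> 2 ^ H \<and> (0 < H \<longrightarrow> 2 ^ (H - 1) < 2 * real n ^ (3 * a + 1)) \<and>
    run (choose_resolution a) s ((100 + 20 * a) * (H + 2)) (\<lambda>s'. fst s' ''H'' 0 = H \<and> (\<forall>h\<le>H + 1. fst s' ''pw'' h = 2 ^ h) \<and> same {''H'', ''pw''} {} s s')"
proof -
  define tgt where "tgt = 2 * real n ^ (3 * a + 1)"
  define H where "H = (LEAST h. tgt \<le> 2 ^ h)"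
  obtain h :: nat where "tgt < 2 ^ h" using real_arch_pow[of 2 tgt] by auto
  then have H1: "tgt \<le> 2 ^ H" unfolding H_def by (rule LeastI[of "\<lambda>h. tgt \<le> 2 ^ h", OF less_imp_le])
  have H2: "2 ^ h < tgt" if "h < H" for h using not_less_Least[of h "\<lambda>h. tgt \<le> 2 ^ h"] that unfolding H_def by simp
  let ?init = "seqs [''H'' ::= NConst 0, NSet ''pw'' (NConst 0) (NConst 1), NSet ''pw'' (NConst 1) (NConst 2)]"
  let ?body = "Seq (incr ''H'') (NSet ''pw'' (var ''H'' \<oplus> NConst 1) (NGet ''pw'' (var ''H'') \<oplus> NGet ''pw'' (var ''H'')))"
  let ?I = "\<lambda>j s'. same {''H'', ''pw''} {} s s' \<and> fst s' ''H'' 0 = j \<and> (\<forall>h\<le>j + 1. fst s' ''pw'' h = 2 ^ h)"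
  have "run ?init s 20 (?I 0)"
    by (rule run_loopfree) (auto simp: same_def le_Suc_eq)
  then obtain t1 s1 where 1: "exec ?init s t1 s1" "t1 \<le> 20" "?I 0 s1" by (elim runE) blast
  have bc: "bcost (coarse a) \<le> 20 + 12 * a" by (simp add: coarse_def rcost_n_power)
  have bv: "bval s' (coarse a) \<longleftrightarrow> 2 ^ j < tgt" if "?I j s'" for j s'
  proof -
    have "fst s' ''n'' 0 = n" using that l sameD(1)[of "{''H'', ''pw''}" "{}" s s' "''n''"] by (simp add: loaded_def)
    then show ?thesis using that by (simp add: coarse_def tgt_def)
  qed
  have "run (While (coarse a) ?body) s1 (H * (30 + bcost (coarse a) + 1) + bcost (coarse a) + 1) (?I H)"
  proof (rule run_While_count[where I = ?I])
    fix j s' assume j: "j < H" and I: "?I j s'"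
    have "run ?body s' 30 (?I (Suc j))"
      by (rule run_loopfree) (use I in \<open>auto simp: same_def le_Suc_eq\<close>)
    then show "bval s' (coarse a) \<and> run ?body s' 30 (?I (Suc j))" using bv[OF I] H2[OF j] by blast
  next
    fix s' assume I: "?I H s'"
    show "\<not> bval s' (coarse a)" unfolding bv[OF I] using H1 by simp
  qed (use 1(3) in simp_all)
  then obtain t2 s2 where 2: "exec (While (coarse a) ?body) s1 t2 s2" "t2 \<le> H * (30 + bcost (coarse a) + 1) + bcost (coarse a) + 1" "?I H s2"
    by (elim runE) blast
  have "H * (30 + bcost (coarse a) + 1) \<le> H * (60 + 20 * a)" using bc by (intro mult_le_mono2) simp
  then have "t1 + t2 \<le> (100 + 20 * a) * (H + 2)" using 1(2) 2(2) bc by (simp add: algebra_simps)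
  then have "run (choose_resolution a) s ((100 + 20 * a) * (H + 2)) (\<lambda>s'. fst s' ''H'' 0 = H \<and> (\<forall>h\<le>H + 1. fst s' ''pw'' h = 2 ^ h) \<and> same {''H'', ''pw''} {} s s')"
    unfolding choose_resolution_def by (intro runI[OF exec.Seq[OF 1(1) 2(1)]]) (use 2(3) in auto)
  then show ?thesis using H1 H2[of "H - 1"] unfolding tgt_def by (intro exI[of _ H]) auto
qed

lemma run_row_offsets:
  assumes "loaded n d P s" "fst s ''H'' 0 = H"
  shows "run row_offsets s (100 * (n * d + 1) * (H + 2)) (\<lambda>s'. (\<forall>m\<le>H + 1. fst s' ''ON'' m = m * (n * d + 1)) \<and> same {''x'', ''j'', ''ON''} {} s s')"
proof -
  let ?loop = "For ''j'' (var ''H'' \<oplus> NConst 2) (Seq (NSet ''ON'' (var ''j'') (var ''x'')) (''x'' ::= var ''x'' \<oplus> var ''N'' \<oplus> NConst 1))"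
  have "run (''x'' ::= NConst 0) s 5 (\<lambda>s'. fst s' ''x'' 0 = 0 \<and> same {''x''} {} s s')"
    by (rule run_loopfree) (simp_all add: same_def)
  then obtain t1 s1 where 1: "exec (''x'' ::= NConst 0) s t1 s1" "t1 \<le> 5" "fst s1 ''x'' 0 = 0" "same {''x''} {} s s1"
    by (elim runE) blast
  have l1: "loaded n d P s1" by (rule loaded_same[OF assms(1) 1(4)]) simp_all
  have "run ?loop s1 (40 * (H + 2 + 1)) (\<lambda>s'. (\<forall>m<H + 2. fst s' ''ON'' m = m * (n * d + 1)) \<and> same {''x'', ''j'', ''ON''} {} s1 s')"
  proof (rule run_For_le[where B = "H + 2" and T = 20 and I = "\<lambda>i s'. fst s' ''x'' 0 = i * (n * d + 1) \<and> (\<forall>m<i. fst s' ''ON'' m = m * (n * d + 1))"], goal_cases)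
    case (5 i s')
    have "fst s' ''N'' 0 = n * d" using l1 sameD(1)[OF 5(2), of "''N''"] by (simp add: loaded_def)
    then show ?case using 5(3,4) by (intro run_loopfree) (auto simp: less_Suc_eq)
  next
    case (2 s')
    then show ?case using assms(2) sameD(1)[OF 1(4), of "''H''"] sameD(1)[OF 2, of "''H''"] by simp
  qed (use 1(3) in \<open>auto simp: same_def\<close>)
  then obtain t2 s2 where 2: "exec ?loop s1 t2 s2" "t2 \<le> 40 * (H + 2 + 1)" "\<forall>m<H + 2. fst s2 ''ON'' m = m * (n * d + 1)"
     "same {''x'', ''j'', ''ON''} {} s1 s2" by (elim runE) blast
  have "same {''x'', ''j'', ''ON''} {} s s2" by (rule same_mono[OF same_trans[OF 1(4) 2(4)]]) auto
  moreover have "t1 + t2 \<le> 100 * (H + 2)" using 1(2) 2(2) by simp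
  moreover have "100 * (H + 2) \<le> 100 * (n * d + 1) * (H + 2)" by (rule mult_le_mono1) simp
  ultimately show ?thesis
    unfolding row_offsets_def by (intro runI[OF exec.Seq[OF 1(1) 2(1)]]) (use 2(3) in auto)
qed

lemma run_double_x:
  assumes "fst s ''H'' 0 = H"
  shows "run (For ''m'' (var ''H'' \<oplus> NConst 1) (''x'' ::= var ''x'' \<oplus> var ''x'')) s (30 * (H + 1 + 1))
    (\<lambda>s'. fst s' ''x'' 0 = 2 ^ (H + 1) * fst s ''x'' 0 \<and> same {''m'', ''x''} {} s s')"
proof (rule run_For_le[where B = "H + 1" and T = 10 and I = "\<lambda>i s'. fst s' ''x'' 0 = 2 ^ i * fst s ''x'' 0"], goal_cases)
  case (5 i s')
  then show ?case by (intro run_loopfree) auto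
qed (use assms in \<open>auto simp: same_def\<close>)

lemma run_base_powers:
  assumes "loaded n d P s" "fst s ''H'' 0 = H" "1 \<le> n"
  shows "run base_powers s (100 * (n * d + 1) * (H + 2)) (\<lambda>s'. (\<forall>j<d. fst s' ''BW'' j = (2 ^ (H + 1)) ^ j) \<and> same {''x'', ''j'', ''m'', ''BW''} {} s s')"
proof -
  let ?inner = "For ''m'' (var ''H'' \<oplus> NConst 1) (''x'' ::= var ''x'' \<oplus> var ''x'')"
  let ?loop = "For ''j'' (var ''d'') (Seq (NSet ''BW'' (var ''j'') (var ''x'')) ?inner)"
  have "run (''x'' ::= NConst 1) s 5 (\<lambda>s'. fst s' ''x'' 0 = 1 \<and> same {''x''} {} s s')"
    by (rule run_loopfree) (simp_all add: same_def)
  then obtain t1 s1 where 1: "exec (''x'' ::= NConst 1) s t1 s1" "t1 \<le> 5" "fst s1 ''x'' 0 = 1" "same {''x''} {} s s1"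
    by (elim runE) blast
  have l1: "loaded n d P s1" by (rule loaded_same[OF assms(1) 1(4)]) simp_all
  have dn: "d \<le> n * d" using assms(3) by simp
  have "run ?loop s1 (60 * (H + 2) * (n * d + 1)) (\<lambda>s'. (\<forall>j<d. fst s' ''BW'' j = (2 ^ (H + 1)) ^ j) \<and> same {''x'', ''j'', ''m'', ''BW''} {} s1 s')"
  proof (rule run_For_le[where B = d and T = "40 * (H + 2)" and I = "\<lambda>i s'. fst s' ''x'' 0 = (2 ^ (H + 1)) ^ i \<and> (\<forall>j<i. fst s' ''BW'' j = (2 ^ (H + 1)) ^ j)"], goal_cases)
    case (5 i s')
    have H': "fst s' ''H'' 0 = H" using assms(2) sameD(1)[OF 1(4), of "''H''"] sameD(1)[OF 5(2), of "''H''"] by simp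
    define s2 where "s2 = nwrite s' ''BW'' i (fst s' ''x'' 0)"
    have "run (NSet ''BW'' (var ''j'') (var ''x'')) s' 10 (\<lambda>s''. s'' = s2)"
      by (rule run_loopfree) (use 5(3) in \<open>simp_all add: s2_def\<close>)
    then obtain u1 where 2: "exec (NSet ''BW'' (var ''j'') (var ''x'')) s' u1 s2" "u1 \<le> 10" by (elim runE) blast
    have "fst s2 ''H'' 0 = H" using H' by (simp add: s2_def)
    from run_double_x[OF this] obtain u2 s3 where 3: "exec ?inner s2 u2 s3" "u2 \<le> 30 * (H + 1 + 1)"
      "fst s3 ''x'' 0 = 2 ^ (H + 1) * fst s2 ''x'' 0" "same {''m'', ''x''} {} s2 s3" by (elim runE) blast
    have "fst s3 ''BW'' = fst s2 ''BW''" using sameD(1)[OF 3(4)] by simp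
    then show ?case
      by (intro runI[OF exec.Seq[OF 2(1) 3(1)]]) (use 2(2) 3(2,3) 5(4) in \<open>auto simp: s2_def less_Suc_eq\<close>)
  qed (use l1 1(3) dn in \<open>auto simp: same_def loaded_def\<close>)
  then obtain t2 s2 where 2: "exec ?loop s1 t2 s2" "t2 \<le> 60 * (H + 2) * (n * d + 1)" "\<forall>j<d. fst s2 ''BW'' j = (2 ^ (H + 1)) ^ j"
     "same {''x'', ''j'', ''m'', ''BW''} {} s1 s2" by (elim runE) blast
  have "same {''x'', ''j'', ''m'', ''BW''} {} s s2" by (rule same_mono[OF same_trans[OF 1(4) 2(4)]]) auto
  moreover have "t1 + t2 \<le> 100 * ((n * d + 1) * (H + 2))"
  proof -
    have "1 * 1 \<le> (n * d + 1) * (H + 2)" by (intro mult_le_mono) simp_all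
    moreover have "t2 \<le> 60 * ((n * d + 1) * (H + 2))" using 2(2) by (simp only: ac_simps)
    ultimately show ?thesis using 1(2) by linarith
  qed
  ultimately show ?thesis
    unfolding base_powers_def mult.assoc by (intro runI[OF exec.Seq[OF 1(1) 2(1)]]) (use 2(3) in auto)
qed

lemma run_digit_weights:
  assumes "loaded n d P s" and "\<And>q. q < n * d \<Longrightarrow> fst s ''co'' q = q mod d" and "\<And>j. j < d \<Longrightarrow> fst s ''BW'' j = B ^ j"
  shows "run digit_weights s (30 * (n * d + 1)) (\<lambda>s'. (\<forall>q<n * d. fst s' ''W'' q = B ^ (q mod d)) \<and> same {''q'', ''W''} {} s s')"
  unfolding digit_weights_def
proof (rule run_For_le[where B = "n * d" and T = 10 and I = "\<lambda>i s'. \<forall>q<i. fst s' ''W'' q = B ^ (q mod d)"], goal_cases)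
  case (5 i s')
  have "fst s' ''co'' i = i mod d" "fst s' ''BW'' (i mod d) = B ^ (i mod d)"
    using assms(2)[OF 5(1)] assms(3)[of "i mod d"] d sameD(1)[OF 5(2), of "''co''"] sameD(1)[OF 5(2), of "''BW''"] by simp_all
  then show ?case using 5(3,4) by (intro run_loopfree) (auto simp: less_Suc_eq)
qed (use assms(1) in \<open>auto simp: same_def loaded_def\<close>)

text \<open>The state of the division with \<open>h\<close> bits to go: \<open>y\<close> is the
  quotient so far plus the offset \<open>2 ^ H\<close>, and \<open>z\<close> the remainder. The
  upper bound on \<open>z\<close> is not strict, because the largest deviation may give exactly
  \<open>2 ^ H\<close> units; it is rounded to the last digit with a full remainder, so that
  coordinates stay below \<open>2 ^ H\<close>.\<close>

definition rounding :: "nat \<Rightarrow> nat \<Rightarrow> nat \<Rightarrow> nat \<Rightarrow> real \<Rightarrow> bool" where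
  "rounding H h q y z \<longleftrightarrow> 2 ^ H \<le> y \<and> y + 2 ^ h \<le> 2 ^ Suc H \<and> 0 \<le> z \<and> z \<le> 2 ^ h * (2 * extent n d P) \<and>
     (relative d P q + extent n d P) * 2 ^ H = z + (real y - 2 ^ H) * (2 * extent n d P)"

lemma rounding_init:
  "q < n * d \<Longrightarrow> rounding H H q (2 ^ H) ((relative d P q + extent n d P) * 2 ^ H)"
proof -
  assume "q < n * d"
  then have "\<bar>relative d P q\<bar> \<le> extent n d P" by (rule relative_bounds)
  then have "0 \<le> relative d P q + extent n d P" "relative d P q + extent n d P \<le> 2 * extent n d P" by simp_all
  then show ?thesis unfolding rounding_def by (simp add: mult.commute mult_right_mono)
qed

lemma rounding_step:
  assumes "rounding H (Suc h) q y z"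
  shows "z < 2 * extent n d P * 2 ^ h \<Longrightarrow> rounding H h q y z"
    "\<not> z < 2 * extent n d P * 2 ^ h \<Longrightarrow> rounding H h q (y + 2 ^ h) (z - 2 * extent n d P * 2 ^ h)"
  using assms unfolding rounding_def by (auto simp: algebra_simps)

lemma run_scale_points:
  assumes l: "loaded n d P s" and co: "\<And>q. q < n * d \<Longrightarrow> fst s ''co'' q = q mod d"
    and H: "fst s ''H'' 0 = H" "fst s ''pw'' H = 2 ^ H" and M: "snd s ''M'' 0 = extent n d P"
  shows "run scale_points s (80 * (n * d + 1)) (\<lambda>s'. (\<forall>q<n * d. rounding H H q (fst s' ''y'' q) (snd s' ''Z'' q)) \<and> same {''q'', ''y''} {''Z''} s s')"
  unfolding scale_points_def
proof (rule run_For_le[where B = "n * d" and T = 60 and I = "\<lambda>i s'. \<forall>q<i. rounding H H q (fst s' ''y'' q) (snd s' ''Z'' q)"], goal_cases)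
  case (5 i s')
  have "loaded n d P s'" by (rule loaded_same[OF l 5(2)]) simp_all
  moreover have "fst s' ''co'' i = i mod d" using co[OF 5(1)] sameD(1)[OF 5(2), of "''co''"] by simp
  ultimately have rc: "rval s' rel_coord = relative d P i" using rval_rel_coord 5(1,3) by blast
  then have "rval (nwrite s' ''y'' i (2 ^ H)) rel_coord = relative d P i" by simp
  moreover have "fst s' ''H'' 0 = H" "fst s' ''pw'' H = 2 ^ H" "snd s' ''M'' 0 = extent n d P"
    using H M sameD(1)[OF 5(2)] sameD(2)[OF 5(2)] by simp_all
  ultimately show ?case
    using 5(3,4) rounding_init[OF 5(1), of H] by (intro run_loopfree) (auto simp: less_Suc_eq simp del: rval.simps(4))
qed (use l in \<open>auto simp: same_def loaded_def\<close>)

lemma run_round_bit: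
  assumes l: "loaded n d P s" and H: "fst s ''H'' 0 = H" and pw: "\<And>h. h \<le> H + 1 \<Longrightarrow> fst s ''pw'' h = 2 ^ h"
    and M: "snd s ''M'' 0 = extent n d P" and j: "fst s ''j'' 0 = j" "j < H"
    and r: "\<And>q. q < n * d \<Longrightarrow> rounding H (H - j) q (fst s ''y'' q) (snd s ''Z'' q)"
  shows "run round_bit s (120 * (n * d + 1)) (\<lambda>s'. \<forall>q<n * d. rounding H (H - Suc j) q (fst s' ''y'' q) (snd s' ''Z'' q))"
proof -
  define h where "h = H - Suc j"
  have h: "H - j = Suc h" "h \<le> H + 1" using j(2) by (simp_all add: h_def)
  let ?loop = "For ''q'' (var ''N'') (Cond (RLess (RGet ''Z'' (var ''q'')) bit_size) Skip
        (Seq (NSet ''y'' (var ''q'') (NGet ''y'' (var ''q'') \<oplus> NGet ''pw'' (var ''m'')))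
           (RSet ''Z'' (var ''q'') (RSub (RGet ''Z'' (var ''q'')) bit_size))))"
  have "run (''m'' ::= (var ''H'' \<ominus> NConst 1) \<ominus> var ''j'') s 20 (\<lambda>s'. fst s' ''m'' 0 = h \<and> same {''m''} {} s s')"
    by (rule run_loopfree) (use H j in \<open>simp_all add: same_def h_def\<close>)
  then obtain t1 s1 where 1: "exec (''m'' ::= (var ''H'' \<ominus> NConst 1) \<ominus> var ''j'') s t1 s1" "t1 \<le> 20" "fst s1 ''m'' 0 = h" "same {''m''} {} s s1"
    by (elim runE) blast
  have l1: "loaded n d P s1" by (rule loaded_same[OF l 1(4)]) simp_all
  have r1: "rounding H (Suc h) q (fst s1 ''y'' q) (snd s1 ''Z'' q)" if "q < n * d" for q
    using r[OF that] h(1) sameD(1)[OF 1(4), of "''y''"] sameD(2)[OF 1(4), of "''Z''"] by simp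
  have "run ?loop s1 (100 * (n * d + 1)) (\<lambda>s'. \<forall>q<n * d. rounding H h q (fst s' ''y'' q) (snd s' ''Z'' q))"
  proof (rule run_For_le[where B = "n * d" and T = 80 and
        I = "\<lambda>i s'. \<forall>q<n * d. rounding H (if q < i then h else Suc h) q (fst s' ''y'' q) (snd s' ''Z'' q)"], goal_cases)
    case (5 i s')
    have st: "fst s' ''m'' 0 = h" "fst s' ''pw'' h = 2 ^ h" "snd s' ''M'' 0 = extent n d P"
      using 1(3) pw[OF h(2)] M sameD(1)[OF 1(4), of "''pw''"] sameD(2)[OF 1(4), of "''M''"] sameD(1)[OF 5(2)] sameD(2)[OF 5(2)] by simp_all
    have ri: "rounding H (Suc h) i (fst s' ''y'' i) (snd s' ''Z'' i)" using 5(1,4) by auto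
    show ?case
    proof (cases "snd s' ''Z'' i < 2 * extent n d P * 2 ^ h")
      case True
      then show ?thesis using 5(3,4) st rounding_step(1)[OF ri True] by (intro run_loopfree) (auto simp: less_Suc_eq)
    next
      case False
      then show ?thesis using 5(3,4) st rounding_step(2)[OF ri False] by (intro run_loopfree) (auto simp: less_Suc_eq)
    qed
  qed (use l1 r1 in \<open>auto simp: same_def loaded_def\<close>)
  then obtain t2 s2 where 2: "exec ?loop s1 t2 s2" "t2 \<le> 100 * (n * d + 1)" "\<forall>q<n * d. rounding H h q (fst s2 ''y'' q) (snd s2 ''Z'' q)"
    by (elim runE) blast
  show ?thesis
    unfolding round_bit_def h_def[symmetric] by (rule runI[OF exec.Seq[OF 1(1) 2(1)]]) (use 1(2) 2(2,3) in auto)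
qed

lemma run_round_points:
  assumes l: "loaded n d P s" and co: "\<And>q. q < n * d \<Longrightarrow> fst s ''co'' q = q mod d" and H: "fst s ''H'' 0 = H"
    and pw: "\<And>h. h \<le> H + 1 \<Longrightarrow> fst s ''pw'' h = 2 ^ h" and M: "snd s ''M'' 0 = extent n d P"
  shows "run round_points s (300 * (n * d + 1) * (H + 2)) (\<lambda>s'. (\<forall>q<n * d. rounding H 0 q (fst s' ''y'' q) (snd s' ''Z'' q)) \<and>
     same {''q'', ''y'', ''j'', ''m''} {''Z''} s s')"
proof -
  have nw: "nwr round_bit = {''q'', ''y'', ''m''}" "rwr round_bit = {''Z''}" by (auto simp: round_bit_def)
  obtain t1 s1 where 1: "exec scale_points s t1 s1" "t1 \<le> 80 * (n * d + 1)"
    "\<forall>q<n * d. rounding H H q (fst s1 ''y'' q) (snd s1 ''Z'' q)" "same {''q'', ''y''} {''Z''} s s1"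
    by (rule runE[OF run_scale_points[OF l co H _ M]]) (use pw in auto)
  have l1: "loaded n d P s1" by (rule loaded_same[OF l 1(4)]) simp_all
  note sm1 = sameD(1)[OF 1(4)] sameD(2)[OF 1(4)]
  have "run (For ''j'' (var ''H'') round_bit) s1 (140 * (n * d + 1) * (H + 1)) (\<lambda>s'. (\<forall>q<n * d. rounding H 0 q (fst s' ''y'' q) (snd s' ''Z'' q)) \<and>
     same {''q'', ''y'', ''j'', ''m''} {''Z''} s1 s')"
  proof (rule run_For_le[where B = H and T = "120 * (n * d + 1)" and
        I = "\<lambda>i s'. \<forall>q<n * d. rounding H (H - i) q (fst s' ''y'' q) (snd s' ''Z'' q)"], goal_cases)
    case (5 j s')
    note sm = 5(2)[unfolded nw]
    have l': "loaded n d P s'" by (rule loaded_same[OF l1 sm]) simp_all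
    have "fst s' ''H'' 0 = H" "\<And>h. h \<le> H + 1 \<Longrightarrow> fst s' ''pw'' h = 2 ^ h" "snd s' ''M'' 0 = extent n d P"
      using H pw M sm1 sameD(1)[OF sm] sameD(2)[OF sm] by simp_all
    from run_round_bit[OF l' this 5(3,1)] 5(4) show ?case by blast
  qed (use 1(3) H sm1 in \<open>auto simp: same_def nw\<close>)
  then obtain t2 s2 where 2: "exec (For ''j'' (var ''H'') round_bit) s1 t2 s2" "t2 \<le> 140 * (n * d + 1) * (H + 1)"
    "\<forall>q<n * d. rounding H 0 q (fst s2 ''y'' q) (snd s2 ''Z'' q)" "same {''q'', ''y'', ''j'', ''m''} {''Z''} s1 s2" by (elim runE) blast
  have "same {''q'', ''y'', ''j'', ''m''} {''Z''} s s2" by (rule same_mono[OF same_trans[OF 1(4) 2(4)]]) auto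
  moreover have "t1 + t2 \<le> 300 * (n * d + 1) * (H + 2)" using 1(2) 2(2) by (simp add: algebra_simps)
  ultimately show ?thesis
    unfolding round_points_def by (intro runI[OF exec.Seq[OF 1(1) 2(1)]]) (use 2(3) in auto)
qed

definition prepared :: "nat \<Rightarrow> store \<Rightarrow> bool" where
  "prepared H s \<longleftrightarrow> loaded n d P s \<and> fst s ''H'' 0 = H \<and>
     (\<forall>q<n * d. fst s ''pt'' q = q div d \<and> fst s ''co'' q = q mod d \<and> fst s ''W'' q = (2 ^ (H + 1)) ^ (q mod d) \<and>
        (\<exists>z. rounding H 0 q (fst s ''y'' q) z)) \<and>
     (\<forall>h\<le>H + 1. fst s ''pw'' h = 2 ^ h) \<and> (\<forall>m\<le>H + 1. fst s ''ON'' m = m * (n * d + 1))"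

lemma run_prelude:
  assumes l: "loaded n d P s" and n: "1 \<le> n"
  shows "\<exists>H. 2 * real n ^ (3 * a + 1) \<le> 2 ^ H \<and> (0 < H \<longrightarrow> 2 ^ (H - 1) < 2 * real n ^ (3 * a + 1)) \<and>
    run (prelude a) s ((1000 + 20 * a) * ((n * d + 1) * (H + 2))) (prepared H)"
proof -
  obtain t1 s1 where 1: "exec index_points s t1 s1" "t1 \<le> 100 * (n * d + 1)"
    "\<forall>q<n * d. fst s1 ''pt'' q = q div d \<and> fst s1 ''co'' q = q mod d" "same {''u'', ''c'', ''q'', ''pt'', ''co''} {} s s1"
    by (rule runE[OF run_index_points[OF l]]) blast
  have l1: "loaded n d P s1" by (rule loaded_same[OF l 1(4)]) simp_all
  obtain t2 s2 where 2: "exec measure_extent s1 t2 s2" "t2 \<le> 100 * (n * d + 1)"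
    "snd s2 ''M'' 0 = extent n d P" "same {''q''} {''M''} s1 s2"
    by (rule runE[OF run_measure_extent[OF l1]]) (use 1(3) in auto)
  have l2: "loaded n d P s2" by (rule loaded_same[OF l1 2(4)]) simp_all
  obtain H t3 s3 where H: "2 * real n ^ (3 * a + 1) \<le> 2 ^ H" "0 < H \<longrightarrow> 2 ^ (H - 1) < 2 * real n ^ (3 * a + 1)"
    and 3: "exec (choose_resolution a) s2 t3 s3" "t3 \<le> (100 + 20 * a) * (H + 2)"
    "fst s3 ''H'' 0 = H" "\<forall>h\<le>H + 1. fst s3 ''pw'' h = 2 ^ h" "same {''H'', ''pw''} {} s2 s3"
    using run_choose_resolution[OF l2, of a] unfolding run_def by blast
  have l3: "loaded n d P s3" by (rule loaded_same[OF l2 3(5)]) simp_all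
  obtain t4 s4 where 4: "exec row_offsets s3 t4 s4" "t4 \<le> 100 * (n * d + 1) * (H + 2)"
    "\<forall>m\<le>H + 1. fst s4 ''ON'' m = m * (n * d + 1)" "same {''x'', ''j'', ''ON''} {} s3 s4"
    by (rule runE[OF run_row_offsets[OF l3 3(3)]]) blast
  have l4: "loaded n d P s4" by (rule loaded_same[OF l3 4(4)]) simp_all
  have H4: "fst s4 ''H'' 0 = H" using 3(3) sameD(1)[OF 4(4), of "''H''"] by simp
  obtain t5 s5 where 5: "exec base_powers s4 t5 s5" "t5 \<le> 100 * (n * d + 1) * (H + 2)"
    "\<forall>j<d. fst s5 ''BW'' j = (2 ^ (H + 1)) ^ j" "same {''x'', ''j'', ''m'', ''BW''} {} s4 s5"
    by (rule runE[OF run_base_powers[OF l4 H4 n]]) blast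
  have l5: "loaded n d P s5" by (rule loaded_same[OF l4 5(4)]) simp_all
  have co5: "fst s5 ''co'' q = q mod d" "fst s5 ''pt'' q = q div d" if "q < n * d" for q
    using 1(3) that sameD(1)[OF 2(4)] sameD(1)[OF 3(5)] sameD(1)[OF 4(4)] sameD(1)[OF 5(4)] by simp_all
  obtain t6 s6 where 6: "exec digit_weights s5 t6 s6" "t6 \<le> 30 * (n * d + 1)"
    "\<forall>q<n * d. fst s6 ''W'' q = (2 ^ (H + 1)) ^ (q mod d)" "same {''q'', ''W''} {} s5 s6"
    by (rule runE[OF run_digit_weights[where B = "2 ^ (H + 1)", OF l5 co5(1)]]) (use 5(3) in auto)
  have l6: "loaded n d P s6" by (rule loaded_same[OF l5 6(4)]) simp_all
  have co6: "fst s6 ''co'' q = q mod d" "fst s6 ''pt'' q = q div d" if "q < n * d" for q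
    using co5[OF that] sameD(1)[OF 6(4)] by simp_all
  have H6: "fst s6 ''H'' 0 = H" using H4 sameD(1)[OF 5(4)] sameD(1)[OF 6(4)] by simp
  have pw6: "fst s6 ''pw'' h = 2 ^ h" if "h \<le> H + 1" for h
    using 3(4) that sameD(1)[OF 4(4)] sameD(1)[OF 5(4)] sameD(1)[OF 6(4)] by simp
  have ON6: "fst s6 ''ON'' m = m * (n * d + 1)" if "m \<le> H + 1" for m
    using 4(3) that sameD(1)[OF 5(4)] sameD(1)[OF 6(4)] by simp
  have M6: "snd s6 ''M'' 0 = extent n d P"
    using 2(3) sameD(2)[OF 3(5)] sameD(2)[OF 4(4)] sameD(2)[OF 5(4)] sameD(2)[OF 6(4)] by simp
  obtain t7 s7 where 7: "exec round_points s6 t7 s7" "t7 \<le> 300 * (n * d + 1) * (H + 2)"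
    "\<forall>q<n * d. rounding H 0 q (fst s7 ''y'' q) (snd s7 ''Z'' q)" "same {''q'', ''y'', ''j'', ''m''} {''Z''} s6 s7"
    by (rule runE[OF run_round_points[OF l6 co6(1) H6 pw6 M6]]) auto
  have l7: "loaded n d P s7" by (rule loaded_same[OF l6 7(4)]) simp_all
  note s7 = sameD(1)[OF 7(4)]
  have prep: "prepared H s7"
    unfolding prepared_def using l7 7(3) H6 co6 pw6 ON6 6(3) by (auto simp: s7)
  let ?X = "(n * d + 1) * (H + 2)"
  have X1: "n * d + 1 \<le> ?X" by simp
  have X2: "H + 2 \<le> ?X" by simp
  have "t3 \<le> (100 + 20 * a) * ?X" using 3(2) mult_le_mono2[OF X2, of "100 + 20 * a"] by linarith
  moreover have "t4 \<le> 100 * ?X" "t5 \<le> 100 * ?X" "t7 \<le> 300 * ?X" using 4(2) 5(2) 7(2) by (simp_all only: mult.assoc)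
  moreover have "t1 \<le> 100 * ?X" using 1(2) mult_le_mono2[OF X1, of 100] by linarith
  moreover have "t2 \<le> 100 * ?X" using 2(2) mult_le_mono2[OF X1, of 100] by linarith
  moreover have "t6 \<le> 30 * ?X" using 6(2) mult_le_mono2[OF X1, of 30] by linarith
  moreover have "(1000 + 20 * a) * ?X = (100 + 20 * a) * ?X + 900 * ?X" unfolding distrib_right[symmetric] by simp
  ultimately have T: "t1 + (t2 + (t3 + (t4 + (t5 + (t6 + t7))))) \<le> (1000 + 20 * a) * ?X" by linarith
  have "run (prelude a) s ((1000 + 20 * a) * ?X) (prepared H)"
    unfolding prelude_def
    by (rule runI[OF exec.Seq[OF 1(1) exec.Seq[OF 2(1) exec.Seq[OF 3(1) exec.Seq[OF 4(1) exec.Seq[OF 5(1) exec.Seq[OF 6(1) 7(1)]]]]]] T]) (rule prep)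
  then show ?thesis using H by blast
qed

end

lemma nwr_prelude:
  "nwr (prelude a) = {''u'', ''c'', ''q'', ''pt'', ''co'', ''H'', ''pw'', ''x'', ''j'', ''ON'', ''m'', ''BW'', ''W'', ''y''}"
  "rwr (prelude a) = {''M'', ''Z''}"
  by (auto simp: prelude_def index_points_def measure_extent_def choose_resolution_def row_offsets_def base_powers_def
      digit_weights_def round_points_def scale_points_def round_bit_def)

section \<open>The complete algorithm\<close>

text \<open>
  The given approximation algorithm runs on copies of the input whose names start with the letter A,
  which no array of the surrounding program does; only its array of centers is shared.
\<close>

definition private_name :: "name \<Rightarrow> name" where
  "private_name x = (if x = ''center'' then x else CHR ''A'' # x)"

definition copy_input :: com where
  "copy_input = Seq (seqs [''An'' ::= var ''n'', ''Ad'' ::= var ''d'', ''Ak'' ::= var ''k'', ''N'' ::= NConst 0])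
     (Seq (For ''i'' (var ''n'') (''N'' ::= var ''N'' \<oplus> var ''d''))
       (For ''q'' (var ''N'') (RSet ''Apoints'' (var ''q'') (RGet ''points'' (var ''q'')))))"

definition relabel :: com where
  "relabel = For ''i'' (var ''n'') (NSet ''label'' (var ''i'') (NGet ''Alabel'' (NGet ''rep'' (var ''i''))))"

text \<open>Only the labels pass through the representatives. The centers stay in the shared array:
  \<open>k\<close> is not bounded in terms of \<open>n\<close>, so nothing in the time bound would
  pay for copying \<open>k * d\<close> numbers.\<close>

definition fair_algorithm :: "nat \<Rightarrow> com \<Rightarrow> com" where
  "fair_algorithm a A = Seq copy_input (Seq (ren private_name A) (Seq (prelude a) (Seq fairlets relabel)))"

lemma inj_private_name: "inj private_name"
  by (rule injI) (auto simp: private_name_def split: if_splits)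

lemma range_private_name: "x \<in> range private_name \<Longrightarrow> x = ''center'' \<or> hd x = CHR ''A''"
  by (auto simp: private_name_def)

lemma nwr_fairlets:
  "x \<in> {''n'', ''Alabel''} \<Longrightarrow> x \<notin> nwr fairlets" "rwr fairlets = {}"
  by (auto simp: fairlets_def extract_all_def init_extract_def extract_level_def double_fp_def extract_row_def store_fp_def
      order_all_def order_level_def select_shift_def nwr_select_level shift_points_def clear_root_def init_groups_def
      fair_levels_def nwr_fair_level nwr_emit scatter_def)

lemma run_copy_input:
  assumes d: "1 \<le> d"
  shows "run copy_input (fair_kmedian_input r b n d k P red) (100 * (n * d + 1)) (\<lambda>s'.
     pull private_name s' = kmedian_input n d k P \<and> loaded n d P s' \<and>
     same {''An'', ''Ad'', ''Ak'', ''N'', ''i'', ''q''} {''Apoints''} (fair_kmedian_input r b n d k P red) s')"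
proof -
  let ?s = "fair_kmedian_input r b n d k P red"
  let ?c1 = "seqs [''An'' ::= var ''n'', ''Ad'' ::= var ''d'', ''Ak'' ::= var ''k'', ''N'' ::= NConst 0]"
  let ?c2 = "For ''i'' (var ''n'') (''N'' ::= var ''N'' \<oplus> var ''d'')"
  let ?c3 = "For ''q'' (var ''N'') (RSet ''Apoints'' (var ''q'') (RGet ''points'' (var ''q'')))"
  have nd: "n \<le> n * d" using d by simp
  have "run ?c1 ?s 20 (\<lambda>s'. fst s' ''An'' = scalar n \<and> fst s' ''Ad'' = scalar d \<and> fst s' ''Ak'' = scalar k \<and>
      fst s' ''N'' 0 = 0 \<and> same {''An'', ''Ad'', ''Ak'', ''N''} {} ?s s')"
    by (rule run_loopfree) (auto simp: same_def fair_kmedian_input_def scalar_def)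
  then obtain t1 s1 where 1: "exec ?c1 ?s t1 s1" "t1 \<le> 20"
    "fst s1 ''An'' = scalar n" "fst s1 ''Ad'' = scalar d" "fst s1 ''Ak'' = scalar k" "fst s1 ''N'' 0 = 0"
    "same {''An'', ''Ad'', ''Ak'', ''N''} {} ?s s1" by (elim runE) blast
  have n1: "fst s1 ''n'' 0 = n" "fst s1 ''d'' 0 = d" using sameD(1)[OF 1(7)] by (simp_all add: fair_kmedian_input_def scalar_def)
  have "run ?c2 s1 (30 * (n * d + 1)) (\<lambda>s'. fst s' ''N'' 0 = n * d \<and> same {''N'', ''i''} {} s1 s')"
  proof (rule run_For_le[where B = n and T = 10 and I = "\<lambda>i s'. fst s' ''N'' 0 = i * d"], goal_cases)
    case (5 j s')
    then show ?case using n1 sameD(1)[OF 5(2), of "''d''"] by (intro run_loopfree) auto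
  qed (use 1(6) n1 nd in \<open>auto simp: same_def\<close>)
  then obtain t2 s2 where 2: "exec ?c2 s1 t2 s2" "t2 \<le> 30 * (n * d + 1)" "fst s2 ''N'' 0 = n * d" "same {''N'', ''i''} {} s1 s2"
    by (elim runE) blast
  have pts: "snd s2 ''points'' = flatten n d P" "snd s2 ''Apoints'' = (\<lambda>_. 0)"
    using sameD(2)[OF 1(7)] sameD(2)[OF 2(4)] by (simp_all add: fair_kmedian_input_def)
  have "run ?c3 s2 (30 * (n * d + 1)) (\<lambda>s'. snd s' ''Apoints'' = flatten n d P \<and> same {''q''} {''Apoints''} s2 s')"
  proof (rule run_For_le[where B = "n * d" and T = 10 and
        I = "\<lambda>i s'. snd s' ''Apoints'' = (\<lambda>q. if q < i then flatten n d P q else 0)"], goal_cases)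
    case (5 j s')
    then show ?case using pts sameD(2)[OF 5(2), of "''points''"] by (intro run_loopfree) (auto simp: fun_eq_iff less_Suc_eq)
  qed (use 2(3) pts in \<open>auto simp: same_def flatten_def fun_eq_iff\<close>)
  then obtain t3 s3 where 3: "exec ?c3 s2 t3 s3" "t3 \<le> 30 * (n * d + 1)" "snd s3 ''Apoints'' = flatten n d P" "same {''q''} {''Apoints''} s2 s3"
    by (elim runE) blast
  have sm: "same {''An'', ''Ad'', ''Ak'', ''N'', ''i'', ''q''} {''Apoints''} ?s s3"
    by (rule same_mono[OF same_trans[OF 1(7) same_trans[OF 2(4) 3(4)]]]) auto
  have l: "loaded n d P s3"
    using n1 2(3) pts sameD(1)[OF 2(4)] sameD(1)[OF 3(4)] sameD(2)[OF 3(4)] by (simp add: loaded_def)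
  have A: "fst s3 ''An'' = scalar n" "fst s3 ''Ad'' = scalar d" "fst s3 ''Ak'' = scalar k"
    using 1(3-5) sameD(1)[OF 2(4)] sameD(1)[OF 3(4)] by simp_all
  have "fst s3 (private_name x) = fst (kmedian_input n d k P) x" for x
  proof (cases "x \<in> {''n'', ''d'', ''k''}")
    case True
    then show ?thesis using A by (auto simp: private_name_def kmedian_input_def)
  next
    case False
    then have "fst s3 (private_name x) = fst ?s (private_name x)" by (intro sameD(1)[OF sm]) (auto simp: private_name_def)
    also have "\<dots> = (\<lambda>_. 0)" by (auto simp: fair_kmedian_input_def private_name_def)
    also have "\<dots> = fst (kmedian_input n d k P) x" using False by (simp add: kmedian_input_def)
    finally show ?thesis .
  qed
  moreover have "snd s3 (private_name x) = snd (kmedian_input n d k P) x" for x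
  proof (cases "x = ''points''")
    case True
    then show ?thesis using 3(3) by (simp add: private_name_def kmedian_input_def)
  next
    case False
    then have "snd s3 (private_name x) = snd ?s (private_name x)" by (intro sameD(2)[OF sm]) (auto simp: private_name_def)
    also have "\<dots> = (\<lambda>_. 0)" by (auto simp: fair_kmedian_input_def private_name_def)
    also have "\<dots> = snd (kmedian_input n d k P) x" using False by (simp add: kmedian_input_def)
    finally show ?thesis .
  qed
  ultimately have "pull private_name s3 = kmedian_input n d k P"
    by (simp add: pull_def prod_eq_iff fun_eq_iff)
  then show ?thesis
    unfolding copy_input_def by (intro runI[OF exec.Seq[OF 1(1) exec.Seq[OF 2(1) 3(1)]]]) (use 1(2) 2(2) 3(2) sm l in auto)
qed

lemma run_relabel:
  assumes "fst s ''n'' 0 = n"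
  shows "run relabel s (30 * (n + 1)) (\<lambda>s'. \<forall>i<n. fst s' ''label'' i = fst s ''Alabel'' (fst s ''rep'' i))"
  unfolding relabel_def
proof (rule run_For_le[where B = n and T = 10 and I = "\<lambda>j s'. \<forall>i<j. fst s' ''label'' i = fst s ''Alabel'' (fst s ''rep'' i)"], goal_cases)
  case (5 j s')
  then show ?case using sameD(1)[OF 5(2)] by (intro run_loopfree) (auto simp: less_Suc_eq)
qed (use assms in \<open>auto simp: same_def\<close>)

section \<open>The approximation guarantee and the running time\<close>

lemma approx_ratio_nonneg:
  assumes "approx_kmedian_algorithm A \<alpha> T"
  shows "0 \<le> \<alpha>"
proof (rule ccontr)
  assume "\<not> 0 \<le> \<alpha>"
  \<comment> \<open>Two points at distance 1 and one center: the optimum is positive, so a negative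
    ratio would demand a negative cost.\<close>
  define P :: "nat \<Rightarrow> vector" where "P = (\<lambda>i j. real i)"
  obtain s where s: "clustering 2 1 (out_labels s)" "cost 2 1 P (out_centers 1 s) (out_labels s) \<le> \<alpha> * kmedian_opt 2 1 1 P"
    using assms unfolding approx_kmedian_algorithm_def by (metis le_refl one_le_numeral)
  have "1 \<le> kmedian_opt 2 1 1 P"
    unfolding kmedian_opt_def
  proof (rule cInf_greatest)
    show "{cost 2 1 P Z lab |Z lab. clustering 2 1 lab} \<noteq> {}" using s(1) by blast
    fix x assume "x \<in> {cost 2 1 P Z lab |Z lab. clustering 2 1 lab}"
    then obtain Z lab where x: "x = cost 2 1 P Z lab" "clustering 2 1 lab" by blast
    have "lab 0 = 0" "lab 1 = 0" using x(2) by (auto simp: clustering_def)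
    then have "x = edist 1 (P 0) (Z 0) + edist 1 (Z 0) (P 1)"
      unfolding x(1) cost_def by (simp add: numeral_2_eq_2 edist_commute)
    also have "\<dots> \<ge> edist 1 (P 0) (P 1)" by (rule edist_triangle)
    also have "edist 1 (P 0) (P 1) = 1" by (simp add: edist_def L2_set_def P_def)
    finally show "1 \<le> x" .
  qed
  then have "\<alpha> * kmedian_opt 2 1 1 P < 0" using \<open>\<not> 0 \<le> \<alpha>\<close> by (simp add: mult_less_0_iff)
  moreover have "0 \<le> cost 2 1 P (out_centers 1 s) (out_labels s)" unfolding cost_def by (rule sum_nonneg) simp
  ultimately show False using s(2) by simp
qed

lemma kmedian_opt_le: "clustering n k lab \<Longrightarrow> kmedian_opt n d k P \<le> cost n d P Z lab"
  unfolding kmedian_opt_def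
  by (rule cInf_lower) (auto intro!: bdd_belowI[of _ 0] sum_nonneg simp: cost_def)

lemma cost_cong: "(\<And>i. i < n \<Longrightarrow> lab i = lab' i) \<Longrightarrow> cost n d P Z lab = cost n d P Z lab'"
  by (simp add: cost_def)

lemma fair_clustering_cong:
  assumes "\<And>i. i < n \<Longrightarrow> lab i = lab' i"
  shows "fair_clustering r b n k red lab \<longleftrightarrow> fair_clustering r b n k red lab'"
proof -
  have "cluster n lab = cluster n lab'" using assms by (auto simp: cluster_def fun_eq_iff)
  then show ?thesis using assms by (simp add: fair_clustering_def clustering_def)
qed

text \<open>The whole input as a single cluster is a fair clustering, so its cluster has at least
  two points. This makes \<open>ln (real n)\<close> positive and lets it absorb constants.\<close>

lemma two_points:
  assumes "1 \<le> b" "b \<le> r" "real b / real r \<le> balance red {..<n}"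
  shows "2 \<le> n"
proof -
  interpret fairness r b "\<lambda>i. if i < n \<and> red i then 1 else 0" by unfold_locales (use assms in auto)
  have "n \<noteq> 0"
  proof
    assume "n = 0"
    then have "real b / real r \<le> 0" using assms(3) by (simp add: balance_def)
    then show False using assms(1,2) by (simp add: divide_le_0_iff)
  qed
  moreover have "fair_clustering r b n 1 red (\<lambda>_. 0)"
    using assms(3) by (simp add: fair_clustering_def clustering_def cluster_def lessThan_def)
  ultimately obtain i' where "i' < n" "i' \<noteq> 0" using fair_clustering_two[of n 1 red "\<lambda>_. 0" 0] by auto
  then show ?thesis by simp
qed

lemma distances:
  assumes n: "2 \<le> n" and dist: "distinct_points n d P" and asp: "aspect_ratio n d P \<le> real n ^ a"
  obtains \<delta> where "0 < \<delta>" "\<And>i i'. i < n \<Longrightarrow> i' < n \<Longrightarrow> i \<noteq> i' \<Longrightarrow> \<delta> \<le> edist d (P i) (P i')"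
    "\<And>i i'. i < n \<Longrightarrow> i' < n \<Longrightarrow> edist d (P i) (P i') \<le> real n ^ a * \<delta>"
proof -
  let ?D = "pair_dists n d P"
  have "?D \<subseteq> (\<lambda>(i, i'). edist d (P i) (P i')) ` ({..<n} \<times> {..<n})" by (auto simp: pair_dists_def)
  then have fin: "finite ?D" by (rule finite_subset) simp
  have "edist d (P 0) (P 1) \<in> ?D" using n unfolding pair_dists_def by (intro CollectI exI[of _ 0] exI[of _ 1]) simp
  then have ne: "?D \<noteq> {}" by blast
  have mem: "edist d (P i) (P i') \<in> ?D" if "i < n" "i' < n" "i \<noteq> i'" for i i' using that by (auto simp: pair_dists_def)
  have "0 < x" if x: "x \<in> ?D" for x
  proof -
    obtain i i' where i: "i < n" "i' < n" "i \<noteq> i'" "x = edist d (P i) (P i')" using x unfolding pair_dists_def by blast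
    then obtain j where "j < d" "P i j \<noteq> P i' j" using dist by (auto simp: distinct_points_def)
    then have "x \<noteq> 0" unfolding i(4) edist_def by (subst L2_set_eq_0_iff) auto
    then show ?thesis using edist_nonneg[of d "P i" "P i'"] unfolding i(4) by linarith
  qed
  then have pos: "0 < Min ?D" using Min_in[OF fin ne] by blast
  then have max: "Max ?D \<le> real n ^ a * Min ?D" using asp by (simp add: aspect_ratio_def divide_le_eq)
  have "edist d (P i) (P i') \<le> real n ^ a * Min ?D" if "i < n" "i' < n" for i i'
  proof (cases "i = i'")
    case True
    then show ?thesis using pos by simp
  next
    case False
    then show ?thesis using Max_ge[OF fin mem[OF that False]] max by simp
  qed
  moreover have "Min ?D \<le> edist d (P i) (P i')" if "i < n" "i' < n" "i \<noteq> i'" for i i' using Min_le[OF fin mem[OF that]] .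
  ultimately show ?thesis using pos that by blast
qed

lemma half_le_ln2: "1 / 2 \<le> ln (2 :: real)"
  using exp_half_le2 by (subst ln_ge_iff) simp_all

text \<open>Logarithms of the minimality bound give \<open>(H + 2) * ln 2\<close> at most
  \<open>4 * ln 2 + (3 * a + 1) * ln n\<close>, hence at most \<open>(3 * a + 5) * ln n\<close>.
  Since \<open>ln 2\<close> is at least 1/2, the factor doubles to
  \<open>6 * a + 10\<close>.\<close>

lemma resolution_log:
  assumes n: "2 \<le> n" and H: "0 < H \<longrightarrow> 2 ^ (H - 1) < 2 * real n ^ (3 * a + 1)"
  shows "real H + 2 \<le> real (6 * a + 10) * ln (real n)"
proof -
  note half = half_le_ln2
  have ln: "ln 2 \<le> ln (real n)" using n by simp
  show ?thesis
  proof (cases "H = 0")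
    case True
    have "10 * (1 / 2) \<le> real (6 * a + 10) * ln (real n)" using half ln by (intro mult_mono) auto
    then show ?thesis using True by simp
  next
    case False
    then have "2 ^ (H - 1) < 2 * real n ^ (3 * a + 1)" using H by simp
    then have "ln (2 ^ (H - 1)) \<le> ln (2 * real n ^ (3 * a + 1))" by (intro ln_mono) simp_all
    then have "real (H - 1) * ln 2 \<le> ln 2 + real (3 * a + 1) * ln (real n)"
      using n by (simp add: ln_mult ln_realpow algebra_simps)
    then have "(real H + 2) * ln 2 \<le> 4 * ln 2 + real (3 * a + 1) * ln (real n)"
      using False by (simp add: of_nat_diff algebra_simps)
    also have "\<dots> \<le> real (3 * a + 5) * ln (real n)" using ln by (simp add: algebra_simps)
    finally have *: "(real H + 2) * ln 2 \<le> real (3 * a + 5) * ln (real n)" .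
    have "(real H + 2) * (1 / 2) \<le> (real H + 2) * ln 2" using half by (intro mult_left_mono) simp_all
    with * show ?thesis by (simp add: algebra_simps)
  qed
qed

lemma fair_algorithm_correct:
  assumes A: "approx_kmedian_algorithm A \<alpha> T"
    and params: "1 \<le> b" "b \<le> r" "1 \<le> d" "1 \<le> k"
    and dist: "distinct_points n d P" and bal: "real b / real r \<le> balance red {..<n}" and asp: "aspect_ratio n d P \<le> real n ^ a"
  shows "\<exists>t s H. exec (fair_algorithm a A) (fair_kmedian_input r b n d k P red) t s \<and>
     (0 < H \<longrightarrow> 2 ^ (H - 1) < 2 * real n ^ (3 * a + 1)) \<and>
     t \<le> T n d k + (8000 + 20 * a) * ((n * d + 1) * (H + 2)) \<and>
     fair_clustering r b n k red (out_labels s) \<and>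
     (\<forall>Z lab. fair_clustering r b n k red lab \<longrightarrow> cost n d P (out_centers d s) (out_labels s)
        \<le> real ((1 + (r + b) * b) * (4 + 16 * r * d * (H + 1))) * cost n d P Z lab + real (r + b) * (\<alpha> * kmedian_opt n d k P))"
proof -
  let ?s0 = "fair_kmedian_input r b n d k P red"
  define col :: "nat \<Rightarrow> nat" where "col i = (if i < n \<and> red i then 1 else 0)" for i
  interpret fairness r b col by unfold_locales (use params in \<open>auto simp: col_def\<close>)
  have col: "col i = (if red i then 1 else 0)" if "i < n" for i using that by (simp add: col_def)
  have n: "2 \<le> n" by (rule two_points[OF params(1,2) bal])
  obtain \<delta> where \<delta>: "0 < \<delta>" "\<And>i i'. i < n \<Longrightarrow> i' < n \<Longrightarrow> i \<noteq> i' \<Longrightarrow> \<delta> \<le> edist d (P i) (P i')"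
    "\<And>i i'. i < n \<Longrightarrow> i' < n \<Longrightarrow> edist d (P i) (P i') \<le> real n ^ a * \<delta>"
    using distances[OF n dist asp] by blast
  obtain t1 s1 where 1: "exec copy_input ?s0 t1 s1" "t1 \<le> 100 * (n * d + 1)" "pull private_name s1 = kmedian_input n d k P" "loaded n d P s1"
    "same {''An'', ''Ad'', ''Ak'', ''N'', ''i'', ''q''} {''Apoints''} ?s0 s1"
    by (rule runE[OF run_copy_input[OF params(3), of r b n k P red]]) blast
  obtain t2 sA where AA: "exec A (kmedian_input n d k P) t2 sA" "t2 \<le> T n d k" "clustering n k (out_labels sA)"
     "cost n d P (out_centers d sA) (out_labels sA) \<le> \<alpha> * kmedian_opt n d k P"
    using A n params(3,4) unfolding approx_kmedian_algorithm_def by (metis one_le_numeral order_trans)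
  obtain s2 where 2: "exec (ren private_name A) s1 t2 s2" "sA = pull private_name s2"
    using exec_ren[OF inj_private_name AA(1)] 1(3) by metis
  have sm2: "same (range private_name) (range private_name) s1 s2"
    by (rule same_mono[OF exec_same[OF 2(1)] nwr_ren rwr_ren])
  have own: "x \<notin> range private_name" if "x \<noteq> ''center''" "hd x \<noteq> CHR ''A''" for x using range_private_name[of x] that by blast
  have l2: "loaded n d P s2"
    by (rule loaded_same[OF 1(4) sm2]) (use own in auto)
  have keep2: "fst s2 x = fst ?s0 x" if "x \<noteq> ''center''" "hd x \<noteq> CHR ''A''" "x \<notin> {''N'', ''i'', ''q''}" for x
  proof -
    have "x \<notin> {''An'', ''Ad'', ''Ak'', ''N'', ''i'', ''q''}" 
    proof
      assume "x \<in> {''An'', ''Ad'', ''Ak'', ''N'', ''i'', ''q''}"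
      then consider "x = ''An''" | "x = ''Ad''" | "x = ''Ak''" | "x \<in> {''N'', ''i'', ''q''}" by blast
      then show False by cases (use that(2,3) in simp_all)
    qed
    then have "fst s1 x = fst ?s0 x" by (rule sameD(1)[OF 1(5)])
    then show ?thesis using sameD(1)[OF sm2 own[OF that(1,2)]] by (rule trans[rotated])
  qed
  obtain H t3 s3 where H: "2 * real n ^ (3 * a + 1) \<le> 2 ^ H" "0 < H \<longrightarrow> 2 ^ (H - 1) < 2 * real n ^ (3 * a + 1)"
    and 3: "exec (prelude a) s2 t3 s3" "t3 \<le> (1000 + 20 * a) * ((n * d + 1) * (H + 2))" "prepared n d P H s3"
    using run_prelude[OF params(3) l2, of a] n unfolding run_def by auto
  note sm3 = exec_same[OF 3(1), unfolded nwr_prelude]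
  note prep = 3(3)[unfolded prepared_def[OF params(3)]]
  \<comment> \<open>The program stores the coordinates with the offset \<open>2 ^ H\<close> already
    added, so that \<open>y\<close> agrees with \<open>S\<close> of the grid.\<close>
  define crd where "crd q = fst s3 ''y'' q - 2 ^ H" for q
  have round: "2 ^ H \<le> fst s3 ''y'' q" "crd q < 2 ^ H"
     "real (crd q) * (2 * extent n d P) \<le> (relative d P q + extent n d P) * 2 ^ H"
     "(relative d P q + extent n d P) * 2 ^ H \<le> (real (crd q) + 1) * (2 * extent n d P)" if q: "q < n * d" for q
  proof -
    obtain z where *: "rounding n d P H 0 q (fst s3 ''y'' q) z" using prep q by blast
    note r = *[unfolded rounding_def[OF params(3)]]
    show y: "2 ^ H \<le> fst s3 ''y'' q" using r by blast
    have "fst s3 ''y'' q < 2 ^ H + 2 ^ H" using r by simp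
    then show "crd q < 2 ^ H" unfolding crd_def by (rule less_diff_conv2[THEN iffD2, OF y])
    have ceq: "real (crd q) = real (fst s3 ''y'' q) - 2 ^ H" using y by (simp add: crd_def of_nat_diff)
    have "0 \<le> z" "z \<le> 2 * extent n d P" using r by simp_all
    moreover have "(relative d P q + extent n d P) * 2 ^ H = z + real (crd q) * (2 * extent n d P)" unfolding ceq using r by blast
    ultimately show "real (crd q) * (2 * extent n d P) \<le> (relative d P q + extent n d P) * 2 ^ H"
      "(relative d P q + extent n d P) * 2 ^ H \<le> (real (crd q) + 1) * (2 * extent n d P)"
      unfolding distrib_right[of "real (crd q)"] by simp_all
  qed
  interpret quantized r b col n d H crd P "extent n d P" \<delta> a
  proof unfold_locales
    show "extent n d P = (\<Sum>k<n * d. \<bar>P (k div d) (k mod d) - P 0 (k mod d)\<bar>)" by (simp add: extent_def relative_def)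
  qed (use params(3) round H(1) \<delta> n in \<open>simp_all add: relative_def\<close>)
  have keep3: "fst s3 x = fst ?s0 x" if "x \<in> {''r'', ''b'', ''color'', ''P'', ''Q'', ''G'', ''T'', ''fP'', ''fQ'', ''hd''}" for x
    using keep2[of x] sameD(1)[OF sm3, of x] that by auto
  have "ctx s3"
    unfolding ctx_def
  proof (intro conjI)
    show "fst s3 ''r'' 0 = r" "fst s3 ''b'' 0 = b" "\<forall>i<n. fst s3 ''color'' i = col i"
      by (simp_all add: keep3 fair_kmedian_input_def scalar_def col_def)
  qed (use prep in \<open>simp_all add: loaded_def W_def\<close>)
  have y: "fst s3 ''y'' q = S q" if "q < n * d" for q using round(1)[OF that] by (simp add: S_def crd_def)
  have zero: "fst s3 x q = 0" if "x \<in> {''P'', ''Q'', ''G'', ''T'', ''fP'', ''fQ'', ''hd''}" for x q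
    using keep3[of x] that by (auto simp: fair_kmedian_input_def)
  have total: "excess (card {i \<in> {..<n}. col i = 0}) (card {i \<in> {..<n}. col i = 1}) = 0"
    using balance_excess[of "{..<n}" red] bal col n by (auto simp: lessThan_empty_iff)
  obtain t4 s4 t' where 4: "exec fairlets s3 t4 s4" "t4 \<le> 6000 * (n * d + 1) * (H + 2)"
     "groups {..<n} (\<lambda>_. 0) (fst s4 ''rep'')" "bad {..<n} (fst s4 ''rep'') = {}" "\<forall>t<2 ^ H. weight 0 t' \<le> weight 0 t"
     "(\<Sum>i<n. edist d (P i) (P (fst s4 ''rep'' i))) \<le> kappa * (sqrt d * width) * (n + 2 * weight 0 t')"
    by (rule runE[OF run_fairlets[where dst = "\<lambda>i i'. edist d (P i) (P i')" and \<delta> = "sqrt d * width", OF \<open>ctx s3\<close> y zero total edist_cell]])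
      (use width_nonneg in auto)
  note sm4 = exec_same[OF 4(1), unfolded nwr_fairlets(2)]
  have n4: "fst s4 ''n'' 0 = n" using prep sameD(1)[OF sm4 nwr_fairlets(1), of "''n''"] by (simp add: loaded_def)
  obtain t5 s5 where 5: "exec relabel s4 t5 s5" "t5 \<le> 30 * (n + 1)" "\<forall>i<n. fst s5 ''label'' i = fst s4 ''Alabel'' (fst s4 ''rep'' i)"
    by (rule runE[OF run_relabel[OF n4]]) blast
  let ?rep = "fst s4 ''rep''"
  have "fst s4 ''Alabel'' = fst s2 ''Alabel''"
    using sameD(1)[OF sm4 nwr_fairlets(1), of "''Alabel''"] sameD(1)[OF sm3, of "''Alabel''"] by simp
  moreover have "out_labels sA = fst s2 ''Alabel''" unfolding 2(2) by (simp add: out_labels_def pull_def private_name_def fun_eq_iff)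
  ultimately have lab: "out_labels s5 i = out_labels sA (?rep i)" if "i < n" for i
    using 5(3) that by (simp add: out_labels_def)
  have "rwr relabel = {}" by (simp add: relabel_def)
  then have "snd s5 ''center'' = snd s2 ''center''"
    using sameD(2)[OF exec_same[OF 5(1)], of "''center''"] sameD(2)[OF sm4, of "''center''"] sameD(2)[OF sm3, of "''center''"] by simp
  then have cen: "out_centers d s5 = out_centers d sA" unfolding 2(2) by (simp add: out_centers_def pull_def private_name_def fun_eq_iff)
  have rep: "?rep i < n" if "i < n" for i using groupsD(1)[OF 4(3)] that by (auto simp: heads_def)
  have fair: "fair_clustering r b n k red (out_labels s5)"
    using fair_clustering_groups[OF 4(3,4) col AA(3)] fair_clustering_cong[of n "out_labels s5" "\<lambda>i. out_labels sA (?rep i)"] lab by simp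
  have "cost n d P (out_centers d s5) (out_labels s5) \<le> real (kappa * (4 + 16 * r * d * (H + 1))) * cost n d P Z lab + real (r + b) * (\<alpha> * kmedian_opt n d k P)"
    if F: "fair_clustering r b n k red lab" for Z lab
  proof -
    have "cost n d P (out_centers d s5) (out_labels s5) = cost n d P (out_centers d sA) (\<lambda>i. out_labels sA (?rep i))"
      unfolding cen by (rule cost_cong) (rule lab)
    also have "\<dots> \<le> (\<Sum>i<n. edist d (P i) (P (?rep i))) + real (r + b) * cost n d P (out_centers d sA) (out_labels sA)"
      by (rule cost_groups[OF 4(3)])
    also have "\<dots> \<le> real (kappa * (4 + 16 * r * d * (H + 1))) * cost n d P Z lab + real (r + b) * (\<alpha> * kmedian_opt n d k P)"
      by (intro add_mono mult_left_mono representatives_cost[OF _ 4(6) rep F col] AA(4)) (use 4(5) in auto)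
    finally show ?thesis .
  qed
  then have cost: "\<forall>Z lab. fair_clustering r b n k red lab \<longrightarrow> cost n d P (out_centers d s5) (out_labels s5)
      \<le> real ((1 + (r + b) * b) * (4 + 16 * r * d * (H + 1))) * cost n d P Z lab + real (r + b) * (\<alpha> * kmedian_opt n d k P)"
    unfolding kappa_def by blast
  let ?X = "(n * d + 1) * (H + 2)"
  have X: "n * d + 1 \<le> ?X" by simp
  have "t1 \<le> 100 * ?X" using 1(2) mult_le_mono2[OF X, of 100] by linarith
  moreover have "t5 \<le> 30 * ?X" using 5(2) mult_le_mono2[OF order_trans[OF add_le_mono1[OF n_le_N] X], of 30] by linarith
  moreover have "t4 \<le> 6000 * ?X" using 4(2) by (simp only: mult.assoc)
  moreover have "(8000 + 20 * a) * ?X = (1000 + 20 * a) * ?X + 7000 * ?X" unfolding distrib_right[symmetric] by simp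
  ultimately have "t1 + (t2 + (t3 + (t4 + t5))) \<le> T n d k + (8000 + 20 * a) * ?X" using AA(2) 3(2) by linarith
  moreover have "exec (fair_algorithm a A) ?s0 (t1 + (t2 + (t3 + (t4 + t5)))) s5"
    unfolding fair_algorithm_def using 1(1) 2(1) 3(1) 4(1) 5(1) by (intro exec.Seq)
  ultimately show ?thesis using H(2) fair cost by blast
qed

theorem theorem1p1:
  fixes a :: nat
  shows "\<exists>(C :: real) (K :: nat \<Rightarrow> nat \<Rightarrow> real). \<forall>A \<alpha> T. approx_kmedian_algorithm A \<alpha> T \<longrightarrow>
    (\<exists>F :: com. \<forall>r b n d k P red.
       1 \<le> b \<longrightarrow> b \<le> r \<longrightarrow> gcd r b = 1 \<longrightarrow> 1 \<le> d \<longrightarrow> 1 \<le> k \<longrightarrow>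
       distinct_points n d P \<longrightarrow>
       balance red {..<n} \<ge> real b / real r \<longrightarrow>
       aspect_ratio n d P \<le> real n ^ a \<longrightarrow>
       (\<exists>t s. exec F (fair_kmedian_input r b n d k P red) t s \<and>
          real t \<le> C * (real d * real n * ln (real n) + real (T n d k)) \<and>
          fair_clustering r b n k red (out_labels s) \<and>
          cost n d P (out_centers d s) (out_labels s)
            \<le> K r b * (real d * ln (real n) + \<alpha>) * fair_kmedian_opt r b n d k P red))"
proof -
  define L where "L = 6 * a + 10"
  \<comment> \<open>\<open>2 * L\<close> comes from \<open>n * d + 1 \<le> 2 * (n * d)\<close> and
    \<open>H + 2 \<le> L * ln n\<close>; the final 1 covers the time of the given algorithm.\<close>
  define C where "C = real ((8000 + 20 * a) * (2 * L) + 1)"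
  \<comment> \<open>The 8 absorbs the additive 4 by means of \<open>d * ln n \<ge> 1 / 2\<close>;
    the last summand \<open>r + b\<close> is the loss on the cost of the given algorithm.\<close>
  define K where "K r b = real ((1 + (r + b) * b) * (8 + 16 * r * L) + (r + b))" for r b
  show ?thesis
  proof (intro exI[of _ C] exI[of _ K] allI impI)
    fix A \<alpha> T assume A: "approx_kmedian_algorithm A \<alpha> T"
    show "\<exists>F :: com. \<forall>r b n d k P red.
       1 \<le> b \<longrightarrow> b \<le> r \<longrightarrow> gcd r b = 1 \<longrightarrow> 1 \<le> d \<longrightarrow> 1 \<le> k \<longrightarrow>
       distinct_points n d P \<longrightarrow> balance red {..<n} \<ge> real b / real r \<longrightarrow> aspect_ratio n d P \<le> real n ^ a \<longrightarrow>
       (\<exists>t s. exec F (fair_kmedian_input r b n d k P red) t s \<and>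
          real t \<le> C * (real d * real n * ln (real n) + real (T n d k)) \<and>
          fair_clustering r b n k red (out_labels s) \<and>
          cost n d P (out_centers d s) (out_labels s)
            \<le> K r b * (real d * ln (real n) + \<alpha>) * fair_kmedian_opt r b n d k P red)"
    proof (intro exI[of _ "fair_algorithm a A"] allI impI)
      fix r b n d k :: nat and P :: "nat \<Rightarrow> vector" and red :: "nat \<Rightarrow> bool"
      assume params: "1 \<le> b" "b \<le> r" "1 \<le> d" "1 \<le> k"
        and dist: "distinct_points n d P" and bal: "balance red {..<n} \<ge> real b / real r" and asp: "aspect_ratio n d P \<le> real n ^ a"
      obtain t s H where *: "exec (fair_algorithm a A) (fair_kmedian_input r b n d k P red) t s"
        "0 < H \<longrightarrow> 2 ^ (H - 1) < 2 * real n ^ (3 * a + 1)"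
        "t \<le> T n d k + (8000 + 20 * a) * ((n * d + 1) * (H + 2))"
        "fair_clustering r b n k red (out_labels s)"
        "\<And>Z lab. fair_clustering r b n k red lab \<Longrightarrow> cost n d P (out_centers d s) (out_labels s)
           \<le> real ((1 + (r + b) * b) * (4 + 16 * r * d * (H + 1))) * cost n d P Z lab + real (r + b) * (\<alpha> * kmedian_opt n d k P)"
        using fair_algorithm_correct[OF A params dist bal asp] by blast
      have n: "2 \<le> n" by (rule two_points[OF params(1,2) bal])
      define l where "l = ln (real n)"
      have "ln 2 \<le> l" using n by (simp add: l_def)
      then have l: "1 / 2 \<le> l" using half_le_ln2 by simp
      have HL: "real H + 2 \<le> real L * l" unfolding L_def l_def by (rule resolution_log[OF n *(2)])
      have dl: "1 / 2 \<le> real d * l" using mult_mono[of 1 "real d" "1 / 2" l] params(3) l by simp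
      have nd: "1 \<le> n * d" using n params(3) by simp
      have \<alpha>: "0 \<le> \<alpha>" by (rule approx_ratio_nonneg[OF A])
      have "real ((n * d + 1) * (H + 2)) = real (n * d + 1) * (real H + 2)" by (simp add: algebra_simps)
      also have "\<dots> \<le> real (2 * (n * d)) * (real L * l)"
        proof (intro mult_mono HL)
        show "real (n * d + 1) \<le> real (2 * (n * d))" using nd unfolding of_nat_le_iff by linarith
      qed simp_all
      also have "\<dots> = real (2 * L) * (real d * real n * l)" by simp
      finally have X: "real ((n * d + 1) * (H + 2)) \<le> real (2 * L) * (real d * real n * l)" .
      have "real t \<le> real (T n d k + (8000 + 20 * a) * ((n * d + 1) * (H + 2)))" using *(3) by (simp only: of_nat_le_iff)
      also have "\<dots> = real (T n d k) + real (8000 + 20 * a) * real ((n * d + 1) * (H + 2))" by (simp only: of_nat_add of_nat_mult)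
      also have "\<dots> \<le> real (T n d k) + real (8000 + 20 * a) * (real (2 * L) * (real d * real n * l))"
        by (intro add_left_mono mult_left_mono X) simp
      also have "\<dots> \<le> C * (real d * real n * l + real (T n d k))"
      proof -
        have "0 \<le> real d * real n * l" using l by simp
        then show ?thesis by (simp add: C_def algebra_simps)
      qed
      finally have time: "real t \<le> C * (real d * real n * l + real (T n d k))" .
      let ?K = "K r b * (real d * l + \<alpha>)" and ?cost = "cost n d P (out_centers d s) (out_labels s)"
      have K: "0 < ?K"
        using dl \<alpha> params(1) by (intro mult_pos_pos) (simp_all add: K_def add_pos_nonneg)
      have "?cost \<le> ?K * c" if "c \<in> {cost n d P Z lab |Z lab. fair_clustering r b n k red lab}" for c
      proof -
        obtain Z lab where c: "c = cost n d P Z lab" and F: "fair_clustering r b n k red lab" using \<open>c \<in> _\<close> by blast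
        have c0: "0 \<le> c" unfolding c cost_def by (rule sum_nonneg) simp
        have "kmedian_opt n d k P \<le> c" unfolding c using F by (intro kmedian_opt_le) (simp add: fair_clustering_def)
        then have opt: "real (r + b) * (\<alpha> * kmedian_opt n d k P) \<le> real (r + b) * (\<alpha> * c)" using \<alpha> by (intro mult_left_mono) simp_all
        have "real (16 * r * d) * (real H + 1) \<le> real (16 * r * d) * (real L * l)" using HL by (intro mult_left_mono) simp_all
        then have "real (4 + 16 * r * d * (H + 1)) \<le> 8 * (real d * l) + real (16 * r * d) * (real L * l)"
          using dl by (simp add: distrib_left mult.assoc)
        also have "\<dots> = real (8 + 16 * r * L) * (real d * l)" by (simp add: algebra_simps)
        finally have "real (1 + (r + b) * b) * real (4 + 16 * r * d * (H + 1)) \<le> real (1 + (r + b) * b) * (real (8 + 16 * r * L) * (real d * l))"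
          by (intro mult_left_mono) simp_all
        then have "real ((1 + (r + b) * b) * (4 + 16 * r * d * (H + 1))) * c \<le> real ((1 + (r + b) * b) * (8 + 16 * r * L)) * (real d * l) * c"
          using c0 by (intro mult_right_mono) (simp_all only: of_nat_mult mult.assoc)
        then have "?cost \<le> real ((1 + (r + b) * b) * (8 + 16 * r * L)) * (real d * l) * c + real (r + b) * (\<alpha> * c)"
          using *(5)[OF F, of Z] opt unfolding c by linarith
        also have "\<dots> \<le> real ((1 + (r + b) * b) * (8 + 16 * r * L)) * (real d * l + \<alpha>) * c + real (r + b) * ((real d * l + \<alpha>) * c)"
          using dl \<alpha> c0 by (intro add_mono mult_left_mono mult_right_mono) simp_all
        also have "\<dots> = ?K * c" by (simp add: K_def algebra_simps)
        finally show ?thesis .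
      qed
      \<comment> \<open>The fair optimum is an infimum, which need not be known to be attained:
        dividing by the positive factor turns the bound against every fair solution into a lower
        bound of the set.\<close>
      then have "?cost / ?K \<le> c" if "c \<in> {cost n d P Z lab |Z lab. fair_clustering r b n k red lab}" for c
        using that K by (simp add: pos_divide_le_eq mult.commute)
      moreover have "{cost n d P Z lab |Z lab. fair_clustering r b n k red lab} \<noteq> {}" using *(4) by blast
      ultimately have "?cost / ?K \<le> fair_kmedian_opt r b n d k P red"
        unfolding fair_kmedian_opt_def by (intro cInf_greatest)
      then have "?cost \<le> ?K * fair_kmedian_opt r b n d k P red" using K by (simp add: pos_divide_le_eq mult.commute)
      then show "\<exists>t s. exec (fair_algorithm a A) (fair_kmedian_input r b n d k P red) t s \<and>
          real t \<le> C * (real d * real n * ln (real n) + real (T n d k)) \<and>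
          fair_clustering r b n k red (out_labels s) \<and>
          cost n d P (out_centers d s) (out_labels s)
            \<le> K r b * (real d * ln (real n) + \<alpha>) * fair_kmedian_opt r b n d k P red"
        using *(1,4) time unfolding l_def by blast
    qed
  qed
qed

end
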